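(* Let $N\ge1$, $s\in(0,1)$, let $\Omega\subset\mathbb{R}^N$ be a $C^{1,1}$ bounded domain that is star-shaped with respect to the origin, and let $B_\delta(0)$ be a ball centered at the origin with radius $\delta>0$ such that $B_\delta(0)\subset\Omega$. Let $\mathcal{A}$ be the set of all $u_0\in C_0^\infty(\Omega)$ with $\operatorname{supp}u_0\subset B_\delta(0)$ and $u_0(x)=-u_0(-x)$ for $x\in B_\delta(0)$. For $u_0\in\mathcal{A}$ let $w$ be the solution of $$\partial_t^2w+(-\Delta)^sw=0\ \text{ in }\Omega\times(0,\infty),\quad w(x,0)=0,\ \partial_tw(x,0)=u_0(x)\ \text{ for }x\in\Omega,\quad w(x,t)=0\ \text{ for }x\in\mathbb{R}^N\setminus\Omega,\ t>0,$$ and for $\lambda>0$ let $W_\lambda(x)=\int_0^\infty e^{-\lambda t}w(x,t)\,dt$ be its Laplace transform. Then the following conditions are equivalent: (1) $W_\lambda(0)=0$ for any $\lambda>0$ and any $u_0\in\mathcal{A}$; (2) $\Omega$ is centrosymmetric with respect to the origin, i.e. $x\in\Omega\implies-x\in\Omega$.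
   Context: A domain is a connected open set; $B_r(0)$ is the open ball of radius $r$ centered at the origin; star-shaped with respect to the origin means that the segment from $0$ to $x$ lies in $\Omega$ for every $x\in\Omega$. The fractional Laplacian is $(-\Delta)^s u(x)=c_{N,s}\lim_{\varepsilon\to0^+}\int_{|y-x|>\varepsilon}\frac{u(x)-u(y)}{|x-y|^{N+2s}}\,dy$ with $c_{N,s}=\frac{2^{2s}s\,\Gamma((N+2s)/2)}{\pi^{N/2}\Gamma(1-s)}$. Put $\mathcal{E}_s[u,v]=\iint_{\mathbb{R}^{2N}}\frac{(u(x)-u(y))(v(x)-v(y))}{|x-y|^{N+2s}}dx\,dy$ and $\widetilde{H}^s(\Omega)=\{u\in L^2(\mathbb{R}^N):\mathcal{E}_s[u,u]<\infty,\ u\equiv0\text{ on }\mathbb{R}^N\setminus\Omega\}$. The solution $w$ is the one given by separation of variables: $w(\cdot,t)=\sum_k\frac{\sin(\sqrt{\lambda_k}\,t)}{\sqrt{\lambda_k}}\langle u_0,\phi_k\rangle_{L^2(\Omega)}\phi_k$ (convergence in $L^2(\Omega)$), where $\{\phi_k\}\subset\widetilde{H}^s(\Omega)$ is an $L^2(\Omega)$-orthonormal basis of eigenfunctions of $(-\Delta)^s$ with zero exterior condition, i.e. $\frac{c_{N,s}}{2}\mathcal{E}_s[\phi_k,v]=\lambda_k\langle\phi_k,v\rangle_{L^2}$ for all $v\in\widetilde{H}^s(\Omega)$. The Laplace transform is an $L^2(\Omega)$-valued integral; $W_\lambda$ is identified with its representative that is continuous in $\Omega$, so that $W_\lambda(0)$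 makes sense. *)

theory Defs
  imports "HOL-Analysis.Analysis"
begin

section \<open>Domains and test functions\<close>

text \<open>
  Near each boundary point, \<open>\<Omega>\<close> is the region strictly above the graph of a \<open>C\<^sup>1\<^sup>,\<^sup>1\<close> function \<open>\<gamma>\<close> over
  the hyperplane orthogonal to a unit vector \<open>e\<close> (the choice of \<open>e\<close> plays the role of the rigid
  change of coordinates). Since hyperplanes are not types, \<open>\<gamma>\<close> is a function on the whole space, but
  only its values on the hyperplane are used; a \<open>C\<^sup>1\<^sup>,\<^sup>1\<close> function on the hyperplane extends to the
  space by composition with the orthogonal projection.
\<close>

definition C11_function :: "('a::euclidean_space \<Rightarrow> real) \<Rightarrow> bool" where
  "C11_function \<gamma> \<longleftrightarrow> (\<exists>D L. (\<forall>x. GDERIV \<gamma> x :> D x) \<and> lipschitz_on L UNIV D)"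

definition C11_boundary :: "'a::euclidean_space set \<Rightarrow> bool" where
  "C11_boundary \<Omega> \<longleftrightarrow>
     (\<forall>p\<in>frontier \<Omega>. \<exists>r>0. \<exists>e \<gamma>. norm e = 1 \<and> C11_function \<gamma> \<and>
        \<Omega> \<inter> ball p r = {x \<in> ball p r. \<gamma> (x - (x \<bullet> e) *\<^sub>R e) < x \<bullet> e})"

definition star_shaped_origin :: "'a::euclidean_space set \<Rightarrow> bool" where
  "star_shaped_origin \<Omega> \<longleftrightarrow> (\<forall>x\<in>\<Omega>. closed_segment 0 x \<subseteq> \<Omega>)"

definition centrosymmetric :: "'a::euclidean_space set \<Rightarrow> bool" where
  "centrosymmetric \<Omega> \<longleftrightarrow> (\<forall>x. x \<in> \<Omega> \<longrightarrow> - x \<in> \<Omega>)"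

primrec Ck_function :: "nat \<Rightarrow> ('a::euclidean_space \<Rightarrow> real) \<Rightarrow> bool" where
  "Ck_function 0 f \<longleftrightarrow> continuous_on UNIV f"
| "Ck_function (Suc k) f \<longleftrightarrow>
     (\<forall>x. f differentiable at x) \<and> (\<forall>v. Ck_function k (\<lambda>x. frechet_derivative f (at x) v))"

definition supp :: "('a::euclidean_space \<Rightarrow> real) \<Rightarrow> 'a set" where
  "supp f = closure {x. f x \<noteq> 0}"

text \<open>As usual, the elements of \<open>C\<^sub>0\<^sup>\<infinity>(\<Omega>)\<close> are regarded as functions on the whole space, extended by zero.\<close>

definition test_functions :: "'a::euclidean_space set \<Rightarrow> ('a \<Rightarrow> real) set" where
  "test_functions \<Omega> = {f. (\<forall>k. Ck_function k f) \<and> compact (supp f) \<and> supp f \<subseteq> \<Omega>}"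

definition odd_data :: "'a::euclidean_space set \<Rightarrow> real \<Rightarrow> ('a \<Rightarrow> real) set" where
  "odd_data \<Omega> \<delta> =
     {u \<in> test_functions \<Omega>. supp u \<subseteq> ball 0 \<delta> \<and> (\<forall>x\<in>ball 0 \<delta>. u x = - u (- x))}"


section \<open>The space \<open>L\<^sup>2(\<Omega>)\<close>\<close>

text \<open>
  Elements of \<open>L\<^sup>2(\<Omega>)\<close> are represented by functions, which may be taken Borel measurable; all notions
  below only see the restriction to \<open>\<Omega>\<close> up to null sets. \<open>L2_norm\<close> is meaningful only on \<open>L2 \<Omega>\<close>
  (the Bochner integral of a non-integrable function is \<open>0\<close>), so membership is always required
  separately.
\<close>

definition L2 :: "'a::euclidean_space set \<Rightarrow> ('a \<Rightarrow> real) set" where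
  "L2 \<Omega> = {f. set_borel_measurable lborel \<Omega> f \<and> set_integrable lborel \<Omega> (\<lambda>x. (f x)\<^sup>2)}"

definition L2_inner :: "'a::euclidean_space set \<Rightarrow> ('a \<Rightarrow> real) \<Rightarrow> ('a \<Rightarrow> real) \<Rightarrow> real" where
  "L2_inner \<Omega> f g = (LINT x:\<Omega>|lborel. f x * g x)"

definition L2_norm :: "'a::euclidean_space set \<Rightarrow> ('a \<Rightarrow> real) \<Rightarrow> real" where
  "L2_norm \<Omega> f = sqrt (L2_inner \<Omega> f f)"

definition L2_sums ::
    "'a::euclidean_space set \<Rightarrow> (nat \<Rightarrow> 'a \<Rightarrow> real) \<Rightarrow> ('a \<Rightarrow> real) \<Rightarrow> bool" where
  "L2_sums \<Omega> g f \<longleftrightarrow> (\<forall>k. g k \<in> L2 \<Omega>) \<and> f \<in> L2 \<Omega> \<and>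
     (\<lambda>n. L2_norm \<Omega> (\<lambda>x. f x - (\<Sum>k<n. g k x))) \<longlonglongrightarrow> 0"

text \<open>
  The library's \<^const>\<open>has_bochner_integral\<close> needs a type of class \<^class>\<open>real_normed_vector\<close> as codomain,
  whereas \<open>L\<^sup>2(\<Omega>)\<close> depends on the term \<open>\<Omega>\<close>. The following is its definition with the norm of
  \<open>L\<^sup>2(\<Omega>)\<close>; the list \<open>[(A\<^sub>1,g\<^sub>1),\<dots>]\<close> stands for the simple function \<open>t \<mapsto> \<Sum>\<^sub>i 1\<^bsub>A\<^sub>i\<^esub>(t) g\<^sub>i\<close>.
\<close>

definition L2_simple_integrable ::
    "'a::euclidean_space set \<Rightarrow> 'b measure \<Rightarrow> ('b set \<times> ('a \<Rightarrow> real)) list \<Rightarrow> bool" where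
  "L2_simple_integrable \<Omega> M S \<longleftrightarrow>
     (\<forall>(A, g) \<in> set S. A \<in> sets M \<and> emeasure M A < \<infinity> \<and> g \<in> L2 \<Omega>)"

definition simple_value :: "('b set \<times> ('a \<Rightarrow> real)) list \<Rightarrow> 'b \<Rightarrow> 'a \<Rightarrow> real" where
  "simple_value S t x = (\<Sum>(A, g)\<leftarrow>S. indicator A t * g x)"

definition simple_integral :: "'b measure \<Rightarrow> ('b set \<times> ('a \<Rightarrow> real)) list \<Rightarrow> 'a \<Rightarrow> real" where
  "simple_integral M S x = (\<Sum>(A, g)\<leftarrow>S. measure M A * g x)"

definition has_L2_bochner_integral ::
    "'a::euclidean_space set \<Rightarrow> 'b measure \<Rightarrow> ('b \<Rightarrow> 'a \<Rightarrow> real) \<Rightarrow> ('a \<Rightarrow> real) \<Rightarrow> bool" where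
  "has_L2_bochner_integral \<Omega> M F G \<longleftrightarrow>
     (\<forall>t\<in>space M. F t \<in> L2 \<Omega>) \<and> G \<in> L2 \<Omega> \<and>
     (\<exists>S. (\<forall>n. L2_simple_integrable \<Omega> M (S n)) \<and>
          (\<forall>n. (\<lambda>t. L2_norm \<Omega> (\<lambda>x. F t x - simple_value (S n) t x)) \<in> borel_measurable M) \<and>
          (\<lambda>n. \<integral>\<^sup>+ t. ennreal (L2_norm \<Omega> (\<lambda>x. F t x - simple_value (S n) t x)) \<partial>M) \<longlonglongrightarrow> 0 \<and>
          (\<lambda>n. L2_norm \<Omega> (\<lambda>x. simple_integral M (S n) x - G x)) \<longlonglongrightarrow> 0)"


section \<open>The fractional Laplacian: energy form and Dirichlet eigenfunctions\<close>

definition frac_const :: "nat \<Rightarrow> real \<Rightarrow> real" where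
  "frac_const N s =
     2 powr (2 * s) * s * Gamma ((real N + 2 * s) / 2) / (pi powr (real N / 2) * Gamma (1 - s))"

definition energy_integrand ::
    "real \<Rightarrow> ('a::euclidean_space \<Rightarrow> real) \<Rightarrow> ('a \<Rightarrow> real) \<Rightarrow> 'a \<times> 'a \<Rightarrow> real" where
  "energy_integrand s u v =
     (\<lambda>(x, y). (u x - u y) * (v x - v y) / norm (x - y) powr (real DIM('a) + 2 * s))"

definition energy :: "real \<Rightarrow> ('a::euclidean_space \<Rightarrow> real) \<Rightarrow> ('a \<Rightarrow> real) \<Rightarrow> real" where
  "energy s u v = integral\<^sup>L (lborel \<Otimes>\<^sub>M lborel) (energy_integrand s u v)"

definition Htilde :: "real \<Rightarrow> 'a::euclidean_space set \<Rightarrow> ('a \<Rightarrow> real) set" where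
  "Htilde s \<Omega> = {u \<in> L2 UNIV. integrable (lborel \<Otimes>\<^sub>M lborel) (energy_integrand s u u) \<and>
                   (AE x in lborel. x \<notin> \<Omega> \<longrightarrow> u x = 0)}"

definition frac_eigenbasis ::
    "real \<Rightarrow> 'a::euclidean_space set \<Rightarrow> (nat \<Rightarrow> 'a \<Rightarrow> real) \<Rightarrow> (nat \<Rightarrow> real) \<Rightarrow> bool" where
  "frac_eigenbasis s \<Omega> \<phi> \<mu> \<longleftrightarrow>
     (\<forall>k. \<phi> k \<in> Htilde s \<Omega>) \<and>
     (\<forall>j k. L2_inner \<Omega> (\<phi> j) (\<phi> k) = (if j = k then 1 else 0)) \<and>
     (\<forall>f\<in>L2 \<Omega>. L2_sums \<Omega> (\<lambda>k x. L2_inner \<Omega> f (\<phi> k) * \<phi> k x) f) \<and>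
     (\<forall>k. \<forall>v\<in>Htilde s \<Omega>.
        frac_const DIM('a) s / 2 * energy s (\<phi> k) v = \<mu> k * L2_inner \<Omega> (\<phi> k) v)"


section \<open>The wave equation and the Laplace transform\<close>

text \<open>
  \<open>wave_solution \<Omega> \<phi> \<mu> u\<^sub>0 t\<close> is \<open>w(\<cdot>,t)\<close>, a representative vanishing outside \<open>\<Omega>\<close> of the sum
  in \<open>L\<^sup>2(\<Omega>)\<close> of the series obtained by separation of variables.
\<close>

definition wave_solution ::
    "'a::euclidean_space set \<Rightarrow> (nat \<Rightarrow> 'a \<Rightarrow> real) \<Rightarrow> (nat \<Rightarrow> real) \<Rightarrow> ('a \<Rightarrow> real) \<Rightarrow> real \<Rightarrow> 'a \<Rightarrow> real"
  where
  "wave_solution \<Omega> \<phi> \<mu> u0 t = (SOME f. (\<forall>x. x \<notin> \<Omega> \<longrightarrow> f x = 0) \<and>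
     L2_sums \<Omega> (\<lambda>k x. sin (sqrt (\<mu> k) * t) / sqrt (\<mu> k) * L2_inner \<Omega> u0 (\<phi> k) * \<phi> k x) f)"

text \<open>
  The \<open>L\<^sup>2(\<Omega>)\<close>-valued Laplace transform, identified with its representative that is continuous in
  \<open>\<Omega>\<close>. Two such representatives agree on the open set \<open>\<Omega>\<close>, so the choice is irrelevant there.
\<close>

definition L2_laplace_transform ::
    "'a::euclidean_space set \<Rightarrow> (real \<Rightarrow> 'a \<Rightarrow> real) \<Rightarrow> real \<Rightarrow> 'a \<Rightarrow> real" where
  "L2_laplace_transform \<Omega> w l = (SOME W. continuous_on \<Omega> W \<and>
     has_L2_bochner_integral \<Omega> (restrict_space lborel {0..}) (\<lambda>t x. exp (- l * t) * w t x) W)"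

end

theory Submission
  imports Defs "HOL-Real_Asymp.Real_Asymp"
begin

text \<open>
  The Laplace transform \<open>W\<^sub>\<lambda>\<close> is the resolvent \<open>(\<lambda>\<^sup>2 + (-\<Delta>)\<^sup>s)\<^sup>-\<^sup>1 u\<^sub>0\<close>. If \<open>\<Omega>\<close> is centrosymmetric, the
  resolvent commutes with the reflection in \<open>0\<close>, so it maps odd data to odd functions, which vanish
  at \<open>0\<close>.

  Conversely, let \<open>\<ell> f\<close> be the value at \<open>0\<close> of the resolvent of \<open>f\<close> for \<open>\<lambda> = 1\<close>, a functional bounded in the
  supremum norm by the maximum principle. For a bump \<open>v\<close> compactly supported in \<open>\<Omega>\<close> the resolvent of
  \<open>v + (-\<Delta>)\<^sup>s v\<close> is \<open>v\<close>, so \<open>\<ell>\<close> determines \<open>\<ell> ((-\<Delta>)\<^sup>s v)\<close> from \<open>\<ell> v\<close>. The key is a unique continuation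
  principle for functionals: if \<open>\<Lambda>\<close> vanishes on all functions supported in some ball and on \<open>(-\<Delta>)\<^sup>s v\<close> for all
  bumps \<open>v\<close> in that ball, then \<open>\<Lambda> = 0\<close>. Indeed, shrinking the bumps shows that away from the ball \<open>\<Lambda>\<close>
  annihilates the kernels \<open>\<bar>y - x\<bar>\<^sup>-\<^sup>N\<^sup>-\<^sup>2\<^sup>s\<close> with \<open>x\<close> near the centre; applying the Laplacian in \<open>x\<close> yields all exponents
  \<open>-N - 2s - 2m\<close>, hence by Weierstrass approximation the Gaussians, hence by differentiation in \<open>x\<close> and
  Stone-Weierstrass everything.

  Under hypothesis (1) this applies to \<open>f \<mapsto> \<ell> f - \<ell> (f(-\<cdot>))\<close> and \<open>B\<^sub>\<delta>(0)\<close>, so \<open>\<ell>\<close> is reflection invariant. If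
  \<open>\<Omega>\<close> were not centrosymmetric, some ball in \<open>\<Omega>\<close> would miss the reflection of the closure of \<open>\<Omega>\<close>; then \<open>\<ell>\<close>
  itself would vanish on functions supported in that ball, hence everywhere, contradicting
  \<open>\<ell> (v + (-\<Delta>)\<^sup>s v) = v 0 = 1\<close> for a bump \<open>v\<close> centred at \<open>0\<close>.
\<close>

section \<open>Radial integrals and the fractional kernel\<close>

text \<open>In terms of Riesz representation, \<open>point_value\<close>, which evaluates the
  resolvent at 0, is integration against the Green function of 1 + (-\<Delta>)^s with pole 0. Unique
  continuation is the antilocality of (-\<Delta>)^s for such measures; phrased for functionals it
  needs no construction or estimate of the Green function. The obstacle is to evaluate at a point at
  all: eigenfunction expansions give only an L2 class. In place of regularity theory there is one
  family of test functions, the translates and dilates of \<open>bump\<close>. Testing the weak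
  equation with them controls the means of the solution against dilates of \<open>bump_op\<close>,
  the fractional Laplacian of \<open>bump\<close> up to a constant. Superposing these over all
  scales yields a nonnegative integrable mollifier \<open>profile\<close>, and the mollified
  solutions converge locally uniformly. The function (1 - |x|^2)_+^2 is smooth enough for this,
  since its second differences are quadratically small, and its radial monotonicity makes
  \<open>profile\<close> nonnegative. The same bumps return in the uniqueness proof, where the tail
  of \<open>bump_op\<close> supplies the kernel functions.\<close>

lemma nn_integral_affine:
  fixes t :: "'a::euclidean_space"
  assumes [measurable]: "f \<in> borel_measurable borel" and c: "c \<noteq> 0"
  shows "(\<integral>\<^sup>+x. f x \<partial>lborel) = ennreal (\<bar>c\<bar> ^ DIM('a)) * (\<integral>\<^sup>+x. f (t + c *\<^sub>R x) \<partial>lborel)"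
  by (subst lborel_affine[OF c, of t])
     (simp add: nn_integral_density nn_integral_distr nn_integral_cmult)

lemma integrable_affine:
  fixes t :: "'a::euclidean_space" and f :: "'a \<Rightarrow> real"
  assumes f: "integrable lborel f" and c: "c \<noteq> 0"
  shows "integrable lborel (\<lambda>x. f (t + c *\<^sub>R x))"
  using f f[THEN borel_measurable_integrable] c unfolding integrable_iff_bounded
  by (subst (asm) nn_integral_affine[where c=c and t=t]) (auto simp: ennreal_mult_less_top)

lemma integrable_affine_iff:
  fixes t :: "'a::euclidean_space" and f :: "'a \<Rightarrow> real"
  assumes c: "c \<noteq> 0"
  shows "integrable lborel (\<lambda>x. f (t + c *\<^sub>R x)) \<longleftrightarrow> integrable lborel f"
proof
  assume "integrable lborel (\<lambda>x. f (t + c *\<^sub>R x))"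
  from integrable_affine[OF this, of "1/c" "- (t /\<^sub>R c)"] c
  show "integrable lborel f" by (simp add: scaleR_diff_right divide_inverse)
qed (use integrable_affine[OF _ c] in blast)

lemma integral_affine:
  fixes t :: "'a::euclidean_space" and f :: "'a \<Rightarrow> real"
  assumes c: "c \<noteq> 0"
  shows "(\<integral>x. f x \<partial>lborel) = \<bar>c\<bar> ^ DIM('a) * (\<integral>x. f (t + c *\<^sub>R x) \<partial>lborel)"
proof (cases "integrable lborel f")
  case True
  then have [measurable]: "f \<in> borel_measurable borel" by auto
  have [measurable]: "(\<lambda>x. f (t + c *\<^sub>R x)) \<in> borel_measurable borel" by measurable
  show ?thesis
    by (subst lborel_affine[OF c, of t]) (simp add: integral_density integral_distr)
next
  case False
  then show ?thesis using integrable_affine_iff[OF c, of f t]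
    by (simp add: not_integrable_integral_eq)
qed

lemma integral_translate:
  fixes t :: "'a::euclidean_space" and f :: "'a \<Rightarrow> real"
  shows "(\<integral>x. f (x + t) \<partial>lborel) = (\<integral>x. f x \<partial>lborel)"
  using integral_affine[of 1 f t] by (simp add: add.commute)

lemma integrable_translate_iff:
  fixes t :: "'a::euclidean_space" and f :: "'a \<Rightarrow> real"
  shows "integrable lborel (\<lambda>x. f (x + t)) \<longleftrightarrow> integrable lborel f"
  using integrable_affine_iff[of 1 f t] by (simp add: add.commute)

lemma integral_reflect:
  fixes f :: "'a::euclidean_space \<Rightarrow> real"
  shows "(\<integral>x. f (- x) \<partial>lborel) = (\<integral>x. f x \<partial>lborel)"
  using integral_affine[of "-1" f 0] by simp

lemma integrable_reflect_iff:
  fixes f :: "'a::euclidean_space \<Rightarrow> real"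
  shows "integrable lborel (\<lambda>x. f (- x)) \<longleftrightarrow> integrable lborel f"
  using integrable_affine_iff[of "-1" f 0] by simp

text \<open>Surface measure of the unit sphere, as the derivative at t = 1 of the ball volume
  \<open>unit_ball_vol N * t ^ N\<close>.\<close>

definition sphere_area :: "'a::euclidean_space itself \<Rightarrow> real" where
  "sphere_area _ = real DIM('a) * unit_ball_vol (real DIM('a))"

lemma sphere_area_pos: "sphere_area TYPE('a::euclidean_space) > 0"
  by (simp add: sphere_area_def)

text \<open>Polar coordinates without a surface measure: both sides give a half-line
  \<open>{..a}\<close> the volume of the ball of radius a, and the half-lines form an
  intersection-stable generator.\<close>

lemma distr_norm_lborel:
  "distr (lborel :: 'a::euclidean_space measure) borel norm =
     density lborel (\<lambda>t. ennreal (sphere_area TYPE('a) * t ^ (DIM('a) - 1) * indicator {0..} t))"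
proof -
  let ?N = "DIM('a)"
  let ?E = "range (\<lambda>a::real. {..a})"
  let ?D = "density lborel (\<lambda>t. ennreal (sphere_area TYPE('a) * t ^ (?N - 1) * indicator {0..} t))"
  have eq: "emeasure (distr (lborel :: 'a measure) borel norm) {..a} = emeasure ?D {..a}" for a :: real
  proof -
    have L: "emeasure (distr (lborel :: 'a measure) borel norm) {..a} = emeasure lborel (cball 0 a :: 'a set)"
      by (subst emeasure_distr) (auto intro!: arg_cong[where f="emeasure lborel"])
    have R: "emeasure ?D {..a} = (\<integral>\<^sup>+t. ennreal (sphere_area TYPE('a) * t ^ (?N - 1)) * indicator {0..a} t \<partial>lborel)"
      by (subst emeasure_density) (auto intro!: nn_integral_cong split: split_indicator)
    show ?thesis
    proof (cases "a \<ge> 0")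
      case True
      have "(\<integral>\<^sup>+t. ennreal (sphere_area TYPE('a) * t ^ (?N - 1)) * indicator {0..a} t \<partial>lborel)
          = ennreal (unit_ball_vol (real ?N) * a ^ ?N - unit_ball_vol (real ?N) * 0 ^ ?N)"
        using True
        by (intro nn_integral_FTC_Icc)
           (auto intro!: derivative_eq_intros mult_nonneg_nonneg simp: sphere_area_def)
      then show ?thesis unfolding L R using True by (simp add: emeasure_cball)
    next
      case False
      then show ?thesis unfolding L R by simp
    qed
  qed
  show ?thesis
  proof (rule measure_eqI_generator_eq[where E="?E" and \<Omega>=UNIV and A="\<lambda>i. {..real i}"])
    show "Int_stable ?E" by (auto simp: Int_stable_def intro: range_eqI[of _ _ "min _ _"])
    show "sets (distr (lborel :: 'a measure) borel norm) = sigma_sets UNIV ?E"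
      by (simp add: borel_eq_atMost)
    show "sets ?D = sigma_sets UNIV ?E" by (simp add: borel_eq_atMost)
    show "(\<Union>i. {..real i}) = UNIV" by (auto intro: real_arch_simple)
    show "emeasure (distr (lborel :: 'a measure) borel norm) {..real i} \<noteq> \<infinity>" for i
    proof -
      have "emeasure (distr (lborel :: 'a measure) borel norm) {..real i} = emeasure lborel (cball 0 (real i) :: 'a set)"
        by (subst emeasure_distr) (auto intro!: arg_cong[where f="emeasure lborel"])
      then show ?thesis by (simp add: emeasure_cball)
    qed
  qed (auto simp: eq)
qed

lemma nn_integral_radial:
  fixes f :: "real \<Rightarrow> ennreal"
  assumes [measurable]: "f \<in> borel_measurable borel"
  shows "(\<integral>\<^sup>+x. f (norm x) \<partial>(lborel :: 'a::euclidean_space measure)) =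
    (\<integral>\<^sup>+t. ennreal (sphere_area TYPE('a) * t ^ (DIM('a) - 1) * indicator {0..} t) * f t \<partial>lborel)"
proof -
  have "(\<integral>\<^sup>+x. f (norm x) \<partial>(lborel :: 'a measure)) = (\<integral>\<^sup>+t. f t \<partial>(distr (lborel :: 'a measure) borel norm))"
    by (subst nn_integral_distr) auto
  then show ?thesis unfolding distr_norm_lborel by (subst (asm) nn_integral_density) auto
qed

lemma integral_radial:
  fixes f :: "real \<Rightarrow> real"
  assumes [measurable]: "f \<in> borel_measurable borel"
  shows "(\<integral>x. f (norm x) \<partial>(lborel :: 'a::euclidean_space measure)) =
    (\<integral>t. sphere_area TYPE('a) * t ^ (DIM('a) - 1) * indicator {0..} t * f t \<partial>lborel)"
proof -
  have "(\<integral>x. f (norm x) \<partial>(lborel :: 'a measure)) = (\<integral>t. f t \<partial>(distr (lborel :: 'a measure) borel norm))"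
    by (subst integral_distr) auto
  then show ?thesis unfolding distr_norm_lborel
    by (subst (asm) integral_density) (auto simp: sphere_area_pos less_imp_le split: split_indicator)
qed

text \<open>By the convention \<open>0 powr a = 0\<close> the kernel vanishes at the origin, so
  formulas on the diagonal need no case distinction.\<close>

definition frac_kernel :: "real \<Rightarrow> 'a::euclidean_space \<Rightarrow> real" where
  "frac_kernel s z = norm z powr (- (real DIM('a) + 2 * s))"

lemma frac_kernel_nonneg [simp]: "0 \<le> frac_kernel s z"
  by (simp add: frac_kernel_def)

lemma frac_kernel_pos: "z \<noteq> 0 \<Longrightarrow> 0 < frac_kernel s z"
  by (simp add: frac_kernel_def)

lemma frac_kernel_0 [simp]: "frac_kernel s 0 = 0"
  by (simp add: frac_kernel_def)

lemma frac_kernel_minus [simp]: "frac_kernel s (- z) = frac_kernel s z"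
  by (simp add: frac_kernel_def)

lemma borel_measurable_frac_kernel [measurable]: "frac_kernel s \<in> borel_measurable borel"
  unfolding frac_kernel_def[abs_def] by measurable

lemma frac_kernel_scale:
  fixes z :: "'a::euclidean_space"
  assumes "c > 0"
  shows "frac_kernel s (c *\<^sub>R z) = c powr (- (real DIM('a) + 2 * s)) * frac_kernel s z"
  using assms by (simp add: frac_kernel_def powr_mult)

lemma continuous_on_frac_kernel: "continuous_on (- {0}) (frac_kernel s)"
  unfolding frac_kernel_def[abs_def] by (auto intro!: continuous_intros)

lemma frac_kernel_mono:
  fixes x y :: "'a::euclidean_space"
  assumes "0 < norm x" "norm x \<le> norm y" "s > 0"
  shows "frac_kernel s y \<le> frac_kernel s x"
  unfolding frac_kernel_def using assms by (intro powr_mono2') auto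

lemma nn_integral_frac_kernel_outside:
  assumes s: "s > 0" and r: "r > 0"
  shows "(\<integral>\<^sup>+z. ennreal (frac_kernel s z * indicator {r..} (norm z)) \<partial>(lborel::'a::euclidean_space measure))
      = ennreal (sphere_area TYPE('a) / (2 * s) * r powr (- 2 * s))"
proof -
  let ?N = "DIM('a)" and ?A = "sphere_area TYPE('a)"
  let ?F = "\<lambda>t. - ?A / (2 * s) * t powr (- 2 * s)"
  have "(\<integral>\<^sup>+z. ennreal (frac_kernel s z * indicator {r..} (norm z)) \<partial>(lborel::'a measure))
     = (\<integral>\<^sup>+t. ennreal (?A * t ^ (?N - 1) * indicator {0..} t) * ennreal (t powr (- (real ?N + 2 * s)) * indicator {r..} t) \<partial>lborel)"
    unfolding frac_kernel_def by (rule nn_integral_radial) measurable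
  also have "\<dots> = (\<integral>\<^sup>+t. ennreal (?A * t powr (- 1 - 2 * s)) * indicator {r..} t \<partial>lborel)"
  proof (intro nn_integral_cong)
    fix t :: real
    show "ennreal (?A * t ^ (?N - 1) * indicator {0..} t) * ennreal (t powr (- (real ?N + 2 * s)) * indicator {r..} t)
       = ennreal (?A * t powr (- 1 - 2 * s)) * indicator {r..} t"
    proof (cases "t \<ge> r")
      case True
      with r have t: "t > 0" by simp
      have "t ^ (?N - 1) * t powr (- (real ?N + 2 * s)) = t powr (real (?N - 1) + - (real ?N + 2 * s))"
        unfolding powr_add powr_realpow[OF t] ..
      also have "real (?N - 1) + - (real ?N + 2 * s) = - 1 - 2 * s"
        using DIM_positive[where 'a='a] by (simp add: of_nat_diff Suc_le_eq)
      finally show ?thesis using t True sphere_area_pos[where 'a='a]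
        by (simp add: ennreal_mult[symmetric] mult.assoc)
    qed (use r in auto)
  qed
  also have "\<dots> = ennreal (0 - ?F r)"
  proof (rule nn_integral_FTC_atLeast)
    show "DERIV ?F t :> ?A * t powr (- 1 - 2 * s)" if "r \<le> t" for t
    proof -
      have *: "- 1 - 2 * s = - 2 * s - 1" by simp
      have "((\<lambda>t. t powr (- 2 * s)) has_real_derivative (- 2 * s) * t powr (- 2 * s - 1)) (at t)"
        using that r by (intro has_real_derivative_powr) auto
      from DERIV_cmult[OF this, of "- ?A / (2 * s)"] show ?thesis unfolding * using s by simp
    qed
    have "((\<lambda>t::real. t powr (- 2 * s)) \<longlongrightarrow> 0) at_top"
      using s by (intro tendsto_neg_powr filterlim_ident) auto
    from tendsto_mult[OF tendsto_const[of "- ?A / (2 * s)"] this]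
    show "(?F \<longlongrightarrow> 0) at_top" by simp
  qed (use sphere_area_pos[where 'a='a] in auto)
  finally show ?thesis by simp
qed

lemma integrable_frac_kernel_outside:
  assumes s: "s > 0" and r: "r > 0"
  shows "integrable lborel (\<lambda>z::'a::euclidean_space. frac_kernel s z * indicator {r..} (norm z))"
    and "(\<integral>z. frac_kernel s z * indicator {r..} (norm z) \<partial>(lborel::'a measure))
        = sphere_area TYPE('a) / (2 * s) * r powr (- 2 * s)"
proof -
  have "has_bochner_integral lborel (\<lambda>z::'a. frac_kernel s z * indicator {r..} (norm z))
     (sphere_area TYPE('a) / (2 * s) * r powr (- 2 * s))"
    using sphere_area_pos[where 'a='a] s r
    by (intro has_bochner_integral_nn_integral nn_integral_frac_kernel_outside) auto
  then show "integrable lborel (\<lambda>z::'a. frac_kernel s z * indicator {r..} (norm z))"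
    and "(\<integral>z. frac_kernel s z * indicator {r..} (norm z) \<partial>(lborel::'a measure))
        = sphere_area TYPE('a) / (2 * s) * r powr (- 2 * s)"
    by (auto simp: has_bochner_integral_iff)
qed

text \<open>In polar coordinates the integrand becomes a multiple of
  \<open>t powr (1 - 2 * s)\<close>, which is integrable at 0 because s < 1.\<close>

lemma nn_integral_frac_kernel_inside:
  assumes s: "s > 0" "s < 1"
  shows "(\<integral>\<^sup>+z. ennreal ((norm z)\<^sup>2 * frac_kernel s z * indicator {0..1} (norm z)) \<partial>(lborel::'a::euclidean_space measure)) < \<infinity>"
proof -
  let ?N = "DIM('a)" and ?A = "sphere_area TYPE('a)"
  have "(\<integral>\<^sup>+z. ennreal ((norm z)\<^sup>2 * frac_kernel s z * indicator {0..1} (norm z)) \<partial>(lborel::'a measure))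
     = (\<integral>\<^sup>+t. ennreal (?A * t ^ (?N - 1) * indicator {0..} t) * ennreal (t\<^sup>2 * t powr (- (real ?N + 2 * s)) * indicator {0..1} t) \<partial>lborel)"
    unfolding frac_kernel_def by (rule nn_integral_radial) measurable
  also have "\<dots> = (\<integral>\<^sup>+t. ennreal ?A * (ennreal (indicator {0..1} t * t powr (1 - 2 * s))) \<partial>lborel)"
  proof (intro nn_integral_cong)
    fix t :: real
    show "ennreal (?A * t ^ (?N - 1) * indicator {0..} t) * ennreal (t\<^sup>2 * t powr (- (real ?N + 2 * s)) * indicator {0..1} t)
       = ennreal ?A * (ennreal (indicator {0..1} t * t powr (1 - 2 * s)))"
    proof (cases "t > 0")
      case True
      have "t ^ (?N - 1) * (t\<^sup>2 * t powr (- (real ?N + 2 * s))) = t powr (real (?N - 1) + (2 + - (real ?N + 2 * s)))"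
        using True unfolding powr_add powr_realpow[OF True] by (simp add: powr_numeral)
      also have "real (?N - 1) + (2 + - (real ?N + 2 * s)) = 1 - 2 * s"
        using DIM_positive[where 'a='a] by (simp add: of_nat_diff Suc_le_eq)
      finally show ?thesis using True sphere_area_pos[where 'a='a]
        by (simp add: ennreal_mult[symmetric] mult.assoc split: split_indicator)
    next
      case False
      then show ?thesis by (cases "t = 0") auto
    qed
  qed
  also have "\<dots> = ennreal ?A * (\<integral>\<^sup>+t. ennreal (indicator {0..1} t * t powr (1 - 2 * s)) \<partial>lborel)"
    by (rule nn_integral_cmult) measurable
  also have "(\<integral>\<^sup>+t. ennreal (indicator {0..1} t * t powr (1 - 2 * s)) \<partial>lborel) = ennreal (1 powr ((1 - 2 * s) + 1) / ((1 - 2 * s) + 1))"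
    using s by (intro nn_integral_has_integral_lebesgue has_integral_powr_from_0) auto
  finally show ?thesis by (simp add: ennreal_mult_less_top)
qed

text \<open>The weight is the size of a second difference of a bounded C^{1,1} function: quadratic
  near 0, bounded far away. This is the common majorant of the singular integrals below.\<close>

lemma integrable_min_frac_kernel:
  assumes s: "s > 0" "s < 1"
  shows "integrable lborel (\<lambda>z::'a::euclidean_space. min 1 ((norm z)\<^sup>2) * frac_kernel s z)"
proof -
  have "integrable lborel (\<lambda>z::'a. (norm z)\<^sup>2 * frac_kernel s z * indicator {0..1} (norm z))"
    using nn_integral_frac_kernel_inside[OF s, where 'a='a]
    by (intro integrableI_nonneg) auto
  from Bochner_Integration.integrable_add[OF this integrable_frac_kernel_outside(1)[OF s(1) zero_less_one]]
  show ?thesis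
  proof (rule Bochner_Integration.integrable_bound)
    show "AE z::'a in lborel. norm (min 1 ((norm z)\<^sup>2) * frac_kernel s z)
       \<le> norm ((norm z)\<^sup>2 * frac_kernel s z * indicator {0..1} (norm z) + frac_kernel s z * indicator {1..} (norm z))"
    proof (intro AE_I2)
      fix z :: 'a
      have "min 1 ((norm z)\<^sup>2) * frac_kernel s z \<le> 1 * frac_kernel s z"
        by (intro mult_right_mono) auto
      moreover have "min 1 ((norm z)\<^sup>2) * frac_kernel s z \<le> (norm z)\<^sup>2 * frac_kernel s z"
        by (intro mult_right_mono) auto
      ultimately show "norm (min 1 ((norm z)\<^sup>2) * frac_kernel s z)
       \<le> norm ((norm z)\<^sup>2 * frac_kernel s z * indicator {0..1} (norm z) + frac_kernel s z * indicator {1..} (norm z))"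
        by (auto simp: abs_mult split: split_indicator)
    qed
  qed measurable
qed

section \<open>Invariance of Lebesgue measure under translations, isometric involutions and
  shears\<close>

lemma nn_integral_translate:
  fixes t :: "'a::euclidean_space"
  assumes "f \<in> borel_measurable borel"
  shows "(\<integral>\<^sup>+x. f (x + t) \<partial>lborel) = (\<integral>\<^sup>+x. f x \<partial>lborel)"
  using nn_integral_affine[OF assms, of 1 t] by (simp add: add.commute)

lemma nn_integral_reflect:
  fixes f :: "'a::euclidean_space \<Rightarrow> ennreal"
  assumes "f \<in> borel_measurable borel"
  shows "(\<integral>\<^sup>+x. f (- x) \<partial>lborel) = (\<integral>\<^sup>+x. f x \<partial>lborel)"
  using nn_integral_affine[OF assms, of "-1" 0] by simp

text \<open>
  Uniqueness of Haar measure, comparing the two translation invariant measures on the unit ball: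
  Fubini gives \<open>\<nu>(A) \<lambda>(B) = \<nu>(B) \<lambda>(A)\<close>.
\<close>

lemma distr_lborel_involutive_isometry:
  fixes T :: "'a::euclidean_space \<Rightarrow> 'a"
  assumes lin: "linear T" and iso: "\<And>x. norm (T x) = norm x" and inv: "\<And>x. T (T x) = x"
  shows "distr lborel borel T = lborel"
proof (rule measure_eqI)
  have [measurable]: "T \<in> borel_measurable borel"
    using lin linear_continuous_on[of T UNIV] linear_conv_bounded_linear
    by (intro borel_measurable_continuous_onI) auto
  fix A assume "A \<in> sets (distr lborel borel T)"
  then have A[measurable]: "A \<in> sets borel" by simp
  define B where "B = cball (0 :: 'a) 1"
  have [measurable]: "B \<in> sets borel" by (simp add: B_def)
  have TB: "T x \<in> B \<longleftrightarrow> x \<in> B" for x by (simp add: B_def iso)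
  let ?f = "indicator A :: 'a \<Rightarrow> ennreal" and ?g = "indicator B :: 'a \<Rightarrow> ennreal"
  have "emeasure (distr lborel borel T) A * emeasure lborel B = (\<integral>\<^sup>+x. ?f (T x) * (\<integral>\<^sup>+y. ?g y \<partial>lborel) \<partial>lborel)"
  proof -
    have "(\<integral>\<^sup>+x. ?f (T x) \<partial>lborel) = emeasure (distr lborel borel T) A"
      using nn_integral_distr[of T lborel borel "indicator A"] by simp
    then show ?thesis by (simp add: nn_integral_multc)
  qed
  also have "\<dots> = (\<integral>\<^sup>+x. (\<integral>\<^sup>+y. ?f (T x) * ?g (y + T x) \<partial>lborel) \<partial>lborel)"
  proof (rule nn_integral_cong)
    fix x
    show "?f (T x) * (\<integral>\<^sup>+y. ?g y \<partial>lborel) = (\<integral>\<^sup>+y. ?f (T x) * ?g (y + T x) \<partial>lborel)"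
    proof -
      have [measurable]: "?g \<in> borel_measurable borel" by measurable
      have "(\<integral>\<^sup>+y. ?f (T x) * ?g (y + T x) \<partial>lborel) = ?f (T x) * (\<integral>\<^sup>+y. ?g (y + T x) \<partial>lborel)"
        by (rule nn_integral_cmult) measurable
      then show ?thesis by (simp only: nn_integral_translate[OF \<open>?g \<in> borel_measurable borel\<close>])
    qed
  qed
  also have "\<dots> = (\<integral>\<^sup>+y. (\<integral>\<^sup>+x. ?f (T x) * ?g (y + T x) \<partial>lborel) \<partial>lborel)"
    by (rule lborel_pair.Fubini'[symmetric]) measurable
  also have "\<dots> = (\<integral>\<^sup>+y. (\<integral>\<^sup>+x. ?f (T x - y) * ?g (T x) \<partial>lborel) \<partial>lborel)"
  proof (rule nn_integral_cong)
    \<comment> \<open>Translating x by \<open>- T y\<close> replaces \<open>T x\<close> by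
      \<open>T x - y\<close>, since T is linear and its own inverse.\<close>
    fix y
    have "(\<integral>\<^sup>+x. ?f (T x) * ?g (y + T x) \<partial>lborel)
        = (\<integral>\<^sup>+x. ?f (T (x + - T y)) * ?g (y + T (x + - T y)) \<partial>lborel)"
      by (rule nn_integral_translate[symmetric]) measurable
    then show "(\<integral>\<^sup>+x. ?f (T x) * ?g (y + T x) \<partial>lborel) = (\<integral>\<^sup>+x. ?f (T x - y) * ?g (T x) \<partial>lborel)"
      using lin by (simp add: linear_diff inv)
  qed
  also have "\<dots> = (\<integral>\<^sup>+x. (\<integral>\<^sup>+y. ?f (T x - y) * ?g (T x) \<partial>lborel) \<partial>lborel)"
    by (rule lborel_pair.Fubini') measurable
  also have "\<dots> = (\<integral>\<^sup>+x. emeasure lborel A * ?g x \<partial>lborel)"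
  proof (rule nn_integral_cong)
    fix x
    have "(\<integral>\<^sup>+y. ?f (T x - y) \<partial>lborel) = (\<integral>\<^sup>+y. ?f (y + T x) \<partial>lborel)"
      by (subst nn_integral_reflect[symmetric]) (auto simp: add.commute)
    also have "\<dots> = emeasure lborel A" by (subst nn_integral_translate) auto
    finally show "(\<integral>\<^sup>+y. ?f (T x - y) * ?g (T x) \<partial>lborel) = emeasure lborel A * ?g x"
      by (simp add: nn_integral_multc TB indicator_def)
  qed
  also have "\<dots> = emeasure lborel A * emeasure lborel B"
    by (simp add: nn_integral_cmult)
  finally have "emeasure (distr lborel borel T) A * emeasure lborel B = emeasure lborel A * emeasure lborel B" .
  moreover have "emeasure lborel B \<noteq> 0" "emeasure lborel B \<noteq> \<infinity>"
    using unit_ball_vol_pos[of "real DIM('a)"] by (simp_all add: B_def emeasure_cball del: unit_ball_vol_pos)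
  ultimately show "emeasure (distr lborel borel T) A = emeasure lborel A"
    by (metis ennreal_mult_divide_eq infinity_ennreal_def)
qed simp

text \<open>The Householder reflection in the hyperplane orthogonal to x - y; equality of the norms
  makes it exchange x and y. It serves to show that \<open>bump_op\<close> is radial.\<close>

lemma exists_reflection:
  fixes x y :: "'a::euclidean_space"
  assumes "norm x = norm y"
  obtains T :: "'a \<Rightarrow> 'a" where "linear T" "\<And>z. norm (T z) = norm z" "\<And>z. T (T z) = z" "T x = y"
proof (cases "x = y")
  case True
  then show ?thesis using that[of "\<lambda>z. z"] by (auto simp: linear_iff)
next
  case False
  define n where "n = x - y"
  have n: "n \<bullet> n \<noteq> 0" using False by (simp add: n_def)
  define T where "T z = z - (2 * (z \<bullet> n) / (n \<bullet> n)) *\<^sub>R n" for z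
  have "linear T"
    by (rule linearI) (auto simp: T_def algebra_simps inner_simps add_divide_distrib)
  moreover have "T z \<bullet> T z = z \<bullet> z" for z
    using n by (simp add: T_def inner_simps inner_commute field_simps power2_eq_square)
  then have "norm (T z) = norm z" for z by (simp add: norm_eq)
  moreover have "T (T z) = z" for z
  proof -
    have "T z \<bullet> n = - (z \<bullet> n)" using n by (simp add: T_def inner_simps)
    then show ?thesis by (simp add: T_def[of "T z"]) (simp add: T_def)
  qed
  moreover have "T x = y"
  proof -
    have "x \<bullet> x = y \<bullet> y" using assms by (simp add: norm_eq)
    then have "2 * (x \<bullet> n) = n \<bullet> n" by (simp add: n_def inner_simps inner_commute)
    then show ?thesis using n by (simp add: T_def) (simp add: n_def)
  qed
  ultimately show ?thesis using that by blast
qed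

text \<open>Fubini and translation invariance of the inner integral. It provides the substitution y
  = x + z in the double integrals of the energy form, after which the kernel depends on z
  alone.\<close>

lemma distr_shear:
  "distr (lborel \<Otimes>\<^sub>M lborel) (borel \<Otimes>\<^sub>M borel) (\<lambda>(x, z). (x, x + z)) =
     (lborel \<Otimes>\<^sub>M lborel :: ('a::euclidean_space \<times> 'a) measure)"
proof -
  let ?S = "distr (lborel \<Otimes>\<^sub>M lborel) (borel \<Otimes>\<^sub>M borel) (\<lambda>(x, z). (x, x + z)) :: ('a \<times> 'a) measure"
  have [measurable]: "(\<lambda>(x, z). (x, x + z)) \<in> borel \<Otimes>\<^sub>M borel \<rightarrow>\<^sub>M borel \<Otimes>\<^sub>M (borel :: 'a measure)"
    by measurable
  have "emeasure ?S A = emeasure (lborel \<Otimes>\<^sub>M lborel) A"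
    if A[measurable]: "A \<in> sets (borel \<Otimes>\<^sub>M borel)" for A
  proof -
  have "emeasure (?S) A
      = (\<integral>\<^sup>+p. indicator A p \<partial>?S)"
    by simp
  also have "\<dots> = (\<integral>\<^sup>+p. indicator A (case p of (x, z) \<Rightarrow> (x, x + z)) \<partial>(lborel \<Otimes>\<^sub>M lborel))"
    by (subst nn_integral_distr) (auto simp: measurable_lborel1)
  also have "\<dots> = (\<integral>\<^sup>+x. (\<integral>\<^sup>+z. indicator A (x, x + z) \<partial>lborel) \<partial>lborel)"
    by (subst lborel.nn_integral_fst[symmetric]) auto
  also have "\<dots> = (\<integral>\<^sup>+x. (\<integral>\<^sup>+z. indicator A (x, z) \<partial>lborel) \<partial>lborel)"
  proof (rule nn_integral_cong)
    fix x :: 'a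
    show "(\<integral>\<^sup>+z. indicator A (x, x + z) \<partial>lborel) = (\<integral>\<^sup>+z. indicator A (x, z) \<partial>lborel)"
      using nn_integral_translate[of "\<lambda>z. indicator A (x, z)" x] by (simp add: add.commute)
  qed
  also have "\<dots> = (\<integral>\<^sup>+p. indicator A p \<partial>(lborel \<Otimes>\<^sub>M lborel))"
    by (subst lborel.nn_integral_fst[symmetric]) auto
  also have "\<dots> = emeasure (lborel \<Otimes>\<^sub>M lborel) A"
    by (rule nn_integral_indicator) simp
  finally show ?thesis .
  qed
  then show ?thesis by (intro measure_eqI) auto
qed

lemma nn_integral_shear:
  fixes f :: "'a::euclidean_space \<times> 'a \<Rightarrow> ennreal"
  assumes [measurable]: "f \<in> borel_measurable (borel \<Otimes>\<^sub>M borel)"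
  shows "(\<integral>\<^sup>+p. f p \<partial>(lborel \<Otimes>\<^sub>M lborel)) = (\<integral>\<^sup>+(x, z). f (x, x + z) \<partial>(lborel \<Otimes>\<^sub>M lborel))"
  by (subst distr_shear[symmetric], subst nn_integral_distr) (auto simp: case_prod_beta')

lemma integrable_shear_iff:
  fixes f :: "'a::euclidean_space \<times> 'a \<Rightarrow> real"
  assumes [measurable]: "f \<in> borel_measurable (borel \<Otimes>\<^sub>M borel)"
  shows "integrable (lborel \<Otimes>\<^sub>M lborel) f \<longleftrightarrow> integrable (lborel \<Otimes>\<^sub>M lborel) (\<lambda>(x, z). f (x, x + z))"
  by (subst distr_shear[symmetric], subst integrable_distr_eq) (auto simp: case_prod_beta')

lemma integral_shear:
  fixes f :: "'a::euclidean_space \<times> 'a \<Rightarrow> real"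
  assumes [measurable]: "f \<in> borel_measurable (borel \<Otimes>\<^sub>M borel)"
  shows "(\<integral>p. f p \<partial>(lborel \<Otimes>\<^sub>M lborel)) = (\<integral>(x, z). f (x, x + z) \<partial>(lborel \<Otimes>\<^sub>M lborel))"
  by (subst distr_shear[symmetric], subst integral_distr) (auto simp: case_prod_beta')

lemma integrable_pair_mult:
  fixes f :: "'a::euclidean_space \<Rightarrow> real" and g :: "'b::euclidean_space \<Rightarrow> real"
  assumes f: "integrable lborel f" and g: "integrable lborel g"
  shows "integrable (lborel \<Otimes>\<^sub>M lborel) (\<lambda>(x, y). f x * g y)"
proof -
  have [measurable]: "f \<in> borel_measurable borel" "g \<in> borel_measurable borel" using f g by auto
  show ?thesis
    using f g by (intro lborel_pair.Fubini_integrable) (auto simp: abs_mult)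
qed

section \<open>Second differences and the energy form\<close>

definition second_diff :: "('a::euclidean_space \<Rightarrow> real) \<Rightarrow> 'a \<Rightarrow> 'a \<Rightarrow> real" where
  "second_diff v x z = 2 * v x - v (x + z) - v (x - z)"

text \<open>This is (-\<Delta>)^s divided by \<open>frac_const N s / 2\<close>. Symmetrising in z
  and -z replaces the principal value by an absolutely convergent integral once second differences
  are O(|z|^2).\<close>

definition frac_op :: "real \<Rightarrow> ('a::euclidean_space \<Rightarrow> real) \<Rightarrow> 'a \<Rightarrow> real" where
  "frac_op s v x = (\<integral>z. second_diff v x z * frac_kernel s z \<partial>lborel)"

lemma energy_integrand_frac_kernel:
  fixes x y :: "'a::euclidean_space"
  shows "energy_integrand s u v (x, y) = (u x - u y) * (v x - v y) * frac_kernel s (y - x)"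
proof -
  have "frac_kernel s (y - x) = 1 / norm (x - y) powr (real DIM('a) + 2 * s)"
    by (simp only: frac_kernel_def powr_minus_divide norm_minus_commute[of y x])
  then show ?thesis by (simp add: energy_integrand_def)
qed

lemma measurable_energy_integrand [measurable]:
  assumes [measurable]: "u \<in> borel_measurable borel" "v \<in> borel_measurable borel"
  shows "energy_integrand s u v \<in> borel_measurable (borel \<Otimes>\<^sub>M (borel :: 'a::euclidean_space measure))"
proof -
  have "energy_integrand s u v = (\<lambda>p. (u (fst p) - u (snd p)) * (v (fst p) - v (snd p)) * frac_kernel s (snd p - fst p))"
    by (auto simp: energy_integrand_frac_kernel[symmetric])
  then show ?thesis by simp
qed

lemma integrable_energy_mixed:
  fixes u v :: "'a::euclidean_space \<Rightarrow> real"
  assumes [measurable]: "u \<in> borel_measurable borel" "v \<in> borel_measurable borel"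
    and u: "integrable (lborel \<Otimes>\<^sub>M lborel) (energy_integrand s u u)"
    and v: "integrable (lborel \<Otimes>\<^sub>M lborel) (energy_integrand s v v)"
  shows "integrable (lborel \<Otimes>\<^sub>M lborel) (energy_integrand s u v)"
proof (rule Bochner_Integration.integrable_bound[OF Bochner_Integration.integrable_add[OF u v]])
  show "AE p in lborel \<Otimes>\<^sub>M lborel. norm (energy_integrand s u v p) \<le>
          norm (energy_integrand s u u p + energy_integrand s v v p)"
  proof (rule AE_I2)
    fix p :: "'a \<times> 'a"
    obtain x y where p: "p = (x, y)" by fastforce
    have am: "\<bar>a * b\<bar> \<le> a * a + b * b" for a b :: real
    proof -
      have "2 * (\<bar>a\<bar> * \<bar>b\<bar>) \<le> a * a + b * b"
        using sum_squares_bound[of "\<bar>a\<bar>" "\<bar>b\<bar>"] by (simp add: power2_eq_square)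
      moreover have "0 \<le> \<bar>a\<bar> * \<bar>b\<bar>" by simp
      ultimately show ?thesis unfolding abs_mult by linarith
    qed
    have "\<bar>(u x - u y) * (v x - v y)\<bar> * frac_kernel s (y - x) \<le>
        ((u x - u y) * (u x - u y) + (v x - v y) * (v x - v y)) * frac_kernel s (y - x)"
      by (rule mult_right_mono[OF am]) simp
    then show "norm (energy_integrand s u v p) \<le> norm (energy_integrand s u u p + energy_integrand s v v p)"
      unfolding p energy_integrand_frac_kernel
      by (simp add: abs_mult distrib_right)
  qed
qed (simp add: measurable_lborel1)

lemma integrable_mult_bounded:
  fixes f g :: "'a \<Rightarrow> real"
  assumes f: "integrable M f" and [measurable]: "g \<in> borel_measurable M" and b: "\<And>x. \<bar>g x\<bar> \<le> B"
  shows "integrable M (\<lambda>x. f x * g x)"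
proof (rule Bochner_Integration.integrable_bound)
  show "integrable M (\<lambda>x. B * f x)" using f by simp
  have "B \<ge> 0" using b[of undefined] by linarith
  then show "AE x in M. norm (f x * g x) \<le> norm (B * f x)"
    using b by (intro AE_I2) (simp add: abs_mult mult.commute[of B] mult_left_mono)
qed (use f in measurable)

locale frac_order =
  fixes s :: real
  assumes s_pos: "0 < s" and s_less: "s < 1"
begin

lemma integrable_min_kernel: "integrable lborel (\<lambda>z::'a::euclidean_space. min 1 ((norm z)\<^sup>2) * frac_kernel s z)"
  by (rule integrable_min_frac_kernel[OF s_pos s_less])

lemma integrable_second_diff:
  fixes v :: "'a::euclidean_space \<Rightarrow> real"
  assumes [measurable]: "v \<in> borel_measurable borel"
    and sd: "\<And>z. \<bar>second_diff v x z\<bar> \<le> C * min 1 ((norm z)\<^sup>2)"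
  shows "integrable lborel (\<lambda>z. second_diff v x z * frac_kernel s z)"
proof (rule Bochner_Integration.integrable_bound)
  show "integrable lborel (\<lambda>z::'a. C * (min 1 ((norm z)\<^sup>2) * frac_kernel s z))"
    by (rule integrable_mult_right[OF integrable_min_kernel])
  show "(\<lambda>z. second_diff v x z * frac_kernel s z) \<in> borel_measurable lborel"
    unfolding second_diff_def by measurable
  show "AE z in lborel. norm (second_diff v x z * frac_kernel s z) \<le> norm (C * (min 1 ((norm z)\<^sup>2) * frac_kernel s z))"
  proof (rule AE_I2)
    fix z
    have "\<bar>second_diff v x z\<bar> * frac_kernel s z \<le> C * min 1 ((norm z)\<^sup>2) * frac_kernel s z"
      by (rule mult_right_mono[OF sd]) simp
    then show "norm (second_diff v x z * frac_kernel s z) \<le> norm (C * (min 1 ((norm z)\<^sup>2) * frac_kernel s z))"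
      using abs_ge_self[of "C * (min 1 ((norm z)\<^sup>2) * frac_kernel s z)"]
      unfolding real_norm_def abs_mult[of "second_diff v x z"] abs_of_nonneg[OF frac_kernel_nonneg]
      by (simp only: mult.assoc)
  qed
qed

text \<open>
  Substituting \<open>y = x + z\<close> and translating in \<open>x\<close> for fixed \<open>z\<close> turns the product of differences
  into a second difference before any singular integral has to be split, so no truncation is needed.
\<close>

lemma energy_eq_frac_op:
  fixes u v :: "'a::euclidean_space \<Rightarrow> real"
  assumes u: "integrable lborel u" and [measurable]: "v \<in> borel_measurable borel"
    and vb: "\<And>x. \<bar>v x\<bar> \<le> B"
    and sd: "\<And>x z. \<bar>second_diff v x z\<bar> \<le> C * min 1 ((norm z)\<^sup>2)"
    and int: "integrable (lborel \<Otimes>\<^sub>M lborel) (energy_integrand s u v)"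
  shows "energy s u v = (\<integral>x. u x * frac_op s v x \<partial>lborel)"
proof -
  have [measurable]: "u \<in> borel_measurable borel" using u by auto
  let ?g = "\<lambda>(x, z). (u x - u (x + z)) * (v x - v (x + z)) * frac_kernel s z"
  have g: "(\<lambda>(x, z). energy_integrand s u v (x, x + z)) = ?g"
    by (auto simp: energy_integrand_frac_kernel)
  have gi: "integrable (lborel \<Otimes>\<^sub>M lborel) ?g"
    using int by (subst (asm) integrable_shear_iff) (auto simp: g)
  have "energy s u v = (\<integral>p. ?g p \<partial>(lborel \<Otimes>\<^sub>M lborel))"
    unfolding energy_def by (subst integral_shear) (auto simp: g)
  also have "\<dots> = (\<integral>z. (\<integral>x. (u x - u (x + z)) * (v x - v (x + z)) * frac_kernel s z \<partial>lborel) \<partial>lborel)"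
    by (rule lborel_pair.integral_snd[OF gi, symmetric])
  also have "\<dots> = (\<integral>z. (\<integral>x. u x * second_diff v x z * frac_kernel s z \<partial>lborel) \<partial>lborel)"
  proof (rule Bochner_Integration.integral_cong[OF refl])
    fix z :: 'a
    have i1: "integrable lborel (\<lambda>x. u x * (v x - v (x + z)))"
    proof (rule integrable_mult_bounded[OF u])
      show "\<bar>v x - v (x + z)\<bar> \<le> 2 * B" for x using vb[of x] vb[of "x + z"] by linarith
    qed measurable
    have i2: "integrable lborel (\<lambda>x. u x * (v (x - z) - v x))"
    proof (rule integrable_mult_bounded[OF u])
      show "\<bar>v (x - z) - v x\<bar> \<le> 2 * B" for x using vb[of x] vb[of "x - z"] by linarith
    qed measurable
    have i3: "integrable lborel (\<lambda>x. u (x + z) * (v x - v (x + z)))"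
      using i2 integrable_translate_iff[of "\<lambda>x. u x * (v (x - z) - v x)" z] by simp
    have "(\<integral>x. (u x - u (x + z)) * (v x - v (x + z)) \<partial>lborel)
        = (\<integral>x. u x * (v x - v (x + z)) \<partial>lborel) - (\<integral>x. u (x + z) * (v x - v (x + z)) \<partial>lborel)"
      using i1 i3 by (simp add: left_diff_distrib)
    also have "(\<integral>x. u (x + z) * (v x - v (x + z)) \<partial>lborel) = (\<integral>x. u x * (v (x - z) - v x) \<partial>lborel)"
      using integral_translate[of "\<lambda>x. u x * (v (x - z) - v x)" z] by simp
    also have "(\<integral>x. u x * (v x - v (x + z)) \<partial>lborel) - (\<integral>x. u x * (v (x - z) - v x) \<partial>lborel)
        = (\<integral>x. u x * second_diff v x z \<partial>lborel)"
      using i1 i2 by (simp add: second_diff_def Bochner_Integration.integral_diff[symmetric] algebra_simps del: Bochner_Integration.integral_diff)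
    finally show "(\<integral>x. (u x - u (x + z)) * (v x - v (x + z)) * frac_kernel s z \<partial>lborel)
        = (\<integral>x. u x * second_diff v x z * frac_kernel s z \<partial>lborel)" by simp
  qed
  also have "\<dots> = (\<integral>x. (\<integral>z. u x * second_diff v x z * frac_kernel s z \<partial>lborel) \<partial>lborel)"
  proof (rule lborel_pair.Fubini_integral)
    have "integrable (lborel \<Otimes>\<^sub>M lborel) (\<lambda>(x::'a, z::'a). u x * (C * (min 1 ((norm z)\<^sup>2) * frac_kernel s z)))"
      using integrable_pair_mult[OF u integrable_mult_right[OF integrable_min_kernel]] .
    then show "integrable (lborel \<Otimes>\<^sub>M lborel) (\<lambda>(x, z). u x * second_diff v x z * frac_kernel s z)"
    proof (rule Bochner_Integration.integrable_bound)
      show "(\<lambda>(x, z). u x * second_diff v x z * frac_kernel s z) \<in> borel_measurable (lborel \<Otimes>\<^sub>M lborel)"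
        unfolding second_diff_def by measurable
      have "\<bar>u x\<bar> * (\<bar>second_diff v x z\<bar> * frac_kernel s z) \<le> \<bar>u x\<bar> * (C * min 1 ((norm z)\<^sup>2) * frac_kernel s z)" for x z
        by (intro mult_left_mono mult_right_mono sd) auto
      moreover have "C \<ge> 0"
      proof -
        obtain b :: 'a where "norm b = 1" using vector_choose_size[of 1] by auto
        then show ?thesis using sd[of 0 b] by (simp add: order_trans[OF abs_ge_zero])
      qed
      ultimately show "AE p in lborel \<Otimes>\<^sub>M lborel. norm (case p of (x, z) \<Rightarrow> u x * second_diff v x z * frac_kernel s z)
        \<le> norm (case p of (x, z) \<Rightarrow> u x * (C * (min 1 ((norm z)\<^sup>2) * frac_kernel s z)))"
        by (intro AE_I2) (auto simp: abs_mult mult.assoc)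
    qed
  qed
  also have "\<dots> = (\<integral>x. u x * frac_op s v x \<partial>lborel)"
    by (simp add: frac_op_def mult.assoc)
  finally show ?thesis .
qed

end

section \<open>The bump function and its fractional Laplacian\<close>

text \<open>Radially decreasing, compactly supported and of class C^{1,1}: squaring the positive
  part removes the corner at the unit sphere, and all estimates reduce to elementary inequalities
  for a quadratic function.\<close>

definition bump :: "'a::euclidean_space \<Rightarrow> real" where
  "bump x = (max 0 (1 - (norm x)\<^sup>2))\<^sup>2"

lemma bump_nonneg [simp]: "0 \<le> bump x" by (simp add: bump_def)

lemma bump_le_1: "bump x \<le> 1"
  unfolding bump_def by (intro power_le_one) auto

lemma bump_0 [simp]: "bump 0 = 1" by (simp add: bump_def)

lemma bump_minus [simp]: "bump (- x) = bump x" by (simp add: bump_def)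

lemma bump_eq_0: "1 \<le> norm x \<Longrightarrow> bump x = 0"
proof -
  assume "1 \<le> norm x"
  then have "1 \<le> (norm x)\<^sup>2" using power_mono[of 1 "norm x" 2] by simp
  then show ?thesis by (simp add: bump_def max_def)
qed

lemma bump_pos: "norm x < 1 \<Longrightarrow> 0 < bump x"
  using power_strict_mono[of "norm x" 1 2] by (simp add: bump_def)

lemma bump_decreasing: "norm x \<le> norm y \<Longrightarrow> bump y \<le> bump x"
  unfolding bump_def by (intro power_mono max.mono diff_left_mono) auto

lemma bump_strict_decreasing: "norm x < norm y \<Longrightarrow> norm x < 1 \<Longrightarrow> bump y < bump x"
  using power_strict_mono[of "norm x" 1 2] power_strict_mono[of "norm x" "norm y" 2]
  unfolding bump_def by (intro power_strict_mono) auto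

lemma continuous_on_bump: "continuous_on A bump"
  unfolding bump_def[abs_def] by (auto intro!: continuous_intros)

lemma continuous_bump_compose [continuous_intros]:
  "continuous_on A f \<Longrightarrow> continuous_on A (\<lambda>x. bump (f x))"
  by (rule continuous_on_compose2[OF continuous_on_bump[of UNIV]]) auto

lemma borel_measurable_bump [measurable]: "bump \<in> borel_measurable borel"
  by (rule borel_measurable_continuous_onI[OF continuous_on_bump])

lemma integrable_bump: "integrable lborel bump"
proof -
  have "integrable lborel (\<lambda>x::'a. indicator (cball 0 1) x *\<^sub>R bump x)"
    by (rule borel_integrable_compact) (auto intro: continuous_on_bump)
  also have "(\<lambda>x::'a. indicator (cball 0 1) x *\<^sub>R bump x) = bump"
    by (auto simp: fun_eq_iff bump_eq_0 split: split_indicator)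
  finally show ?thesis .
qed

lemma integral_bump_pos: "0 < (\<integral>x. bump x \<partial>(lborel :: 'a::euclidean_space measure))"
proof -
  have "(\<integral>x. bump x \<partial>(lborel :: 'a measure)) \<noteq> 0"
  proof
    assume "(\<integral>x. bump x \<partial>(lborel :: 'a measure)) = 0"
    then have "AE x in (lborel :: 'a measure). bump x = 0"
      by (subst (asm) integral_nonneg_eq_0_iff_AE) (auto intro: integrable_bump)
    then have "AE x in (lborel :: 'a measure). x \<notin> ball 0 1"
      by eventually_elim (use bump_pos in fastforce)
    then have "emeasure lborel (ball (0::'a) 1) = 0"
      by (subst (asm) AE_iff_measurable[of "ball 0 1"]) auto
    then show False using unit_ball_vol_pos[of "real DIM('a)"]
      by (simp add: emeasure_ball del: unit_ball_vol_pos)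
  qed
  then show ?thesis by (simp add: less_le)
qed

text \<open>With a and b the two positive parts, the difference is (a + b)(a - b). The first factor
  is at most 2, the second at most (|x| + |y|) |x - y|, hence 4 |x - y| when both norms are at most
  2. Beyond that radius either both values vanish or the points are at distance at least 1.\<close>

lemma bump_lipschitz: "\<bar>bump x - bump y\<bar> \<le> 8 * norm (x - y)"
proof -
  have *: "\<bar>bump x - bump y\<bar> \<le> 8 * norm (x - y)" if xy: "norm x \<le> norm y" for x y :: 'a
  proof (cases "norm y \<le> 2")
    case True
    let ?a = "max 0 (1 - (norm x)\<^sup>2)" and ?b = "max 0 (1 - (norm y)\<^sup>2)"
    have le: "(norm x)\<^sup>2 \<le> (norm y)\<^sup>2" using xy by (intro power_mono) auto
    have ab: "0 \<le> ?b" "?b \<le> ?a" "?a \<le> 1" "?a - ?b \<le> (norm y)\<^sup>2 - (norm x)\<^sup>2"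
      unfolding max_def using le by (smt (verit) zero_le_power2)+
    have "(norm y)\<^sup>2 - (norm x)\<^sup>2 = (norm y + norm x) * (norm y - norm x)"
      by (simp add: power2_eq_square algebra_simps)
    also have "\<dots> \<le> 4 * norm (x - y)"
      using True xy norm_triangle_ineq2[of y x] by (intro mult_mono) (auto simp: norm_minus_commute)
    finally have d: "?a - ?b \<le> 4 * norm (x - y)" using ab by linarith
    have "bump x - bump y = (?a + ?b) * (?a - ?b)"
      by (simp add: bump_def power2_eq_square algebra_simps)
    also have "\<dots> \<le> 2 * (4 * norm (x - y))"
    proof (rule mult_mono)
      show "?a + ?b \<le> 2" using ab by linarith
    qed (use ab d in auto)
    finally show ?thesis using bump_decreasing[OF xy] by simp
  next
    case False
    then have y: "bump y = 0" by (simp add: bump_eq_0)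
    show ?thesis
    proof (cases "1 \<le> norm x")
      case True then show ?thesis using y by (simp add: bump_eq_0)
    next
      case c: False
      have "1 \<le> norm (x - y)" using c False norm_triangle_ineq2[of y x] by (simp add: norm_minus_commute)
      then show ?thesis using y bump_le_1[of x] by simp
    qed
  qed
  show ?thesis
  proof (cases "norm x \<le> norm y")
    case False
    then show ?thesis using *[of y x] by (simp add: norm_minus_commute abs_minus_commute)
  qed (use * in blast)
qed

text \<open>The factor \<open>54\<close> comes from the second order Taylor bound
  \<open>0 \<le> f b - f a - f' a (b - a) \<le> (b - a)\<^sup>2\<close> for \<open>f t = (max 0 (1 - t))\<^sup>2\<close>.\<close>

lemma second_diff_bump: "\<bar>second_diff bump x z\<bar> \<le> 54 * min 1 ((norm z)\<^sup>2)" for x z :: "'a::euclidean_space"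
proof -
  have b4: "\<bar>second_diff bump x z\<bar> \<le> 4"
    using bump_nonneg[of x] bump_nonneg[of "x + z"] bump_nonneg[of "x - z"]
      bump_le_1[of x] bump_le_1[of "x + z"] bump_le_1[of "x - z"]
    unfolding second_diff_def by linarith
  show ?thesis
  proof (cases "norm z \<le> 1")
    case False
    then have "1 \<le> (norm z)\<^sup>2" using power_mono[of 1 "norm z" 2] by simp
    then show ?thesis using b4 by (simp add: min_def)
  next
    case z: True
    then have mz: "min 1 ((norm z)\<^sup>2) = (norm z)\<^sup>2" using power_mono[of "norm z" 1 2] by (simp add: min_def)
    have "\<bar>second_diff bump x z\<bar> \<le> 54 * (norm z)\<^sup>2"
    proof (cases "norm x \<le> 2")
      case False
      have "1 \<le> norm x" "1 \<le> norm (x + z)" "1 \<le> norm (x - z)"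
        using False z norm_triangle_ineq2[of x "-z"] norm_triangle_ineq2[of x z] by auto
      then show ?thesis by (simp add: second_diff_def bump_eq_0)
    next
      case x: True
      define f where "f t = (max 0 (1 - t))\<^sup>2" for t :: real
      define f' where "f' t = - 2 * max 0 (1 - t)" for t :: real
      have taylor: "0 \<le> f b - f a - f' a * (b - a) \<and> f b - f a - f' a * (b - a) \<le> (b - a)\<^sup>2" for a b
      proof (cases "a \<le> 1"; cases "b \<le> 1")
        assume a: "a \<le> 1" and b: "b \<le> 1"
        then have "f b - f a - f' a * (b - a) = (b - a)\<^sup>2"
          by (simp add: f_def f'_def power2_eq_square algebra_simps)
        then show ?thesis by simp
      next
        assume a: "a \<le> 1" and b: "\<not> b \<le> 1"
        have e: "f b - f a - f' a * (b - a) = (1 - a) * (2 * b - a - 1)"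
          using a b by (simp add: f_def f'_def power2_eq_square algebra_simps)
        have "(b - a)\<^sup>2 - (1 - a) * (2 * b - a - 1) = (b - 1)\<^sup>2"
          by (simp add: power2_eq_square algebra_simps)
        then have "(1 - a) * (2 * b - a - 1) \<le> (b - a)\<^sup>2" by (smt (verit) zero_le_power2)
        moreover have "0 \<le> (1 - a) * (2 * b - a - 1)" using a b by (intro mult_nonneg_nonneg) auto
        ultimately show ?thesis unfolding e by simp
      next
        assume a: "\<not> a \<le> 1" and b: "b \<le> 1"
        then have "f b - f a - f' a * (b - a) = (1 - b)\<^sup>2" by (simp add: f_def f'_def)
        moreover have "(1 - b)\<^sup>2 \<le> (a - b)\<^sup>2" using a b by (intro power_mono) auto
        ultimately show ?thesis by (simp add: power2_commute)
      next
        assume "\<not> a \<le> 1" "\<not> b \<le> 1"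
        then show ?thesis by (simp add: f_def f'_def)
      qed
      let ?t = "(norm x)\<^sup>2" and ?p = "(norm (x + z))\<^sup>2" and ?q = "(norm (x - z))\<^sup>2"
      have p: "?p - ?t = 2 * (x \<bullet> z) + (norm z)\<^sup>2" and q: "?q - ?t = - 2 * (x \<bullet> z) + (norm z)\<^sup>2"
        by (simp_all add: power2_norm_eq_inner inner_simps inner_commute)
      have xz: "\<bar>x \<bullet> z\<bar> \<le> 2 * norm z"
        using Cauchy_Schwarz_ineq2[of x z] x mult_right_mono[OF x norm_ge_zero[of z]] by linarith
      have zz: "(norm z)\<^sup>2 \<le> norm z" using z by (simp add: power2_eq_square mult_left_le)
      have "\<bar>?p - ?t\<bar> \<le> 5 * norm z" "\<bar>?q - ?t\<bar> \<le> 5 * norm z"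
        unfolding p q using xz zz zero_le_power2[of "norm z"] norm_ge_zero[of z] by linarith+
      then have "\<bar>?p - ?t\<bar> \<le> \<bar>5 * norm z\<bar>" "\<bar>?q - ?t\<bar> \<le> \<bar>5 * norm z\<bar>" by simp_all
      then have "(?p - ?t)\<^sup>2 \<le> (5 * norm z)\<^sup>2" "(?q - ?t)\<^sup>2 \<le> (5 * norm z)\<^sup>2"
        by (simp_all only: abs_le_square_iff)
      then have sq: "(?p - ?t)\<^sup>2 \<le> 25 * (norm z)\<^sup>2" "(?q - ?t)\<^sup>2 \<le> 25 * (norm z)\<^sup>2"
        by (simp_all add: power_mult_distrib)
      \<comment> \<open>The terms linear in z cancel between x + z and x - z, so the first order
        part is at most 4 |z|^2. With two Taylor remainders of at most (5 |z|)^2 this gives 25 + 25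
        + 4 = 54.\<close>
      have "f' ?t * (?p - ?t) + f' ?t * (?q - ?t) = f' ?t * (2 * (norm z)\<^sup>2)"
        unfolding p q by (simp add: algebra_simps)
      moreover have "\<bar>f' ?t * (2 * (norm z)\<^sup>2)\<bar> \<le> 2 * (2 * (norm z)\<^sup>2)"
        unfolding abs_mult by (intro mult_mono) (auto simp: f'_def)
      moreover have "second_diff bump x z = 2 * f ?t - f ?p - f ?q"
        by (simp add: second_diff_def bump_def f_def)
      ultimately show ?thesis using taylor[of ?p ?t] taylor[of ?q ?t] sq by linarith
    qed
    then show ?thesis using mz by simp
  qed
qed

definition bump_at :: "'a::euclidean_space \<Rightarrow> real \<Rightarrow> 'a \<Rightarrow> real" where
  "bump_at x0 e y = bump ((y - x0) /\<^sub>R e)"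

lemma bump_at_nonneg [simp]: "0 \<le> bump_at x e y" by (simp add: bump_at_def)

lemma bump_at_le_1: "bump_at x e y \<le> 1" by (simp add: bump_at_def bump_le_1)

lemma bump_at_self [simp]: "bump_at x e x = 1" by (simp add: bump_at_def)

lemma bump_at_reflect: "bump_at x e (- y) = bump_at (- x) e y"
proof -
  have "bump ((- y - x) /\<^sub>R e) = bump (- ((- y - x) /\<^sub>R e))" by simp
  then show ?thesis by (simp add: bump_at_def algebra_simps)
qed

lemma bump_at_eq_0: "e > 0 \<Longrightarrow> e \<le> norm (y - x) \<Longrightarrow> bump_at x e y = 0"
proof -
  assume "e > 0" "e \<le> norm (y - x)"
  then have "1 \<le> norm (y - x) / e" by simp
  then show ?thesis unfolding bump_at_def using \<open>e > 0\<close>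
    by (intro bump_eq_0) (simp add: divide_inverse mult.commute)
qed

lemma continuous_on_bump_at: "continuous_on A (bump_at x e)"
  unfolding bump_at_def[abs_def] by (intro continuous_intros)

lemma borel_measurable_bump_at [measurable]: "bump_at x e \<in> borel_measurable borel"
  by (rule borel_measurable_continuous_onI[OF continuous_on_bump_at])

lemma second_diff_bump_at: "second_diff (bump_at x e) y z = second_diff bump ((y - x) /\<^sub>R e) (z /\<^sub>R e)"
  by (simp add: second_diff_def bump_at_def algebra_simps)

lemma second_diff_bump_at_le:
  assumes "e > 0"
  shows "\<bar>second_diff (bump_at x e) y z\<bar> \<le> 54 * max 1 (1 / e\<^sup>2) * min 1 ((norm z)\<^sup>2)"
proof -
  have "min 1 ((norm (z /\<^sub>R e))\<^sup>2) \<le> max 1 (1 / e\<^sup>2) * min 1 ((norm z)\<^sup>2)"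
  proof (cases "(norm z)\<^sup>2 \<le> 1")
    case True
    have "(norm (z /\<^sub>R e))\<^sup>2 = 1 / e\<^sup>2 * (norm z)\<^sup>2" using assms by (simp add: power_mult_distrib field_simps)
    also have "\<dots> \<le> max 1 (1 / e\<^sup>2) * (norm z)\<^sup>2" by (intro mult_right_mono) auto
    finally show ?thesis using True by (simp add: min_def)
  qed (auto simp: min_def)
  then show ?thesis unfolding second_diff_bump_at
    using order_trans[OF second_diff_bump[of "(y - x) /\<^sub>R e" "z /\<^sub>R e"]] by (simp add: mult.assoc)
qed

section \<open>The fractional Laplacian of the bump: symmetry, scaling and behaviour at
  infinity\<close>

context frac_order
begin

abbreviation bump_op :: "'a::euclidean_space \<Rightarrow> real" where
  "bump_op \<equiv> frac_op s bump"

lemma integrable_bump_second_diff: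
  "integrable lborel (\<lambda>z. second_diff bump x z * frac_kernel s z)" for x :: "'a::euclidean_space"
  by (rule integrable_second_diff[OF _ second_diff_bump]) measurable

definition bump_op_bound :: "'a::euclidean_space itself \<Rightarrow> real" where
  "bump_op_bound _ = 54 * (\<integral>z. min 1 ((norm z)\<^sup>2) * frac_kernel s z \<partial>(lborel :: 'a measure))"

lemma bump_op_bounded: "\<bar>bump_op x\<bar> \<le> bump_op_bound TYPE('a)" for x :: "'a::euclidean_space"
proof -
  have "\<bar>bump_op x\<bar> \<le> (\<integral>z. \<bar>second_diff bump x z * frac_kernel s z\<bar> \<partial>lborel)"
    unfolding frac_op_def by (rule integral_abs_bound)
  also have "\<dots> \<le> (\<integral>z. 54 * (min 1 ((norm z)\<^sup>2) * frac_kernel s z) \<partial>(lborel :: 'a measure))"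
  proof (rule integral_mono)
    show "integrable lborel (\<lambda>z. \<bar>second_diff bump x z * frac_kernel s z\<bar>)"
      using integrable_bump_second_diff[of x] by (rule integrable_abs)
    show "integrable lborel (\<lambda>z::'a. 54 * (min 1 ((norm z)\<^sup>2) * frac_kernel s z))"
      by (rule integrable_mult_right[OF integrable_min_kernel])
    fix z
    have "\<bar>second_diff bump x z\<bar> * frac_kernel s z \<le> 54 * min 1 ((norm z)\<^sup>2) * frac_kernel s z"
      by (rule mult_right_mono[OF second_diff_bump]) simp
    then show "\<bar>second_diff bump x z * frac_kernel s z\<bar> \<le> 54 * (min 1 ((norm z)\<^sup>2) * frac_kernel s z)"
      by (simp add: abs_mult)
  qed
  finally show ?thesis by (simp add: bump_op_bound_def)
qed

lemma bump_op_bound_nonneg: "0 \<le> bump_op_bound TYPE('a::euclidean_space)"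
  using order_trans[OF abs_ge_zero bump_op_bounded[of "0::'a"]] .

lemma continuous_on_bump_op: "continuous_on A (bump_op :: 'a::euclidean_space \<Rightarrow> real)"
proof (rule continuous_on_subset[of UNIV])
  show "continuous_on UNIV (bump_op :: 'a \<Rightarrow> real)"
  unfolding continuous_on_sequentially
  proof (intro allI ballI impI, elim conjE)
    fix x :: "nat \<Rightarrow> 'a" and a assume x: "x \<longlonglongrightarrow> a"
    show "(bump_op \<circ> x) \<longlonglongrightarrow> bump_op a"
      unfolding o_def frac_op_def
    proof (rule integral_dominated_convergence)
      show "integrable lborel (\<lambda>z::'a. 54 * (min 1 ((norm z)\<^sup>2) * frac_kernel s z))"
        by (rule integrable_mult_right[OF integrable_min_kernel])
      show "AE z in lborel. (\<lambda>n. second_diff bump (x n) z * frac_kernel s z) \<longlonglongrightarrow> second_diff bump a z * frac_kernel s z"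
      proof (rule AE_I2)
        fix z
        have b: "(\<lambda>n. bump (y n)) \<longlonglongrightarrow> bump b" if "y \<longlonglongrightarrow> b" for y :: "nat \<Rightarrow> 'a" and b
          using continuous_on_tendsto_compose[OF continuous_on_bump[of UNIV] that] by simp
        show "(\<lambda>n. second_diff bump (x n) z * frac_kernel s z) \<longlonglongrightarrow> second_diff bump a z * frac_kernel s z"
          unfolding second_diff_def by (intro tendsto_intros b x)
      qed
      fix n
      show "AE z in lborel. norm (second_diff bump (x n) z * frac_kernel s z) \<le> 54 * (min 1 ((norm z)\<^sup>2) * frac_kernel s z)"
      proof (rule AE_I2)
        fix z
        have "\<bar>second_diff bump (x n) z\<bar> * frac_kernel s z \<le> 54 * min 1 ((norm z)\<^sup>2) * frac_kernel s z"
          by (rule mult_right_mono[OF second_diff_bump]) simp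
        then show "norm (second_diff bump (x n) z * frac_kernel s z) \<le> 54 * (min 1 ((norm z)\<^sup>2) * frac_kernel s z)"
          by (simp add: abs_mult)
      qed
    qed (unfold second_diff_def, measurable)
  qed
qed simp

lemma borel_measurable_bump_op [measurable]: "bump_op \<in> borel_measurable (borel :: 'a::euclidean_space measure)"
  by (rule borel_measurable_continuous_onI[OF continuous_on_bump_op])

text \<open>A reflection that takes x to y preserves Lebesgue measure, \<open>bump\<close> and the
  kernel.\<close>

lemma bump_op_radial:
  fixes x y :: "'a::euclidean_space"
  assumes "norm x = norm y"
  shows "bump_op x = bump_op y"
proof -
  obtain T :: "'a \<Rightarrow> 'a" where T: "linear T" "\<And>z. norm (T z) = norm z" "\<And>z. T (T z) = z" "T x = y"
    using exists_reflection[OF assms] by blast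
  have [measurable]: "T \<in> borel_measurable borel"
    using T(1) linear_continuous_on[of T UNIV] linear_conv_bounded_linear
    by (intro borel_measurable_continuous_onI) auto
  have [measurable]: "(\<lambda>z. second_diff bump y z * frac_kernel s z) \<in> borel_measurable borel"
    unfolding second_diff_def by measurable
  have "bump_op y = (\<integral>z. second_diff bump y z * frac_kernel s z \<partial>distr lborel borel T)"
    unfolding distr_lborel_involutive_isometry[OF T(1-3)] by (simp add: frac_op_def)
  also have "\<dots> = (\<integral>z. second_diff bump y (T z) * frac_kernel s (T z) \<partial>lborel)"
    by (rule integral_distr) measurable
  also have "\<dots> = bump_op x"
  proof -
    have "bump (T u) = bump u" for u by (simp add: bump_def T(2))
    moreover have "y + T z = T (x + z)" "y - T z = T (x - z)" for z
      using T(1,4) by (simp_all add: linear_add linear_diff)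
    ultimately have "second_diff bump y (T z) = second_diff bump x z" for z
      using T(4) unfolding second_diff_def by metis
    then show ?thesis by (simp add: frac_op_def frac_kernel_def T(2))
  qed
  finally show ?thesis by simp
qed

lemma frac_op_bump_at:
  fixes x y :: "'a::euclidean_space"
  assumes e: "e > 0"
  shows "frac_op s (bump_at x e) y = e powr (- 2 * s) * bump_op ((y - x) /\<^sub>R e)"
proof -
  have "frac_op s (bump_at x e) y
      = \<bar>e\<bar> ^ DIM('a) * (\<integral>z. second_diff (bump_at x e) y (0 + e *\<^sub>R z) * frac_kernel s (0 + e *\<^sub>R z) \<partial>lborel)"
    unfolding frac_op_def using e by (intro integral_affine) auto
  also have "\<dots> = e ^ DIM('a) * (\<integral>z. e powr (- (real DIM('a) + 2 * s)) * (second_diff bump ((y - x) /\<^sub>R e) z * frac_kernel s z) \<partial>lborel)"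
    using e by (simp add: second_diff_bump_at frac_kernel_scale[OF e] mult_ac)
  also have "\<dots> = (e ^ DIM('a) * e powr (- (real DIM('a) + 2 * s))) * bump_op ((y - x) /\<^sub>R e)"
    by (simp add: frac_op_def)
  also have "e ^ DIM('a) * e powr (- (real DIM('a) + 2 * s)) = e powr (- 2 * s)"
    unfolding powr_realpow[OF e, symmetric] powr_add[symmetric] by simp
  finally show ?thesis .
qed

lemma integrable_bump_kernel:
  fixes x :: "'a::euclidean_space"
  assumes "2 \<le> norm x"
  shows "integrable lborel (\<lambda>u. bump u * frac_kernel s (x - u))"
proof (rule Bochner_Integration.integrable_bound)
  obtain b :: 'a where b: "norm b = 1" using vector_choose_size[of 1] by auto
  show "integrable lborel (bump :: 'a \<Rightarrow> real)" by (rule integrable_bump)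
  show "AE u in lborel. norm (bump u * frac_kernel s (x - u)) \<le> norm (bump u)"
  proof (rule AE_I2)
    fix u
    show "norm (bump u * frac_kernel s (x - u)) \<le> norm (bump u)"
    proof (cases "norm u < 1")
      case True
      then have "1 \<le> norm (x - u)" using assms norm_triangle_ineq2[of x u] by simp
      then have "frac_kernel s (x - u) \<le> frac_kernel s b"
        using b s_pos by (intro frac_kernel_mono) auto
      also have "frac_kernel s b = 1" using b by (simp add: frac_kernel_def)
      finally show ?thesis by (simp add: abs_mult mult_left_le)
    qed (simp add: bump_eq_0)
  qed
qed measurable

text \<open>Away from the support the term \<open>2 * bump x\<close> drops out and nothing singular
  is left: each of the two shifted terms is minus the convolution of \<open>bump\<close> with the
  kernel.\<close>

lemma bump_op_far:
  fixes x :: "'a::euclidean_space"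
  assumes x: "2 \<le> norm x"
  shows "bump_op x = - 2 * (\<integral>u. bump u * frac_kernel s (x - u) \<partial>lborel)"
proof -
  let ?h = "\<lambda>u. bump u * frac_kernel s (x - u)"
  have i: "integrable lborel ?h" by (rule integrable_bump_kernel[OF x])
  have 0: "integrable lborel (\<lambda>z. ?h (- z))" "(\<integral>z. ?h (- z) \<partial>lborel) = (\<integral>z. ?h z \<partial>lborel)"
    using i integrable_reflect_iff[of ?h] integral_reflect[of ?h] by auto
  have e1: "(\<lambda>z. bump (x - z) * frac_kernel s z) = (\<lambda>z. ?h (- (z + (- x))))"
    by (auto simp: fun_eq_iff)
  have 1: "integrable lborel (\<lambda>z. bump (x - z) * frac_kernel s z)"
    "(\<integral>z. bump (x - z) * frac_kernel s z \<partial>lborel) = (\<integral>z. ?h z \<partial>lborel)"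
    unfolding e1 using 0 integrable_translate_iff[of "\<lambda>z. ?h (- z)" "- x"] integral_translate[of "\<lambda>z. ?h (- z)" "- x"]
    by auto
  have e2: "(\<lambda>z. bump (x + z) * frac_kernel s z) = (\<lambda>z. ?h (z + x))"
    by (auto simp: fun_eq_iff add.commute)
  have 2: "integrable lborel (\<lambda>z. bump (x + z) * frac_kernel s z)"
    "(\<integral>z. bump (x + z) * frac_kernel s z \<partial>lborel) = (\<integral>z. ?h z \<partial>lborel)"
    unfolding e2 using i integrable_translate_iff[of ?h x] integral_translate[of ?h x] by auto
  have "bump_op x = (\<integral>z. - (bump (x + z) * frac_kernel s z) - bump (x - z) * frac_kernel s z \<partial>lborel)"
    unfolding frac_op_def second_diff_def using x by (simp add: bump_eq_0 algebra_simps)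
  also have "\<dots> = - (\<integral>z. ?h z \<partial>lborel) - (\<integral>z. ?h z \<partial>lborel)"
    using 1 2 by simp
  finally show ?thesis by simp
qed

text \<open>The ratio of norm (x - u) to norm x lies between 1 - 1/R and 1 + 1/R, and fixed powers
  of both bounds tend to 1. The error is relative to the kernel, so it survives rescaling.\<close>

lemma frac_kernel_near:
  assumes "\<eta> > 0"
  obtains R where "R \<ge> 2"
    "\<And>x u :: 'a::euclidean_space. R \<le> norm x \<Longrightarrow> norm u \<le> 1 \<Longrightarrow> \<bar>frac_kernel s (x - u) - frac_kernel s x\<bar> \<le> \<eta> * frac_kernel s x"
proof -
  let ?e = "- (real DIM('a) + 2 * s)"
  have "((\<lambda>R. (1 - 1 / R) powr ?e) \<longlongrightarrow> (1 - 0) powr ?e) at_top"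
    by (intro tendsto_intros tendsto_divide_0[OF tendsto_const] filterlim_at_top_imp_at_infinity filterlim_ident) auto
  then have 1: "eventually (\<lambda>R. (1 - 1 / R) powr ?e < 1 + \<eta>) at_top"
    using assms order_tendstoD(2)[of _ "(1 - 0) powr ?e" at_top "1 + \<eta>"] by simp
  have "((\<lambda>R. (1 + 1 / R) powr ?e) \<longlongrightarrow> (1 + 0) powr ?e) at_top"
    by (intro tendsto_intros tendsto_divide_0[OF tendsto_const] filterlim_at_top_imp_at_infinity filterlim_ident) auto
  then have 2: "eventually (\<lambda>R. 1 - \<eta> < (1 + 1 / R) powr ?e) at_top"
    using assms order_tendstoD(1)[of _ "(1 + 0) powr ?e" at_top "1 - \<eta>"] by simp
  from eventually_conj[OF 1 eventually_conj[OF 2 eventually_ge_at_top[of 2]]]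
  obtain R where R: "R \<ge> 2" "(1 - 1 / R) powr ?e < 1 + \<eta>" "1 - \<eta> < (1 + 1 / R) powr ?e"
    by (auto simp: eventually_at_top_linorder)
  show ?thesis
  proof (rule that[OF R(1)])
    fix x u :: 'a assume x: "R \<le> norm x" and u: "norm u \<le> 1"
    let ?n = "norm (x - u)" and ?r = "norm x"
    have r: "?r > 0" using x R(1) by linarith
    have q: "1 / ?r \<le> 1 / R" using x R(1) by (simp add: frac_le)
    have lo: "1 - 1 / R \<le> ?n / ?r"
    proof -
      have "1 - 1 / R \<le> 1 - 1 / ?r" using q by simp
      also have "\<dots> = (?r - 1) / ?r" using r by (simp add: diff_divide_distrib)
      also have "\<dots> \<le> ?n / ?r" using r u norm_triangle_ineq2[of x u] by (intro divide_right_mono) auto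
      finally show ?thesis .
    qed
    have hi: "?n / ?r \<le> 1 + 1 / R"
    proof -
      have "?n / ?r \<le> (?r + 1) / ?r" using r u norm_triangle_ineq4[of x u] by (intro divide_right_mono) auto
      also have "\<dots> = 1 + 1 / ?r" using r by (simp add: add_divide_distrib)
      finally have "?n / ?r \<le> 1 + 1 / ?r" .
      then show ?thesis using q by simp
    qed
    have R1: "0 < 1 - 1 / R" using R(1) by (simp add: field_simps)
    have pos: "0 < ?n / ?r" using lo R1 by linarith
    have "(?n / ?r) powr ?e \<le> (1 - 1 / R) powr ?e" using lo R1 s_pos by (intro powr_mono2') auto
    moreover have "(1 + 1 / R) powr ?e \<le> (?n / ?r) powr ?e" using hi pos s_pos by (intro powr_mono2') auto
    ultimately have b: "\<bar>(?n / ?r) powr ?e - 1\<bar> \<le> \<eta>" using R by linarith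
    have eq: "frac_kernel s (x - u) = (?n / ?r) powr ?e * frac_kernel s x"
    proof -
      have "?n = (?n / ?r) * ?r" using r by simp
      then have "?n powr ?e = ((?n / ?r) * ?r) powr ?e" by simp
      also have "\<dots> = (?n / ?r) powr ?e * ?r powr ?e" by (rule powr_mult)
      finally show ?thesis by (simp add: frac_kernel_def)
    qed
    have "\<bar>frac_kernel s (x - u) - frac_kernel s x\<bar> = \<bar>((?n / ?r) powr ?e - 1) * frac_kernel s x\<bar>"
      unfolding eq by (simp add: left_diff_distrib)
    also have "\<dots> \<le> \<eta> * frac_kernel s x"
      unfolding abs_mult using b by (simp add: mult_right_mono)
    finally show "\<bar>frac_kernel s (x - u) - frac_kernel s x\<bar> \<le> \<eta> * frac_kernel s x" .
  qed
qed

text \<open>Seen from far away \<open>bump\<close> acts like a point mass of size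
  \<open>\<integral>u. bump u\<close>, so \<open>bump_op_far\<close> becomes a multiple of the
  kernel itself. This is how the kernel functions are reached from bumps.\<close>

lemma bump_op_asymptotics:
  assumes "\<eta> > 0"
  obtains R where "R \<ge> 2"
    "\<And>x :: 'a::euclidean_space. R \<le> norm x \<Longrightarrow>
       \<bar>bump_op x + 2 * (\<integral>u. bump u \<partial>(lborel :: 'a measure)) * frac_kernel s x\<bar> \<le> \<eta> * frac_kernel s x"
proof -
  let ?I = "\<integral>u. bump u \<partial>(lborel :: 'a measure)"
  have I: "?I > 0" by (rule integral_bump_pos)
  then have "\<eta> / (2 * ?I) > 0" using assms by simp
  then obtain R where R: "R \<ge> 2"
    "\<And>x u :: 'a. R \<le> norm x \<Longrightarrow> norm u \<le> 1 \<Longrightarrow> \<bar>frac_kernel s (x - u) - frac_kernel s x\<bar> \<le> \<eta> / (2 * ?I) * frac_kernel s x"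
    using frac_kernel_near[where 'a='a] by metis
  show ?thesis
  proof (rule that[OF R(1)])
    fix x :: 'a assume x: "R \<le> norm x"
    then have x2: "2 \<le> norm x" using R(1) by simp
    have i: "integrable lborel (\<lambda>u. bump u * (frac_kernel s (x - u) - frac_kernel s x))"
      using integrable_bump_kernel[OF x2] integrable_bump by (auto simp: right_diff_distrib)
    have "(\<integral>u. bump u * (frac_kernel s (x - u) - frac_kernel s x) \<partial>lborel)
        = (\<integral>u. bump u * frac_kernel s (x - u) \<partial>lborel) - ?I * frac_kernel s x"
      unfolding right_diff_distrib
      by (subst Bochner_Integration.integral_diff[OF integrable_bump_kernel[OF x2]])
         (auto intro: integrable_mult_left integrable_bump)
    then have "bump_op x + 2 * ?I * frac_kernel s x = - 2 * (\<integral>u. bump u * (frac_kernel s (x - u) - frac_kernel s x) \<partial>lborel)"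
      unfolding bump_op_far[OF x2] by simp
    then have "\<bar>bump_op x + 2 * ?I * frac_kernel s x\<bar> = 2 * \<bar>\<integral>u. bump u * (frac_kernel s (x - u) - frac_kernel s x) \<partial>lborel\<bar>"
      by (simp add: abs_mult)
    also have "\<bar>\<integral>u. bump u * (frac_kernel s (x - u) - frac_kernel s x) \<partial>lborel\<bar>
        \<le> (\<integral>u. \<bar>bump u * (frac_kernel s (x - u) - frac_kernel s x)\<bar> \<partial>lborel)"
      by (rule integral_abs_bound)
    also have "\<dots> \<le> (\<integral>u. bump u * (\<eta> / (2 * ?I) * frac_kernel s x) \<partial>(lborel :: 'a measure))"
    proof (rule integral_mono)
      show "integrable lborel (\<lambda>u. \<bar>bump u * (frac_kernel s (x - u) - frac_kernel s x)\<bar>)"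
        using i by (rule integrable_abs)
      show "integrable lborel (\<lambda>u::'a. bump u * (\<eta> / (2 * ?I) * frac_kernel s x))"
        using integrable_bump by (rule integrable_mult_left)
      fix u :: 'a
      show "\<bar>bump u * (frac_kernel s (x - u) - frac_kernel s x)\<bar> \<le> bump u * (\<eta> / (2 * ?I) * frac_kernel s x)"
      proof (cases "norm u \<le> 1")
        case True
        then show ?thesis using mult_left_mono[OF R(2)[OF x True] bump_nonneg[of u]]
          by (simp only: abs_mult abs_of_nonneg[OF bump_nonneg])
      qed (simp add: bump_eq_0)
    qed
    also have "(\<integral>u. bump u * (\<eta> / (2 * ?I) * frac_kernel s x) \<partial>(lborel :: 'a measure)) = \<eta> / 2 * frac_kernel s x"
      using I by simp
    finally show "\<bar>bump_op x + 2 * ?I * frac_kernel s x\<bar> \<le> \<eta> * frac_kernel s x" by simp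
  qed
qed

end

section \<open>The mollifier generated by the bump\<close>

text \<open>The integrand lives on the shell of points whose norm differs from \<open>\<rho>\<close>
  by at most |z|. Its thickness is 2 |z|, and all its radii are at most
  \<open>\<rho> + 1\<close>.\<close>

lemma nn_integral_ball_indicator_diff:
  fixes z :: "'a::euclidean_space"
  assumes \<rho>: "\<rho> > 0" and z: "norm z \<le> 1"
  shows "(\<integral>\<^sup>+x. ennreal \<bar>indicator (ball 0 \<rho>) x - indicator (ball 0 \<rho>) (x + z)\<bar> \<partial>lborel)
     \<le> ennreal (2 * sphere_area TYPE('a) * (\<rho> + 1) ^ (DIM('a) - 1) * norm z)"
proof -
  let ?A = "sphere_area TYPE('a)" and ?d = "norm z"
  have "(\<integral>\<^sup>+x. ennreal \<bar>indicator (ball 0 \<rho>) x - indicator (ball 0 \<rho>) (x + z)\<bar> \<partial>lborel)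
     \<le> (\<integral>\<^sup>+x. indicator {\<rho> - ?d .. \<rho> + ?d} (norm x) \<partial>(lborel :: 'a measure))"
  proof (rule nn_integral_mono)
    fix x :: 'a
    show "ennreal \<bar>indicator (ball 0 \<rho>) x - indicator (ball 0 \<rho>) (x + z)\<bar> \<le> indicator {\<rho> - ?d .. \<rho> + ?d} (norm x)"
      using norm_triangle_ineq[of x z] norm_triangle_ineq2[of x "- z"]
      by (auto split: split_indicator)
  qed
  also have "\<dots> = (\<integral>\<^sup>+t. ennreal (?A * t ^ (DIM('a) - 1) * indicator {0..} t) * indicator {\<rho> - ?d .. \<rho> + ?d} t \<partial>lborel)"
    by (rule nn_integral_radial) measurable
  also have "\<dots> \<le> (\<integral>\<^sup>+t. ennreal (?A * (\<rho> + 1) ^ (DIM('a) - 1)) * indicator {\<rho> - ?d .. \<rho> + ?d} t \<partial>lborel)"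
  proof (rule nn_integral_mono)
    fix t :: real
    show "ennreal (?A * t ^ (DIM('a) - 1) * indicator {0..} t) * indicator {\<rho> - ?d .. \<rho> + ?d} t
       \<le> ennreal (?A * (\<rho> + 1) ^ (DIM('a) - 1)) * indicator {\<rho> - ?d .. \<rho> + ?d} t"
      using z sphere_area_pos[where 'a='a]
      by (auto split: split_indicator intro!: ennreal_leI mult_left_mono power_mono)
  qed
  also have "\<dots> = ennreal (?A * (\<rho> + 1) ^ (DIM('a) - 1)) * ennreal (2 * ?d)"
    by (simp add: nn_integral_cmult)
  also have "\<dots> = ennreal (2 * ?A * (\<rho> + 1) ^ (DIM('a) - 1) * ?d)"
    using sphere_area_pos[where 'a='a] \<rho> by (simp add: ennreal_mult[symmetric] mult_ac)
  finally show ?thesis .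
qed

context frac_order
begin

lemma integrable_energy_ball_bump:
  assumes \<rho>: "\<rho> > 0"
  shows "integrable (lborel \<Otimes>\<^sub>M lborel) (energy_integrand s (indicator (ball (0::'a::euclidean_space) \<rho>)) bump)"
proof -
  let ?B = "indicator (ball (0::'a) \<rho>) :: 'a \<Rightarrow> real"
  have [measurable]: "ball (0::'a) \<rho> \<in> sets borel" by simp
  define K1 where "K1 = 2 * sphere_area TYPE('a) * (\<rho> + 1) ^ (DIM('a) - 1)"
  define K where "K = 8 * K1 + 2 * measure lborel (ball (0::'a) \<rho>)"
  have K1: "K1 \<ge> 0" using sphere_area_pos[where 'a='a] \<rho> by (simp add: K1_def)
  have inner: "(\<integral>\<^sup>+x. ennreal \<bar>(?B x - ?B (x + z)) * (bump x - bump (x + z)) * frac_kernel s z\<bar> \<partial>lborel)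
      \<le> ennreal (K * (min 1 ((norm z)\<^sup>2) * frac_kernel s z))" for z :: 'a
  proof (cases "norm z \<le> 1")
    case True
    then have mz: "min 1 ((norm z)\<^sup>2) = (norm z)\<^sup>2" using power_mono[of "norm z" 1 2] by (simp add: min_def)
    have "(\<integral>\<^sup>+x. ennreal \<bar>(?B x - ?B (x + z)) * (bump x - bump (x + z)) * frac_kernel s z\<bar> \<partial>lborel)
        \<le> (\<integral>\<^sup>+x. ennreal (8 * norm z * frac_kernel s z) * ennreal \<bar>?B x - ?B (x + z)\<bar> \<partial>lborel)"
    proof (rule nn_integral_mono)
      fix x
      have "\<bar>?B x - ?B (x + z)\<bar> * \<bar>bump x - bump (x + z)\<bar> \<le> \<bar>?B x - ?B (x + z)\<bar> * (8 * norm z)"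
        using bump_lipschitz[of x "x + z"] by (intro mult_left_mono) auto
      then have "\<bar>?B x - ?B (x + z)\<bar> * \<bar>bump x - bump (x + z)\<bar> * frac_kernel s z \<le> \<bar>?B x - ?B (x + z)\<bar> * (8 * norm z) * frac_kernel s z"
        by (rule mult_right_mono) simp
      then show "ennreal \<bar>(?B x - ?B (x + z)) * (bump x - bump (x + z)) * frac_kernel s z\<bar>
        \<le> ennreal (8 * norm z * frac_kernel s z) * ennreal \<bar>?B x - ?B (x + z)\<bar>"
        by (simp add: abs_mult ennreal_mult[symmetric] mult_ac ennreal_leI)
    qed
    also have "\<dots> = ennreal (8 * norm z * frac_kernel s z) * (\<integral>\<^sup>+x. ennreal \<bar>?B x - ?B (x + z)\<bar> \<partial>lborel)"
      by (rule nn_integral_cmult) measurable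
    also have "\<dots> \<le> ennreal (8 * norm z * frac_kernel s z) * ennreal (K1 * norm z)"
      unfolding K1_def by (intro mult_left_mono nn_integral_ball_indicator_diff[OF \<rho> True]) simp
    also have "\<dots> = ennreal (8 * K1 * ((norm z)\<^sup>2 * frac_kernel s z))"
      using K1 by (simp add: ennreal_mult[symmetric] power2_eq_square mult_ac)
    also have "\<dots> \<le> ennreal (K * (min 1 ((norm z)\<^sup>2) * frac_kernel s z))"
      unfolding mz K_def by (intro ennreal_leI mult_right_mono) auto
    finally show ?thesis .
  next
    case False
    then have mz: "min 1 ((norm z)\<^sup>2) = 1" using power_mono[of 1 "norm z" 2] by (simp add: min_def)
    have "(\<integral>\<^sup>+x. ennreal \<bar>(?B x - ?B (x + z)) * (bump x - bump (x + z)) * frac_kernel s z\<bar> \<partial>lborel)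
        \<le> (\<integral>\<^sup>+x. ennreal (frac_kernel s z) * (ennreal (?B x) + ennreal (?B (x + z))) \<partial>lborel)"
    proof (rule nn_integral_mono)
      fix x
      have "\<bar>bump x - bump (x + z)\<bar> \<le> 1"
        using bump_le_1[of x] bump_le_1[of "x + z"] bump_nonneg[of x] bump_nonneg[of "x + z"] by linarith
      moreover have "\<bar>?B x - ?B (x + z)\<bar> \<le> ?B x + ?B (x + z)" by (auto split: split_indicator)
      ultimately have "\<bar>?B x - ?B (x + z)\<bar> * \<bar>bump x - bump (x + z)\<bar> \<le> (?B x + ?B (x + z)) * 1"
        by (intro mult_mono) auto
      then have "\<bar>?B x - ?B (x + z)\<bar> * \<bar>bump x - bump (x + z)\<bar> * frac_kernel s z \<le> (?B x + ?B (x + z)) * 1 * frac_kernel s z"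
        by (rule mult_right_mono) simp
      then show "ennreal \<bar>(?B x - ?B (x + z)) * (bump x - bump (x + z)) * frac_kernel s z\<bar>
        \<le> ennreal (frac_kernel s z) * (ennreal (?B x) + ennreal (?B (x + z)))"
        by (simp add: abs_mult ennreal_mult[symmetric] ennreal_plus[symmetric] mult_ac ennreal_leI del: ennreal_plus)
    qed
    also have "\<dots> = ennreal (frac_kernel s z) * ((\<integral>\<^sup>+x. ennreal (?B x) \<partial>lborel) + (\<integral>\<^sup>+x. ennreal (?B (x + z)) \<partial>lborel))"
      by (simp add: nn_integral_cmult nn_integral_add)
    also have "(\<integral>\<^sup>+x. ennreal (?B (x + z)) \<partial>lborel) = (\<integral>\<^sup>+x. ennreal (?B x) \<partial>lborel)"
      by (rule nn_integral_translate) measurable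
    also have "(\<integral>\<^sup>+x. ennreal (?B x) \<partial>lborel) = ennreal (measure lborel (ball (0::'a) \<rho>))"
      using emeasure_lborel_ball_finite[of "0::'a" \<rho>] by (simp add: ennreal_indicator emeasure_eq_ennreal_measure less_top)
    also have "ennreal (frac_kernel s z) * (ennreal (measure lborel (ball (0::'a) \<rho>)) + ennreal (measure lborel (ball (0::'a) \<rho>)))
        = ennreal (2 * measure lborel (ball (0::'a) \<rho>) * (1 * frac_kernel s z))"
      by (simp add: ennreal_mult[symmetric] ennreal_plus[symmetric] mult_ac del: ennreal_plus)
    also have "\<dots> \<le> ennreal (K * (min 1 ((norm z)\<^sup>2) * frac_kernel s z))"
      unfolding mz K_def using K1 by (intro ennreal_leI mult_right_mono) auto
    finally show ?thesis .
  qed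
  have "(\<integral>\<^sup>+p. ennreal (norm (energy_integrand s ?B bump p)) \<partial>(lborel \<Otimes>\<^sub>M lborel))
      = (\<integral>\<^sup>+(x, z). ennreal \<bar>(?B x - ?B (x + z)) * (bump x - bump (x + z)) * frac_kernel s z\<bar> \<partial>(lborel \<Otimes>\<^sub>M lborel))"
    by (subst nn_integral_shear) (auto simp: energy_integrand_frac_kernel intro!: nn_integral_cong)
  also have "\<dots> = (\<integral>\<^sup>+z. (\<integral>\<^sup>+x. ennreal \<bar>(?B x - ?B (x + z)) * (bump x - bump (x + z)) * frac_kernel s z\<bar> \<partial>lborel) \<partial>lborel)"
    by (subst lborel_pair.nn_integral_snd[symmetric]) (auto simp: case_prod_beta)
  also have "\<dots> \<le> (\<integral>\<^sup>+z. ennreal (K * (min 1 ((norm z)\<^sup>2) * frac_kernel s z)) \<partial>(lborel :: 'a measure))"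
    by (rule nn_integral_mono[OF inner])
  also have "\<dots> < \<infinity>"
  proof -
    have "integrable lborel (\<lambda>z::'a. K * (min 1 ((norm z)\<^sup>2) * frac_kernel s z))"
      by (rule integrable_mult_right[OF integrable_min_kernel])
    moreover have "K \<ge> 0" using K1 by (simp add: K_def)
    ultimately show ?thesis unfolding integrable_iff_bounded by (simp add: abs_mult)
  qed
  finally show ?thesis by (intro integrableI_bounded) (auto simp: measurable_lborel1)
qed

text \<open>Nonlocal analogue of a flux through the sphere: in the local case the divergence theorem
  turns the integral of -\<Delta> over a ball into a boundary integral; here it becomes an energy of
  \<open>bump\<close> against the indicator.\<close>

definition ball_flux :: "'a::euclidean_space itself \<Rightarrow> real \<Rightarrow> real" where
  "ball_flux _ \<rho> = (\<integral>x. indicator (ball (0::'a) \<rho>) x * bump_op x \<partial>lborel)"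

lemma ball_flux_eq_energy:
  assumes \<rho>: "\<rho> > 0"
  shows "ball_flux TYPE('a::euclidean_space) \<rho> = energy s (indicator (ball (0::'a) \<rho>)) bump"
  unfolding ball_flux_def
proof (rule energy_eq_frac_op[symmetric, OF _ _ _ second_diff_bump integrable_energy_ball_bump[OF \<rho>]])
  show "integrable lborel (indicator (ball (0::'a) \<rho>) :: 'a \<Rightarrow> real)"
    using emeasure_lborel_ball_finite[of "0::'a" \<rho>] by (simp add: less_top)
  show "\<bar>bump x\<bar> \<le> 1" for x :: 'a using bump_le_1 by simp
qed measurable

text \<open>\<open>bump\<close> is radially decreasing, so it is larger inside the ball than outside.\<close>

lemma energy_integrand_ball_bump_nonneg:
  "0 \<le> energy_integrand s (indicator (ball (0::'a::euclidean_space) \<rho>)) bump p"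
proof -
  obtain x y where p: "p = (x, y)" by fastforce
  have "0 \<le> (indicator (ball 0 \<rho>) x - indicator (ball 0 \<rho>) y) * (bump x - bump y :: real)"
    using bump_decreasing[of x y] bump_decreasing[of y x] by (auto split: split_indicator)
  then show ?thesis unfolding p energy_integrand_frac_kernel by (rule mult_nonneg_nonneg) simp
qed

lemma ball_flux_nonneg: "\<rho> > 0 \<Longrightarrow> 0 \<le> ball_flux TYPE('a::euclidean_space) \<rho>"
  unfolding ball_flux_eq_energy energy_def
  by (intro integral_nonneg_AE AE_I2 energy_integrand_ball_bump_nonneg)

text \<open>At radius 1/2 there is a set of pairs of positive measure with strictly positive
  integrand: x in the half ball, where \<open>bump\<close> is positive, and y in the shell 1 <= |y|
  < 2, where it vanishes.\<close>

lemma ball_flux_pos: "0 < ball_flux TYPE('a::euclidean_space) (1/2)"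
proof -
  let ?E = "energy_integrand s (indicator (ball (0::'a) (1/2))) bump"
  have "ball_flux TYPE('a) (1/2) \<noteq> 0"
  proof
    assume "ball_flux TYPE('a) (1/2) = 0"
    then have "(\<integral>p. ?E p \<partial>(lborel \<Otimes>\<^sub>M lborel)) = 0"
      by (simp add: ball_flux_eq_energy energy_def)
    then have ae: "AE p in lborel \<Otimes>\<^sub>M lborel. ?E p = 0"
      by (subst (asm) integral_nonneg_eq_0_iff_AE)
         (auto intro!: integrable_energy_ball_bump energy_integrand_ball_bump_nonneg)
    have pos: "0 < ?E (x, y)" if "norm x < 1/2" "1 \<le> norm y" for x y :: 'a
    proof -
      have "bump y < bump x" using that by (intro bump_strict_decreasing) auto
      moreover have "0 < frac_kernel s (y - x)" using that by (intro frac_kernel_pos) auto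
      ultimately show ?thesis unfolding energy_integrand_frac_kernel using that by simp
    qed
    have "AE p in lborel \<Otimes>\<^sub>M lborel. p \<notin> ball (0::'a) (1/2) \<times> (ball (0::'a) 2 - ball 0 1)"
      using ae
    proof eventually_elim
      fix p :: "'a \<times> 'a" assume "?E p = 0"
      then show "p \<notin> ball (0::'a) (1/2) \<times> (ball (0::'a) 2 - ball 0 1)"
        using pos[of "fst p" "snd p"] by (cases p) (force simp: not_less)
    qed
    then have "emeasure (lborel \<Otimes>\<^sub>M lborel) (ball (0::'a) (1/2) \<times> (ball (0::'a) 2 - ball 0 1)) = 0"
      by (subst (asm) AE_iff_measurable[of "ball (0::'a) (1/2) \<times> (ball (0::'a) 2 - ball 0 1)"])
         (auto simp: space_pair_measure)
    moreover have "emeasure (lborel \<Otimes>\<^sub>M lborel) (ball (0::'a) (1/2) \<times> (ball (0::'a) 2 - ball 0 1))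
        = emeasure lborel (ball (0::'a) (1/2)) * emeasure lborel (ball (0::'a) 2 - ball 0 1)"
      by (rule lborel.emeasure_pair_measure_Times) auto
    moreover have "emeasure lborel (ball (0::'a) (1/2)) \<noteq> 0"
      using unit_ball_vol_pos[of "real DIM('a)"] by (simp add: emeasure_ball del: unit_ball_vol_pos)
    moreover have "emeasure lborel (ball (0::'a) 2 - ball 0 1) \<noteq> 0"
    proof -
      have "emeasure lborel (ball (0::'a) 2 - ball 0 1) = ennreal (unit_ball_vol (real DIM('a)) * 2 ^ DIM('a)) - ennreal (unit_ball_vol (real DIM('a)))"
        by (subst emeasure_Diff) (auto simp: emeasure_ball)
      also have "\<dots> = ennreal (unit_ball_vol (real DIM('a)) * 2 ^ DIM('a) - unit_ball_vol (real DIM('a)))"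
        by (rule ennreal_minus) simp
      finally show ?thesis
        using unit_ball_vol_pos[of "real DIM('a)"] one_less_power[of "2::real" "DIM('a)"]
        by (simp add: ennreal_eq_0_iff not_le del: unit_ball_vol_pos)
    qed
    ultimately show False by simp
  qed
  then show ?thesis using ball_flux_nonneg[of "1/2", where 'a='a] by simp
qed

text \<open>A pair contributes only if one point lies in the unit ball and the two points lie on
  different sides of the sphere of radius \<open>\<rho>\<close>. As \<open>\<rho> >= 2\<close>, they
  are at least \<open>\<rho> / 2\<close> apart, so only the tail of the kernel matters.\<close>

lemma ball_flux_le:
  assumes \<rho>: "\<rho> \<ge> 2"
  shows "ball_flux TYPE('a::euclidean_space) \<rho> \<le>
    2 * (\<integral>u. bump u \<partial>(lborel :: 'a measure)) * (sphere_area TYPE('a) / (2 * s)) * (\<rho> / 2) powr (- 2 * s)"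
proof -
  let ?B = "indicator (ball (0::'a) \<rho>) :: 'a \<Rightarrow> real"
  let ?I = "\<integral>u. bump u \<partial>(lborel :: 'a measure)"
  let ?J = "sphere_area TYPE('a) / (2 * s) * (\<rho> / 2) powr (- 2 * s)"
  let ?k = "\<lambda>z::'a. frac_kernel s z * indicator {\<rho>/2..} (norm z)"
  have r: "\<rho> / 2 > 0" using \<rho> by simp
  have k: "integrable lborel ?k" "(\<integral>z. ?k z \<partial>lborel) = ?J"
    using integrable_frac_kernel_outside[OF s_pos r, where 'a='a] by auto
  let ?g1 = "\<lambda>(x::'a, z::'a). bump x * ?k z" and ?g2 = "\<lambda>(x::'a, z::'a). bump (x + z) * ?k z"
  have [measurable]: "ball (0::'a) \<rho> \<in> sets borel" by simp
  have g1: "integrable (lborel \<Otimes>\<^sub>M lborel) ?g1" "(\<integral>p. ?g1 p \<partial>(lborel \<Otimes>\<^sub>M lborel)) = ?I * ?J"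
  proof -
    show i: "integrable (lborel \<Otimes>\<^sub>M lborel) ?g1" by (rule integrable_pair_mult[OF integrable_bump k(1)])
    have "(\<integral>p. ?g1 p \<partial>(lborel \<Otimes>\<^sub>M lborel)) = (\<integral>x. (\<integral>z. bump x * ?k z \<partial>lborel) \<partial>(lborel :: 'a measure))"
      by (rule lborel_pair.integral_fst[OF i, symmetric])
    then show "(\<integral>p. ?g1 p \<partial>(lborel \<Otimes>\<^sub>M lborel)) = ?I * ?J" by (simp add: k(2))
  qed
  have g2: "integrable (lborel \<Otimes>\<^sub>M lborel) ?g2" "(\<integral>p. ?g2 p \<partial>(lborel \<Otimes>\<^sub>M lborel)) = ?I * ?J"
  proof -
    show i: "integrable (lborel \<Otimes>\<^sub>M lborel) ?g2"
    proof (rule lborel_pair.integrable_product_swap_iff[THEN iffD1], rule lborel_pair.Fubini_integrable)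
      show "AE x in lborel. integrable lborel (\<lambda>y. case (x, y) of (x, y) \<Rightarrow> ?g2 (y, x))"
        using integrable_translate_iff[of bump] by (intro AE_I2) (auto intro!: integrable_mult_left integrable_bump)
      have "(\<lambda>x. \<integral>y. norm (case (x, y) of (x, y) \<Rightarrow> ?g2 (y, x)) \<partial>lborel) = (\<lambda>z. ?I * ?k z)"
        by (auto simp: fun_eq_iff abs_mult integral_translate)
      then show "integrable lborel (\<lambda>x. \<integral>y. norm (case (x, y) of (x, y) \<Rightarrow> ?g2 (y, x)) \<partial>lborel)"
        using k(1) by simp
    qed measurable
    have "(\<integral>p. ?g2 p \<partial>(lborel \<Otimes>\<^sub>M lborel)) = (\<integral>z. (\<integral>x. bump (x + z) * ?k z \<partial>lborel) \<partial>lborel)"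
      by (rule lborel_pair.integral_snd[OF i, symmetric])
    then show "(\<integral>p. ?g2 p \<partial>(lborel \<Otimes>\<^sub>M lborel)) = ?I * ?J" by (simp add: k(2) integral_translate)
  qed
  have "ball_flux TYPE('a) \<rho> = (\<integral>p. energy_integrand s ?B bump p \<partial>(lborel \<Otimes>\<^sub>M lborel))"
    using \<rho> by (simp add: ball_flux_eq_energy energy_def)
  also have "\<dots> = (\<integral>(x, z). energy_integrand s ?B bump (x, x + z) \<partial>(lborel \<Otimes>\<^sub>M lborel))"
    by (rule integral_shear) measurable
  also have "\<dots> \<le> (\<integral>p. ?g1 p + ?g2 p \<partial>(lborel \<Otimes>\<^sub>M lborel))"
  proof (rule integral_mono)
    have "integrable (lborel \<Otimes>\<^sub>M lborel) (energy_integrand s ?B bump)"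
      using \<rho> by (intro integrable_energy_ball_bump) simp
    then show "integrable (lborel \<Otimes>\<^sub>M lborel) (\<lambda>(x, z). energy_integrand s ?B bump (x, x + z))"
      by (subst (asm) integrable_shear_iff) auto
    show "integrable (lborel \<Otimes>\<^sub>M lborel) (\<lambda>p. ?g1 p + ?g2 p)"
      using g1(1) g2(1) by (rule Bochner_Integration.integrable_add)
    fix p :: "'a \<times> 'a"
    obtain x z where p: "p = (x, z)" by fastforce
    have "(?B x - ?B (x + z)) * (bump x - bump (x + z)) \<le> (bump x + bump (x + z)) * indicator {\<rho>/2..} (norm z)"
    proof (cases "norm z < \<rho> / 2")
      case False
      then show ?thesis using bump_nonneg[of x] bump_nonneg[of "x + z"]
        by (auto split: split_indicator)
    next
      case True
      have "?B x = ?B (x + z) \<or> (bump x = 0 \<and> bump (x + z) = 0)"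
      proof (cases "norm x < 1 \<or> norm (x + z) < 1")
        case c: True
        then have "norm x < \<rho> \<and> norm (x + z) < \<rho>"
          using True \<rho> norm_triangle_ineq[of x z] norm_triangle_ineq4[of "x + z" z] by auto
        then show ?thesis by simp
      qed (auto intro: bump_eq_0)
      then show ?thesis using True by auto
    qed
    then have "(?B x - ?B (x + z)) * (bump x - bump (x + z)) * frac_kernel s z
        \<le> (bump x + bump (x + z)) * indicator {\<rho>/2..} (norm z) * frac_kernel s z"
      by (rule mult_right_mono) simp
    then show "(case p of (x, z) \<Rightarrow> energy_integrand s ?B bump (x, x + z)) \<le> ?g1 p + ?g2 p"
      unfolding p by (simp add: energy_integrand_frac_kernel algebra_simps)
  qed
  also have "\<dots> = 2 * ?I * (sphere_area TYPE('a) / (2 * s)) * (\<rho> / 2) powr (- 2 * s)"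
    using g1 g2 by simp
  finally show ?thesis .
qed

end

lemma AE_lborel_open_ex:
  fixes S :: "'a::euclidean_space set"
  assumes ae: "AE x in lborel. x \<in> S \<longrightarrow> P x" and S: "open S" "S \<noteq> {}"
  obtains x where "x \<in> S" "P x"
proof -
  obtain c r where c: "r > 0" "ball c r \<subseteq> S" using S by (metis ex_in_conv open_contains_ball)
  have "\<exists>x\<in>S. P x"
  proof (rule ccontr)
    assume no: "\<not> (\<exists>x\<in>S. P x)"
    have "AE x in lborel. x \<notin> ball c r"
      using ae by eventually_elim (use c(2) no in blast)
    then have "emeasure lborel (ball c r) = 0"
      by (subst (asm) AE_iff_measurable[of "ball c r"]) auto
    then show False using unit_ball_vol_pos[of "real DIM('a)"] c(1)
      by (simp add: emeasure_ball del: unit_ball_vol_pos)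
  qed
  then show ?thesis using that by blast
qed

text \<open>Inside S the functions differ on an open set, and an open null set is empty.\<close>

lemma continuous_AE_eq_on_open:
  fixes f g :: "'a::euclidean_space \<Rightarrow> real"
  assumes ae: "AE x in lborel. x \<in> S \<longrightarrow> f x = g x" and S: "open S"
    and f: "continuous_on S f" and g: "continuous_on S g" and x: "x \<in> S"
  shows "f x = g x"
proof (rule ccontr)
  assume ne: "f x \<noteq> g x"
  let ?T = "S \<inter> (\<lambda>x. f x - g x) -` (- {0})"
  have "open ?T"
    using S by (intro continuous_open_preimage continuous_intros f g) auto
  moreover have "x \<in> ?T" using x ne by simp
  moreover have "AE x in lborel. x \<in> ?T \<longrightarrow> False" using ae by eventually_elim auto
  ultimately show False using AE_lborel_open_ex[of ?T "\<lambda>_. False"] by blast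
qed

section \<open>The mollifier as a normalised average of \<open>bump_op\<close> over balls\<close>

context frac_order
begin

text \<open>The radial profile of \<open>bump_op\<close>, read off along an arbitrary basis vector;
  \<open>bump_op_radial\<close> makes the choice immaterial.\<close>

definition bump_op_radius :: "'a::euclidean_space itself \<Rightarrow> real \<Rightarrow> real" where
  "bump_op_radius _ t = bump_op (t *\<^sub>R (SOME b::'a. b \<in> Basis))"

lemma bump_op_radius: "0 \<le> t \<Longrightarrow> norm x = t \<Longrightarrow> bump_op_radius TYPE('a) t = bump_op x" for x :: "'a::euclidean_space"
  unfolding bump_op_radius_def
  by (rule bump_op_radial) (simp add: norm_Basis[OF SOME_Basis])

lemma continuous_on_bump_op_radius: "continuous_on A (bump_op_radius TYPE('a::euclidean_space))"
  unfolding bump_op_radius_def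
  by (rule continuous_on_compose2[OF continuous_on_bump_op[of UNIV]]) (auto intro!: continuous_intros)

definition radial_primitive :: "'a::euclidean_space itself \<Rightarrow> real \<Rightarrow> real" where
  "radial_primitive _ \<rho> = integral {0..\<rho>} (\<lambda>t. t ^ (DIM('a) - 1) * bump_op_radius TYPE('a) t)"

lemma continuous_radial_integrand:
  "continuous_on A (\<lambda>t. t ^ (DIM('a) - 1) * bump_op_radius TYPE('a::euclidean_space) t)"
  by (intro continuous_intros continuous_on_bump_op_radius)

lemma has_derivative_radial_primitive:
  assumes "\<rho> > 0"
  shows "(radial_primitive TYPE('a::euclidean_space) has_real_derivative
     \<rho> ^ (DIM('a) - 1) * bump_op_radius TYPE('a) \<rho>) (at \<rho>)"
proof -
  have "(radial_primitive TYPE('a) has_real_derivative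
     \<rho> ^ (DIM('a) - 1) * bump_op_radius TYPE('a) \<rho>) (at \<rho> within {0..\<rho> + 1})"
    unfolding radial_primitive_def
    using assms by (intro integral_has_real_derivative continuous_radial_integrand) auto
  then show ?thesis using assms by (simp add: at_within_Icc_at)
qed

lemma ball_flux_radial_primitive:
  assumes "\<rho> > 0"
  shows "ball_flux TYPE('a::euclidean_space) \<rho> = sphere_area TYPE('a) * radial_primitive TYPE('a) \<rho>"
proof -
  let ?N = "DIM('a)" and ?m = "bump_op_radius TYPE('a)"
  have [measurable]: "?m \<in> borel_measurable borel"
    by (rule borel_measurable_continuous_onI[OF continuous_on_bump_op_radius])
  have "ball_flux TYPE('a) \<rho> = (\<integral>x. indicator {..<\<rho>} (norm x) * ?m (norm x) \<partial>(lborel :: 'a measure))"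
    unfolding ball_flux_def
    by (intro Bochner_Integration.integral_cong refl) (auto simp: bump_op_radius split: split_indicator)
  also have "\<dots> = (\<integral>t. sphere_area TYPE('a) * t ^ (?N - 1) * indicator {0..} t * (indicator {..<\<rho>} t * ?m t) \<partial>lborel)"
    by (rule integral_radial) measurable
  also have "\<dots> = (\<integral>t. sphere_area TYPE('a) * (indicator {0..\<rho>} t *\<^sub>R (t ^ (?N - 1) * ?m t)) \<partial>lborel)"
  proof (rule integral_cong_AE)
    show "AE t in lborel. sphere_area TYPE('a) * t ^ (?N - 1) * indicator {0..} t * (indicator {..<\<rho>} t * ?m t)
        = sphere_area TYPE('a) * (indicator {0..\<rho>} t *\<^sub>R (t ^ (?N - 1) * ?m t))"
      using AE_lborel_singleton[of \<rho>] by eventually_elim (auto split: split_indicator)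
  qed measurable
  also have "\<dots> = sphere_area TYPE('a) * (\<integral>t. indicator {0..\<rho>} t *\<^sub>R (t ^ (?N - 1) * ?m t) \<partial>lborel)"
    by simp
  also have "(\<integral>t. indicator {0..\<rho>} t *\<^sub>R (t ^ (?N - 1) * ?m t) \<partial>lborel) = radial_primitive TYPE('a) \<rho>"
    unfolding radial_primitive_def set_lebesgue_integral_def[symmetric]
    by (intro set_borel_integral_eq_integral borel_integrable_atLeastAtMost' continuous_radial_integrand)
  finally show ?thesis .
qed

lemma radial_primitive_nonneg: "\<rho> > 0 \<Longrightarrow> 0 \<le> radial_primitive TYPE('a::euclidean_space) \<rho>"
  using ball_flux_nonneg[of \<rho>, where 'a='a] sphere_area_pos[where 'a='a]
  by (simp add: ball_flux_radial_primitive zero_le_mult_iff)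

lemma radial_primitive_le:
  assumes "\<rho> > 0"
  shows "radial_primitive TYPE('a::euclidean_space) \<rho> \<le> bump_op_bound TYPE('a) * \<rho> ^ DIM('a)"
proof -
  have "norm (radial_primitive TYPE('a) \<rho>) \<le> (bump_op_bound TYPE('a) * \<rho> ^ (DIM('a) - 1)) * (\<rho> - 0)"
    unfolding radial_primitive_def
  proof (rule integral_bound)
    fix t assume t: "t \<in> {0..\<rho>}"
    obtain x :: 'a where x: "norm x = t" using vector_choose_size[of t] t by auto
    have "t ^ (DIM('a) - 1) * \<bar>bump_op_radius TYPE('a) t\<bar> \<le> \<rho> ^ (DIM('a) - 1) * bump_op_bound TYPE('a)"
      using t x bump_op_bounded[of x] by (intro mult_mono power_mono) (auto simp: bump_op_radius)
    then show "norm (t ^ (DIM('a) - 1) * bump_op_radius TYPE('a) t) \<le> bump_op_bound TYPE('a) * \<rho> ^ (DIM('a) - 1)"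
      using t by (simp add: abs_mult mult.commute)
  qed (use assms continuous_radial_integrand in auto)
  also have "\<dots> = bump_op_bound TYPE('a) * (\<rho> ^ (DIM('a) - 1) * \<rho>)" by simp
  also have "\<rho> ^ (DIM('a) - 1) * \<rho> = \<rho> ^ DIM('a)"
    using power_minus_mult[of "DIM('a)" \<rho>] by simp
  finally show ?thesis by simp
qed

text \<open>The average of \<open>bump_op\<close> over the ball of radius \<open>norm y\<close>, up to a factor. Its dilates are
  primitives of the dilates of \<open>bump_op\<close> with respect to the scale.\<close>

definition profile :: "'a::euclidean_space \<Rightarrow> real" where
  "profile y = radial_primitive TYPE('a) (norm y) / norm y ^ DIM('a)"

lemma profile_0 [simp]: "profile 0 = 0"
  by (simp add: profile_def radial_primitive_def)

lemma profile_nonneg: "0 \<le> profile y" for y :: "'a::euclidean_space"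
proof (cases "y = 0")
  case False
  then show ?thesis using radial_primitive_nonneg[of "norm y", where 'a='a] by (simp add: profile_def)
qed simp

lemma profile_bounded: "profile y \<le> bump_op_bound TYPE('a)" for y :: "'a::euclidean_space"
proof (cases "y = 0")
  case False
  then show ?thesis using radial_primitive_le[of "norm y", where 'a='a] by (simp add: profile_def divide_le_eq)
qed (simp add: bump_op_bound_nonneg)

text \<open>For |y| >= 2, \<open>ball_flux_le\<close> bounds the primitive by a multiple of
  |y|^(-2s), and division by |y|^N gives the kernel; this is \<open>C1\<close>. For smaller y
  boundedness suffices, since the kernel is at least 2^(-N-2s) there; this is
  \<open>C2\<close>.\<close>

lemma profile_le_kernel:
  obtains C where "C > 0" "\<And>y :: 'a::euclidean_space. y \<noteq> 0 \<Longrightarrow> profile y \<le> C * frac_kernel s y"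
proof -
  let ?N = "real DIM('a)"
  let ?I = "\<integral>u. bump u \<partial>(lborel :: 'a measure)"
  define C1 where "C1 = 2 * ?I / (2 * s) * (1 / 2) powr (- 2 * s)"
  define C2 where "C2 = bump_op_bound TYPE('a) * 2 powr (?N + 2 * s)"
  have C1: "C1 > 0" using integral_bump_pos[where 'a='a] s_pos by (simp add: C1_def)
  have C2: "C2 \<ge> 0" using bump_op_bound_nonneg[where 'a='a] by (simp add: C2_def)
  show ?thesis
  proof (rule that[of "C1 + C2"])
    show "C1 + C2 > 0" using C1 C2 by simp
    fix y :: 'a assume y: "y \<noteq> 0"
    show "profile y \<le> (C1 + C2) * frac_kernel s y"
    proof (cases "2 \<le> norm y")
      case True
      have "sphere_area TYPE('a) * radial_primitive TYPE('a) (norm y) \<le>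
         2 * ?I * (sphere_area TYPE('a) / (2 * s)) * (norm y / 2) powr (- 2 * s)"
        using ball_flux_le[OF True, where 'a='a] y by (simp add: ball_flux_radial_primitive)
      also have "(norm y / 2) powr (- 2 * s) = norm y powr (- 2 * s) * (1 / 2) powr (- 2 * s)"
        by (subst powr_mult[symmetric]) simp
      finally have "sphere_area TYPE('a) * radial_primitive TYPE('a) (norm y) \<le>
          sphere_area TYPE('a) * (C1 * norm y powr (- 2 * s))"
        by (simp add: C1_def mult_ac)
      then have "radial_primitive TYPE('a) (norm y) \<le> C1 * norm y powr (- 2 * s)"
        using sphere_area_pos[where 'a='a] by (simp only: mult_le_cancel_left_pos)
      then have "profile y \<le> C1 * norm y powr (- 2 * s) / norm y ^ DIM('a)"
        unfolding profile_def by (intro divide_right_mono) auto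
      also have "\<dots> = C1 * (norm y powr (- 2 * s) * norm y powr (- ?N))"
        using y by (simp add: powr_minus_divide powr_realpow)
      also have "norm y powr (- 2 * s) * norm y powr (- ?N) = frac_kernel s y"
        unfolding powr_add[symmetric] frac_kernel_def by (simp add: algebra_simps)
      also have "C1 * frac_kernel s y \<le> (C1 + C2) * frac_kernel s y"
        using C2 by (intro mult_right_mono) auto
      finally show ?thesis .
    next
      case False
      have "2 powr (- (?N + 2 * s)) \<le> frac_kernel s y"
        unfolding frac_kernel_def using y False s_pos by (intro powr_mono2') auto
      then have "C2 * 2 powr (- (?N + 2 * s)) \<le> C2 * frac_kernel s y" using C2 by (rule mult_left_mono)
      moreover have "C2 * 2 powr (- (?N + 2 * s)) = bump_op_bound TYPE('a)"
        unfolding C2_def mult.assoc powr_add[symmetric] by simp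
      ultimately have "profile y \<le> C2 * frac_kernel s y" using profile_bounded[of y] by linarith
      also have "\<dots> \<le> (C1 + C2) * frac_kernel s y" using C1 by (intro mult_right_mono) auto
      finally show ?thesis .
    qed
  qed
qed

lemma continuous_on_radial_primitive: "continuous_on {0<..} (radial_primitive TYPE('a::euclidean_space))"
  using has_derivative_radial_primitive[where 'a='a]
  by (intro continuous_at_imp_continuous_on ballI) (auto intro: DERIV_isCont)

lemma continuous_on_profile: "continuous_on (- {0}) (profile :: 'a::euclidean_space \<Rightarrow> real)"
  unfolding profile_def
  by (intro continuous_intros continuous_on_compose2[OF continuous_on_radial_primitive]) auto

lemma borel_measurable_profile [measurable]: "profile \<in> borel_measurable (borel :: 'a::euclidean_space measure)"
proof -
  have "(\<lambda>y. if y \<in> - {0} then profile y else (0::real)) \<in> borel_measurable (borel :: 'a measure)"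
    by (rule borel_measurable_continuous_on_if) (auto intro: continuous_on_profile)
  moreover have "(\<lambda>y. if y \<in> - {0} then profile y else (0::real)) = (profile :: 'a \<Rightarrow> real)"
    by (auto simp: fun_eq_iff profile_def)
  ultimately show ?thesis by simp
qed

lemma integrable_profile: "integrable lborel (profile :: 'a::euclidean_space \<Rightarrow> real)"
proof -
  obtain C where C: "C > 0" "\<And>y :: 'a. y \<noteq> 0 \<Longrightarrow> profile y \<le> C * frac_kernel s y"
    using profile_le_kernel[where 'a='a] by blast
  have i1: "integrable lborel (\<lambda>y::'a. bump_op_bound TYPE('a) * indicator (cball 0 1) y)"
    using emeasure_lborel_cball_finite[of "0::'a" 1] by (intro integrable_mult_right) (simp add: less_top)
  have i2: "integrable lborel (\<lambda>y::'a. C * (frac_kernel s y * indicator {1..} (norm y)))"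
    by (intro integrable_mult_right integrable_frac_kernel_outside s_pos) simp
  show ?thesis
  proof (rule Bochner_Integration.integrable_bound[OF Bochner_Integration.integrable_add[OF i1 i2]])
    show "AE y in lborel. norm (profile y) \<le>
        norm (bump_op_bound TYPE('a) * indicator (cball 0 1) y + C * (frac_kernel s y * indicator {1..} (norm (y::'a))))"
    proof (rule AE_I2)
      fix y :: 'a
      show "norm (profile y) \<le>
        norm (bump_op_bound TYPE('a) * indicator (cball 0 1) y + C * (frac_kernel s y * indicator {1..} (norm y)))"
      proof (cases "norm y \<le> 1")
        case True
        have "0 \<le> C * (frac_kernel s y * indicator {1..} (norm y))"
          using C(1) by (intro mult_nonneg_nonneg) auto
        then show ?thesis using True profile_bounded[of y] profile_nonneg[of y] by simp
      next
        case False
        then have "y \<noteq> 0" by auto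
        then show ?thesis using False C profile_nonneg[of y] by simp
      qed
    qed
  qed measurable
qed

definition profile_mass :: "'a::euclidean_space itself \<Rightarrow> real" where
  "profile_mass _ = (\<integral>y. profile y \<partial>(lborel :: 'a measure))"

text \<open>With zero mass the nonnegative function \<open>profile\<close> would vanish off the
  origin by continuity, against \<open>ball_flux_pos\<close> at radius 1/2.\<close>

lemma profile_mass_pos: "0 < profile_mass TYPE('a::euclidean_space)"
proof -
  have "profile_mass TYPE('a) \<noteq> 0"
  proof
    assume "profile_mass TYPE('a) = 0"
    then have ae: "AE y in lborel. profile (y :: 'a) = 0"
      unfolding profile_mass_def
      by (subst (asm) integral_nonneg_eq_0_iff_AE) (auto intro: integrable_profile profile_nonneg)
    obtain y :: 'a where y: "norm y = 1/2" using vector_choose_size[of "1/2"] by auto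
    have "profile y = 0"
      by (rule continuous_AE_eq_on_open[where S="- {0}" and g="\<lambda>_. 0"])
         (use ae y in \<open>auto intro: continuous_on_profile\<close>)
    moreover have "0 < profile y"
      using ball_flux_pos[where 'a='a] sphere_area_pos[where 'a='a]
      unfolding profile_def y by (simp add: ball_flux_radial_primitive zero_less_mult_iff)
    ultimately show False by simp
  qed
  moreover have "0 \<le> profile_mass TYPE('a)"
    unfolding profile_mass_def by (intro integral_nonneg_AE AE_I2 profile_nonneg)
  ultimately show ?thesis by simp
qed

definition profile_at :: "real \<Rightarrow> 'a::euclidean_space \<Rightarrow> real" where
  "profile_at e y = profile (y /\<^sub>R e) / e ^ DIM('a)"

text \<open>The powers of e cancel,
  \<open>profile_at e y = radial_primitive (norm y / e) / norm y ^ N\<close>, so only the argument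
  of the primitive depends on the scale. This is why the average over balls is the right
  mollifier.\<close>

lemma has_derivative_profile_at:
  fixes y :: "'a::euclidean_space"
  assumes e: "e > 0" and y: "y \<noteq> 0"
  shows "((\<lambda>e. profile_at e y) has_real_derivative - (bump_op (y /\<^sub>R e) / e ^ (DIM('a) + 1))) (at e)"
proof -
  let ?N = "DIM('a)" and ?r = "norm y"
  have r: "?r > 0" using y by simp
  have eq: "profile_at a y = radial_primitive TYPE('a) (?r / a) / ?r ^ ?N" if "a > 0" for a
    using that r by (simp add: profile_at_def profile_def field_simps power_mult_distrib)
  have "((\<lambda>a. radial_primitive TYPE('a) (?r / a)) has_real_derivative
     ((?r / e) ^ (?N - 1) * bump_op_radius TYPE('a) (?r / e)) * (- ?r / e\<^sup>2)) (at e)"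
    by (rule DERIV_chain2[OF has_derivative_radial_primitive])
       (use e r in \<open>auto intro!: derivative_eq_intros simp: power2_eq_square\<close>)
  then have "((\<lambda>a. radial_primitive TYPE('a) (?r / a) / ?r ^ ?N) has_real_derivative
     ((?r / e) ^ (?N - 1) * bump_op_radius TYPE('a) (?r / e)) * (- ?r / e\<^sup>2) / ?r ^ ?N) (at e)"
    by (rule DERIV_cdivide)
  also have "((?r / e) ^ (?N - 1) * bump_op_radius TYPE('a) (?r / e)) * (- ?r / e\<^sup>2) / ?r ^ ?N
      = - (bump_op (y /\<^sub>R e) / e ^ (?N + 1))"
  proof -
    obtain n where n: "?N = Suc n" using DIM_positive[where 'a='a] gr0_implies_Suc by blast
    have "bump_op_radius TYPE('a) (?r / e) = bump_op (y /\<^sub>R e)"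
      using e by (intro bump_op_radius) (auto simp: divide_inverse mult.commute)
    then show ?thesis using e r unfolding n by (simp add: power_divide field_simps power2_eq_square)
  qed
  finally show ?thesis
  proof (rule DERIV_cong_ev[THEN iffD1, rotated 3, OF _ refl _ refl])
    show "eventually (\<lambda>a. radial_primitive TYPE('a) (?r / a) / ?r ^ ?N = profile_at a y) (nhds e)"
      using eventually_nhds_in_open[of "{0<..}" e] e by (auto elim!: eventually_mono simp: eq)
  qed
qed

lemma integral_bump_op_scales:
  fixes y :: "'a::euclidean_space"
  assumes a: "0 < a" "a \<le> b" and y: "y \<noteq> 0"
  shows "(\<integral>e. bump_op (y /\<^sub>R e) / e ^ (DIM('a) + 1) * indicator {a..b} e \<partial>lborel) = profile_at a y - profile_at b y"
proof -
  have "(\<integral>e. bump_op (y /\<^sub>R e) / e ^ (DIM('a) + 1) * indicator {a..b} e \<partial>lborel) = (- profile_at b y) - (- profile_at a y)"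
  proof (rule integral_FTC_Icc_real[OF a(2)])
    fix e assume e: "a \<le> e" "e \<le> b"
    then have e0: "e > 0" using a by simp
    show "((\<lambda>e. - profile_at e y) has_real_derivative bump_op (y /\<^sub>R e) / e ^ (DIM('a) + 1)) (at e)"
      using DERIV_minus[OF has_derivative_profile_at[OF e0 y]] by simp
    have "isCont (\<lambda>e. bump_op (y /\<^sub>R e)) e"
    proof -
      have "isCont bump_op (y /\<^sub>R e)"
        using continuous_on_bump_op[where A="UNIV :: 'a set"] by (simp add: continuous_on_eq_continuous_at)
      moreover have "isCont (\<lambda>e. y /\<^sub>R e) e" using e0 by (auto intro!: continuous_intros)
      ultimately show ?thesis by (rule isCont_o2[rotated])
    qed
    then show "isCont (\<lambda>e. bump_op (y /\<^sub>R e) / e ^ (DIM('a) + 1)) e"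
      using e0 by (auto intro!: continuous_intros)
  qed
  then show ?thesis by simp
qed

end

section \<open>Square integrable functions and orthonormal bases\<close>

text \<open>A version of L2 over an arbitrary measure: the same completeness and orthogonality
  arguments are needed on the space itself and, for energies, on the product space.\<close>

definition sq_int :: "'a measure \<Rightarrow> ('a \<Rightarrow> real) set" where
  "sq_int M = {f \<in> borel_measurable M. integrable M (\<lambda>x. (f x)\<^sup>2)}"

definition sq_norm :: "'a measure \<Rightarrow> ('a \<Rightarrow> real) \<Rightarrow> real" where
  "sq_norm M f = sqrt (\<integral>x. (f x)\<^sup>2 \<partial>M)"

lemma sq_intD: "f \<in> sq_int M \<Longrightarrow> f \<in> borel_measurable M" "f \<in> sq_int M \<Longrightarrow> integrable M (\<lambda>x. (f x)\<^sup>2)"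
  by (auto simp: sq_int_def)

lemma sq_norm_nonneg [simp]: "0 \<le> sq_norm M f"
  by (simp add: sq_norm_def)

lemma sq_norm_square: "(sq_norm M f)\<^sup>2 = (\<integral>x. (f x)\<^sup>2 \<partial>M)"
  by (simp add: sq_norm_def)

lemma integrable_sq_int_mult:
  assumes f: "f \<in> sq_int M" and g: "g \<in> sq_int M"
  shows "integrable M (\<lambda>x. f x * g x)"
proof (rule Bochner_Integration.integrable_bound)
  show "integrable M (\<lambda>x. (f x)\<^sup>2 + (g x)\<^sup>2)" using f g by (auto simp: sq_int_def)
  show "(\<lambda>x. f x * g x) \<in> borel_measurable M" using f g by (auto simp: sq_int_def)
  have "\<bar>a * b\<bar> \<le> a\<^sup>2 + b\<^sup>2" for a b :: real
  proof -
    have "2 * (\<bar>a\<bar> * \<bar>b\<bar>) \<le> a\<^sup>2 + b\<^sup>2"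
      using sum_squares_bound[of "\<bar>a\<bar>" "\<bar>b\<bar>"] by simp
    moreover have "0 \<le> \<bar>a\<bar> * \<bar>b\<bar>" by simp
    ultimately show ?thesis unfolding abs_mult by linarith
  qed
  then show "AE x in M. norm (f x * g x) \<le> norm ((f x)\<^sup>2 + (g x)\<^sup>2)" by (intro AE_I2) auto
qed

lemma sq_int_lincomb:
  assumes f: "f \<in> sq_int M" and g: "g \<in> sq_int M"
  shows "(\<lambda>x. a * f x + b * g x) \<in> sq_int M"
proof -
  have "integrable M (\<lambda>x. a\<^sup>2 * (f x)\<^sup>2 + 2 * a * b * (f x * g x) + b\<^sup>2 * (g x)\<^sup>2)"
    using f g integrable_sq_int_mult[OF f g] by (auto simp: sq_int_def)
  also have "(\<lambda>x. a\<^sup>2 * (f x)\<^sup>2 + 2 * a * b * (f x * g x) + b\<^sup>2 * (g x)\<^sup>2) = (\<lambda>x. (a * f x + b * g x)\<^sup>2)"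
    by (auto simp: power2_eq_square algebra_simps)
  finally show ?thesis using f g by (auto simp: sq_int_def)
qed

lemma sq_int_add: "f \<in> sq_int M \<Longrightarrow> g \<in> sq_int M \<Longrightarrow> (\<lambda>x. f x + g x) \<in> sq_int M"
  using sq_int_lincomb[of f M g 1 1] by simp

lemma sq_int_diff: "f \<in> sq_int M \<Longrightarrow> g \<in> sq_int M \<Longrightarrow> (\<lambda>x. f x - g x) \<in> sq_int M"
  using sq_int_lincomb[of f M g 1 "-1"] by simp

lemma sq_int_cmult: "f \<in> sq_int M \<Longrightarrow> (\<lambda>x. c * f x) \<in> sq_int M"
  using sq_int_lincomb[of f M f c 0] by simp

lemma sq_int_sum: "(\<And>i. i \<in> I \<Longrightarrow> f i \<in> sq_int M) \<Longrightarrow> (\<lambda>x. \<Sum>i\<in>I. f i x) \<in> sq_int M"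
proof (induction I rule: infinite_finite_induct)
  case (insert i I)
  then show ?case by (auto intro!: sq_int_add)
qed (auto simp: sq_int_def)

lemma sq_norm_eq_0_iff: "f \<in> sq_int M \<Longrightarrow> sq_norm M f = 0 \<longleftrightarrow> (AE x in M. f x = 0)"
  unfolding sq_norm_def by (auto simp: sq_int_def integral_nonneg_eq_0_iff_AE)

lemma cauchy_schwarz_sq_int:
  assumes f: "f \<in> sq_int M" and g: "g \<in> sq_int M"
  shows "\<bar>(\<integral>x. f x * g x \<partial>M)\<bar> \<le> sq_norm M f * sq_norm M g"
proof (cases "sq_norm M g = 0")
  case True
  then have "AE x in M. f x * g x = 0" using sq_norm_eq_0_iff[OF g] by auto
  then have "(\<integral>x. f x * g x \<partial>M) = 0" by (simp add: integral_eq_zero_AE)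
  then show ?thesis by simp
next
  case False
  let ?p = "\<integral>x. f x * g x \<partial>M" and ?G = "\<integral>x. (g x)\<^sup>2 \<partial>M" and ?F = "\<integral>x. (f x)\<^sup>2 \<partial>M"
  have G: "?G > 0" using False integral_nonneg_AE[of "\<lambda>x. (g x)\<^sup>2" M] by (auto simp: sq_norm_def less_le)
  define t where "t = ?p / ?G"
  have "0 \<le> (\<integral>x. (f x - t * g x)\<^sup>2 \<partial>M)" by simp
  also have "(\<integral>x. (f x - t * g x)\<^sup>2 \<partial>M) = (\<integral>x. (f x)\<^sup>2 - 2 * t * (f x * g x) + t\<^sup>2 * (g x)\<^sup>2 \<partial>M)"
    by (intro Bochner_Integration.integral_cong) (auto simp: power2_eq_square algebra_simps)
  also have "\<dots> = ?F - 2 * t * ?p + t\<^sup>2 * ?G"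
    using f g integrable_sq_int_mult[OF f g] by (simp add: sq_int_def)
  also have "\<dots> = ?F - ?p\<^sup>2 / ?G"
    using G by (simp add: t_def power2_eq_square field_simps)
  finally have "?p\<^sup>2 \<le> ?F * ?G" using G by (simp add: field_simps)
  then have "sqrt (?p\<^sup>2) \<le> sqrt (?F * ?G)" by (rule real_sqrt_le_mono)
  then show ?thesis by (simp add: sq_norm_def real_sqrt_mult)
qed

lemma sq_norm_minus_commute: "sq_norm M (\<lambda>x. f x - g x) = sq_norm M (\<lambda>x. g x - f x)"
  by (simp add: sq_norm_def power2_commute)

text \<open>
  The series \<open>\<Sum> 4\<^sup>i d\<^sub>i\<^sup>2\<close> of increments of a fast subsequence is integrable, so almost everywhere the
  increments decay geometrically.
\<close>

lemma sq_int_complete: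
  fixes f :: "nat \<Rightarrow> 'a \<Rightarrow> real"
  assumes f: "\<And>n. f n \<in> sq_int M"
    and cauchy: "\<And>e. e > 0 \<Longrightarrow> \<exists>N. \<forall>m\<ge>N. \<forall>n\<ge>N. sq_norm M (\<lambda>x. f m x - f n x) < e"
  obtains g r where "g \<in> sq_int M" "(\<lambda>n. sq_norm M (\<lambda>x. g x - f n x)) \<longlonglongrightarrow> 0"
    "strict_mono (r :: nat \<Rightarrow> nat)" "AE x in M. (\<lambda>n. f (r n) x) \<longlonglongrightarrow> g x"
proof -
  have [measurable]: "f n \<in> borel_measurable M" for n using f by (auto simp: sq_int_def)
  \<comment> \<open>The rate 1/8 leaves 4^i / 8^i = (1/2)^i, so the series remains summable after
    weighting with 4^i.\<close>
  have "\<exists>N. \<forall>m\<ge>N. \<forall>n\<ge>N. (sq_norm M (\<lambda>x. f m x - f n x))\<^sup>2 < (1/8)^i" for i :: nat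
  proof -
    have "sqrt ((1/8)^i) > (0::real)" by simp
    from cauchy[OF this] obtain N where N: "\<And>m n. m \<ge> N \<Longrightarrow> n \<ge> N \<Longrightarrow> sq_norm M (\<lambda>x. f m x - f n x) < sqrt ((1/8)^i)"
      by blast
    have "(sq_norm M (\<lambda>x. f m x - f n x))\<^sup>2 < (sqrt ((1/8)^i))\<^sup>2" if "m \<ge> N" "n \<ge> N" for m n
      using N[OF that] by (intro power_strict_mono) auto
    then show ?thesis by auto
  qed
  then obtain K where K: "\<And>i m n. m \<ge> K i \<Longrightarrow> n \<ge> K i \<Longrightarrow> (sq_norm M (\<lambda>x. f m x - f n x))\<^sup>2 < (1/8)^i"
    by metis
  define r where "r = rec_nat (K 0) (\<lambda>i p. Suc (max p (K (Suc i))))"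
  have rS: "r (Suc i) = Suc (max (r i) (K (Suc i)))" for i by (simp add: r_def)
  have rK: "K i \<le> r i" for i by (cases i) (auto simp: r_def)
  have sm: "strict_mono r" by (rule strict_monoI_Suc) (simp add: rS)
  define d where "d i x = f (r (Suc i)) x - f (r i) x" for i x
  have [measurable]: "d i \<in> borel_measurable M" for i by (simp add: d_def[abs_def])
  have di: "integrable M (\<lambda>x. (d i x)\<^sup>2)" for i
    unfolding d_def using sq_int_diff[OF f f] by (auto simp: sq_int_def)
  have dn: "(\<integral>\<^sup>+x. ennreal ((d i x)\<^sup>2) \<partial>M) \<le> ennreal ((1/8)^i)" for i
  proof -
    have "(\<integral>\<^sup>+x. ennreal ((d i x)\<^sup>2) \<partial>M) = ennreal ((sq_norm M (d i))\<^sup>2)"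
      unfolding sq_norm_square by (rule nn_integral_eq_integral[OF di]) simp
    also have "\<dots> \<le> ennreal ((1/8)^i)"
      using K[of i "r (Suc i)" "r i"] rK[of i] strict_monoD[OF sm, of i "Suc i"]
      by (intro ennreal_leI) (auto simp: d_def[abs_def])
    finally show ?thesis .
  qed
  have "(\<integral>\<^sup>+x. (\<Sum>i. ennreal (4^i * (d i x)\<^sup>2)) \<partial>M) = (\<Sum>i. (\<integral>\<^sup>+x. ennreal (4^i * (d i x)\<^sup>2) \<partial>M))"
    by (rule nn_integral_suminf) measurable
  also have "\<dots> \<le> (\<Sum>i. ennreal ((1/2)^i))"
  proof (intro suminf_le summableI)
    fix i
    have "(\<integral>\<^sup>+x. ennreal (4^i * (d i x)\<^sup>2) \<partial>M) = ennreal (4^i) * (\<integral>\<^sup>+x. ennreal ((d i x)\<^sup>2) \<partial>M)"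
      by (subst nn_integral_cmult[symmetric]) (auto simp: ennreal_mult)
    also have "\<dots> \<le> ennreal (4^i) * ennreal ((1/8)^i)" by (intro mult_left_mono dn) simp
    also have "\<dots> = ennreal ((1/2)^i)"
      by (simp add: ennreal_mult[symmetric] power_mult_distrib[symmetric])
    finally show "(\<integral>\<^sup>+x. ennreal (4^i * (d i x)\<^sup>2) \<partial>M) \<le> ennreal ((1/2)^i)" .
  qed
  also have "\<dots> = ennreal (\<Sum>i. (1/2)^i)"
    by (rule suminf_ennreal2) (auto intro: summable_geometric)
  also have "\<dots> < \<infinity>" by simp
  finally have "AE x in M. (\<Sum>i. ennreal (4^i * (d i x)\<^sup>2)) \<noteq> \<infinity>"
    by (intro nn_integral_PInf_AE) auto
  then have conv: "AE x in M. convergent (\<lambda>n. f (r n) x)"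
  proof eventually_elim
    fix x assume "(\<Sum>i. ennreal (4^i * (d i x)\<^sup>2)) \<noteq> \<infinity>"
    then have s: "summable (\<lambda>i. 4^i * (d i x)\<^sup>2)"
      by (intro summable_suminf_not_top) auto
    \<comment> \<open>Bounded terms are all that is needed: 4^i d_i^2 <= C means |d_i| <= sqrt C
      (1/2)^i.\<close>
    have "Bseq (\<lambda>i. 4^i * (d i x)\<^sup>2)"
      by (rule convergent_imp_Bseq[OF convergentI[OF summable_LIMSEQ_zero[OF s]]])
    then obtain C where C: "\<And>i. norm (4^i * (d i x)\<^sup>2) \<le> C" by (elim BseqE) blast
    have "summable (\<lambda>i. d i x)"
    proof (rule summable_comparison_test')
      show "summable (\<lambda>i. sqrt C * (1/2)^i)" by (intro summable_mult summable_geometric) simp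
      fix i assume "(0::nat) \<le> i"
      have "((2::real)^i)\<^sup>2 = (2\<^sup>2)^i" by (simp only: power_mult[symmetric] mult.commute)
      then have "(2^i * \<bar>d i x\<bar>)\<^sup>2 = 4^i * (d i x)\<^sup>2" by (simp add: power_mult_distrib)
      then have "(2^i * \<bar>d i x\<bar>)\<^sup>2 \<le> C" using C[of i] by simp
      then have "2^i * \<bar>d i x\<bar> \<le> sqrt C" by (rule real_le_rsqrt)
      then show "norm (d i x) \<le> sqrt C * (1/2)^i" by (simp add: field_simps power_divide)
    qed
    then have "convergent (\<lambda>n. \<Sum>i<n. d i x)" by (simp add: summable_iff_convergent)
    moreover have "(\<Sum>i<n. d i x) = f (r n) x - f (r 0) x" for n
      unfolding d_def by (rule sum_lessThan_telescope)
    ultimately have "convergent (\<lambda>n. (f (r n) x - f (r 0) x) + f (r 0) x)"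
      by (intro convergent_add convergent_const) simp
    then show "convergent (\<lambda>n. f (r n) x)" by simp
  qed
  define g where "g x = lim (\<lambda>n. f (r n) x)" for x
  have [measurable]: "g \<in> borel_measurable M" unfolding g_def[abs_def] by measurable
  have lim: "AE x in M. (\<lambda>n. f (r n) x) \<longlonglongrightarrow> g x"
    using conv by eventually_elim (simp add: g_def convergent_LIMSEQ_iff)
  have fatou: "(\<integral>\<^sup>+x. ennreal ((g x - f m x)\<^sup>2) \<partial>M) \<le> ennreal (e\<^sup>2)"
    if e: "e > 0" and m: "\<And>k. k \<ge> N \<Longrightarrow> sq_norm M (\<lambda>x. f k x - f m x) \<le> e" for e m N
  proof -
    have "(\<integral>\<^sup>+x. ennreal ((g x - f m x)\<^sup>2) \<partial>M) = (\<integral>\<^sup>+x. liminf (\<lambda>n. ennreal ((f (r n) x - f m x)\<^sup>2)) \<partial>M)"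
    proof (rule nn_integral_cong_AE)
      show "AE x in M. ennreal ((g x - f m x)\<^sup>2) = liminf (\<lambda>n. ennreal ((f (r n) x - f m x)\<^sup>2))"
        using lim
      proof eventually_elim
        fix x assume "(\<lambda>n. f (r n) x) \<longlonglongrightarrow> g x"
        then have "(\<lambda>n. ennreal ((f (r n) x - f m x)\<^sup>2)) \<longlonglongrightarrow> ennreal ((g x - f m x)\<^sup>2)"
          by (intro tendsto_ennrealI tendsto_power tendsto_diff tendsto_const)
        then show "ennreal ((g x - f m x)\<^sup>2) = liminf (\<lambda>n. ennreal ((f (r n) x - f m x)\<^sup>2))"
          by (rule lim_imp_Liminf[OF sequentially_bot, symmetric])
      qed
    qed
    also have "\<dots> \<le> liminf (\<lambda>n. \<integral>\<^sup>+x. ennreal ((f (r n) x - f m x)\<^sup>2) \<partial>M)"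
      by (rule nn_integral_liminf) measurable
    also have "\<dots> \<le> liminf (\<lambda>n. ennreal (e\<^sup>2))"
    proof (rule Liminf_mono)
      show "eventually (\<lambda>n. (\<integral>\<^sup>+x. ennreal ((f (r n) x - f m x)\<^sup>2) \<partial>M) \<le> ennreal (e\<^sup>2)) sequentially"
        using eventually_ge_at_top[of N]
      proof eventually_elim
        case (elim n)
        then have "sq_norm M (\<lambda>x. f (r n) x - f m x) \<le> e"
          using m[of "r n"] strict_mono_imp_increasing[OF sm, of n] by simp
        then have "(sq_norm M (\<lambda>x. f (r n) x - f m x))\<^sup>2 \<le> e\<^sup>2" by (intro power_mono) auto
        moreover have "integrable M (\<lambda>x. (f (r n) x - f m x)\<^sup>2)" using sq_int_diff[OF f f] by (auto simp: sq_int_def)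
        ultimately show ?case unfolding sq_norm_square
          by (subst nn_integral_eq_integral) (auto intro: ennreal_leI)
      qed
    qed
    also have "\<dots> = ennreal (e\<^sup>2)" by (simp add: Liminf_const)
    finally show ?thesis .
  qed
  have gf: "(\<lambda>x. g x - f m x) \<in> sq_int M \<and> sq_norm M (\<lambda>x. g x - f m x) \<le> e"
    if e: "e > 0" and m: "\<And>k. k \<ge> N \<Longrightarrow> sq_norm M (\<lambda>x. f k x - f m x) \<le> e" for e m N
  proof -
    have b: "(\<integral>\<^sup>+x. ennreal ((g x - f m x)\<^sup>2) \<partial>M) \<le> ennreal (e\<^sup>2)" by (rule fatou[OF that])
    then have i: "integrable M (\<lambda>x. (g x - f m x)\<^sup>2)"
      by (intro integrableI_bounded) (auto intro: le_less_trans)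
    then have "(sq_norm M (\<lambda>x. g x - f m x))\<^sup>2 \<le> e\<^sup>2"
      using b unfolding sq_norm_square by (subst (asm) nn_integral_eq_integral) auto
    then show ?thesis using i e by (auto simp: sq_int_def intro: power2_le_imp_le)
  qed
  have tail: "\<exists>N. \<forall>m\<ge>N. (\<lambda>x. g x - f m x) \<in> sq_int M \<and> sq_norm M (\<lambda>x. g x - f m x) \<le> e" if e: "e > 0" for e
  proof -
    from cauchy[OF e] obtain N where N: "\<forall>m\<ge>N. \<forall>n\<ge>N. sq_norm M (\<lambda>x. f m x - f n x) < e" by blast
    have "(\<lambda>x. g x - f m x) \<in> sq_int M \<and> sq_norm M (\<lambda>x. g x - f m x) \<le> e" if "m \<ge> N" for m
      by (rule gf[OF e, of N]) (use N that in \<open>auto intro: less_imp_le\<close>)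
    then show ?thesis by blast
  qed
  obtain N where "(\<lambda>x. g x - f N x) \<in> sq_int M" using tail[of 1] by auto
  from sq_int_add[OF this f[of N]] have g: "g \<in> sq_int M" by simp
  have "(\<lambda>n. sq_norm M (\<lambda>x. g x - f n x)) \<longlonglongrightarrow> 0"
  proof (rule LIMSEQ_I)
    fix e :: real assume "e > 0"
    with tail[of "e/2"] obtain N where "\<forall>m\<ge>N. sq_norm M (\<lambda>x. g x - f m x) \<le> e/2" by auto
    then show "\<exists>N. \<forall>n\<ge>N. norm (sq_norm M (\<lambda>x. g x - f n x) - 0) < e"
      using \<open>e > 0\<close> by (intro exI[of _ N]) (force)
  qed
  then show ?thesis by (rule that[OF g _ sm lim])
qed

lemma integral_mult_sum_orthogonal:
  assumes e: "\<And>k. e k \<in> sq_int M" and orth: "\<And>j k. j \<noteq> k \<Longrightarrow> (\<integral>x. e j x * e k x \<partial>M) = 0"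
    and "finite I"
  shows "(\<integral>x. (\<Sum>k\<in>I. e k x)\<^sup>2 \<partial>M) = (\<Sum>k\<in>I. (\<integral>x. (e k x)\<^sup>2 \<partial>M))"
proof -
  have "(\<integral>x. (\<Sum>k\<in>I. e k x)\<^sup>2 \<partial>M) = (\<integral>x. (\<Sum>j\<in>I. \<Sum>k\<in>I. e j x * e k x) \<partial>M)"
    by (simp add: power2_eq_square sum_product)
  also have "\<dots> = (\<Sum>j\<in>I. \<Sum>k\<in>I. (\<integral>x. e j x * e k x \<partial>M))"
    using integrable_sq_int_mult[OF e e] by simp
  also have "\<dots> = (\<Sum>j\<in>I. \<Sum>k\<in>I. if j = k then (\<integral>x. (e k x)\<^sup>2 \<partial>M) else 0)"
    using orth by (intro sum.cong refl) (auto simp: power2_eq_square)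
  also have "\<dots> = (\<Sum>k\<in>I. (\<integral>x. (e k x)\<^sup>2 \<partial>M))" using \<open>finite I\<close> by simp
  finally show ?thesis .
qed

text \<open>By Pythagoras the partial sums are Cauchy as soon as the squared norms are summable. The
  almost everywhere convergent subsequence is recorded because it later identifies limits taken in
  different spaces.\<close>

lemma orthogonal_series_complete:
  fixes e :: "nat \<Rightarrow> 'a \<Rightarrow> real"
  assumes e: "\<And>k. e k \<in> sq_int M" and orth: "\<And>j k. j \<noteq> k \<Longrightarrow> (\<integral>x. e j x * e k x \<partial>M) = 0"
    and sum: "summable (\<lambda>k. \<integral>x. (e k x)\<^sup>2 \<partial>M)"
  obtains g r where "g \<in> sq_int M" "(\<lambda>n. sq_norm M (\<lambda>x. g x - (\<Sum>k<n. e k x))) \<longlonglongrightarrow> 0"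
    "strict_mono (r :: nat \<Rightarrow> nat)" "AE x in M. (\<lambda>n. \<Sum>k<r n. e k x) \<longlonglongrightarrow> g x"
proof -
  let ?s = "\<lambda>n. \<Sum>k<n. (\<integral>x. (e k x)\<^sup>2 \<partial>M)"
  have diff: "(sq_norm M (\<lambda>x. (\<Sum>k<m. e k x) - (\<Sum>k<n. e k x)))\<^sup>2 = \<bar>?s m - ?s n\<bar>" for m n
  proof -
    have *: "(sq_norm M (\<lambda>x. (\<Sum>k<m. e k x) - (\<Sum>k<n. e k x)))\<^sup>2 = \<bar>?s m - ?s n\<bar>" if "n \<le> m" for m n
    proof -
      have "{..<n} \<union> {n..<m} = {..<m}" "{..<n} \<inter> {n..<m} = {}" using that by auto
      then have split: "(\<Sum>k<m. h k) = (\<Sum>k<n. h k) + (\<Sum>k=n..<m. h k)" for h :: "nat \<Rightarrow> real"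
        by (metis sum.union_disjoint finite_lessThan finite_atLeastLessThan)
      have "(sq_norm M (\<lambda>x. (\<Sum>k<m. e k x) - (\<Sum>k<n. e k x)))\<^sup>2 = (\<integral>x. (\<Sum>k=n..<m. e k x)\<^sup>2 \<partial>M)"
        unfolding sq_norm_square by (simp add: split)
      also have "\<dots> = (\<Sum>k=n..<m. (\<integral>x. (e k x)\<^sup>2 \<partial>M))"
        by (rule integral_mult_sum_orthogonal[OF e orth]) auto
      also have "\<dots> = \<bar>?s m - ?s n\<bar>" by (simp add: split sum_nonneg)
      finally show ?thesis .
    qed
    show ?thesis
    proof (cases "n \<le> m")
      case False
      then show ?thesis using *[of m n] by (simp add: sq_norm_minus_commute[of M "\<lambda>x. \<Sum>k<m. e k x"] abs_minus_commute)
    qed (rule *)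
  qed
  have "\<exists>N. \<forall>m\<ge>N. \<forall>n\<ge>N. sq_norm M (\<lambda>x. (\<Sum>k<m. e k x) - (\<Sum>k<n. e k x)) < c" if c: "c > 0" for c
  proof -
    have "Cauchy ?s" using sum by (simp add: summable_iff_convergent Cauchy_convergent_iff)
    moreover have "c\<^sup>2 > 0" using c by simp
    ultimately obtain N where "\<forall>m\<ge>N. \<forall>n\<ge>N. dist (?s m) (?s n) < c\<^sup>2"
      unfolding Cauchy_def by blast
    then have N: "\<And>m n. m \<ge> N \<Longrightarrow> n \<ge> N \<Longrightarrow> \<bar>?s m - ?s n\<bar> < c\<^sup>2"
      by (simp only: dist_real_def)
    have "sq_norm M (\<lambda>x. (\<Sum>k<m. e k x) - (\<Sum>k<n. e k x)) < c" if "m \<ge> N" "n \<ge> N" for m n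
    proof (rule power2_less_imp_less)
      show "(sq_norm M (\<lambda>x. (\<Sum>k<m. e k x) - (\<Sum>k<n. e k x)))\<^sup>2 < c\<^sup>2"
        unfolding diff using N[OF that] .
    qed (use c in simp)
    then show ?thesis by blast
  qed
  from sq_int_complete[OF sq_int_sum[OF e] this]
  obtain g r where "g \<in> sq_int M" "(\<lambda>n. sq_norm M (\<lambda>x. g x - (\<Sum>k<n. e k x))) \<longlonglongrightarrow> 0"
    "strict_mono (r :: nat \<Rightarrow> nat)" "AE x in M. (\<lambda>n. \<Sum>k<r n. e k x) \<longlonglongrightarrow> g x" .
  then show ?thesis by (rule that)
qed

text \<open>Extension by zero, which reduces the notions over \<open>\<Omega>\<close> to
  \<open>sq_int lborel\<close>.\<close>

definition restr :: "'a::euclidean_space set \<Rightarrow> ('a \<Rightarrow> real) \<Rightarrow> 'a \<Rightarrow> real" where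
  "restr \<Omega> f x = indicator \<Omega> x * f x"

lemma restr_simps [simp]: "x \<in> \<Omega> \<Longrightarrow> restr \<Omega> f x = f x" "x \<notin> \<Omega> \<Longrightarrow> restr \<Omega> f x = 0"
  by (simp_all add: restr_def)

lemma restr_restr [simp]: "restr \<Omega> (restr \<Omega> f) = restr \<Omega> f"
  by (auto simp: restr_def fun_eq_iff split: split_indicator)

lemma L2_iff_restr: "f \<in> L2 \<Omega> \<longleftrightarrow> restr \<Omega> f \<in> sq_int lborel"
proof -
  have "(\<lambda>x. indicator \<Omega> x *\<^sub>R (f x)\<^sup>2) = (\<lambda>x. (restr \<Omega> f x)\<^sup>2)"
    by (auto simp: restr_def fun_eq_iff split: split_indicator)
  then show ?thesis
    by (simp add: L2_def sq_int_def set_borel_measurable_def set_integrable_def restr_def[abs_def])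
qed

lemma L2_inner_restr: "L2_inner \<Omega> f g = (\<integral>x. restr \<Omega> f x * restr \<Omega> g x \<partial>lborel)"
  unfolding L2_inner_def set_lebesgue_integral_def restr_def
  by (intro Bochner_Integration.integral_cong) (auto split: split_indicator)

lemma L2_norm_restr: "L2_norm \<Omega> f = sq_norm lborel (restr \<Omega> f)"
  by (simp add: L2_norm_def L2_inner_restr sq_norm_def power2_eq_square)

lemma L2_norm_nonneg [simp]: "0 \<le> L2_norm \<Omega> f"
  by (simp add: L2_norm_restr)

lemma L2_norm_square: "(L2_norm \<Omega> f)\<^sup>2 = L2_inner \<Omega> f f"
  unfolding L2_norm_restr sq_norm_square L2_inner_restr by (simp add: power2_eq_square)

lemma restr_lincomb: "restr \<Omega> (\<lambda>x. a * f x + b * g x) = (\<lambda>x. a * restr \<Omega> f x + b * restr \<Omega> g x)"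
  by (auto simp: restr_def fun_eq_iff split: split_indicator)

lemma restr_diff: "restr \<Omega> (\<lambda>x. f x - g x) = (\<lambda>x. restr \<Omega> f x - restr \<Omega> g x)"
  using restr_lincomb[of \<Omega> 1 f "-1" g] by simp

lemma restr_sum: "restr \<Omega> (\<lambda>x. \<Sum>i\<in>I. f i x) = (\<lambda>x. \<Sum>i\<in>I. restr \<Omega> (f i) x)"
  by (auto simp: restr_def fun_eq_iff sum_distrib_left)

lemma L2_lincomb: "f \<in> L2 \<Omega> \<Longrightarrow> g \<in> L2 \<Omega> \<Longrightarrow> (\<lambda>x. a * f x + b * g x) \<in> L2 \<Omega>"
  by (simp add: L2_iff_restr restr_lincomb sq_int_lincomb)

lemma L2_diff: "f \<in> L2 \<Omega> \<Longrightarrow> g \<in> L2 \<Omega> \<Longrightarrow> (\<lambda>x. f x - g x) \<in> L2 \<Omega>"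
  using L2_lincomb[of f \<Omega> g 1 "-1"] by simp

lemma L2_cmult: "f \<in> L2 \<Omega> \<Longrightarrow> (\<lambda>x. c * f x) \<in> L2 \<Omega>"
  using L2_lincomb[of f \<Omega> f c 0] by simp

lemma L2_sum: "(\<And>i. i \<in> I \<Longrightarrow> f i \<in> L2 \<Omega>) \<Longrightarrow> (\<lambda>x. \<Sum>i\<in>I. f i x) \<in> L2 \<Omega>"
  by (simp add: L2_iff_restr restr_sum sq_int_sum)

lemma L2_inner_commute: "L2_inner \<Omega> f g = L2_inner \<Omega> g f"
  by (simp add: L2_inner_def mult.commute)

lemma L2_inner_lincomb:
  assumes "f \<in> L2 \<Omega>" "g \<in> L2 \<Omega>" "h \<in> L2 \<Omega>"
  shows "L2_inner \<Omega> (\<lambda>x. a * f x + b * g x) h = a * L2_inner \<Omega> f h + b * L2_inner \<Omega> g h"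
proof -
  have "integrable lborel (\<lambda>x. restr \<Omega> f x * restr \<Omega> h x)" "integrable lborel (\<lambda>x. restr \<Omega> g x * restr \<Omega> h x)"
    using assms by (auto intro!: integrable_sq_int_mult simp: L2_iff_restr)
  then show ?thesis
    by (simp add: L2_inner_restr restr_lincomb distrib_right mult.assoc)
qed

lemma L2_inner_diff:
  assumes "f \<in> L2 \<Omega>" "g \<in> L2 \<Omega>" "h \<in> L2 \<Omega>"
  shows "L2_inner \<Omega> (\<lambda>x. f x - g x) h = L2_inner \<Omega> f h - L2_inner \<Omega> g h"
  using L2_inner_lincomb[OF assms, of 1 "-1"] by simp

lemma L2_inner_cmult: "L2_inner \<Omega> (\<lambda>x. c * f x) h = c * L2_inner \<Omega> f h"
  by (simp add: L2_inner_def set_lebesgue_integral_def mult.left_commute mult.assoc)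

lemma L2_inner_sum:
  assumes "\<And>i. i \<in> I \<Longrightarrow> f i \<in> L2 \<Omega>" "h \<in> L2 \<Omega>"
  shows "L2_inner \<Omega> (\<lambda>x. \<Sum>i\<in>I. f i x) h = (\<Sum>i\<in>I. L2_inner \<Omega> (f i) h)"
proof -
  have "integrable lborel (\<lambda>x. restr \<Omega> (f i) x * restr \<Omega> h x)" if "i \<in> I" for i
    using assms that by (auto intro!: integrable_sq_int_mult simp: L2_iff_restr)
  then show ?thesis by (simp add: L2_inner_restr restr_sum sum_distrib_right)
qed

lemma L2_inner_cauchy_schwarz:
  "f \<in> L2 \<Omega> \<Longrightarrow> g \<in> L2 \<Omega> \<Longrightarrow> \<bar>L2_inner \<Omega> f g\<bar> \<le> L2_norm \<Omega> f * L2_norm \<Omega> g"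
  unfolding L2_inner_restr L2_norm_restr L2_iff_restr by (rule cauchy_schwarz_sq_int)

lemma L2_norm_eq_0_iff: "f \<in> L2 \<Omega> \<Longrightarrow> L2_norm \<Omega> f = 0 \<longleftrightarrow> (AE x in lborel. x \<in> \<Omega> \<longrightarrow> f x = 0)"
  unfolding L2_norm_restr L2_iff_restr
  by (subst sq_norm_eq_0_iff) (auto simp: restr_def split: split_indicator intro!: AE_cong)

lemma L2_inner_cong_AE:
  assumes "AE x in lborel. x \<in> \<Omega> \<longrightarrow> f x = f' x" "f \<in> L2 \<Omega>" "f' \<in> L2 \<Omega>" "g \<in> L2 \<Omega>"
  shows "L2_inner \<Omega> f g = L2_inner \<Omega> f' g"
  unfolding L2_inner_restr
proof (rule integral_cong_AE)
  show "AE x in lborel. restr \<Omega> f x * restr \<Omega> g x = restr \<Omega> f' x * restr \<Omega> g x"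
    using assms(1) by eventually_elim (auto simp: restr_def split: split_indicator)
qed (use assms in \<open>auto simp: L2_iff_restr sq_int_def\<close>)

lemma tendsto_L2_inner:
  assumes g: "\<And>n. g n \<in> L2 \<Omega>" and f: "f \<in> L2 \<Omega>" and h: "h \<in> L2 \<Omega>"
    and lim: "(\<lambda>n. L2_norm \<Omega> (\<lambda>x. f x - g n x)) \<longlonglongrightarrow> 0"
  shows "(\<lambda>n. L2_inner \<Omega> (g n) h) \<longlonglongrightarrow> L2_inner \<Omega> f h"
proof -
  have "(\<lambda>n. L2_inner \<Omega> f h - L2_inner \<Omega> (g n) h) \<longlonglongrightarrow> 0"
  proof (rule Lim_null_comparison)
    show "eventually (\<lambda>n. norm (L2_inner \<Omega> f h - L2_inner \<Omega> (g n) h) \<le> L2_norm \<Omega> (\<lambda>x. f x - g n x) * L2_norm \<Omega> h) sequentially"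
      using L2_inner_cauchy_schwarz[OF L2_diff[OF f g] h] by (simp add: L2_inner_diff[OF f g h])
    show "(\<lambda>n. L2_norm \<Omega> (\<lambda>x. f x - g n x) * L2_norm \<Omega> h) \<longlonglongrightarrow> 0"
      using tendsto_mult_right[OF lim] by simp
  qed
  from tendsto_diff[OF tendsto_const[of "L2_inner \<Omega> f h"] this] show ?thesis by simp
qed

section \<open>Orthonormal bases: Parseval, uniqueness of coefficients, Riesz-Fischer\<close>

locale L2_basis =
  fixes \<Omega> :: "'a::euclidean_space set" and \<phi> :: "nat \<Rightarrow> 'a \<Rightarrow> real"
  assumes \<Omega>_borel [measurable]: "\<Omega> \<in> sets borel"
    and \<phi>_L2: "\<And>k. \<phi> k \<in> L2 \<Omega>"
    and orthonormal: "\<And>j k. L2_inner \<Omega> (\<phi> j) (\<phi> k) = (if j = k then 1 else 0)"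
    and expansion: "\<And>f. f \<in> L2 \<Omega> \<Longrightarrow> L2_sums \<Omega> (\<lambda>k x. L2_inner \<Omega> f (\<phi> k) * \<phi> k x) f"
begin

definition coef :: "('a \<Rightarrow> real) \<Rightarrow> nat \<Rightarrow> real" where
  "coef f k = L2_inner \<Omega> f (\<phi> k)"

lemma partial_sum_L2: "(\<lambda>x. \<Sum>k<n. a k * \<phi> k x) \<in> L2 \<Omega>"
  by (intro L2_sum L2_cmult \<phi>_L2)

lemma coef_partial_sum: "coef (\<lambda>x. \<Sum>k<n. a k * \<phi> k x) j = (if j < n then a j else 0)"
proof -
  have "coef (\<lambda>x. \<Sum>k<n. a k * \<phi> k x) j = (\<Sum>k<n. a k * (if k = j then 1 else 0))"
    unfolding coef_def by (simp add: L2_inner_sum L2_cmult \<phi>_L2 L2_inner_cmult orthonormal)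
  then show ?thesis by (simp add: if_distrib[of "(*) _"] cong: if_cong)
qed

lemma L2_norm_diff_partial_sum:
  assumes f: "f \<in> L2 \<Omega>"
  shows "(L2_norm \<Omega> (\<lambda>x. f x - (\<Sum>k<n. coef f k * \<phi> k x)))\<^sup>2 = L2_inner \<Omega> f f - (\<Sum>k<n. (coef f k)\<^sup>2)"
proof -
  let ?s = "\<lambda>x. \<Sum>k<n. coef f k * \<phi> k x"
  have s: "?s \<in> L2 \<Omega>" by (rule partial_sum_L2)
  have inner_s: "L2_inner \<Omega> ?s h = (\<Sum>k<n. coef f k * coef h k)" if h: "h \<in> L2 \<Omega>" for h
  proof -
    have "L2_inner \<Omega> (\<phi> k) h = coef h k" for k unfolding coef_def by (rule L2_inner_commute)
    then show ?thesis using h by (simp add: L2_inner_sum L2_cmult \<phi>_L2 L2_inner_cmult)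
  qed
  have "(L2_norm \<Omega> (\<lambda>x. f x - ?s x))\<^sup>2 = L2_inner \<Omega> (\<lambda>x. f x - ?s x) (\<lambda>x. f x - ?s x)"
    by (rule L2_norm_square)
  also have "\<dots> = L2_inner \<Omega> f (\<lambda>x. f x - ?s x) - L2_inner \<Omega> ?s (\<lambda>x. f x - ?s x)"
    by (rule L2_inner_diff[OF f s L2_diff[OF f s]])
  also have "\<dots> = (L2_inner \<Omega> f f - L2_inner \<Omega> ?s f) - (L2_inner \<Omega> f ?s - L2_inner \<Omega> ?s ?s)"
    by (simp add: L2_inner_commute[of _ f "\<lambda>x. f x - ?s x"] L2_inner_commute[of _ ?s "\<lambda>x. f x - ?s x"] L2_inner_diff f s)
  also have "\<dots> = L2_inner \<Omega> f f - (\<Sum>k<n. (coef f k)\<^sup>2)"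
    unfolding L2_inner_commute[of _ f ?s] inner_s[OF f] inner_s[OF s]
    by (simp add: coef_partial_sum power2_eq_square)
  finally show ?thesis .
qed

lemma parseval: "f \<in> L2 \<Omega> \<Longrightarrow> (\<lambda>k. (coef f k)\<^sup>2) sums L2_inner \<Omega> f f"
proof -
  assume f: "f \<in> L2 \<Omega>"
  have "(\<lambda>n. L2_norm \<Omega> (\<lambda>x. f x - (\<Sum>k<n. coef f k * \<phi> k x))) \<longlonglongrightarrow> 0"
    using expansion[OF f] by (simp add: L2_sums_def coef_def)
  from tendsto_power[OF this, of 2]
  have "(\<lambda>n. L2_inner \<Omega> f f - (\<Sum>k<n. (coef f k)\<^sup>2)) \<longlonglongrightarrow> 0"
    by (simp add: L2_norm_diff_partial_sum[OF f])
  from tendsto_diff[OF tendsto_const[of "L2_inner \<Omega> f f"] this]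
  show ?thesis by (simp add: sums_def)
qed

lemma summable_coef: "f \<in> L2 \<Omega> \<Longrightarrow> summable (\<lambda>k. (coef f k)\<^sup>2)"
  using parseval sums_summable by blast

lemma coef_lincomb: "f \<in> L2 \<Omega> \<Longrightarrow> g \<in> L2 \<Omega> \<Longrightarrow> coef (\<lambda>x. a * f x + b * g x) k = a * coef f k + b * coef g k"
  by (simp add: coef_def L2_inner_lincomb \<phi>_L2)

lemma coef_diff: "f \<in> L2 \<Omega> \<Longrightarrow> g \<in> L2 \<Omega> \<Longrightarrow> coef (\<lambda>x. f x - g x) k = coef f k - coef g k"
  by (simp add: coef_def L2_inner_diff \<phi>_L2)

lemma parseval_inner:
  assumes f: "f \<in> L2 \<Omega>" and g: "g \<in> L2 \<Omega>"
  shows "(\<lambda>k. coef f k * coef g k) sums L2_inner \<Omega> f g"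
proof -
  \<comment> \<open>Polarisation: the bilinear identity is a quarter of the difference of the
    quadratic ones for f + g and f - g.\<close>
  let ?p = "\<lambda>x. 1 * f x + 1 * g x" and ?m = "\<lambda>x. 1 * f x + (-1) * g x"
  have p: "?p \<in> L2 \<Omega>" and m: "?m \<in> L2 \<Omega>" by (intro L2_lincomb f g)+
  have "(\<lambda>k. ((coef ?p k)\<^sup>2 - (coef ?m k)\<^sup>2) / 4) sums ((L2_inner \<Omega> ?p ?p - L2_inner \<Omega> ?m ?m) / 4)"
    by (intro sums_divide sums_diff parseval p m)
  moreover have "((coef ?p k)\<^sup>2 - (coef ?m k)\<^sup>2) / 4 = coef f k * coef g k" for k
    unfolding coef_lincomb[OF f g] by (simp add: power2_eq_square field_simps)
  moreover have "(L2_inner \<Omega> ?p ?p - L2_inner \<Omega> ?m ?m) / 4 = L2_inner \<Omega> f g"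
  proof -
    have "L2_inner \<Omega> ?p ?p = (L2_inner \<Omega> f f + L2_inner \<Omega> g f) + (L2_inner \<Omega> f g + L2_inner \<Omega> g g)"
      unfolding L2_inner_lincomb[OF f g p] L2_inner_commute[of _ f ?p] L2_inner_commute[of _ g ?p]
        L2_inner_lincomb[OF f g f] L2_inner_lincomb[OF f g g] by simp
    moreover have "L2_inner \<Omega> ?m ?m = (L2_inner \<Omega> f f - L2_inner \<Omega> g f) - (L2_inner \<Omega> f g - L2_inner \<Omega> g g)"
      unfolding L2_inner_lincomb[OF f g m] L2_inner_commute[of _ f ?m] L2_inner_commute[of _ g ?m]
        L2_inner_lincomb[OF f g f] L2_inner_lincomb[OF f g g] by simp
    ultimately show ?thesis using L2_inner_commute[of _ f g] by simp
  qed
  ultimately show ?thesis by simp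
qed

lemma coef_eq_imp_AE_eq:
  assumes f: "f \<in> L2 \<Omega>" and g: "g \<in> L2 \<Omega>" and eq: "\<And>k. coef f k = coef g k"
  shows "AE x in lborel. x \<in> \<Omega> \<longrightarrow> f x = g x"
proof -
  have d: "(\<lambda>x. f x - g x) \<in> L2 \<Omega>" by (rule L2_diff[OF f g])
  from parseval[OF d] have "L2_inner \<Omega> (\<lambda>x. f x - g x) (\<lambda>x. f x - g x) = 0"
    using sums_unique2[OF _ sums_zero] by (simp add: coef_diff f g eq)
  then have "L2_norm \<Omega> (\<lambda>x. f x - g x) = 0" by (simp add: L2_norm_def)
  then show ?thesis using L2_norm_eq_0_iff[OF d] by simp
qed

lemma L2_sums_coef:
  assumes "L2_sums \<Omega> (\<lambda>k x. a k * \<phi> k x) f"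
  shows "coef f k = a k"
proof -
  have f: "f \<in> L2 \<Omega>" and lim: "(\<lambda>n. L2_norm \<Omega> (\<lambda>x. f x - (\<Sum>k<n. a k * \<phi> k x))) \<longlonglongrightarrow> 0"
    using assms by (auto simp: L2_sums_def)
  have "(\<lambda>n. coef (\<lambda>x. \<Sum>k<n. a k * \<phi> k x) k) \<longlonglongrightarrow> coef f k"
    unfolding coef_def by (rule tendsto_L2_inner[OF partial_sum_L2 f \<phi>_L2 lim])
  moreover have "(\<lambda>n. coef (\<lambda>x. \<Sum>k<n. a k * \<phi> k x) k) \<longlonglongrightarrow> a k"
  proof (rule tendsto_eventually)
    show "eventually (\<lambda>n. coef (\<lambda>x. \<Sum>k<n. a k * \<phi> k x) k = a k) sequentially"
      using eventually_gt_at_top[of k] by eventually_elim (simp add: coef_partial_sum)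
  qed
  ultimately show ?thesis by (rule LIMSEQ_unique)
qed

text \<open>The limit vanishes almost everywhere outside \<open>\<Omega>\<close> because the partial
  sums do; restricting it makes this hold everywhere, as \<open>wave_solution\<close> demands of its
  representative.\<close>

lemma riesz_fischer:
  assumes a: "summable (\<lambda>k. (a k)\<^sup>2)"
  obtains f r where "f \<in> L2 \<Omega>" "\<And>x. x \<notin> \<Omega> \<Longrightarrow> f x = 0" "L2_sums \<Omega> (\<lambda>k x. a k * \<phi> k x) f"
    "strict_mono (r :: nat \<Rightarrow> nat)" "AE x in lborel. (\<lambda>n. \<Sum>k<r n. a k * restr \<Omega> (\<phi> k) x) \<longlonglongrightarrow> f x"
proof -
  let ?e = "\<lambda>k x. a k * restr \<Omega> (\<phi> k) x"
  have e: "?e k \<in> sq_int lborel" for k using \<phi>_L2 by (intro sq_int_cmult) (simp add: L2_iff_restr[symmetric])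
  have ip: "(\<integral>x. ?e j x * ?e k x \<partial>lborel) = a j * a k * (if j = k then 1 else 0)" for j k
    unfolding orthonormal[symmetric] L2_inner_restr
    by (simp add: mult_ac flip: Bochner_Integration.integral_mult_right_zero)
  have "summable (\<lambda>k. \<integral>x. (?e k x)\<^sup>2 \<partial>lborel)"
    using a ip[of k k for k] by (simp add: power2_eq_square)
  from orthogonal_series_complete[OF e _ this] ip
  obtain g r where g: "g \<in> sq_int lborel" "(\<lambda>n. sq_norm lborel (\<lambda>x. g x - (\<Sum>k<n. ?e k x))) \<longlonglongrightarrow> 0"
    and r: "strict_mono (r :: nat \<Rightarrow> nat)" "AE x in lborel. (\<lambda>n. \<Sum>k<r n. ?e k x) \<longlonglongrightarrow> g x"
    by auto
  have ge: "AE x in lborel. g x = restr \<Omega> g x"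
    using r(2)
  proof eventually_elim
    fix x assume lim: "(\<lambda>n. \<Sum>k<r n. ?e k x) \<longlonglongrightarrow> g x"
    show "g x = restr \<Omega> g x"
    proof (cases "x \<in> \<Omega>")
      case False
      then have "(\<lambda>n. 0) \<longlonglongrightarrow> g x" using lim by simp
      then show ?thesis using False by (simp add: LIMSEQ_const_iff)
    qed simp
  qed
  have [measurable]: "g \<in> borel_measurable borel" using g(1) by (simp add: sq_int_def)
  have "restr \<Omega> g \<in> borel_measurable borel" unfolding restr_def[abs_def] by measurable
  moreover have "integrable lborel (\<lambda>x. (restr \<Omega> g x)\<^sup>2)"
  proof (rule Bochner_Integration.integrable_bound[OF sq_intD(2)[OF g(1)]])
    show "(\<lambda>x. (restr \<Omega> g x)\<^sup>2) \<in> borel_measurable lborel" unfolding restr_def by measurable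
  qed (auto simp: restr_def split: split_indicator)
  ultimately have rg: "restr \<Omega> g \<in> sq_int lborel" by (simp add: sq_int_def)
  have norm_eq: "L2_norm \<Omega> (\<lambda>x. restr \<Omega> g x - (\<Sum>k<n. a k * \<phi> k x)) = sq_norm lborel (\<lambda>x. g x - (\<Sum>k<n. ?e k x))" for n
  proof -
    have "restr \<Omega> (\<lambda>x. a k * \<phi> k x) = ?e k" for k by (auto simp: restr_def fun_eq_iff)
    then have "restr \<Omega> (\<lambda>x. restr \<Omega> g x - (\<Sum>k<n. a k * \<phi> k x)) = (\<lambda>x. restr \<Omega> g x - (\<Sum>k<n. ?e k x))"
      by (simp add: restr_diff restr_sum)
    moreover have "sq_norm lborel (\<lambda>x. restr \<Omega> g x - (\<Sum>k<n. ?e k x)) = sq_norm lborel (\<lambda>x. g x - (\<Sum>k<n. ?e k x))"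
    proof -
      have es: "(\<lambda>x. \<Sum>k<n. ?e k x) \<in> sq_int lborel" by (rule sq_int_sum[OF e])
      show ?thesis unfolding sq_norm_def
      proof (rule arg_cong[where f=sqrt], rule integral_cong_AE)
        show "AE x in lborel. (restr \<Omega> g x - (\<Sum>k<n. ?e k x))\<^sup>2 = (g x - (\<Sum>k<n. ?e k x))\<^sup>2"
          using ge by eventually_elim simp
      qed (use sq_int_diff[OF rg es] sq_int_diff[OF g(1) es] in \<open>auto simp: sq_int_def\<close>)
    qed
    ultimately show ?thesis by (simp add: L2_norm_restr)
  qed
  show ?thesis
  proof (rule that[of "restr \<Omega> g" r])
    show fL: "restr \<Omega> g \<in> L2 \<Omega>" using rg by (simp add: L2_iff_restr)
    show "L2_sums \<Omega> (\<lambda>k x. a k * \<phi> k x) (restr \<Omega> g)"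
      using fL g(2) by (auto simp: L2_sums_def norm_eq intro: L2_cmult \<phi>_L2)
    show "AE x in lborel. (\<lambda>n. \<Sum>k<r n. a k * restr \<Omega> (\<phi> k) x) \<longlonglongrightarrow> restr \<Omega> g x"
      using r(2) ge by eventually_elim simp
  qed (use r(1) in auto)
qed

end

section \<open>The resolvent and its maximum principle\<close>

lemma frac_const_pos: "0 < s \<Longrightarrow> s < 1 \<Longrightarrow> 0 < frac_const N s"
  unfolding frac_const_def by (intro divide_pos_pos mult_pos_pos Gamma_real_pos) auto

lemma AE_pair_fst:
  assumes "AE x in (lborel :: 'a::euclidean_space measure). P x"
  shows "AE p in (lborel :: 'a measure) \<Otimes>\<^sub>M (lborel :: 'b::euclidean_space measure). P (fst p)"
proof -
  obtain N where N: "{x. \<not> P x} \<subseteq> N" "N \<in> null_sets (lborel :: 'a measure)"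
    using assms by (auto elim: AE_E simp: null_sets_def)
  have "N \<times> UNIV \<in> null_sets ((lborel :: 'a measure) \<Otimes>\<^sub>M (lborel :: 'b measure))"
    using N(2) lborel.emeasure_pair_measure_Times[of N "lborel :: 'a measure" "UNIV :: 'b set"]
    by (auto simp: null_sets_def)
  then show ?thesis by (rule AE_I') (use N(1) in auto)
qed

lemma AE_pair_snd:
  assumes "AE x in (lborel :: 'b::euclidean_space measure). P x"
  shows "AE p in (lborel :: 'a::euclidean_space measure) \<Otimes>\<^sub>M (lborel :: 'b measure). P (snd p)"
proof -
  obtain N where N: "{x. \<not> P x} \<subseteq> N" "N \<in> null_sets (lborel :: 'b measure)"
    using assms by (auto elim: AE_E simp: null_sets_def)
  have "UNIV \<times> N \<in> null_sets ((lborel :: 'a measure) \<Otimes>\<^sub>M (lborel :: 'b measure))"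
    using N(2) lborel.emeasure_pair_measure_Times[of UNIV "lborel :: 'a measure" N]
    by (auto simp: null_sets_def)
  then show ?thesis by (rule AE_I') (use N(1) in auto)
qed

text \<open>The Gagliardo difference quotient: it turns the energy form into an L2 inner product on
  the product space, to which the orthogonal series lemmas apply.\<close>

definition sqrt_energy :: "real \<Rightarrow> ('a::euclidean_space \<Rightarrow> real) \<Rightarrow> 'a \<times> 'a \<Rightarrow> real" where
  "sqrt_energy s u = (\<lambda>(x, y). (u x - u y) * sqrt (frac_kernel s (y - x)))"

lemma energy_integrand_sqrt_energy:
  "energy_integrand s u v p = sqrt_energy s u p * sqrt_energy s v p"
proof -
  obtain x y where p: "p = (x, y)" by fastforce
  have "frac_kernel s (y - x) = sqrt (frac_kernel s (y - x)) * sqrt (frac_kernel s (y - x))"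
    by simp
  then show ?thesis unfolding p energy_integrand_frac_kernel sqrt_energy_def
    by (simp only: prod.case mult_ac)
qed

lemma energy_sqrt_energy:
  "energy s u v = (\<integral>p. sqrt_energy s u p * sqrt_energy s v p \<partial>(lborel \<Otimes>\<^sub>M lborel))"
  unfolding energy_def by (intro Bochner_Integration.integral_cong refl energy_integrand_sqrt_energy)

lemma measurable_sqrt_energy [measurable]:
  assumes [measurable]: "u \<in> borel_measurable borel"
  shows "sqrt_energy s u \<in> borel_measurable (borel \<Otimes>\<^sub>M (borel :: 'a::euclidean_space measure))"
  unfolding sqrt_energy_def by measurable

lemma Htilde_measurable: "u \<in> Htilde s \<Omega> \<Longrightarrow> u \<in> borel_measurable borel"
  by (simp add: Htilde_def L2_def set_borel_measurable_def)

lemma Htilde_sqrt_energy: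
  assumes "u \<in> Htilde s \<Omega>"
  shows "sqrt_energy s u \<in> sq_int (lborel \<Otimes>\<^sub>M lborel)"
proof -
  have "(\<lambda>p. (sqrt_energy s u p)\<^sup>2) = energy_integrand s u u"
    by (auto simp: fun_eq_iff energy_integrand_sqrt_energy power2_eq_square)
  then show ?thesis using assms Htilde_measurable[OF assms]
    by (simp add: sq_int_def Htilde_def measurable_lborel1)
qed

lemma L2_UNIV_iff: "u \<in> L2 UNIV \<longleftrightarrow> u \<in> sq_int lborel"
proof -
  have "restr UNIV u = u" by (auto simp: restr_def)
  then show ?thesis by (simp add: L2_iff_restr)
qed

lemma L2_mono:
  assumes "u \<in> L2 UNIV" and [measurable]: "\<Omega> \<in> sets borel"
  shows "u \<in> L2 \<Omega>"
  unfolding L2_iff_restr sq_int_def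
proof safe
  have u: "u \<in> sq_int lborel" using assms by (simp add: L2_UNIV_iff)
  then have [measurable]: "u \<in> borel_measurable borel" by (simp add: sq_int_def)
  show m: "restr \<Omega> u \<in> borel_measurable lborel" unfolding restr_def[abs_def] by measurable
  show "integrable lborel (\<lambda>x. (restr \<Omega> u x)\<^sup>2)"
  proof (rule Bochner_Integration.integrable_bound[OF sq_intD(2)[OF u]])
    show "(\<lambda>x. (restr \<Omega> u x)\<^sup>2) \<in> borel_measurable lborel" using m by measurable
  qed (auto simp: restr_def split: split_indicator)
qed

locale frac_dirichlet = frac_order s for s :: real +
  fixes \<Omega> :: "'a::euclidean_space set" and \<phi> :: "nat \<Rightarrow> 'a \<Rightarrow> real" and \<mu> :: "nat \<Rightarrow> real"
  assumes \<Omega>_open: "open \<Omega>" and \<Omega>_bounded: "bounded \<Omega>" and basis: "frac_eigenbasis s \<Omega> \<phi> \<mu>"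
begin

lemma \<phi>_Htilde: "\<phi> k \<in> Htilde s \<Omega>"
  using basis by (simp add: frac_eigenbasis_def)

lemma Htilde_L2: "u \<in> Htilde s \<Omega> \<Longrightarrow> u \<in> L2 \<Omega>"
  using \<Omega>_open by (auto simp: Htilde_def intro: L2_mono)

sublocale L2_basis \<Omega> \<phi>
proof
  show "\<phi> k \<in> L2 \<Omega>" for k by (rule Htilde_L2[OF \<phi>_Htilde])
  show "L2_inner \<Omega> (\<phi> j) (\<phi> k) = (if j = k then 1 else 0)" for j k
    using basis by (simp add: frac_eigenbasis_def)
  show "f \<in> L2 \<Omega> \<Longrightarrow> L2_sums \<Omega> (\<lambda>k x. L2_inner \<Omega> f (\<phi> k) * \<phi> k x) f" for f
    using basis by (simp add: frac_eigenbasis_def)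
qed (use \<Omega>_open in simp)

definition fc :: real where "fc = frac_const DIM('a) s"

lemma fc_pos: "fc > 0" unfolding fc_def by (rule frac_const_pos[OF s_pos s_less])

lemma eigen: "v \<in> Htilde s \<Omega> \<Longrightarrow> fc / 2 * energy s (\<phi> k) v = \<mu> k * coef v k"
  using basis by (simp add: frac_eigenbasis_def fc_def coef_def L2_inner_commute)

lemma energy_\<phi>: "energy s (\<phi> j) (\<phi> k) = (if j = k then 2 * \<mu> k / fc else 0)"
  using eigen[OF \<phi>_Htilde, of j k] fc_pos by (auto simp: coef_def orthonormal field_simps split: if_splits)

text \<open>Zero energy makes \<open>\<phi> k x = \<phi> k y\<close> for almost all pairs. Comparing
  with points y in the nonempty open complement of the closure of the bounded set
  \<open>\<Omega>\<close>, where \<open>\<phi> k\<close> vanishes, gives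
  \<open>\<phi> k = 0\<close>, against normalisation.\<close>

lemma \<mu>_pos: "0 < \<mu> k"
proof -
  have e: "energy s (\<phi> k) (\<phi> k) = 2 * \<mu> k / fc" by (simp add: energy_\<phi>)
  have nonneg: "0 \<le> energy_integrand s (\<phi> k) (\<phi> k) p" for p
    by (simp add: energy_integrand_sqrt_energy)
  then have "0 \<le> energy s (\<phi> k) (\<phi> k)" unfolding energy_def by (simp add: integral_nonneg_AE)
  then have "0 \<le> \<mu> k" using fc_pos unfolding e by (simp add: zero_le_divide_iff)
  moreover have "\<mu> k \<noteq> 0"
  proof
    assume "\<mu> k = 0"
    then have "(\<integral>p. energy_integrand s (\<phi> k) (\<phi> k) p \<partial>(lborel \<Otimes>\<^sub>M lborel)) = 0"
      using e by (simp add: energy_def)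
    moreover have "integrable (lborel \<Otimes>\<^sub>M lborel) (energy_integrand s (\<phi> k) (\<phi> k))"
      using \<phi>_Htilde by (simp add: Htilde_def)
    ultimately have "AE p in lborel \<Otimes>\<^sub>M lborel. energy_integrand s (\<phi> k) (\<phi> k) p = 0"
      using nonneg by (subst (asm) integral_nonneg_eq_0_iff_AE) auto
    then have "AE x in lborel. AE y in lborel. energy_integrand s (\<phi> k) (\<phi> k) (x, y) = 0"
      by (rule lborel_pair.AE_pair)
    then have "AE x in lborel. x \<in> \<Omega> \<longrightarrow> \<phi> k x = 0"
    proof eventually_elim
      fix x assume x: "AE y in lborel. energy_integrand s (\<phi> k) (\<phi> k) (x, y) = 0"
      have "AE y in lborel. y \<notin> \<Omega> \<longrightarrow> \<phi> k y = 0" using \<phi>_Htilde by (simp add: Htilde_def)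
      with x AE_lborel_singleton[of x]
      have "AE y in lborel. y \<in> - closure \<Omega> \<longrightarrow> \<phi> k x = 0"
      proof eventually_elim
        case (elim y)
        show ?case
        proof
          assume y: "y \<in> - closure \<Omega>"
          then have "y \<notin> \<Omega>" using closure_subset by auto
          moreover have "\<phi> k x = \<phi> k y"
            using elim frac_kernel_pos[of "y - x" s] by (simp add: energy_integrand_frac_kernel)
          ultimately show "\<phi> k x = 0" using elim by simp
        qed
      qed
      moreover have "- closure \<Omega> \<noteq> {}"
      proof
        assume "- closure \<Omega> = {}"
        then have "closure \<Omega> = UNIV" by auto
        then show False using bounded_closure[OF \<Omega>_bounded] not_bounded_UNIV by simp
      qed
      ultimately show "x \<in> \<Omega> \<longrightarrow> \<phi> k x = 0"
        using AE_lborel_open_ex[of "- closure \<Omega>" "\<lambda>_. \<phi> k x = 0"] by auto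
    qed
    then have "L2_norm \<Omega> (\<phi> k) = 0" using L2_norm_eq_0_iff[OF \<phi>_L2] by simp
    then have "L2_inner \<Omega> (\<phi> k) (\<phi> k) = 0" using L2_norm_square[of \<Omega> "\<phi> k"] by simp
    then show False by (simp add: orthonormal)
  qed
  ultimately show ?thesis by simp
qed

text \<open>The equation (l^2 + (-\<Delta>)^s) W = f in coefficients, the form in which the Laplace
  transform delivers it. It is a relation because W is determined only up to null sets.\<close>

definition resolvent :: "real \<Rightarrow> ('a \<Rightarrow> real) \<Rightarrow> ('a \<Rightarrow> real) \<Rightarrow> bool" where
  "resolvent l f W \<longleftrightarrow> W \<in> L2 \<Omega> \<and> (\<forall>k. coef W k = coef f k / (l\<^sup>2 + \<mu> k))"

lemma resolvent_unique:
  "resolvent l f W \<Longrightarrow> resolvent l f V \<Longrightarrow> AE x in lborel. x \<in> \<Omega> \<longrightarrow> W x = V x"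
  unfolding resolvent_def by (intro coef_eq_imp_AE_eq) auto

lemma resolvent_lincomb:
  assumes "f \<in> L2 \<Omega>" "g \<in> L2 \<Omega>" "resolvent l f V" "resolvent l g W"
  shows "resolvent l (\<lambda>x. a * f x + b * g x) (\<lambda>x. a * V x + b * W x)"
  using assms unfolding resolvent_def
  by (auto intro!: L2_lincomb simp: coef_lincomb add_divide_distrib)

text \<open>The eigenfunction series is summed twice, in L2 to W and, through
  \<open>sqrt_energy\<close>, in L2 of the product space to G. Almost everywhere convergence along a
  common subsequence shows that G is the difference quotient of W, so W has finite energy and the
  weak equation passes to the limit.\<close>

lemma resolvent_exists:
  assumes l: "l > 0" and f: "f \<in> L2 \<Omega>"
  obtains W where "resolvent l f W" "W \<in> Htilde s \<Omega>" "\<And>x. x \<notin> \<Omega> \<Longrightarrow> W x = 0"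
    "\<And>v. v \<in> Htilde s \<Omega> \<Longrightarrow> fc / 2 * energy s W v + l\<^sup>2 * L2_inner \<Omega> W v = L2_inner \<Omega> f v"
proof -
  define a where "a k = coef f k / (l\<^sup>2 + \<mu> k)" for k
  let ?MM = "lborel \<Otimes>\<^sub>M lborel :: ('a \<times> 'a) measure"
  have den: "l\<^sup>2 + \<mu> k > 0" for k using \<mu>_pos[of k] by (simp add: add_nonneg_pos)
  have l2: "l\<^sup>2 > 0" using l by simp
  \<comment> \<open>The first bound makes the energies of the terms summable, the second their L2
    norms.\<close>
  have a_sq: "(a k)\<^sup>2 * \<mu> k \<le> (coef f k)\<^sup>2 / l\<^sup>2" "(a k)\<^sup>2 \<le> (coef f k)\<^sup>2 / (l\<^sup>2)\<^sup>2" for k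
  proof -
    have "(l\<^sup>2 + \<mu> k)\<^sup>2 = l\<^sup>2 * \<mu> k + ((l\<^sup>2)\<^sup>2 + l\<^sup>2 * \<mu> k + (\<mu> k)\<^sup>2)"
      by (simp add: power2_eq_square algebra_simps)
    moreover have "0 \<le> (l\<^sup>2)\<^sup>2 + l\<^sup>2 * \<mu> k + (\<mu> k)\<^sup>2"
      using \<mu>_pos[of k] by (intro add_nonneg_nonneg mult_nonneg_nonneg) auto
    ultimately have "l\<^sup>2 * \<mu> k \<le> (l\<^sup>2 + \<mu> k)\<^sup>2" by linarith
    then have "(coef f k)\<^sup>2 * (l\<^sup>2 * \<mu> k) \<le> (coef f k)\<^sup>2 * (l\<^sup>2 + \<mu> k)\<^sup>2" by (rule mult_left_mono) simp
    then show "(a k)\<^sup>2 * \<mu> k \<le> (coef f k)\<^sup>2 / l\<^sup>2"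
      unfolding a_def power_divide using den[of k] l2 by (simp add: divide_simps mult_ac)
    show "(a k)\<^sup>2 \<le> (coef f k)\<^sup>2 / (l\<^sup>2)\<^sup>2"
      unfolding a_def power_divide
    proof (rule divide_left_mono)
      show "(l\<^sup>2)\<^sup>2 \<le> (l\<^sup>2 + \<mu> k)\<^sup>2" using \<mu>_pos[of k] by (intro power_mono) auto
      show "0 < (l\<^sup>2 + \<mu> k)\<^sup>2 * (l\<^sup>2)\<^sup>2" by (rule mult_pos_pos[OF zero_less_power[OF den] zero_less_power[OF l2]])
    qed simp
  qed
  have sum_a: "summable (\<lambda>k. (a k)\<^sup>2)"
    by (rule summable_comparison_test'[OF summable_divide[OF summable_coef[OF f], of "(l\<^sup>2)\<^sup>2"]]) (use a_sq in simp)
  obtain W r where W: "W \<in> L2 \<Omega>" "\<And>x. x \<notin> \<Omega> \<Longrightarrow> W x = 0" "L2_sums \<Omega> (\<lambda>k x. a k * \<phi> k x) W"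
    and r: "strict_mono (r :: nat \<Rightarrow> nat)" "AE x in lborel. (\<lambda>n. \<Sum>k<r n. a k * restr \<Omega> (\<phi> k) x) \<longlonglongrightarrow> W x"
    using riesz_fischer[OF sum_a] by blast
  have rW: "restr \<Omega> W = W" using W(2) by (auto simp: restr_def fun_eq_iff split: split_indicator)
  have W_sq: "W \<in> sq_int lborel" using W(1) by (simp add: L2_iff_restr rW)
  then have [measurable]: "W \<in> borel_measurable borel" by (simp add: sq_int_def)
  have coefW: "coef W k = a k" for k by (rule L2_sums_coef[OF W(3)])
  let ?U = "\<lambda>k p. a k * sqrt_energy s (\<phi> k) p"
  have U: "?U k \<in> sq_int ?MM" for k by (intro sq_int_cmult Htilde_sqrt_energy[OF \<phi>_Htilde])
  have UU: "(\<integral>p. ?U j p * ?U k p \<partial>?MM) = (if j = k then (a k)\<^sup>2 * (2 * \<mu> k / fc) else 0)" for j k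
  proof -
    have "(\<integral>p. ?U j p * ?U k p \<partial>?MM) = (\<integral>p. (a j * a k) * energy_integrand s (\<phi> j) (\<phi> k) p \<partial>?MM)"
      by (simp add: energy_integrand_sqrt_energy mult_ac)
    also have "\<dots> = a j * a k * energy s (\<phi> j) (\<phi> k)" unfolding energy_def by simp
    finally show ?thesis by (simp add: energy_\<phi> power2_eq_square)
  qed
  have orth: "(\<integral>p. ?U j p * ?U k p \<partial>?MM) = 0" if "j \<noteq> k" for j k using UU[of j k] that by simp
  have sumU: "summable (\<lambda>k. \<integral>p. (?U k p)\<^sup>2 \<partial>?MM)"
  proof (rule summable_comparison_test')
    show "summable (\<lambda>k. 2 / fc * ((coef f k)\<^sup>2 / l\<^sup>2))"
      by (intro summable_mult summable_divide summable_coef f)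
    fix k assume "(0::nat) \<le> k"
    have "(\<integral>p. (?U k p)\<^sup>2 \<partial>?MM) = 2 / fc * ((a k)\<^sup>2 * \<mu> k)" using UU[of k k] by (simp add: power2_eq_square)
    also have "\<dots> \<le> 2 / fc * ((coef f k)\<^sup>2 / l\<^sup>2)" using fc_pos by (intro mult_left_mono a_sq) auto
    finally show "norm (\<integral>p. (?U k p)\<^sup>2 \<partial>?MM) \<le> 2 / fc * ((coef f k)\<^sup>2 / l\<^sup>2)" by simp
  qed
  obtain G where G: "G \<in> sq_int ?MM" "(\<lambda>n. sq_norm ?MM (\<lambda>p. G p - (\<Sum>k<n. ?U k p))) \<longlonglongrightarrow> 0"
    by (rule orthogonal_series_complete[of ?U ?MM, OF U orth sumU]) blast+
  have S: "(\<lambda>p. \<Sum>k<n. ?U k p) \<in> sq_int ?MM" for n by (rule sq_int_sum[OF U])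
  have D: "(\<lambda>p. G p - (\<Sum>k<n. ?U k p)) \<in> sq_int ?MM" for n by (rule sq_int_diff[OF G(1) S])
  \<comment> \<open>The new subsequence is extracted from r, so along \<open>r (q n)\<close> both
    series converge almost everywhere.\<close>
  have "\<exists>q::nat\<Rightarrow>nat. strict_mono q \<and> (AE p in ?MM. (\<lambda>n. (G p - (\<Sum>k<r (q n). ?U k p))\<^sup>2) \<longlonglongrightarrow> 0)"
  proof (rule tendsto_L1_AE_subseq[of ?MM "\<lambda>n p. (G p - (\<Sum>k<r n. ?U k p))\<^sup>2"])
    show "integrable ?MM (\<lambda>p. (G p - (\<Sum>k<r n. ?U k p))\<^sup>2)" for n using sq_intD(2)[OF D] .
    have "(\<lambda>n. (sq_norm ?MM (\<lambda>p. G p - (\<Sum>k<r n. ?U k p)))\<^sup>2) \<longlonglongrightarrow> 0\<^sup>2"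
      by (intro tendsto_power LIMSEQ_subseq_LIMSEQ[OF G(2) r(1), unfolded o_def])
    then show "(\<lambda>n. \<integral>p. norm ((G p - (\<Sum>k<r n. ?U k p))\<^sup>2) \<partial>?MM) \<longlonglongrightarrow> 0"
      by (simp add: sq_norm_square)
  qed
  then obtain q :: "nat \<Rightarrow> nat" where q: "strict_mono q" "AE p in ?MM. (\<lambda>n. (G p - (\<Sum>k<r (q n). ?U k p))\<^sup>2) \<longlonglongrightarrow> 0"
    by blast
  have ae_\<phi>: "AE x in lborel. \<forall>k. restr \<Omega> (\<phi> k) x = \<phi> k x"
    unfolding AE_all_countable
  proof
    fix k
    have "AE x in lborel. x \<notin> \<Omega> \<longrightarrow> \<phi> k x = 0" using \<phi>_Htilde by (simp add: Htilde_def)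
    then show "AE x in lborel. restr \<Omega> (\<phi> k) x = \<phi> k x"
      by eventually_elim (auto simp: restr_def split: split_indicator)
  qed
  have lim: "AE x in lborel. (\<lambda>n. \<Sum>k<r n. a k * \<phi> k x) \<longlonglongrightarrow> W x"
    using r(2) ae_\<phi> by eventually_elim simp
  have GW: "AE p in ?MM. G p = sqrt_energy s W p"
    using q(2) AE_pair_fst[OF lim] AE_pair_snd[OF lim]
  proof eventually_elim
    fix p assume 1: "(\<lambda>n. (G p - (\<Sum>k<r (q n). ?U k p))\<^sup>2) \<longlonglongrightarrow> 0"
      and 2: "(\<lambda>n. \<Sum>k<r n. a k * \<phi> k (fst p)) \<longlonglongrightarrow> W (fst p)"
      and 3: "(\<lambda>n. \<Sum>k<r n. a k * \<phi> k (snd p)) \<longlonglongrightarrow> W (snd p)"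
    obtain x y where p: "p = (x, y)" by fastforce
    have "(\<lambda>n. \<bar>G p - (\<Sum>k<r (q n). ?U k p)\<bar>) \<longlonglongrightarrow> 0"
      using tendsto_real_sqrt[OF 1] by simp
    then have "(\<lambda>n. G p - (\<Sum>k<r (q n). ?U k p)) \<longlonglongrightarrow> 0" by (rule tendsto_rabs_zero_cancel)
    from tendsto_diff[OF tendsto_const[of "G p"] this]
    have "(\<lambda>n. \<Sum>k<r (q n). ?U k p) \<longlonglongrightarrow> G p" by simp
    moreover have "(\<lambda>n. ((\<Sum>k<r (q n). a k * \<phi> k x) - (\<Sum>k<r (q n). a k * \<phi> k y)) * sqrt (frac_kernel s (y - x)))
        \<longlonglongrightarrow> (W x - W y) * sqrt (frac_kernel s (y - x))"
      using LIMSEQ_subseq_LIMSEQ[OF 2 q(1)] LIMSEQ_subseq_LIMSEQ[OF 3 q(1)]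
      unfolding p o_def by (intro tendsto_mult tendsto_diff tendsto_const) auto
    moreover have "(\<Sum>k<m. ?U k p) = ((\<Sum>k<m. a k * \<phi> k x) - (\<Sum>k<m. a k * \<phi> k y)) * sqrt (frac_kernel s (y - x))" for m
      unfolding p sqrt_energy_def prod.case sum_subtractf[symmetric] sum_distrib_right
      by (intro sum.cong refl) (simp add: algebra_simps)
    ultimately show "G p = sqrt_energy s W p"
      unfolding p sqrt_energy_def using LIMSEQ_unique by fastforce
  qed
  have W_energy: "sqrt_energy s W \<in> sq_int ?MM"
  proof -
    have "integrable ?MM (\<lambda>p. (sqrt_energy s W p)\<^sup>2)"
      by (rule integrable_cong_AE_imp[OF sq_intD(2)[OF G(1)]]) (use GW in \<open>auto simp: measurable_lborel1\<close>)
    then show ?thesis by (simp add: sq_int_def measurable_lborel1)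
  qed
  have "(\<lambda>p. (sqrt_energy s W p)\<^sup>2) = energy_integrand s W W"
    by (auto simp: fun_eq_iff energy_integrand_sqrt_energy power2_eq_square)
  then have WH: "W \<in> Htilde s \<Omega>"
    using W_energy W_sq W(2) by (simp add: Htilde_def L2_UNIV_iff sq_int_def)
  have weak: "fc / 2 * energy s W v + l\<^sup>2 * L2_inner \<Omega> W v = L2_inner \<Omega> f v" if v: "v \<in> Htilde s \<Omega>" for v
  proof -
    have vL: "v \<in> L2 \<Omega>" by (rule Htilde_L2[OF v])
    let ?V = "sqrt_energy s v"
    have V: "?V \<in> sq_int ?MM" by (rule Htilde_sqrt_energy[OF v])
    have "energy s W v = (\<integral>p. sqrt_energy s W p * ?V p \<partial>?MM)"
      by (rule energy_sqrt_energy)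
    also have "\<dots> = (\<integral>p. G p * ?V p \<partial>?MM)"
    proof (rule integral_cong_AE)
      show "AE p in ?MM. sqrt_energy s W p * ?V p = G p * ?V p" using GW by eventually_elim simp
    qed (use W_energy V G(1) in \<open>auto simp: sq_int_def\<close>)
    finally have EW: "energy s W v = (\<integral>p. G p * ?V p \<partial>?MM)" .
    have part: "(\<integral>p. (\<Sum>k<n. ?U k p) * ?V p \<partial>?MM) = (\<Sum>k<n. a k * energy s (\<phi> k) v)" for n
    proof -
      have "(\<integral>p. (\<Sum>k<n. ?U k p) * ?V p \<partial>?MM) = (\<Sum>k<n. (\<integral>p. ?U k p * ?V p \<partial>?MM))"
        using integrable_sq_int_mult[OF U V] by (simp add: sum_distrib_right)
      then show ?thesis by (simp add: energy_sqrt_energy mult.assoc)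
    qed
    have "(\<lambda>n. (\<integral>p. G p * ?V p \<partial>?MM) - (\<integral>p. (\<Sum>k<n. ?U k p) * ?V p \<partial>?MM)) \<longlonglongrightarrow> 0"
    proof (rule Lim_null_comparison)
      have "(\<integral>p. G p * ?V p \<partial>?MM) - (\<integral>p. (\<Sum>k<n. ?U k p) * ?V p \<partial>?MM) = (\<integral>p. (G p - (\<Sum>k<n. ?U k p)) * ?V p \<partial>?MM)" for n
        using integrable_sq_int_mult[OF G(1) V] integrable_sq_int_mult[OF S V]
        unfolding left_diff_distrib by (rule Bochner_Integration.integral_diff[symmetric])
      then show "eventually (\<lambda>n. norm ((\<integral>p. G p * ?V p \<partial>?MM) - (\<integral>p. (\<Sum>k<n. ?U k p) * ?V p \<partial>?MM))
          \<le> sq_norm ?MM (\<lambda>p. G p - (\<Sum>k<n. ?U k p)) * sq_norm ?MM ?V) sequentially"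
        using cauchy_schwarz_sq_int[OF D V] by simp
      show "(\<lambda>n. sq_norm ?MM (\<lambda>p. G p - (\<Sum>k<n. ?U k p)) * sq_norm ?MM ?V) \<longlonglongrightarrow> 0"
        using tendsto_mult_right[OF G(2)] by simp
    qed
    from tendsto_diff[OF tendsto_const[of "energy s W v"] this]
    have "(\<lambda>n. \<Sum>k<n. a k * energy s (\<phi> k) v) \<longlonglongrightarrow> energy s W v"
      by (simp add: EW part)
    then have "(\<lambda>k. a k * energy s (\<phi> k) v) sums energy s W v" by (simp add: sums_def)
    from sums_mult[OF this, of "fc / 2"]
    have "(\<lambda>k. a k * (\<mu> k * coef v k)) sums (fc / 2 * energy s W v)"
      by (simp add: eigen[OF v, symmetric] mult_ac)
    moreover have "(\<lambda>k. l\<^sup>2 * (a k * coef v k)) sums (l\<^sup>2 * L2_inner \<Omega> W v)"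
      using parseval_inner[OF W(1) vL] by (intro sums_mult) (simp add: coefW)
    ultimately have "(\<lambda>k. a k * (\<mu> k * coef v k) + l\<^sup>2 * (a k * coef v k)) sums (fc / 2 * energy s W v + l\<^sup>2 * L2_inner \<Omega> W v)"
      by (rule sums_add)
    moreover have "a k * (\<mu> k * coef v k) + l\<^sup>2 * (a k * coef v k) = coef f k * coef v k" for k
    proof -
      have "a k * (l\<^sup>2 + \<mu> k) = coef f k" using den[of k] by (simp add: a_def)
      moreover have "a k * (\<mu> k * coef v k) + l\<^sup>2 * (a k * coef v k) = a k * (l\<^sup>2 + \<mu> k) * coef v k"
        by (simp add: algebra_simps)
      ultimately show ?thesis by simp
    qed
    ultimately show ?thesis using sums_unique2[OF _ parseval_inner[OF f vL]] by simp
  qed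
  show ?thesis
    by (rule that[OF _ WH W(2) weak]) (auto simp: resolvent_def W(1) coefW a_def)
qed

text \<open>Weak maximum principle: test the equation with the positive part of \<open>W - M / l\<^sup>2\<close>.\<close>

lemma resolvent_le:
  assumes l: "l > 0" and f: "f \<in> L2 \<Omega>" and fM: "\<And>x. x \<in> \<Omega> \<Longrightarrow> f x \<le> M" and M: "0 \<le> M"
    and V: "resolvent l f V"
  shows "AE x in lborel. x \<in> \<Omega> \<longrightarrow> V x \<le> M / l\<^sup>2"
proof -
  obtain W where W: "resolvent l f W" "W \<in> Htilde s \<Omega>" "\<And>x. x \<notin> \<Omega> \<Longrightarrow> W x = 0"
    "\<And>v. v \<in> Htilde s \<Omega> \<Longrightarrow> fc / 2 * energy s W v + l\<^sup>2 * L2_inner \<Omega> W v = L2_inner \<Omega> f v"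
    using resolvent_exists[OF l f] by blast
  have l2: "l\<^sup>2 > 0" using l by simp
  define K where "K = M / l\<^sup>2"
  have K: "K \<ge> 0" using M l2 by (simp add: K_def)
  define v where "v x = max 0 (W x - K)" for x
  have Wsq: "W \<in> sq_int lborel" using W(2) by (simp add: Htilde_def L2_UNIV_iff)
  have [measurable]: "W \<in> borel_measurable borel" by (rule Htilde_measurable[OF W(2)])
  have [measurable]: "v \<in> borel_measurable borel" unfolding v_def[abs_def] by measurable
  \<comment> \<open>A nonnegative truncation level keeps v below W in size and zero outside
    \<open>\<Omega>\<close>, so v is an admissible test function.\<close>
  have vW: "\<bar>v x\<bar> \<le> \<bar>W x\<bar>" for x using K by (auto simp: v_def)
  have v0: "v x = 0" if "x \<notin> \<Omega>" for x using W(3)[OF that] K by (simp add: v_def)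
  have v_sq: "v \<in> sq_int lborel"
  proof -
    have "integrable lborel (\<lambda>x. (v x)\<^sup>2)"
    proof (rule Bochner_Integration.integrable_bound[OF sq_intD(2)[OF Wsq]])
      show "AE x in lborel. norm ((v x)\<^sup>2) \<le> norm ((W x)\<^sup>2)"
        using vW by (intro AE_I2) (simp add: abs_le_square_iff)
    qed measurable
    then show ?thesis by (simp add: sq_int_def)
  qed
  have v_en: "integrable (lborel \<Otimes>\<^sub>M lborel) (energy_integrand s v v)"
  proof (rule Bochner_Integration.integrable_bound)
    show "integrable (lborel \<Otimes>\<^sub>M lborel) (energy_integrand s W W)" using W(2) by (simp add: Htilde_def)
    show "AE p in lborel \<Otimes>\<^sub>M lborel. norm (energy_integrand s v v p) \<le> norm (energy_integrand s W W p)"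
    proof (rule AE_I2)
      fix p :: "'a \<times> 'a"
      obtain x y where p: "p = (x, y)" by fastforce
      have "\<bar>v x - v y\<bar> \<le> \<bar>W x - W y\<bar>" by (auto simp: v_def)
      then have "(v x - v y) * (v x - v y) \<le> (W x - W y) * (W x - W y)"
        using abs_le_square_iff[of "v x - v y" "W x - W y"] by (simp add: power2_eq_square)
      then have "(v x - v y) * (v x - v y) * frac_kernel s (y - x) \<le> (W x - W y) * (W x - W y) * frac_kernel s (y - x)"
        by (rule mult_right_mono) simp
      then show "norm (energy_integrand s v v p) \<le> norm (energy_integrand s W W p)"
        unfolding p energy_integrand_frac_kernel by (simp add: abs_mult)
    qed
  qed (simp add: measurable_lborel1)
  have vH: "v \<in> Htilde s \<Omega>" using v_sq v_en v0 by (simp add: Htilde_def L2_UNIV_iff)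
  have vL: "v \<in> L2 \<Omega>" by (rule Htilde_L2[OF vH])
  have WL: "W \<in> L2 \<Omega>" using W(1) by (simp add: resolvent_def)
  have "0 \<le> energy s W v"
    unfolding energy_def
  proof (intro integral_nonneg_AE AE_I2)
    fix p :: "'a \<times> 'a"
    obtain x y where p: "p = (x, y)" by fastforce
    have "0 \<le> (W x - W y) * (v x - v y)"
      by (cases "W x \<le> W y") (auto simp: v_def intro!: mult_nonneg_nonneg mult_nonpos_nonpos)
    then show "0 \<le> energy_integrand s W v p"
      unfolding p energy_integrand_frac_kernel by (rule mult_nonneg_nonneg) simp
  qed
  then have "l\<^sup>2 * L2_inner \<Omega> W v \<le> L2_inner \<Omega> f v" using W(4)[OF vH] fc_pos by (smt (verit) divide_pos_pos mult_nonneg_nonneg)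
  then have le0: "L2_inner \<Omega> (\<lambda>x. l\<^sup>2 * W x + (-1) * f x) v \<le> 0"
    unfolding L2_inner_lincomb[OF WL f vL] by simp
  let ?h = "\<lambda>x. restr \<Omega> (\<lambda>x. l\<^sup>2 * W x + (-1) * f x) x * restr \<Omega> v x"
  have h_int: "integrable lborel ?h"
    using L2_lincomb[OF WL f, of "l\<^sup>2" "-1"] vL unfolding L2_iff_restr by (rule integrable_sq_int_mult)
  have pos: "0 < l\<^sup>2 * W x - f x" if "x \<in> \<Omega>" "v x > 0" for x
  proof -
    have "K < W x" using that(2) by (simp add: v_def)
    then have "l\<^sup>2 * K < l\<^sup>2 * W x" using l2 by simp
    then show ?thesis using fM[OF that(1)] l2 by (simp add: K_def)
  qed
  have h_nonneg: "0 \<le> ?h x" for x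
  proof (cases "x \<in> \<Omega> \<and> v x > 0")
    case True
    then show ?thesis using pos[of x] by (auto intro!: mult_nonneg_nonneg simp: v_def)
  next
    case False
    then have "restr \<Omega> v x = 0" by (auto simp: restr_def v_def split: split_indicator)
    then show ?thesis by simp
  qed
  have "0 \<le> (\<integral>x. ?h x \<partial>lborel)" by (intro integral_nonneg_AE AE_I2 h_nonneg)
  moreover have "(\<integral>x. ?h x \<partial>lborel) \<le> 0" using le0 unfolding L2_inner_restr .
  ultimately have "(\<integral>x. ?h x \<partial>lborel) = 0" by linarith
  then have "AE x in lborel. ?h x = 0"
    by (subst (asm) integral_nonneg_eq_0_iff_AE[OF h_int]) (use h_nonneg in blast)+
  moreover have "AE x in lborel. x \<in> \<Omega> \<longrightarrow> V x = W x" by (rule resolvent_unique[OF V W(1)])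
  ultimately show ?thesis
  proof eventually_elim
    case (elim x)
    show ?case
    proof
      assume x: "x \<in> \<Omega>"
      have "\<not> 0 < v x"
      proof
        assume v: "0 < v x"
        with elim(1) x pos[OF x v] show False by simp
      qed
      then have "W x \<le> K" by (simp add: v_def)
      then show "V x \<le> M / l\<^sup>2" using elim(2) x by (simp add: K_def)
    qed
  qed
qed

lemma resolvent_bounded:
  assumes l: "l > 0" and f: "f \<in> L2 \<Omega>" and fM: "\<And>x. x \<in> \<Omega> \<Longrightarrow> \<bar>f x\<bar> \<le> M" and M: "0 \<le> M"
    and V: "resolvent l f V"
  shows "AE x in lborel. x \<in> \<Omega> \<longrightarrow> \<bar>V x\<bar> \<le> M / l\<^sup>2"
proof -
  have up: "AE x in lborel. x \<in> \<Omega> \<longrightarrow> V x \<le> M / l\<^sup>2"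
    by (rule resolvent_le[OF l f _ M V]) (use fM in \<open>auto simp: abs_le_iff\<close>)
  have "resolvent l (\<lambda>x. - f x) (\<lambda>x. - V x)"
    using resolvent_lincomb[OF f f V V, of "-1" 0] by simp
  then have "AE x in lborel. x \<in> \<Omega> \<longrightarrow> - V x \<le> M / l\<^sup>2"
    by (rule resolvent_le[OF l _ _ M, rotated 2])
       (use fM L2_cmult[OF f, of "-1"] in \<open>auto simp: abs_le_iff\<close>)
  with up show ?thesis by eventually_elim (auto simp: abs_le_iff)
qed

end

section \<open>Continuity of the resolvent\<close>

context frac_order
begin

text \<open>For |z| <= 1 the Lipschitz bound applies and x stays in the ball of radius r + 1. For
  larger z the squared difference is at most 1 and vanishes unless x or x + z lies in the ball of
  radius r.\<close>

lemma integrable_energy_lipschitz: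
  fixes v :: "'a::euclidean_space \<Rightarrow> real"
  assumes [measurable]: "v \<in> borel_measurable borel"
    and v01: "\<And>x. 0 \<le> v x" "\<And>x. v x \<le> 1"
    and supp: "\<And>x. x \<notin> cball c r \<Longrightarrow> v x = 0"
    and lip: "\<And>x y. \<bar>v x - v y\<bar> \<le> L * norm (x - y)" and L: "0 \<le> L"
  shows "integrable (lborel \<Otimes>\<^sub>M lborel) (energy_integrand s v v)"
proof -
  define m1 where "m1 = measure lborel (cball c (r + 1))"
  define m2 where "m2 = measure lborel (cball c r)"
  define K where "K = L\<^sup>2 * m1 + 2 * m2"
  have m: "0 \<le> m1" "0 \<le> m2" by (simp_all add: m1_def m2_def)
  define B where "B = cball c r"
  define B' where "B' = cball c (r + 1)"
  have [measurable]: "B \<in> sets borel" "B' \<in> sets borel" by (simp_all add: B_def B'_def)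
  have meas: "emeasure lborel B = ennreal m2" "emeasure lborel B' = ennreal m1"
    using emeasure_lborel_cball_finite[of c r] emeasure_lborel_cball_finite[of c "r + 1"]
    by (simp_all add: B_def B'_def m1_def m2_def emeasure_eq_ennreal_measure less_top)
  have inner: "(\<integral>\<^sup>+x. ennreal ((v x - v (x + z))\<^sup>2 * frac_kernel s z) \<partial>lborel)
      \<le> ennreal (K * (min 1 ((norm z)\<^sup>2) * frac_kernel s z))" for z :: 'a
  proof (cases "norm z \<le> 1")
    case True
    then have mz: "min 1 ((norm z)\<^sup>2) = (norm z)\<^sup>2" using power_mono[of "norm z" 1 2] by (simp add: min_def)
    have "(\<integral>\<^sup>+x. ennreal ((v x - v (x + z))\<^sup>2 * frac_kernel s z) \<partial>lborel)
        \<le> (\<integral>\<^sup>+x. ennreal (L\<^sup>2 * (norm z)\<^sup>2 * frac_kernel s z) * indicator B' x \<partial>lborel)"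
    proof (rule nn_integral_mono)
      fix x
      show "ennreal ((v x - v (x + z))\<^sup>2 * frac_kernel s z) \<le> ennreal (L\<^sup>2 * (norm z)\<^sup>2 * frac_kernel s z) * indicator B' x"
      proof (cases "x \<in> B'")
        case x: True
        have "\<bar>v x - v (x + z)\<bar> \<le> \<bar>L * norm z\<bar>" using lip[of x "x + z"] L by simp
        then have "(v x - v (x + z))\<^sup>2 \<le> (L * norm z)\<^sup>2" by (simp only: abs_le_square_iff)
        then show ?thesis using x by (auto simp: power_mult_distrib intro!: ennreal_leI mult_right_mono)
      next
        case x: False
        then have "norm (c - x) > r + 1" by (simp add: B'_def dist_norm)
        then have "x \<notin> cball c r" "x + z \<notin> cball c r"
          using True norm_triangle_ineq[of "c - (x + z)" z] by (auto simp: dist_norm algebra_simps)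
        then show ?thesis using supp by simp
      qed
    qed
    also have "\<dots> = ennreal (L\<^sup>2 * m1 * ((norm z)\<^sup>2 * frac_kernel s z))"
      using m by (subst nn_integral_cmult_indicator) (auto simp: meas ennreal_mult[symmetric] mult_ac)
    also have "\<dots> \<le> ennreal (K * (min 1 ((norm z)\<^sup>2) * frac_kernel s z))"
      unfolding mz K_def using m by (intro ennreal_leI mult_right_mono) auto
    finally show ?thesis .
  next
    case False
    then have mz: "min 1 ((norm z)\<^sup>2) = 1" using power_mono[of 1 "norm z" 2] by (simp add: min_def)
    have "(\<integral>\<^sup>+x. ennreal ((v x - v (x + z))\<^sup>2 * frac_kernel s z) \<partial>lborel)
        \<le> (\<integral>\<^sup>+x. ennreal (frac_kernel s z) * (indicator B x + indicator B (x + z)) \<partial>lborel)"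
    proof (rule nn_integral_mono)
      fix x
      have b: "(v x - v (x + z))\<^sup>2 \<le> 1"
        unfolding abs_square_le_1 using v01[of x] v01[of "x + z"] by linarith
      show "ennreal ((v x - v (x + z))\<^sup>2 * frac_kernel s z) \<le> ennreal (frac_kernel s z) * (indicator B x + indicator B (x + z))"
      proof (cases "x \<in> B \<or> x + z \<in> B")
        case True
        then have "1 \<le> (indicator B x + indicator B (x + z) :: ennreal)" by (auto split: split_indicator)
        then have "ennreal (frac_kernel s z) * 1 \<le> ennreal (frac_kernel s z) * (indicator B x + indicator B (x + z))"
          by (rule mult_left_mono) simp
        moreover have "(v x - v (x + z))\<^sup>2 * frac_kernel s z \<le> 1 * frac_kernel s z"
          by (rule mult_right_mono[OF b]) simp
        then have "ennreal ((v x - v (x + z))\<^sup>2 * frac_kernel s z) \<le> ennreal (frac_kernel s z) * 1"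
          unfolding mult_1_left mult_1_right by (rule ennreal_leI)
        ultimately show ?thesis by (rule order_trans[rotated])
      next
        case False
        then show ?thesis using supp by (simp add: B_def)
      qed
    qed
    also have "\<dots> = ennreal (frac_kernel s z) * ((\<integral>\<^sup>+x. indicator B x \<partial>lborel) + (\<integral>\<^sup>+x. indicator B (x + z) \<partial>lborel))"
      by (subst nn_integral_cmult) (auto simp: nn_integral_add)
    also have "(\<integral>\<^sup>+x. indicator B (x + z) \<partial>lborel) = (\<integral>\<^sup>+x. indicator B x \<partial>lborel)"
      by (rule nn_integral_translate) measurable
    also have "ennreal (frac_kernel s z) * ((\<integral>\<^sup>+x. indicator B x \<partial>lborel) + (\<integral>\<^sup>+x. indicator B x \<partial>lborel))
        = ennreal (2 * m2 * (1 * frac_kernel s z))"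
      using m by (simp add: meas ennreal_mult[symmetric] ennreal_plus[symmetric] mult_ac del: ennreal_plus)
    also have "\<dots> \<le> ennreal (K * (min 1 ((norm z)\<^sup>2) * frac_kernel s z))"
      unfolding mz K_def using m by (intro ennreal_leI mult_right_mono) auto
    finally show ?thesis .
  qed
  have "(\<integral>\<^sup>+p. ennreal (norm (energy_integrand s v v p)) \<partial>(lborel \<Otimes>\<^sub>M lborel))
      = (\<integral>\<^sup>+(x, z). ennreal ((v x - v (x + z))\<^sup>2 * frac_kernel s z) \<partial>(lborel \<Otimes>\<^sub>M lborel))"
    by (subst nn_integral_shear) (auto simp: energy_integrand_frac_kernel abs_mult power2_eq_square intro!: nn_integral_cong)
  also have "\<dots> = (\<integral>\<^sup>+z. (\<integral>\<^sup>+x. ennreal ((v x - v (x + z))\<^sup>2 * frac_kernel s z) \<partial>lborel) \<partial>lborel)"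
    by (subst lborel_pair.nn_integral_snd[symmetric]) (auto simp: case_prod_beta)
  also have "\<dots> \<le> (\<integral>\<^sup>+z. ennreal (K * (min 1 ((norm z)\<^sup>2) * frac_kernel s z)) \<partial>(lborel :: 'a measure))"
    by (rule nn_integral_mono[OF inner])
  also have "\<dots> < \<infinity>"
  proof -
    have "integrable lborel (\<lambda>z::'a. K * (min 1 ((norm z)\<^sup>2) * frac_kernel s z))"
      by (rule integrable_mult_right[OF integrable_min_kernel])
    moreover have "K \<ge> 0" using m by (simp add: K_def)
    ultimately show ?thesis unfolding integrable_iff_bounded by (simp add: abs_mult)
  qed
  finally show ?thesis by (intro integrableI_bounded) (auto simp: measurable_lborel1)
qed

lemma integral_profile_at:
  assumes a: "a > 0"
  shows "integrable lborel (profile_at a :: 'a::euclidean_space \<Rightarrow> real)"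
    and "(\<integral>z. profile_at a z \<partial>(lborel :: 'a measure)) = profile_mass TYPE('a)"
proof -
  have "integrable lborel (\<lambda>x::'a. profile (0 + (1 / a) *\<^sub>R x))"
    using a by (intro integrable_affine integrable_profile) auto
  then show "integrable lborel (profile_at a :: 'a \<Rightarrow> real)"
    unfolding profile_at_def[abs_def] by (simp add: divide_inverse)
  have "(\<integral>x. profile x \<partial>(lborel :: 'a measure)) = \<bar>1 / a\<bar> ^ DIM('a) * (\<integral>x. profile (0 + (1 / a) *\<^sub>R x) \<partial>(lborel :: 'a measure))"
    using a by (intro integral_affine) auto
  then show "(\<integral>z. profile_at a z \<partial>(lborel :: 'a measure)) = profile_mass TYPE('a)"
    using a unfolding profile_at_def profile_mass_def by (simp add: power_inverse divide_inverse mult.commute)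
qed

lemma profile_at_nonneg: "a > 0 \<Longrightarrow> 0 \<le> profile_at a z"
  unfolding profile_at_def by (intro divide_nonneg_pos profile_nonneg) auto

lemma profile_at_bounded: "a > 0 \<Longrightarrow> profile_at a z \<le> bump_op_bound TYPE('a) / a ^ DIM('a)" for z :: "'a::euclidean_space"
  unfolding profile_at_def by (intro divide_right_mono profile_bounded) auto

lemma borel_measurable_profile_at [measurable]: "profile_at a \<in> borel_measurable (borel :: 'a::euclidean_space measure)"
  unfolding profile_at_def[abs_def] by measurable

text \<open>The kernel is homogeneous of degree -N - 2s while the dilation carries only the factor
  a^(-N); the surplus is \<open>a powr (2 * s)\<close>.\<close>

lemma profile_at_le_kernel:
  obtains C where "C > 0" "\<And>a (z :: 'a::euclidean_space). a > 0 \<Longrightarrow> profile_at a z \<le> C * a powr (2 * s) * frac_kernel s z"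
proof -
  obtain C where C: "C > 0" "\<And>y :: 'a. y \<noteq> 0 \<Longrightarrow> profile y \<le> C * frac_kernel s y"
    using profile_le_kernel[where 'a='a] by blast
  show ?thesis
  proof (rule that[OF C(1)])
    fix a and z :: 'a assume a: "a > (0::real)"
    show "profile_at a z \<le> C * a powr (2 * s) * frac_kernel s z"
    proof (cases "z = 0")
      case False
      have "profile (z /\<^sub>R a) / a ^ DIM('a) \<le> C * frac_kernel s (z /\<^sub>R a) / a ^ DIM('a)"
        using a False C(2)[of "z /\<^sub>R a"] by (intro divide_right_mono) auto
      also have "frac_kernel s (z /\<^sub>R a) = inverse a powr (- (real DIM('a) + 2 * s)) * frac_kernel s z"
        using a by (intro frac_kernel_scale) simp
      also have "inverse a powr (- (real DIM('a) + 2 * s)) = a powr real DIM('a) * a powr (2 * s)"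
        unfolding powr_minus inverse_powr powr_add by simp
      also have "C * (a powr real DIM('a) * a powr (2 * s) * frac_kernel s z) / a ^ DIM('a) = C * a powr (2 * s) * frac_kernel s z"
        using a by (simp add: powr_realpow)
      finally show ?thesis by (simp add: profile_at_def)
    qed (simp add: profile_at_def)
  qed
qed

lemma tendsto_profile_at:
  fixes y :: "'a::euclidean_space"
  assumes a: "a > 0" and y: "y \<noteq> 0" and lim: "x \<longlonglongrightarrow> y"
  shows "(\<lambda>n. profile_at a (x n)) \<longlonglongrightarrow> profile_at a y"
proof -
  have "open (- {0 :: 'a})" by auto
  from continuous_on_eq_continuous_at[OF this, of "profile :: 'a \<Rightarrow> real"] continuous_on_profile[where 'a='a]
  have "isCont profile (y /\<^sub>R a)" using a y by simp
  moreover have "(\<lambda>n. x n /\<^sub>R a) \<longlonglongrightarrow> y /\<^sub>R a" by (intro tendsto_intros lim)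
  ultimately have "(\<lambda>n. profile (x n /\<^sub>R a)) \<longlonglongrightarrow> profile (y /\<^sub>R a)" by (rule isCont_tendsto_compose)
  then show ?thesis unfolding profile_at_def using a by (intro tendsto_divide tendsto_const) auto
qed

end

section \<open>Testing the equation with bumps and mollifying the solution\<close>

context frac_dirichlet
begin

lemma bump_at_Htilde:
  assumes e: "e > 0" and sub: "cball x e \<subseteq> \<Omega>"
  shows "bump_at x e \<in> Htilde s \<Omega>"
proof -
  have supp: "y \<notin> cball x e \<Longrightarrow> bump_at x e y = 0" for y
    using e by (intro bump_at_eq_0) (auto simp: dist_norm norm_minus_commute)
  have sq: "bump_at x e \<in> sq_int lborel"
  proof -
    have "integrable lborel (\<lambda>y. indicator (cball x e) y *\<^sub>R (bump_at x e y)\<^sup>2)"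
      by (rule borel_integrable_compact) (auto intro!: continuous_intros continuous_on_bump_at)
    also have "(\<lambda>y. indicator (cball x e) y *\<^sub>R (bump_at x e y)\<^sup>2) = (\<lambda>y. (bump_at x e y)\<^sup>2)"
      using supp by (auto simp: fun_eq_iff split: split_indicator)
    finally show ?thesis by (simp add: sq_int_def)
  qed
  have "integrable (lborel \<Otimes>\<^sub>M lborel) (energy_integrand s (bump_at x e) (bump_at x e))"
  proof (rule integrable_energy_lipschitz)
    show "\<bar>bump_at x e y - bump_at x e z\<bar> \<le> 8 / e * norm (y - z)" for y z
    proof -
      have "(y - x) /\<^sub>R e - (z - x) /\<^sub>R e = (y - z) /\<^sub>R e" by (simp add: algebra_simps)
      then show ?thesis
        using bump_lipschitz[of "(y - x) /\<^sub>R e" "(z - x) /\<^sub>R e"] e by (simp add: bump_at_def divide_inverse mult_ac)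
    qed
    show "bump_at x e y = 0" if "y \<notin> cball x e" for y by (rule supp[OF that])
  qed (use e bump_at_le_1 in auto)
  moreover have "bump_at x e y = 0" if "y \<notin> \<Omega>" for y using supp sub that by blast
  ultimately show ?thesis using sq by (simp add: Htilde_def L2_UNIV_iff)
qed

text \<open>All differences are moved onto the bump, so that in the integral W enters merely as an
  integrable function.\<close>

lemma energy_bump_at:
  assumes e: "e > 0" and sub: "cball x e \<subseteq> \<Omega>" and W: "W \<in> Htilde s \<Omega>" "integrable lborel W"
  shows "energy s W (bump_at x e) = e powr (- 2 * s) * (\<integral>y. W y * bump_op ((y - x) /\<^sub>R e) \<partial>lborel)"
proof -
  have v: "bump_at x e \<in> Htilde s \<Omega>" by (rule bump_at_Htilde[OF e sub])
  have "energy s W (bump_at x e) = (\<integral>y. W y * frac_op s (bump_at x e) y \<partial>lborel)"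
  proof (rule energy_eq_frac_op[OF W(2) _ _ second_diff_bump_at_le[OF e]])
    show "\<bar>bump_at x e y\<bar> \<le> 1" for y using bump_at_le_1[of x e y] by simp
    show "integrable (lborel \<Otimes>\<^sub>M lborel) (energy_integrand s W (bump_at x e))"
    proof (rule integrable_energy_mixed)
      show "integrable (lborel \<Otimes>\<^sub>M lborel) (energy_integrand s W W)"
        using W(1) unfolding Htilde_def by blast
      show "integrable (lborel \<Otimes>\<^sub>M lborel) (energy_integrand s (bump_at x e) (bump_at x e))"
        using v unfolding Htilde_def by blast
    qed (rule Htilde_measurable[OF W(1)] Htilde_measurable[OF v])+
  qed measurable
  also have "\<dots> = (\<integral>y. e powr (- 2 * s) * (W y * bump_op ((y - x) /\<^sub>R e)) \<partial>lborel)"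
    unfolding frac_op_bump_at[OF e] by (simp only: mult.left_commute)
  finally show ?thesis by simp
qed

lemma integrable_of_L2:
  assumes W: "W \<in> L2 \<Omega>" and W0: "\<And>x. x \<notin> \<Omega> \<Longrightarrow> W x = 0"
  shows "integrable lborel W"
proof -
  have rW: "restr \<Omega> W = W" using W0 by (auto simp: restr_def fun_eq_iff split: split_indicator)
  have W_sq: "W \<in> sq_int lborel" using W by (simp add: L2_iff_restr rW)
  have one: "(indicator \<Omega> :: 'a \<Rightarrow> real) \<in> sq_int lborel"
  proof -
    have "(\<lambda>x. (indicator \<Omega> x :: real)\<^sup>2) = indicator \<Omega>" by (auto simp: fun_eq_iff split: split_indicator)
    then show ?thesis using \<Omega>_open emeasure_bounded_finite[OF \<Omega>_bounded]
      by (simp add: sq_int_def less_top)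
  qed
  from integrable_sq_int_mult[OF one W_sq]
  show ?thesis using rW by (simp add: restr_def[abs_def])
qed

text \<open>Mollification with the bump profile: the difference of two scales is an integral of
  \<open>bump_op\<close> over the intermediate scales, on which the equation can be tested. This gives uniform
  convergence on interior sets.\<close>

definition smoothed :: "('a \<Rightarrow> real) \<Rightarrow> real \<Rightarrow> 'a \<Rightarrow> real" where
  "smoothed W a x = (\<integral>y. W y * profile_at a (y - x) \<partial>lborel)"

lemma continuous_on_smoothed:
  assumes W: "integrable lborel W" and a: "a > 0"
  shows "continuous_on A (smoothed W a)"
proof (rule continuous_on_subset[of UNIV])
  show "continuous_on UNIV (smoothed W a)"
    unfolding continuous_on_sequentially
  proof (intro allI ballI impI, elim conjE)
    fix x :: "nat \<Rightarrow> 'a" and c assume x: "x \<longlonglongrightarrow> c"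
    have [measurable]: "W \<in> borel_measurable borel" using W by auto
    let ?b = "bump_op_bound TYPE('a) / a ^ DIM('a)"
    show "(smoothed W a \<circ> x) \<longlonglongrightarrow> smoothed W a c"
      unfolding o_def smoothed_def
    proof (rule integral_dominated_convergence)
      show "integrable lborel (\<lambda>y. \<bar>W y\<bar> * ?b)" using W by (intro integrable_mult_left integrable_abs)
      show "AE y in lborel. (\<lambda>n. W y * profile_at a (y - x n)) \<longlonglongrightarrow> W y * profile_at a (y - c)"
        \<comment> \<open>Continuity of \<open>profile\<close> is available away from 0 only, hence
          the exceptional point y = c.\<close>
        using AE_lborel_singleton[of c]
      proof eventually_elim
        fix y assume y: "y \<noteq> c"
        have "(\<lambda>n. y - x n) \<longlonglongrightarrow> y - c" by (intro tendsto_intros x)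
        then have "(\<lambda>n. profile_at a (y - x n)) \<longlonglongrightarrow> profile_at a (y - c)"
          using y by (intro tendsto_profile_at[OF a]) auto
        then show "(\<lambda>n. W y * profile_at a (y - x n)) \<longlonglongrightarrow> W y * profile_at a (y - c)"
          by (intro tendsto_mult tendsto_const)
      qed
      fix n
      show "AE y in lborel. norm (W y * profile_at a (y - x n)) \<le> \<bar>W y\<bar> * ?b"
      proof (rule AE_I2)
        fix y
        have "\<bar>profile_at a (y - x n)\<bar> \<le> ?b"
          using profile_at_nonneg[OF a, of "y - x n"] profile_at_bounded[OF a, of "y - x n"] by simp
        then show "norm (W y * profile_at a (y - x n)) \<le> \<bar>W y\<bar> * ?b"
          unfolding real_norm_def abs_mult by (rule mult_left_mono) simp
      qed
    qed measurable
  qed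
qed simp

lemma smoothed_minus_mass:
  assumes W: "integrable lborel W" and a: "a > 0"
  shows "smoothed W a x - profile_mass TYPE('a) * W x = (\<integral>z. (W (x + z) - W x) * profile_at a z \<partial>lborel)"
proof -
  have "smoothed W a x = (\<integral>z. W (x + z) * profile_at a z \<partial>lborel)"
    unfolding smoothed_def using integral_translate[of "\<lambda>y. W y * profile_at a (y - x)" x]
    by (simp add: add.commute)
  moreover have i1: "integrable lborel (\<lambda>z. W (x + z) * profile_at a z)"
  proof (rule integrable_mult_bounded)
    show "integrable lborel (\<lambda>z. W (x + z))" using W integrable_translate_iff[of W x] by (simp add: add.commute)
    show "\<bar>profile_at a z\<bar> \<le> bump_op_bound TYPE('a) / a ^ DIM('a)" for z :: 'a
      using profile_at_nonneg[OF a, of z] profile_at_bounded[OF a, of z] by simp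
  qed measurable
  moreover have "(\<integral>z. (W (x + z) - W x) * profile_at a z \<partial>lborel)
      = (\<integral>z. W (x + z) * profile_at a z \<partial>lborel) - (\<integral>z. W x * profile_at a z \<partial>(lborel :: 'a measure))"
  proof -
    have "integrable lborel (\<lambda>z :: 'a. W x * profile_at a z)"
      by (intro integrable_mult_right integral_profile_at(1) a)
    with i1 show ?thesis unfolding left_diff_distrib by (rule Bochner_Integration.integral_diff)
  qed
  ultimately show ?thesis by (simp add: integral_profile_at(2)[OF a] mult.commute)
qed

text \<open>
  Young's inequality splits \<open>\<bar>W (x + z) - W x\<bar> p z\<close>, where \<open>p = profile_at a\<close> is controlled by
  \<open>a powr (2 * s)\<close> times the kernel, so that the energy of \<open>W\<close> gives the rate \<open>a powr s\<close>.
\<close>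

lemma smoothed_approximates:
  assumes W: "W \<in> Htilde s \<Omega>" "integrable lborel W"
  obtains C where "\<And>a. a > 0 \<Longrightarrow>
    (\<integral>\<^sup>+x. indicator \<Omega> x * ennreal \<bar>smoothed W a x - profile_mass TYPE('a) * W x\<bar> \<partial>lborel) \<le> ennreal (C * a powr s)"
proof -
  obtain C where C: "C > 0" "\<And>a (z :: 'a). a > 0 \<Longrightarrow> profile_at a z \<le> C * a powr (2 * s) * frac_kernel s z"
    using profile_at_le_kernel[where 'a='a] by blast
  have [measurable]: "W \<in> borel_measurable borel" "\<Omega> \<in> sets borel" using W(2) \<Omega>_open by auto
  define E where "E = energy s W W"
  define m where "m = measure lborel \<Omega>"
  let ?A = "profile_mass TYPE('a)"
  have m: "emeasure lborel \<Omega> = ennreal m"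
    using emeasure_bounded_finite[OF \<Omega>_bounded] by (simp add: m_def emeasure_eq_ennreal_measure less_top)
  have E: "(\<integral>\<^sup>+x. (\<integral>\<^sup>+z. ennreal ((W (x + z) - W x)\<^sup>2 * frac_kernel s z) \<partial>lborel) \<partial>lborel) = ennreal E"
  proof -
    have nn: "0 \<le> energy_integrand s W W p" for p by (simp add: energy_integrand_sqrt_energy)
    have "ennreal E = (\<integral>\<^sup>+p. ennreal (energy_integrand s W W p) \<partial>(lborel \<Otimes>\<^sub>M lborel))"
      unfolding E_def energy_def using W(1) nn by (intro nn_integral_eq_integral[symmetric]) (auto simp: Htilde_def)
    also have "\<dots> = (\<integral>\<^sup>+(x, z). ennreal (energy_integrand s W W (x, x + z)) \<partial>(lborel \<Otimes>\<^sub>M lborel))"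
      by (rule nn_integral_shear) measurable
    also have "\<dots> = (\<integral>\<^sup>+x. (\<integral>\<^sup>+z. ennreal (energy_integrand s W W (x, x + z)) \<partial>lborel) \<partial>lborel)"
      by (subst lborel.nn_integral_fst[symmetric]) (auto simp: case_prod_beta)
    also have "\<dots> = (\<integral>\<^sup>+x. (\<integral>\<^sup>+z. ennreal ((W (x + z) - W x)\<^sup>2 * frac_kernel s z) \<partial>lborel) \<partial>lborel)"
      by (intro nn_integral_cong) (simp add: energy_integrand_frac_kernel power2_eq_square algebra_simps)
    finally show ?thesis by simp
  qed
  have E0: "E \<ge> 0" unfolding E_def energy_def by (simp add: energy_integrand_sqrt_energy integral_nonneg_AE)
  have A0: "?A \<ge> 0" using profile_mass_pos[where 'a='a] by simp
  have m0: "m \<ge> 0" by (simp add: m_def)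
  show ?thesis
  proof (rule that[of "?A * m / 2 + C * E / 2"])
    fix a :: real assume a: "a > 0"
    \<comment> \<open>The weight in Young's inequality. As the profile is at most
      \<open>C * \<eta> * \<eta>\<close> times the kernel, this choice makes both terms of order
      \<open>\<eta>\<close>.\<close>
    define \<eta> where "\<eta> = a powr s"
    have \<eta>: "\<eta> > 0" using a by (simp add: \<eta>_def)
    have \<eta>2: "a powr (2 * s) = \<eta> * \<eta>" by (simp add: \<eta>_def powr_add[symmetric])
    let ?p = "profile_at a :: 'a \<Rightarrow> real"
    have young: "\<bar>(W (x + z) - W x) * ?p z\<bar> \<le> \<eta> / 2 * ?p z + C * \<eta> / 2 * ((W (x + z) - W x)\<^sup>2 * frac_kernel s z)" for x z
    proof -
      let ?d = "W (x + z) - W x"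
      have p0: "0 \<le> ?p z" by (rule profile_at_nonneg[OF a])
      have "2 * (\<bar>?d\<bar> * \<eta>) \<le> ?d\<^sup>2 + \<eta>\<^sup>2" using sum_squares_bound[of "\<bar>?d\<bar>" \<eta>] by (simp add: mult.assoc)
      then have "\<bar>?d\<bar> \<le> (?d\<^sup>2 + \<eta>\<^sup>2) / (2 * \<eta>)" using \<eta> by (simp add: field_simps)
      then have "\<bar>?d\<bar> * ?p z \<le> (?d\<^sup>2 + \<eta>\<^sup>2) / (2 * \<eta>) * ?p z" using p0 by (rule mult_right_mono)
      also have "\<dots> = \<eta> / 2 * ?p z + ?d\<^sup>2 / (2 * \<eta>) * ?p z" using \<eta> by (simp add: field_simps power2_eq_square)
      also have "?d\<^sup>2 / (2 * \<eta>) * ?p z \<le> ?d\<^sup>2 / (2 * \<eta>) * (C * a powr (2 * s) * frac_kernel s z)"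
        using \<eta> C(2)[OF a] by (intro mult_left_mono) auto
      also have "\<dots> = C * \<eta> / 2 * (?d\<^sup>2 * frac_kernel s z)" using \<eta> unfolding \<eta>2 by (simp add: field_simps)
      finally show ?thesis using p0 by (simp add: abs_mult)
    qed
    have "(\<integral>\<^sup>+x. indicator \<Omega> x * ennreal \<bar>smoothed W a x - ?A * W x\<bar> \<partial>lborel)
        \<le> (\<integral>\<^sup>+x. ennreal (\<eta> / 2 * ?A) * indicator \<Omega> x
             + ennreal (C * \<eta> / 2) * (\<integral>\<^sup>+z. ennreal ((W (x + z) - W x)\<^sup>2 * frac_kernel s z) \<partial>lborel) \<partial>lborel)"
    proof (rule nn_integral_mono)
      fix x
      let ?J = "\<integral>\<^sup>+z. ennreal ((W (x + z) - W x)\<^sup>2 * frac_kernel s z) \<partial>lborel"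
      show "indicator \<Omega> x * ennreal \<bar>smoothed W a x - ?A * W x\<bar> \<le> ennreal (\<eta> / 2 * ?A) * indicator \<Omega> x + ennreal (C * \<eta> / 2) * ?J"
      proof (cases "x \<in> \<Omega>")
        case True
        have i: "integrable lborel (\<lambda>z. (W (x + z) - W x) * ?p z)"
        proof -
          have "integrable lborel (\<lambda>z. W (x + z) * ?p z)"
          proof (rule integrable_mult_bounded)
            show "integrable lborel (\<lambda>z. W (x + z))" using W(2) integrable_translate_iff[of W x] by (simp add: add.commute)
            show "\<bar>?p z\<bar> \<le> bump_op_bound TYPE('a) / a ^ DIM('a)" for z
              using profile_at_nonneg[OF a, of z] profile_at_bounded[OF a, of z] by simp
          qed measurable
          moreover have "integrable lborel (\<lambda>z. W x * ?p z)"
            using integral_profile_at(1)[OF a, where 'a='a] by (rule integrable_mult_right)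
          ultimately show ?thesis unfolding left_diff_distrib by (rule Bochner_Integration.integrable_diff)
        qed
        have "ennreal \<bar>smoothed W a x - ?A * W x\<bar> \<le> (\<integral>\<^sup>+z. ennreal (norm ((W (x + z) - W x) * ?p z)) \<partial>lborel)"
          unfolding smoothed_minus_mass[OF W(2) a] using integral_norm_bound_ennreal[OF i] by simp
        also have "\<dots> \<le> (\<integral>\<^sup>+z. ennreal (\<eta> / 2) * ennreal (?p z) + ennreal (C * \<eta> / 2) * ennreal ((W (x + z) - W x)\<^sup>2 * frac_kernel s z) \<partial>lborel)"
        proof (rule nn_integral_mono)
          fix z
          have "ennreal \<bar>(W (x + z) - W x) * ?p z\<bar> \<le> ennreal (\<eta> / 2 * ?p z + C * \<eta> / 2 * ((W (x + z) - W x)\<^sup>2 * frac_kernel s z))"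
            by (rule ennreal_leI[OF young])
          also have "\<dots> = ennreal (\<eta> / 2) * ennreal (?p z) + ennreal (C * \<eta> / 2) * ennreal ((W (x + z) - W x)\<^sup>2 * frac_kernel s z)"
            using \<eta> C(1) profile_at_nonneg[OF a, of z] by (simp add: ennreal_plus ennreal_mult[symmetric])
          finally show "ennreal (norm ((W (x + z) - W x) * ?p z)) \<le> ennreal (\<eta> / 2) * ennreal (?p z) + ennreal (C * \<eta> / 2) * ennreal ((W (x + z) - W x)\<^sup>2 * frac_kernel s z)"
            by simp
        qed
        also have "\<dots> = ennreal (\<eta> / 2) * (\<integral>\<^sup>+z. ennreal (?p z) \<partial>lborel) + ennreal (C * \<eta> / 2) * ?J"
          by (simp add: nn_integral_add nn_integral_cmult)
        also have "(\<integral>\<^sup>+z. ennreal (?p z) \<partial>lborel) = ennreal ?A"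
          unfolding integral_profile_at(2)[OF a, symmetric]
          using integral_profile_at(1)[OF a] profile_at_nonneg[OF a] by (intro nn_integral_eq_integral) auto
        also have "ennreal (\<eta> / 2) * ennreal ?A = ennreal (\<eta> / 2 * ?A)" using \<eta> A0 by (simp add: ennreal_mult[symmetric])
        finally show ?thesis using True by simp
      qed simp
    qed
    also have "\<dots> = ennreal (\<eta> / 2 * ?A) * ennreal m + ennreal (C * \<eta> / 2) * ennreal E"
      by (subst nn_integral_add) (auto simp: nn_integral_cmult E m)
    also have "\<dots> = ennreal ((?A * m / 2 + C * E / 2) * a powr s)"
      using \<eta> A0 m0 E0 C(1)
      by (simp add: ennreal_mult[symmetric] ennreal_plus[symmetric] \<eta>_def[symmetric] algebra_simps del: ennreal_plus)
    finally show "(\<integral>\<^sup>+x. indicator \<Omega> x * ennreal \<bar>smoothed W a x - ?A * W x\<bar> \<partial>lborel)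
       \<le> ennreal ((?A * m / 2 + C * E / 2) * a powr s)" .
  qed
qed

text \<open>The resolvent equation is read as (-\<Delta>)^s W = f - l^2 W with a right-hand side
  bounded by M; the estimates below see f and l through M alone.\<close>

definition bounded_solution :: "real \<Rightarrow> ('a \<Rightarrow> real) \<Rightarrow> real \<Rightarrow> ('a \<Rightarrow> real) \<Rightarrow> bool" where
  "bounded_solution l f M W \<longleftrightarrow> W \<in> Htilde s \<Omega> \<and> (\<forall>x. x \<notin> \<Omega> \<longrightarrow> W x = 0) \<and> f \<in> L2 \<Omega> \<and>
     (\<forall>v\<in>Htilde s \<Omega>. fc / 2 * energy s W v + l\<^sup>2 * L2_inner \<Omega> W v = L2_inner \<Omega> f v) \<and>
     0 \<le> M \<and> (AE x in lborel. x \<in> \<Omega> \<longrightarrow> \<bar>f x - l\<^sup>2 * W x\<bar> \<le> M)"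

lemma bounded_solution_integrable:
  assumes "bounded_solution l f M W"
  shows "integrable lborel W"
  using assms Htilde_L2 by (intro integrable_of_L2) (auto simp: bounded_solution_def)

text \<open>Test with \<open>bump_at x e\<close>: the energy is \<open>e powr (- 2 * s)\<close>
  times the integral in question, and the right-hand side is at most M times the volume of the ball
  of radius e.\<close>

lemma bump_op_convolution_bound:
  assumes sol: "bounded_solution l f M W" and e: "e > 0" and sub: "cball x e \<subseteq> \<Omega>"
  shows "\<bar>(\<integral>y. W y * bump_op ((y - x) /\<^sub>R e) \<partial>lborel)\<bar>
    \<le> 2 * M * unit_ball_vol (real DIM('a)) / fc * e powr (2 * s) * e ^ DIM('a)"
proof -
  let ?I = "\<integral>y. W y * bump_op ((y - x) /\<^sub>R e) \<partial>lborel" and ?v = "bump_at x e"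
  let ?w = "unit_ball_vol (real DIM('a))" and ?F = "\<lambda>x. 1 * f x + (- (l\<^sup>2)) * W x"
  have W: "W \<in> Htilde s \<Omega>" and f: "f \<in> L2 \<Omega>" and M: "0 \<le> M"
    and F: "AE x in lborel. x \<in> \<Omega> \<longrightarrow> \<bar>f x - l\<^sup>2 * W x\<bar> \<le> M"
    using sol by (auto simp: bounded_solution_def)
  have v: "?v \<in> Htilde s \<Omega>" by (rule bump_at_Htilde[OF e sub])
  have L: "W \<in> L2 \<Omega>" "?v \<in> L2 \<Omega>" using W v Htilde_L2 by auto
  have supp: "y \<notin> cball x e \<Longrightarrow> ?v y = 0" for y
    using e by (intro bump_at_eq_0) (auto simp: dist_norm norm_minus_commute)
  have "fc / 2 * energy s W ?v = L2_inner \<Omega> ?F ?v"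
    unfolding L2_inner_lincomb[OF f L] using sol v by (auto simp: bounded_solution_def algebra_simps)
  then have I: "fc / 2 * (e powr (- 2 * s) * ?I) = L2_inner \<Omega> ?F ?v"
    by (simp add: energy_bump_at[OF e sub W bounded_solution_integrable[OF sol]])
  have "\<bar>L2_inner \<Omega> ?F ?v\<bar> \<le> (\<integral>y. \<bar>restr \<Omega> ?F y * restr \<Omega> ?v y\<bar> \<partial>lborel)"
    unfolding L2_inner_restr by (rule integral_abs_bound)
  also have "\<dots> \<le> (\<integral>y. M * indicator (cball x e) y \<partial>lborel)"
  proof (rule integral_mono_AE)
    show "integrable lborel (\<lambda>y. \<bar>restr \<Omega> ?F y * restr \<Omega> ?v y\<bar>)"
      using L2_lincomb[OF f L(1), of 1 "- (l\<^sup>2)"] L(2)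
      unfolding L2_iff_restr by (intro integrable_abs integrable_sq_int_mult)
    show "integrable lborel (\<lambda>y. M * indicator (cball x e) y)"
      using emeasure_lborel_cball_finite[of x e] by (intro integrable_mult_right) (simp add: less_top)
    show "AE y in lborel. \<bar>restr \<Omega> ?F y * restr \<Omega> ?v y\<bar> \<le> M * indicator (cball x e) y"
      using F
    proof eventually_elim
      fix y assume Fy: "y \<in> \<Omega> \<longrightarrow> \<bar>f y - l\<^sup>2 * W y\<bar> \<le> M"
      show "\<bar>restr \<Omega> ?F y * restr \<Omega> ?v y\<bar> \<le> M * indicator (cball x e) y"
      proof (cases "y \<in> cball x e")
        case True
        then have y: "y \<in> \<Omega>" using sub by auto
        have "\<bar>f y - l\<^sup>2 * W y\<bar> * ?v y \<le> M * 1"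
          using Fy y M bump_at_le_1[of x e y] by (intro mult_mono) auto
        then show ?thesis using y True by (simp add: abs_mult)
      next
        case False
        then have "restr \<Omega> ?v y = 0" using supp[of y] by (simp add: restr_def)
        then show ?thesis using False by simp
      qed
    qed
  qed
  also have "\<dots> = M * (?w * e ^ DIM('a))" using e by (simp add: content_cball)
  finally have "fc / 2 * (e powr (- 2 * s) * \<bar>?I\<bar>) \<le> M * (?w * e ^ DIM('a))"
    unfolding I[symmetric] using fc_pos by (simp add: abs_mult)
  then have le: "(2 / fc * e powr (2 * s)) * (fc / 2 * (e powr (- 2 * s) * \<bar>?I\<bar>)) \<le> (2 / fc * e powr (2 * s)) * (M * (?w * e ^ DIM('a)))"
    using fc_pos by (intro mult_left_mono) auto
  have eq: "(2 / fc * e powr (2 * s)) * (fc / 2 * (e powr (- 2 * s) * \<bar>?I\<bar>)) = \<bar>?I\<bar>"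
  proof -
    have "e powr (2 * s) * e powr (- 2 * s) = 1" using e by (simp add: powr_add[symmetric])
    then have "e powr (2 * s) * (e powr (- 2 * s) * \<bar>?I\<bar>) = \<bar>?I\<bar>" by (simp add: mult.assoc[symmetric])
    then show ?thesis using fc_pos by simp
  qed
  have "\<bar>?I\<bar> \<le> (2 / fc * e powr (2 * s)) * (M * (?w * e ^ DIM('a)))" using le unfolding eq .
  then show ?thesis by (simp add: mult_ac)
qed

text \<open>The difference of two scales is the integral of the previous quantity divided by
  e^(N+1). Its bound then leaves a multiple of e^(2s-1), integrable at 0, so the estimate does not
  depend on a and makes the mollifications Cauchy.\<close>

lemma smoothed_diff_bound:
  assumes sol: "bounded_solution l f M W" and ab: "0 < a" "a \<le> b" and sub: "cball x b \<subseteq> \<Omega>"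
  shows "\<bar>smoothed W a x - smoothed W b x\<bar>
    \<le> M * unit_ball_vol (real DIM('a)) / (fc * s) * b powr (2 * s)"
proof -
  let ?N = "DIM('a)" and ?w = "unit_ball_vol (real DIM('a))"
  define C0 where "C0 = 2 * M * ?w / fc"
  have C0: "C0 \<ge> 0" using sol fc_pos by (simp add: C0_def bounded_solution_def)
  have W: "integrable lborel W" by (rule bounded_solution_integrable[OF sol])
  then have [measurable]: "W \<in> borel_measurable borel" by auto
  have b: "b > 0" using ab by simp
  have int: "integrable lborel (\<lambda>y. W y * profile_at c (y - x))" if "c > 0" for c
  proof (rule integrable_mult_bounded[OF W])
    show "\<bar>profile_at c (y - x)\<bar> \<le> bump_op_bound TYPE('a) / c ^ ?N" for y
      using profile_at_nonneg[OF that, of "y - x"] profile_at_bounded[OF that, of "y - x"] by simp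
  qed measurable
  let ?g = "\<lambda>y e. W y * (bump_op ((y - x) /\<^sub>R e) / e ^ (?N + 1) * indicator {a..b} e)"
  \<comment> \<open>All scales stay above a > 0, which bounds the factor of W and permits
    Fubini.\<close>
  have prod: "integrable (lborel \<Otimes>\<^sub>M lborel) (\<lambda>(y, e). ?g y e)"
  proof (rule Bochner_Integration.integrable_bound)
    show "integrable (lborel \<Otimes>\<^sub>M lborel) (\<lambda>(y, e). \<bar>W y\<bar> * (bump_op_bound TYPE('a) / a ^ (?N + 1) * indicator {a..b} (e::real)))"
    by (intro integrable_pair_mult integrable_abs W integrable_mult_right integrable_real_indicator) (use ab in auto)
    show "AE p in lborel \<Otimes>\<^sub>M lborel. norm (case p of (y, e) \<Rightarrow> ?g y e)
        \<le> norm (case p of (y, e) \<Rightarrow> \<bar>W y\<bar> * (bump_op_bound TYPE('a) / a ^ (?N + 1) * indicator {a..b} e))"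
    proof (rule AE_I2)
      fix p :: "'a \<times> real"
      obtain y e where p: "p = (y, e)" by fastforce
      show "norm (case p of (y, e) \<Rightarrow> ?g y e)
        \<le> norm (case p of (y, e) \<Rightarrow> \<bar>W y\<bar> * (bump_op_bound TYPE('a) / a ^ (?N + 1) * indicator {a..b} e))"
      proof (cases "e \<in> {a..b}")
        case True
        then have e: "a \<le> e" "e > 0" using ab by auto
        have "\<bar>bump_op ((y - x) /\<^sub>R e)\<bar> / e ^ (?N + 1) \<le> bump_op_bound TYPE('a) / a ^ (?N + 1)"
          using e ab bump_op_bounded[of "(y - x) /\<^sub>R e"] bump_op_bound_nonneg[where 'a='a]
          by (intro frac_le power_mono) auto
        then have "\<bar>W y\<bar> * (\<bar>bump_op ((y - x) /\<^sub>R e)\<bar> / e ^ (?N + 1)) \<le> \<bar>W y\<bar> * (bump_op_bound TYPE('a) / a ^ (?N + 1))"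
          by (rule mult_left_mono) simp
        then show ?thesis using True e ab bump_op_bound_nonneg[where 'a='a] unfolding p by (simp add: abs_mult)
      qed (simp add: p)
    qed
  qed measurable
  have "smoothed W a x - smoothed W b x = (\<integral>y. W y * (profile_at a (y - x) - profile_at b (y - x)) \<partial>lborel)"
    unfolding smoothed_def right_diff_distrib
    by (rule Bochner_Integration.integral_diff[symmetric, OF int[OF ab(1)] int[OF b]])
  also have "\<dots> = (\<integral>y. (\<integral>e. ?g y e \<partial>lborel) \<partial>lborel)"
  proof (rule integral_cong_AE)
    show "AE y in lborel. W y * (profile_at a (y - x) - profile_at b (y - x)) = (\<integral>e. ?g y e \<partial>lborel)"
      using AE_lborel_singleton[of x]
    proof eventually_elim
      fix y assume "y \<noteq> x"
      then have "profile_at a (y - x) - profile_at b (y - x) = (\<integral>e. bump_op ((y - x) /\<^sub>R e) / e ^ (?N + 1) * indicator {a..b} e \<partial>lborel)"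
        using integral_bump_op_scales[OF ab, of "y - x"] by simp
      then show "W y * (profile_at a (y - x) - profile_at b (y - x)) = (\<integral>e. ?g y e \<partial>lborel)"
        by (simp only: integral_mult_right_zero)
    qed
  qed measurable
  also have "\<dots> = (\<integral>e. (\<integral>y. ?g y e \<partial>lborel) \<partial>lborel)"
    by (rule lborel_pair.Fubini_integral[OF prod, symmetric])
  also have "\<bar>\<dots>\<bar> \<le> (\<integral>e. \<bar>\<integral>y. ?g y e \<partial>lborel\<bar> \<partial>lborel)" by (rule integral_abs_bound)
  also have "\<dots> \<le> (\<integral>e. C0 * e powr (2 * s - 1) * indicator {a..b} e \<partial>lborel)"
  proof (rule integral_mono)
    show "integrable lborel (\<lambda>e. \<bar>\<integral>y. ?g y e \<partial>lborel\<bar>)"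
      by (rule integrable_abs[OF lborel_pair.integrable_snd[OF prod]])
    have "continuous_on {a..b} (\<lambda>e. C0 * e powr (2 * s - 1))"
      using ab by (intro continuous_intros) auto
    from borel_integrable_atLeastAtMost'[OF this]
    show "integrable lborel (\<lambda>e. C0 * e powr (2 * s - 1) * indicator {a..b} e)"
      unfolding set_integrable_def by (simp add: mult.commute)
    fix e :: real
    show "\<bar>\<integral>y. ?g y e \<partial>lborel\<bar> \<le> C0 * e powr (2 * s - 1) * indicator {a..b} e"
    proof (cases "e \<in> {a..b}")
      case True
      then have e: "e > 0" "cball x e \<subseteq> \<Omega>" using ab sub subset_cball[of e b x] by auto
      let ?I = "\<integral>y. W y * bump_op ((y - x) /\<^sub>R e) \<partial>lborel"
      have "(\<integral>y. ?g y e \<partial>lborel) = (\<integral>y. (W y * bump_op ((y - x) /\<^sub>R e)) / e ^ (?N + 1) \<partial>lborel)"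
        using True by simp
      also have "\<dots> = ?I / e ^ (?N + 1)" by (rule integral_divide_zero)
      finally have "\<bar>\<integral>y. ?g y e \<partial>lborel\<bar> = \<bar>?I\<bar> / e ^ (?N + 1)" using e by simp
      also have "\<dots> \<le> C0 * e powr (2 * s) * e ^ ?N / e ^ (?N + 1)"
        unfolding C0_def using e bump_op_convolution_bound[OF sol e] by (intro divide_right_mono) auto
      also have "\<dots> = C0 * e powr (2 * s - 1)" using e by (simp add: powr_diff)
      finally show ?thesis using True by simp
    qed simp
  qed
  also have "\<dots> = C0 / (2 * s) * b powr (2 * s) - C0 / (2 * s) * a powr (2 * s)"
  proof (rule integral_FTC_Icc_real[OF ab(2)])
    fix e assume "a \<le> e" "e \<le> b"
    then have e: "e > 0" using ab by simp
    have "((\<lambda>e. e powr (2 * s)) has_real_derivative 2 * s * e powr (2 * s - 1)) (at e)"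
      using e by (rule has_real_derivative_powr)
    from DERIV_cmult[OF this, of "C0 / (2 * s)"]
    show "((\<lambda>e. C0 / (2 * s) * e powr (2 * s)) has_real_derivative C0 * e powr (2 * s - 1)) (at e)"
      using s_pos by simp
    show "isCont (\<lambda>e. C0 * e powr (2 * s - 1)) e" using e by (intro continuous_intros) auto
  qed
  also have "\<dots> \<le> C0 / (2 * s) * b powr (2 * s)" using C0 s_pos by simp
  also have "\<dots> = M * ?w / (fc * s) * b powr (2 * s)" using s_pos fc_pos by (simp add: C0_def)
  finally show ?thesis .
qed

text \<open>\<open>lborel\<close> is not complete, so measurability of V is not inherited from W and
  is taken from its continuity.\<close>

lemma L2_cong_AE:
  assumes ae: "AE x in lborel. x \<in> \<Omega> \<longrightarrow> V x = W x" and W: "W \<in> L2 \<Omega>" and V: "continuous_on \<Omega> V"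
  shows "V \<in> L2 \<Omega>"
proof -
  have "(\<lambda>x. if x \<in> \<Omega> then V x else 0) \<in> borel_measurable borel"
    using V \<Omega>_open by (intro borel_measurable_continuous_on_if) auto
  moreover have "(\<lambda>x. if x \<in> \<Omega> then V x else 0) = restr \<Omega> V"
    by (auto simp: restr_def fun_eq_iff)
  ultimately have m: "restr \<Omega> V \<in> borel_measurable borel" by simp
  have "integrable lborel (\<lambda>x. (restr \<Omega> V x)\<^sup>2)"
  proof (rule integrable_cong_AE_imp)
    show "integrable lborel (\<lambda>x. (restr \<Omega> W x)\<^sup>2)" using W by (auto simp: L2_iff_restr sq_int_def)
    show "(\<lambda>x. (restr \<Omega> V x)\<^sup>2) \<in> borel_measurable lborel" using m by measurable
    show "AE x in lborel. (restr \<Omega> W x)\<^sup>2 = (restr \<Omega> V x)\<^sup>2"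
      using ae by eventually_elim (auto simp: restr_def split: split_indicator)
  qed
  then show ?thesis using m by (simp add: L2_iff_restr sq_int_def)
qed

lemma resolvent_cong_AE:
  assumes W: "resolvent l f W" and ae: "AE x in lborel. x \<in> \<Omega> \<longrightarrow> V x = W x" and V: "continuous_on \<Omega> V"
  shows "resolvent l f V"
proof -
  have L: "W \<in> L2 \<Omega>" using W by (simp add: resolvent_def)
  have V2: "V \<in> L2 \<Omega>" by (rule L2_cong_AE[OF ae L V])
  have "coef V k = coef W k" for k unfolding coef_def by (rule L2_inner_cong_AE[OF ae V2 L \<phi>_L2])
  then show ?thesis using W V2 by (simp add: resolvent_def)
qed

text \<open>The mollifications at scales (1/2)^n converge locally uniformly to a continuous V by
  \<open>smoothed_diff_bound\<close>, and in L1 on \<open>\<Omega>\<close> to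
  \<open>profile_mass\<close> times W by \<open>smoothed_approximates\<close>. Dividing by the mass
  gives the continuous representative.\<close>

lemma resolvent_continuous_exists:
  assumes l: "l > 0" and f: "f \<in> L2 \<Omega>" and fM: "\<And>x. x \<in> \<Omega> \<Longrightarrow> \<bar>f x\<bar> \<le> M" and M: "0 \<le> M"
  obtains V where "resolvent l f V" "continuous_on \<Omega> V"
proof -
  obtain W where W: "resolvent l f W" "W \<in> Htilde s \<Omega>" "\<And>x. x \<notin> \<Omega> \<Longrightarrow> W x = 0"
    "\<And>v. v \<in> Htilde s \<Omega> \<Longrightarrow> fc / 2 * energy s W v + l\<^sup>2 * L2_inner \<Omega> W v = L2_inner \<Omega> f v"
    using resolvent_exists[OF l f] by blast
  have l2: "l\<^sup>2 > 0" using l by simp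
  \<comment> \<open>One M bounds f, the other bounds \<open>l\<^sup>2 * W\<close> by the maximum
    principle.\<close>
  have sol: "bounded_solution l f (2 * M) W"
  proof -
    have "AE x in lborel. x \<in> \<Omega> \<longrightarrow> \<bar>W x\<bar> \<le> M / l\<^sup>2" by (rule resolvent_bounded[OF l f fM M W(1)])
    then have "AE x in lborel. x \<in> \<Omega> \<longrightarrow> \<bar>f x - l\<^sup>2 * W x\<bar> \<le> 2 * M"
    proof eventually_elim
      case (elim x)
      show ?case
      proof
        assume x: "x \<in> \<Omega>"
        then have "\<bar>W x\<bar> \<le> M / l\<^sup>2" using elim by simp
        then have "l\<^sup>2 * \<bar>W x\<bar> \<le> l\<^sup>2 * (M / l\<^sup>2)" by (rule mult_left_mono) simp
        then have "\<bar>l\<^sup>2 * W x\<bar> \<le> M" using l2 by (simp add: abs_mult)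
        then show "\<bar>f x - l\<^sup>2 * W x\<bar> \<le> 2 * M" using fM[OF x] by linarith
      qed
    qed
    then show ?thesis using W f M by (simp add: bounded_solution_def)
  qed
  have Wi: "integrable lborel W" by (rule bounded_solution_integrable[OF sol])
  have [measurable]: "W \<in> borel_measurable borel" "\<Omega> \<in> sets borel" using Wi \<Omega>_open by auto
  let ?A = "profile_mass TYPE('a)"
  define K where "K = 2 * M * unit_ball_vol (real DIM('a)) / (fc * s)"
  define r where "r n = (1/2::real) ^ n" for n :: nat
  have r: "r n > 0" "r m \<le> r n" if "n \<le> m" for n m using that by (auto simp: r_def power_decreasing)
  have r0: "r n > 0" for n by (simp add: r_def)
  have r_lim: "r \<longlonglongrightarrow> 0" unfolding r_def by (rule LIMSEQ_realpow_zero) auto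
  have K: "K \<ge> 0" using M fc_pos s_pos by (simp add: K_def)
  have rs_lim: "(\<lambda>n. c * r n powr p) \<longlonglongrightarrow> 0" if "p > 0" for c p
  proof -
    have "(\<lambda>n. r n powr p) \<longlonglongrightarrow> 0 powr p" using that r0 by (intro tendsto_powr' r_lim tendsto_const) (auto intro: always_eventually less_imp_le)
    from tendsto_mult_right_zero[OF this[simplified]] show ?thesis by simp
  qed
  let ?H = "\<lambda>n. smoothed W (r n)"
  have H_diff: "\<bar>?H m x - ?H n x\<bar> \<le> K * r n powr (2 * s)" if "n \<le> m" "cball x (r n) \<subseteq> \<Omega>" for m n x
    unfolding K_def by (rule smoothed_diff_bound[OF sol]) (use that r in auto)
  have small: "\<exists>N. \<forall>n\<ge>N. r n \<le> \<rho>" if "\<rho> > 0" for \<rho>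
    using order_tendstoD(2)[OF r_lim that] by (auto simp: eventually_sequentially intro: less_imp_le)
  have unif: "\<exists>V. uniform_limit (ball x0 \<rho>) ?H V sequentially" if \<rho>: "\<rho> > 0" "ball x0 (2 * \<rho>) \<subseteq> \<Omega>" for x0 \<rho>
  proof -
    have "uniformly_Cauchy_on (ball x0 \<rho>) ?H"
    proof (rule uniformly_Cauchy_onI')
      fix e :: real assume e: "e > 0"
      obtain N1 where N1: "\<And>n. n \<ge> N1 \<Longrightarrow> r n \<le> \<rho> / 2" using small[of "\<rho> / 2"] \<rho> by auto
      have "eventually (\<lambda>n. K * r n powr (2 * s) < e) sequentially"
        using rs_lim[of "2 * s" K] s_pos e by (intro order_tendstoD) auto
      then obtain N2 where N2: "\<And>n. n \<ge> N2 \<Longrightarrow> K * r n powr (2 * s) < e" by (auto simp: eventually_sequentially)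
      show "\<exists>N. \<forall>x\<in>ball x0 \<rho>. \<forall>m\<ge>N. \<forall>n>m. dist (?H m x) (?H n x) < e"
      proof (intro exI[of _ "max N1 N2"] ballI allI impI)
        fix x m n assume x: "x \<in> ball x0 \<rho>" and m: "max N1 N2 \<le> m" and n: "m < n"
        have "cball x (r m) \<subseteq> ball x0 (2 * \<rho>)"
        proof
          fix y assume "y \<in> cball x (r m)"
          then have "dist x y \<le> \<rho> / 2" using N1[of m] m by simp
          moreover have "dist x0 x < \<rho>" using x by simp
          ultimately show "y \<in> ball x0 (2 * \<rho>)" using dist_triangle[of x0 y x] \<rho>(1) by simp
        qed
        then have "\<bar>?H n x - ?H m x\<bar> \<le> K * r m powr (2 * s)" using \<rho>(2) n by (intro H_diff) auto
        also have "\<dots> < e" using N2[of m] m by simp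
        finally show "dist (?H m x) (?H n x) < e" by (simp add: dist_real_def abs_minus_commute)
      qed
    qed
    then show ?thesis using Cauchy_uniformly_convergent uniformly_convergent_on_def by blast
  qed
  define V where "V x = lim (\<lambda>n. ?H n x)" for x
  have V_loc: "continuous_on (ball x0 \<rho>) V \<and> (\<forall>x\<in>ball x0 \<rho>. (\<lambda>n. ?H n x) \<longlonglongrightarrow> V x)"
    if \<rho>: "\<rho> > 0" "ball x0 (2 * \<rho>) \<subseteq> \<Omega>" for x0 \<rho>
  proof -
    obtain V' where V': "uniform_limit (ball x0 \<rho>) ?H V' sequentially" using unif[OF \<rho>] by blast
    have pt: "(\<lambda>n. ?H n x) \<longlonglongrightarrow> V' x" if "x \<in> ball x0 \<rho>" for x
      using tendsto_uniform_limitI[OF V' that] .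
    then have eq: "V x = V' x" if "x \<in> ball x0 \<rho>" for x using that unfolding V_def by (intro limI) auto
    have "continuous_on (ball x0 \<rho>) V'"
      using r0 by (intro uniform_limit_theorem[OF _ V']) (auto intro!: always_eventually continuous_on_smoothed[OF Wi])
    moreover have "continuous_on (ball x0 \<rho>) V \<longleftrightarrow> continuous_on (ball x0 \<rho>) V'"
      using eq by (intro continuous_on_cong) auto
    ultimately have "continuous_on (ball x0 \<rho>) V" by simp
    then show ?thesis using pt eq by simp
  qed
  have ex_ball: "\<exists>\<rho>>0. ball x (2 * \<rho>) \<subseteq> \<Omega>" if "x \<in> \<Omega>" for x
  proof -
    obtain e where "e > 0" "ball x e \<subseteq> \<Omega>" using \<Omega>_open \<open>x \<in> \<Omega>\<close> by (auto simp: open_contains_ball)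
    then show ?thesis by (intro exI[of _ "e/2"]) auto
  qed
  have V_cont: "continuous_on \<Omega> V"
    unfolding continuous_on_eq_continuous_at[OF \<Omega>_open]
  proof
    fix x assume "x \<in> \<Omega>"
    then obtain \<rho> where \<rho>: "\<rho> > 0" "ball x (2 * \<rho>) \<subseteq> \<Omega>" using ex_ball by blast
    from V_loc[OF this] have "continuous_on (ball x \<rho>) V" by simp
    then show "isCont V x" using \<rho>(1) by (simp add: continuous_on_eq_continuous_at)
  qed
  have V_lim: "(\<lambda>n. ?H n x) \<longlonglongrightarrow> V x" if "x \<in> \<Omega>" for x
  proof -
    obtain \<rho> where \<rho>: "\<rho> > 0" "ball x (2 * \<rho>) \<subseteq> \<Omega>" using ex_ball \<open>x \<in> \<Omega>\<close> by blast
    then show ?thesis using V_loc[OF \<rho>] by simp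
  qed
  obtain C where C: "\<And>a. a > 0 \<Longrightarrow>
    (\<integral>\<^sup>+x. indicator \<Omega> x * ennreal \<bar>smoothed W a x - ?A * W x\<bar> \<partial>lborel) \<le> ennreal (C * a powr s)"
    using smoothed_approximates[OF W(2) Wi] by blast
  have H_meas [measurable]: "?H n \<in> borel_measurable borel" for n
    by (rule borel_measurable_continuous_onI[OF continuous_on_smoothed[OF Wi r0]])
  \<comment> \<open>Fatou's lemma turns L1 convergence into equality of the two limits almost
    everywhere without a further subsequence.\<close>
  have "(\<integral>\<^sup>+x. liminf (\<lambda>n. indicator \<Omega> x * ennreal \<bar>?H n x - ?A * W x\<bar>) \<partial>lborel)
      \<le> liminf (\<lambda>n. \<integral>\<^sup>+x. indicator \<Omega> x * ennreal \<bar>?H n x - ?A * W x\<bar> \<partial>lborel)"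
    by (rule nn_integral_liminf) measurable
  also have "\<dots> \<le> liminf (\<lambda>n. ennreal (C * r n powr s))"
    by (intro Liminf_mono always_eventually allI C r0)
  also have "\<dots> = 0"
  proof (rule lim_imp_Liminf[OF sequentially_bot])
    show "(\<lambda>n. ennreal (C * r n powr s)) \<longlonglongrightarrow> 0"
      using tendsto_ennrealI[OF rs_lim[OF s_pos, of C]] by simp
  qed
  finally have "AE x in lborel. liminf (\<lambda>n. indicator \<Omega> x * ennreal \<bar>?H n x - ?A * W x\<bar>) = 0"
    by (subst (asm) le_zero_eq, subst (asm) nn_integral_0_iff_AE) auto
  then have VW: "AE x in lborel. x \<in> \<Omega> \<longrightarrow> V x / ?A = W x"
  proof eventually_elim
    fix x assume 0: "liminf (\<lambda>n. indicator \<Omega> x * ennreal \<bar>?H n x - ?A * W x\<bar>) = 0"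
    show "x \<in> \<Omega> \<longrightarrow> V x / ?A = W x"
    proof
      assume x: "x \<in> \<Omega>"
      have "(\<lambda>n. ennreal \<bar>?H n x - ?A * W x\<bar>) \<longlonglongrightarrow> ennreal \<bar>V x - ?A * W x\<bar>"
        by (intro tendsto_ennrealI tendsto_rabs tendsto_diff tendsto_const V_lim[OF x])
      from lim_imp_Liminf[OF sequentially_bot this] have "ennreal \<bar>V x - ?A * W x\<bar> = 0"
        using 0 x by simp
      then have "V x = ?A * W x" by simp
      then show "V x / ?A = W x" using profile_mass_pos[where 'a='a] by simp
    qed
  qed
  have cont: "continuous_on \<Omega> (\<lambda>x. V x / ?A)"
    using profile_mass_pos[where 'a='a] by (intro continuous_intros V_cont) auto
  show ?thesis by (rule that[OF resolvent_cong_AE[OF W(1) VW cont] cont])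
qed

lemma resolvent_continuous_bound:
  assumes l: "l > 0" and f: "f \<in> L2 \<Omega>" and fM: "\<And>x. x \<in> \<Omega> \<Longrightarrow> \<bar>f x\<bar> \<le> M" and M: "0 \<le> M"
    and V: "resolvent l f V" "continuous_on \<Omega> V" and x: "x \<in> \<Omega>"
  shows "\<bar>V x\<bar> \<le> M / l\<^sup>2"
proof -
  \<comment> \<open>The inequality is written as an equality of continuous functions so that it
    passes from almost everywhere to every point.\<close>
  have "max \<bar>V x\<bar> (M / l\<^sup>2) = M / l\<^sup>2"
  proof (rule continuous_AE_eq_on_open[OF _ \<Omega>_open _ _ x])
    show "AE x in lborel. x \<in> \<Omega> \<longrightarrow> max \<bar>V x\<bar> (M / l\<^sup>2) = M / l\<^sup>2"
    proof -
      have "AE x in lborel. x \<in> \<Omega> \<longrightarrow> \<bar>V x\<bar> \<le> M / l\<^sup>2" by (rule resolvent_bounded[OF l f fM M V(1)])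
      then show ?thesis by eventually_elim auto
    qed
  qed (intro continuous_intros V(2))+
  then show ?thesis by linarith
qed

lemma resolvent_continuous_unique:
  assumes "resolvent l f V" "resolvent l f W" "continuous_on \<Omega> V" "continuous_on \<Omega> W" "x \<in> \<Omega>"
  shows "V x = W x"
  using continuous_AE_eq_on_open[OF resolvent_unique[OF assms(1,2)] \<Omega>_open assms(3,4,5)] .

end

section \<open>The Laplace transform of the wave\<close>

text \<open>The function t \<mapsto> q t * g for simple q, one level set per value. The value 0 is
  left out since its level set may have infinite measure; the choice merely fixes an enumeration of
  the finite range.\<close>

definition scalar_simple_list :: "'b measure \<Rightarrow> ('b \<Rightarrow> real) \<Rightarrow> ('a \<Rightarrow> real) \<Rightarrow> ('b set \<times> ('a \<Rightarrow> real)) list" where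
  "scalar_simple_list M q g = map (\<lambda>c. (q -` {c} \<inter> space M, \<lambda>x. c * g x))
     (SOME cs. set cs = q ` space M - {0} \<and> distinct cs)"

lemma scalar_simple_list_sum:
  assumes "finite (q ` space M)"
  shows "(\<Sum>(A, g')\<leftarrow>scalar_simple_list M q g. P A g') = (\<Sum>c\<in>q ` space M - {0}. P (q -` {c} \<inter> space M) (\<lambda>x. c * g x))"
    and "set (scalar_simple_list M q g) = (\<lambda>c. (q -` {c} \<inter> space M, \<lambda>x. c * g x)) ` (q ` space M - {0})"
proof -
  let ?cs = "SOME cs. set cs = q ` space M - {0} \<and> distinct cs"
  have cs: "set ?cs = q ` space M - {0} \<and> distinct ?cs"
    by (rule someI_ex) (use assms in \<open>auto intro: finite_distinct_list\<close>)
  show "(\<Sum>(A, g')\<leftarrow>scalar_simple_list M q g. P A g') = (\<Sum>c\<in>q ` space M - {0}. P (q -` {c} \<inter> space M) (\<lambda>x. c * g x))"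
    using cs by (simp add: scalar_simple_list_def o_def sum_list_distinct_conv_sum_set)
  show "set (scalar_simple_list M q g) = (\<lambda>c. (q -` {c} \<inter> space M, \<lambda>x. c * g x)) ` (q ` space M - {0})"
    using cs by (simp add: scalar_simple_list_def)
qed

lemma simple_value_scalar:
  assumes q: "Bochner_Integration.simple_bochner_integrable M q" and t: "t \<in> space M"
  shows "simple_value (scalar_simple_list M q g) t x = q t * g x"
proof -
  have fin: "finite (q ` space M)" using q by (auto simp: Bochner_Integration.simple_bochner_integrable.simps simple_function_def)
  have "simple_value (scalar_simple_list M q g) t x = (\<Sum>c\<in>q ` space M - {0}. if c = q t then c * g x else 0)"
    unfolding simple_value_def scalar_simple_list_sum(1)[OF fin]
    using t by (intro sum.cong) (auto simp: indicator_def)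
  also have "\<dots> = q t * g x" using fin t by (cases "q t = 0") auto
  finally show ?thesis .
qed

lemma simple_integral_scalar:
  assumes q: "Bochner_Integration.simple_bochner_integrable M q"
  shows "simple_integral M (scalar_simple_list M q g) x = (\<integral>t. q t \<partial>M) * g x"
proof -
  have fin: "finite (q ` space M)" using q by (auto simp: Bochner_Integration.simple_bochner_integrable.simps simple_function_def)
  have "(\<integral>t. q t \<partial>M) = (\<Sum>c\<in>q ` space M. measure M {t \<in> space M. q t = c} * c)"
    unfolding simple_bochner_integrable_eq_integral[OF q, symmetric] simple_bochner_integral_def by simp
  also have "\<dots> = (\<Sum>c\<in>q ` space M - {0}. measure M (q -` {c} \<inter> space M) * c)"
    using fin by (intro sum.mono_neutral_cong_right) (auto intro!: arg_cong[where f="measure M"])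
  finally show ?thesis
    unfolding simple_integral_def scalar_simple_list_sum(1)[OF fin] by (simp add: sum_distrib_right mult.assoc)
qed

lemma L2_simple_integrable_scalar:
  assumes q: "Bochner_Integration.simple_bochner_integrable M q" and g: "g \<in> L2 \<Omega>"
  shows "L2_simple_integrable \<Omega> M (scalar_simple_list M q g)"
proof -
  have sf: "simple_function M q" and em: "emeasure M {t \<in> space M. q t \<noteq> 0} \<noteq> \<infinity>"
    using q by (auto simp: Bochner_Integration.simple_bochner_integrable.simps)
  have fin: "finite (q ` space M)" using sf by (simp add: simple_function_def)
  have ms: "q -` {c} \<inter> space M \<in> sets M" for c using sf by (rule simple_functionD(2))
  have [measurable]: "q \<in> borel_measurable M" using sf by (rule borel_measurable_simple_function)
  have "emeasure M (q -` {c} \<inter> space M) < \<infinity>" if "c \<noteq> 0" for c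
  proof -
    have "emeasure M (q -` {c} \<inter> space M) \<le> emeasure M {t \<in> space M. q t \<noteq> 0}"
      using that by (intro emeasure_mono) auto
    then show ?thesis using em by (simp add: less_top[symmetric] top_unique) (metis neq_top_trans)
  qed
  then show ?thesis unfolding L2_simple_integrable_def scalar_simple_list_sum(2)[OF fin]
    using ms g by (auto intro: L2_cmult)
qed

context L2_basis
begin

lemma coef_sum_list:
  assumes "\<And>p. p \<in> set S \<Longrightarrow> snd p \<in> L2 \<Omega>"
  shows "(\<lambda>x. \<Sum>(A, g)\<leftarrow>S. c A * g x) \<in> L2 \<Omega> \<and> coef (\<lambda>x. \<Sum>(A, g)\<leftarrow>S. c A * g x) k = (\<Sum>(A, g)\<leftarrow>S. c A * coef g k)"
  using assms
proof (induction S)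
  case Nil
  have "(\<lambda>x. 0) \<in> L2 \<Omega>" using L2_cmult[OF \<phi>_L2, of 0 0] by simp
  then show ?case by (simp add: coef_def L2_inner_def)
next
  case (Cons p S)
  obtain A g where p: "p = (A, g)" by fastforce
  have g: "g \<in> L2 \<Omega>" using Cons.prems[of p] p by simp
  have IH: "(\<lambda>x. \<Sum>(A, g)\<leftarrow>S. c A * g x) \<in> L2 \<Omega>"
    "coef (\<lambda>x. \<Sum>(A, g)\<leftarrow>S. c A * g x) k = (\<Sum>(A, g)\<leftarrow>S. c A * coef g k)"
    using Cons by auto
  show ?case
    using L2_lincomb[OF g IH(1), of "c A" 1] coef_lincomb[OF g IH(1), of "c A" 1 k] IH(2)
    by (simp add: p)
qed

lemma coef_le_L2_norm: "f \<in> L2 \<Omega> \<Longrightarrow> \<bar>coef f k\<bar> \<le> L2_norm \<Omega> f"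
  using L2_inner_cauchy_schwarz[OF _ \<phi>_L2, of f k] by (simp add: coef_def L2_norm_def[of \<Omega> "\<phi> k"] orthonormal)

text \<open>A coefficient is a linear functional bounded by the norm, so it commutes with the
  integral of simple functions and, by the two limits in the definition, with the Bochner
  integral.\<close>

lemma coef_L2_bochner_integral:
  assumes F: "has_L2_bochner_integral \<Omega> M F G" and int: "integrable M (\<lambda>t. coef (F t) k)"
  shows "coef G k = (\<integral>t. coef (F t) k \<partial>M)"
proof -
  from F obtain S where FL: "\<And>t. t \<in> space M \<Longrightarrow> F t \<in> L2 \<Omega>" and G: "G \<in> L2 \<Omega>"
    and S: "\<And>n. L2_simple_integrable \<Omega> M (S n)"
    and lim1: "(\<lambda>n. \<integral>\<^sup>+ t. ennreal (L2_norm \<Omega> (\<lambda>x. F t x - simple_value (S n) t x)) \<partial>M) \<longlonglongrightarrow> 0"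
    and lim2: "(\<lambda>n. L2_norm \<Omega> (\<lambda>x. simple_integral M (S n) x - G x)) \<longlonglongrightarrow> 0"
    unfolding has_L2_bochner_integral_def by blast
  have Sg: "p \<in> set (S n) \<Longrightarrow> snd p \<in> L2 \<Omega>" for p n using S[of n] by (auto simp: L2_simple_integrable_def)
  have val: "simple_value (S n) t \<in> L2 \<Omega>" "coef (simple_value (S n) t) k = (\<Sum>(A, g)\<leftarrow>S n. indicator A t * coef g k)" for n t
    using coef_sum_list[of "S n" "\<lambda>A. indicator A t" k] Sg unfolding simple_value_def[abs_def] by auto
  have sint: "simple_integral M (S n) \<in> L2 \<Omega>" "coef (simple_integral M (S n)) k = (\<Sum>(A, g)\<leftarrow>S n. measure M A * coef g k)" for n
    using coef_sum_list[of "S n" "measure M" k] Sg unfolding simple_integral_def[abs_def] by auto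
  have ints: "integrable M (\<lambda>t. \<Sum>(A, g)\<leftarrow>T. indicator A t * coef g k) \<and>
      (\<integral>t. (\<Sum>(A, g)\<leftarrow>T. indicator A t * coef g k) \<partial>M) = (\<Sum>(A, g)\<leftarrow>T. measure M A * coef g k)"
    if "L2_simple_integrable \<Omega> M T" for T
    using that
  proof (induction T)
    case (Cons p T)
    obtain A g where p: "p = (A, g)" by fastforce
    have A: "A \<in> sets M" "emeasure M A < \<infinity>" using Cons.prems by (auto simp: L2_simple_integrable_def p)
    have T: "L2_simple_integrable \<Omega> M T" using Cons.prems by (auto simp: L2_simple_integrable_def)
    have i: "integrable M (\<lambda>t. indicator A t * coef g k)"
      using A by (intro integrable_mult_left integrable_real_indicator) auto
    have "(\<integral>t. indicator A t * coef g k \<partial>M) = measure M A * coef g k"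
      using A sets.sets_into_space[OF A(1)] by (simp add: Int_absorb2)
    then show ?case using Cons.IH[OF T] i by (simp add: p)
  qed simp
  have sq: "coef (simple_integral M (S n)) k = (\<integral>t. coef (simple_value (S n) t) k \<partial>M)" and
    si: "integrable M (\<lambda>t. coef (simple_value (S n) t) k)" for n
    using ints[OF S[of n]] by (simp_all add: val sint)
  have bound: "ennreal \<bar>(\<integral>t. coef (F t) k \<partial>M) - coef (simple_integral M (S n)) k\<bar>
      \<le> (\<integral>\<^sup>+ t. ennreal (L2_norm \<Omega> (\<lambda>x. F t x - simple_value (S n) t x)) \<partial>M)" for n
  proof -
    have "ennreal \<bar>(\<integral>t. coef (F t) k \<partial>M) - coef (simple_integral M (S n)) k\<bar>
        = ennreal (norm (\<integral>t. coef (F t) k - coef (simple_value (S n) t) k \<partial>M))"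
      unfolding sq using int si by simp
    also have "\<dots> \<le> (\<integral>\<^sup>+ t. ennreal (norm (coef (F t) k - coef (simple_value (S n) t) k)) \<partial>M)"
      by (rule integral_norm_bound_ennreal[OF Bochner_Integration.integrable_diff[OF int si]])
    also have "\<dots> \<le> (\<integral>\<^sup>+ t. ennreal (L2_norm \<Omega> (\<lambda>x. F t x - simple_value (S n) t x)) \<partial>M)"
    proof (rule nn_integral_mono)
      fix t assume t: "t \<in> space M"
      show "ennreal (norm (coef (F t) k - coef (simple_value (S n) t) k)) \<le> ennreal (L2_norm \<Omega> (\<lambda>x. F t x - simple_value (S n) t x))"
        using coef_le_L2_norm[OF L2_diff[OF FL[OF t] val(1)[of n t]], of k]
        by (intro ennreal_leI) (simp add: coef_diff[OF FL[OF t] val(1)])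
    qed
    finally show ?thesis .
  qed
  have "(\<lambda>n. ennreal \<bar>(\<integral>t. coef (F t) k \<partial>M) - coef (simple_integral M (S n)) k\<bar>) \<longlonglongrightarrow> 0"
    by (rule tendsto_sandwich[OF _ _ tendsto_const lim1]) (auto intro: always_eventually bound)
  then have "(\<lambda>n. \<bar>(\<integral>t. coef (F t) k \<partial>M) - coef (simple_integral M (S n)) k\<bar>) \<longlonglongrightarrow> 0"
    by (simp add: tendsto_ennreal_iff[where x=0, simplified] flip: ennreal_0)
  from tendsto_diff[OF tendsto_const[of "\<integral>t. coef (F t) k \<partial>M"] tendsto_rabs_zero_cancel[OF this]]
  have l1: "(\<lambda>n. coef (simple_integral M (S n)) k) \<longlonglongrightarrow> (\<integral>t. coef (F t) k \<partial>M)" by simp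
  have "(\<lambda>n. L2_norm \<Omega> (\<lambda>x. G x - simple_integral M (S n) x)) \<longlonglongrightarrow> 0"
    using lim2 unfolding L2_norm_restr restr_diff by (simp add: sq_norm_minus_commute)
  then have "(\<lambda>n. coef (simple_integral M (S n)) k) \<longlonglongrightarrow> coef G k"
    unfolding coef_def by (rule tendsto_L2_inner[OF sint(1) G \<phi>_L2])
  then show ?thesis using l1 LIMSEQ_unique by blast
qed

text \<open>Parseval, with a sum of squares estimated by the square of a sum. The split fits the
  approximation below: finitely many coefficients are controlled in L1 in time, the tail by a
  dominating sequence.\<close>

lemma L2_norm_le_coefs:
  assumes f: "f \<in> L2 \<Omega>"
  shows "L2_norm \<Omega> f \<le> (\<Sum>k<n. \<bar>coef f k\<bar>) + sqrt (\<Sum>k. (coef f (k + n))\<^sup>2)"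
proof -
  let ?s = "\<Sum>k<n. \<bar>coef f k\<bar>" and ?t = "\<Sum>k. (coef f (k + n))\<^sup>2"
  have sm: "summable (\<lambda>k. (coef f k)\<^sup>2)" by (rule summable_coef[OF f])
  have t0: "?t \<ge> 0" by (intro suminf_nonneg summable_ignore_initial_segment[OF sm]) auto
  have s0: "?s \<ge> 0" by (intro sum_nonneg) auto
  have "(\<Sum>k<n. (coef f k)\<^sup>2) \<le> ?s\<^sup>2"
  proof (induction n)
    case (Suc n)
    have "0 \<le> 2 * (\<Sum>k<n. \<bar>coef f k\<bar>) * \<bar>coef f n\<bar>" by (intro mult_nonneg_nonneg sum_nonneg) auto
    then show ?case using Suc unfolding sum.lessThan_Suc power2_sum power2_abs by linarith
  qed simp
  moreover have "L2_inner \<Omega> f f = ?t + (\<Sum>k<n. (coef f k)\<^sup>2)"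
    using suminf_split_initial_segment[OF sm, of n] sums_unique[OF parseval[OF f]] by simp
  ultimately have "(L2_norm \<Omega> f)\<^sup>2 \<le> ?s\<^sup>2 + (sqrt ?t)\<^sup>2" using t0 by (simp add: L2_norm_square)
  also have "\<dots> \<le> (?s + sqrt ?t)\<^sup>2"
    using s0 t0 by (simp add: power2_sum)
  finally show ?thesis using s0 t0 by (intro power2_le_imp_le[of "L2_norm \<Omega> f"]) auto
qed

text \<open>The n-th approximant replaces each of the first n coefficient functions by a scalar
  simple function and drops the rest. The norm of the error is at most the sum of n scalar errors
  plus w times the tail of b, and both tend to 0 in the integral over M.\<close>

lemma has_L2_bochner_integralI:
  assumes F: "\<And>t. t \<in> space M \<Longrightarrow> F t \<in> L2 \<Omega>" and G: "G \<in> L2 \<Omega>"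
    and int: "\<And>k. integrable M (\<lambda>t. coef (F t) k)"
    and coefG: "\<And>k. coef G k = (\<integral>t. coef (F t) k \<partial>M)"
    and w: "integrable M w" "\<And>t. t \<in> space M \<Longrightarrow> 0 \<le> w t"
    and b: "summable (\<lambda>k. (b k)\<^sup>2)"
    and dom: "\<And>t k. t \<in> space M \<Longrightarrow> \<bar>coef (F t) k\<bar> \<le> w t * \<bar>b k\<bar>"
  shows "has_L2_bochner_integral \<Omega> M F G"
proof -
  \<comment> \<open>The square is needed because n such errors are added, giving n / (n +
    1)^2.\<close>
  have "\<exists>q. Bochner_Integration.simple_bochner_integrable M q \<and> (\<integral>\<^sup>+t. ennreal (norm (coef (F t) k - q t)) \<partial>M) \<le> ennreal (1 / (real n + 1)\<^sup>2)" for k n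
  proof -
    from int[of k] obtain I where "has_bochner_integral M (\<lambda>t. coef (F t) k) I" by (auto simp: integrable.simps)
    then obtain q where q: "\<And>i. Bochner_Integration.simple_bochner_integrable M (q i)"
      "(\<lambda>i. \<integral>\<^sup>+t. ennreal (norm (coef (F t) k - q i t)) \<partial>M) \<longlonglongrightarrow> 0"
      by (elim has_bochner_integral.cases) blast
    have "eventually (\<lambda>i. (\<integral>\<^sup>+t. ennreal (norm (coef (F t) k - q i t)) \<partial>M) < ennreal (1 / (real n + 1)\<^sup>2)) sequentially"
      by (rule order_tendstoD(2)[OF q(2)]) simp
    then obtain i where "(\<integral>\<^sup>+t. ennreal (norm (coef (F t) k - q i t)) \<partial>M) < ennreal (1 / (real n + 1)\<^sup>2)"
      by (auto simp: eventually_sequentially)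
    then show ?thesis using q(1) by (intro exI[of _ "q i"]) auto
  qed
  then obtain q where q: "\<And>k n. Bochner_Integration.simple_bochner_integrable M (q k n)"
    and q_le: "\<And>k n. (\<integral>\<^sup>+t. ennreal (norm (coef (F t) k - q k n t)) \<partial>M) \<le> ennreal (1 / (real n + 1)\<^sup>2)"
    by metis
  have q_int: "integrable M (q k n)" for k n
    by (rule integrableI_simple_bochner_integrable[OF q])
  define S where "S n = concat (map (\<lambda>k. scalar_simple_list M (q k n) (\<phi> k)) [0..<n])" for n
  have sl: "(\<Sum>p\<leftarrow>concat (map L [0..<n]). P p) = (\<Sum>k<n. \<Sum>p\<leftarrow>L k. P p)"
    for L :: "nat \<Rightarrow> ('b set \<times> ('a \<Rightarrow> real)) list" and P :: "_ \<Rightarrow> real" and n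
    by (induction n) auto
  have val: "simple_value (S n) t = (\<lambda>x. \<Sum>k<n. q k n t * \<phi> k x)" if t: "t \<in> space M" for n t
  proof
    fix x
    have "simple_value (S n) t x = (\<Sum>k<n. simple_value (scalar_simple_list M (q k n) (\<phi> k)) t x)"
      unfolding simple_value_def S_def by (rule sl)
    then show "simple_value (S n) t x = (\<Sum>k<n. q k n t * \<phi> k x)" by (simp add: simple_value_scalar[OF q t])
  qed
  have sint: "simple_integral M (S n) = (\<lambda>x. \<Sum>k<n. (\<integral>t. q k n t \<partial>M) * \<phi> k x)" for n
  proof
    fix x
    have "simple_integral M (S n) x = (\<Sum>k<n. simple_integral M (scalar_simple_list M (q k n) (\<phi> k)) x)"
      unfolding simple_integral_def S_def by (rule sl)
    then show "simple_integral M (S n) x = (\<Sum>k<n. (\<integral>t. q k n t \<partial>M) * \<phi> k x)" by (simp add: simple_integral_scalar[OF q])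
  qed
  have S_simple: "L2_simple_integrable \<Omega> M (S n)" for n
    using L2_simple_integrable_scalar[OF q \<phi>_L2] unfolding L2_simple_integrable_def S_def by fastforce
  define R where "R n = sqrt (\<Sum>k. (b (k + n))\<^sup>2)" for n
  have bn: "summable (\<lambda>k. (b (k + n))\<^sup>2)" for n by (rule summable_ignore_initial_segment[OF b])
  have R_lim: "R \<longlonglongrightarrow> 0"
    unfolding R_def using tendsto_real_sqrt[OF suminf_exist_split2[OF b]] by simp
  have D: "(\<lambda>x. F t x - simple_value (S n) t x) \<in> L2 \<Omega>" if "t \<in> space M" for t n
    unfolding val[OF that] by (intro L2_diff F[OF that] partial_sum_L2)
  have coefD: "coef (\<lambda>x. F t x - simple_value (S n) t x) k = coef (F t) k - (if k < n then q k n t else 0)"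
    if "t \<in> space M" for t n k
    unfolding val[OF that] by (simp add: coef_diff[OF F[OF that] partial_sum_L2] coef_partial_sum)
  have normD: "L2_norm \<Omega> (\<lambda>x. F t x - simple_value (S n) t x) \<le> (\<Sum>k<n. norm (coef (F t) k - q k n t)) + w t * R n"
    if t: "t \<in> space M" for t n
  proof -
    have "(\<Sum>k. (coef (\<lambda>x. F t x - simple_value (S n) t x) (k + n))\<^sup>2) \<le> (\<Sum>k. (w t)\<^sup>2 * (b (k + n))\<^sup>2)"
    proof (intro suminf_le summable_mult bn)
      show "summable (\<lambda>k. (coef (\<lambda>x. F t x - simple_value (S n) t x) (k + n))\<^sup>2)"
        by (rule summable_ignore_initial_segment[OF summable_coef[OF D[OF t]]])
      fix k
      have "\<bar>coef (F t) (k + n)\<bar> \<le> \<bar>w t * b (k + n)\<bar>" using dom[OF t, of "k + n"] w(2)[OF t] by (simp add: abs_mult)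
      then show "(coef (\<lambda>x. F t x - simple_value (S n) t x) (k + n))\<^sup>2 \<le> (w t)\<^sup>2 * (b (k + n))\<^sup>2"
        by (simp add: coefD[OF t] abs_le_square_iff power_mult_distrib)
    qed
    also have "\<dots> = (w t)\<^sup>2 * (\<Sum>k. (b (k + n))\<^sup>2)" by (rule suminf_mult[OF bn])
    finally have "sqrt (\<Sum>k. (coef (\<lambda>x. F t x - simple_value (S n) t x) (k + n))\<^sup>2) \<le> w t * R n"
      using real_sqrt_le_mono w(2)[OF t] by (fastforce simp: R_def real_sqrt_mult)
    moreover have "(\<Sum>k<n. \<bar>coef (\<lambda>x. F t x - simple_value (S n) t x) k\<bar>) = (\<Sum>k<n. norm (coef (F t) k - q k n t))"
      by (intro sum.cong) (auto simp: coefD[OF t])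
    ultimately show ?thesis using L2_norm_le_coefs[OF D[OF t], of n n] by linarith
  qed
  \<comment> \<open>By Parseval the norm is a series of measurable coefficient functions; joint
    measurability in t and x is never invoked.\<close>
  have meas: "(\<lambda>t. L2_norm \<Omega> (\<lambda>x. F t x - simple_value (S n) t x)) \<in> borel_measurable M" for n
  proof -
    have [measurable]: "(\<lambda>t. coef (F t) k) \<in> borel_measurable M" "q k n \<in> borel_measurable M" for k
      using int q_int by auto
    have "(\<lambda>t. sqrt (\<Sum>k. (coef (F t) k - (if k < n then q k n t else 0))\<^sup>2)) \<in> borel_measurable M" by measurable
    moreover have "sqrt (\<Sum>k. (coef (F t) k - (if k < n then q k n t else 0))\<^sup>2) = L2_norm \<Omega> (\<lambda>x. F t x - simple_value (S n) t x)"
      if "t \<in> space M" for t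
      using sums_unique[OF parseval[OF D[OF that, of n]]] by (simp add: L2_norm_def coefD[OF that])
    ultimately show ?thesis by (simp cong: measurable_cong)
  qed
  define Kw where "Kw = (\<integral>t. w t \<partial>M)"
  have Kw: "Kw \<ge> 0" unfolding Kw_def using w(2) by (intro integral_nonneg_AE) auto
  have R0: "R n \<ge> 0" for n using bn by (auto simp: R_def intro!: suminf_nonneg)
  have nn: "(\<integral>\<^sup>+ t. ennreal (L2_norm \<Omega> (\<lambda>x. F t x - simple_value (S n) t x)) \<partial>M) \<le> ennreal (real n / (real n + 1)\<^sup>2 + Kw * R n)" for n
  proof -
    have [measurable]: "(\<lambda>t. coef (F t) k) \<in> borel_measurable M" "q k n \<in> borel_measurable M" "w \<in> borel_measurable M" for k
      using int q_int w by auto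
    have "(\<integral>\<^sup>+ t. ennreal (L2_norm \<Omega> (\<lambda>x. F t x - simple_value (S n) t x)) \<partial>M)
        \<le> (\<integral>\<^sup>+ t. (\<Sum>k<n. ennreal (norm (coef (F t) k - q k n t))) + ennreal (w t) * ennreal (R n) \<partial>M)"
    proof (rule nn_integral_mono)
      fix t assume t: "t \<in> space M"
      have "ennreal (L2_norm \<Omega> (\<lambda>x. F t x - simple_value (S n) t x)) \<le> ennreal ((\<Sum>k<n. norm (coef (F t) k - q k n t)) + w t * R n)"
        by (rule ennreal_leI[OF normD[OF t]])
      also have "\<dots> = (\<Sum>k<n. ennreal (norm (coef (F t) k - q k n t))) + ennreal (w t) * ennreal (R n)"
        using R0 w(2)[OF t] by (simp add: ennreal_plus sum_nonneg sum_ennreal ennreal_mult)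
      finally show "ennreal (L2_norm \<Omega> (\<lambda>x. F t x - simple_value (S n) t x)) \<le> \<dots>" .
    qed
    also have "\<dots> = (\<Sum>k<n. (\<integral>\<^sup>+ t. ennreal (norm (coef (F t) k - q k n t)) \<partial>M)) + (\<integral>\<^sup>+ t. ennreal (w t) \<partial>M) * ennreal (R n)"
      by (simp add: nn_integral_add nn_integral_sum nn_integral_multc del: sum_ennreal)
    also have "(\<integral>\<^sup>+ t. ennreal (w t) \<partial>M) = ennreal Kw"
      unfolding Kw_def using w by (intro nn_integral_eq_integral) auto
    also have "(\<Sum>k<n. (\<integral>\<^sup>+ t. ennreal (norm (coef (F t) k - q k n t)) \<partial>M)) \<le> (\<Sum>k<n. ennreal (1 / (real n + 1)\<^sup>2))"
      by (intro sum_mono q_le)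
    also have "\<dots> = ennreal (real n / (real n + 1)\<^sup>2)"
      by (subst sum_ennreal) auto
    also have "ennreal (real n / (real n + 1)\<^sup>2) + ennreal Kw * ennreal (R n) = ennreal (real n / (real n + 1)\<^sup>2 + Kw * R n)"
      using Kw R0 by (simp add: ennreal_mult[symmetric] ennreal_plus[symmetric] del: ennreal_plus)
    finally show ?thesis by (simp add: add_right_mono)
  qed
  have c_lim: "(\<lambda>n. real n / (real n + 1)\<^sup>2) \<longlonglongrightarrow> 0" by real_asymp
  have "(\<lambda>n. real n / (real n + 1)\<^sup>2 + Kw * R n) \<longlonglongrightarrow> 0 + Kw * 0"
    by (intro tendsto_intros c_lim R_lim)
  then have up: "(\<lambda>n. ennreal (real n / (real n + 1)\<^sup>2 + Kw * R n)) \<longlonglongrightarrow> 0"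
    using tendsto_ennrealI by fastforce
  have lim1: "(\<lambda>n. \<integral>\<^sup>+ t. ennreal (L2_norm \<Omega> (\<lambda>x. F t x - simple_value (S n) t x)) \<partial>M) \<longlonglongrightarrow> 0"
    by (rule tendsto_sandwich[OF _ _ tendsto_const up]) (auto intro: always_eventually nn)
  have lim2: "(\<lambda>n. L2_norm \<Omega> (\<lambda>x. simple_integral M (S n) x - G x)) \<longlonglongrightarrow> 0"
  proof (rule Lim_null_comparison)
    define RG where "RG n = sqrt (\<Sum>k. (coef G (k + n))\<^sup>2)" for n
    have RG_lim: "RG \<longlonglongrightarrow> 0"
      unfolding RG_def using tendsto_real_sqrt[OF suminf_exist_split2[OF summable_coef[OF G]]] by simp
    show "(\<lambda>n. real n / (real n + 1)\<^sup>2 + RG n) \<longlonglongrightarrow> 0" using tendsto_add[OF c_lim RG_lim] by simp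
    have "norm (L2_norm \<Omega> (\<lambda>x. simple_integral M (S n) x - G x)) \<le> real n / (real n + 1)\<^sup>2 + RG n" for n
    proof -
      let ?d = "\<lambda>x. simple_integral M (S n) x - G x"
      have d: "?d \<in> L2 \<Omega>" unfolding sint by (intro L2_diff partial_sum_L2 G)
      have cd: "coef ?d k = (if k < n then (\<integral>t. q k n t \<partial>M) else 0) - (\<integral>t. coef (F t) k \<partial>M)" for k
        unfolding sint coef_diff[OF partial_sum_L2 G] coef_partial_sum coefG ..
      have "\<bar>coef ?d k\<bar> \<le> 1 / (real n + 1)\<^sup>2" if "k < n" for k
      proof -
        have "ennreal \<bar>coef ?d k\<bar> = ennreal (norm (\<integral>t. coef (F t) k - q k n t \<partial>M))"
          using int q_int that by (simp add: cd abs_minus_commute)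
        also have "\<dots> \<le> (\<integral>\<^sup>+t. ennreal (norm (coef (F t) k - q k n t)) \<partial>M)"
          by (rule integral_norm_bound_ennreal[OF Bochner_Integration.integrable_diff[OF int q_int]])
        also have "\<dots> \<le> ennreal (1 / (real n + 1)\<^sup>2)" by (rule q_le)
        finally show ?thesis by simp
      qed
      then have "(\<Sum>k<n. \<bar>coef ?d k\<bar>) \<le> (\<Sum>k<n. 1 / (real n + 1)\<^sup>2)" by (intro sum_mono) auto
      moreover have "(\<Sum>k. (coef ?d (k + n))\<^sup>2) = (\<Sum>k. (coef G (k + n))\<^sup>2)"
        by (simp add: cd coefG)
      ultimately show ?thesis using L2_norm_le_coefs[OF d, of n] by (simp add: RG_def)
    qed
    then show "eventually (\<lambda>n. norm (L2_norm \<Omega> (\<lambda>x. simple_integral M (S n) x - G x)) \<le> real n / (real n + 1)\<^sup>2 + RG n) sequentially"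
      by simp
  qed
  show ?thesis
    unfolding has_L2_bochner_integral_def using F G S_simple meas lim1 lim2 by blast
qed

end

section \<open>Scalar Laplace transforms\<close>

lemma integrable_exp_half_line:
  fixes l :: real
  assumes "l > 0"
  shows "integrable lborel (\<lambda>t. indicator {0..} t * exp (- l * t))"
proof (rule integrableI_nonneg)
  have "(\<integral>\<^sup>+t. ennreal (exp (- l * t)) * indicator {0..} t \<partial>lborel) = ennreal (0 - (- exp (- l * 0) / l))"
  proof (rule nn_integral_FTC_atLeast)
    show "((\<lambda>t. - exp (- l * t) / l) has_real_derivative exp (- l * t)) (at t)" for t
      using assms by (auto intro!: derivative_eq_intros)
    show "((\<lambda>t. - exp (- l * t) / l) \<longlongrightarrow> 0) at_top" using assms by real_asymp
  qed auto
  moreover have "(\<integral>\<^sup>+t. ennreal (indicator {0..} t * exp (- l * t)) \<partial>lborel) = (\<integral>\<^sup>+t. ennreal (exp (- l * t)) * indicator {0..} t \<partial>lborel)"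
    by (intro nn_integral_cong) (auto split: split_indicator)
  ultimately show "(\<integral>\<^sup>+t. ennreal (indicator {0..} t * exp (- l * t)) \<partial>lborel) < \<infinity>" by simp
qed auto

lemma integrable_mult_exp_half_line:
  fixes l :: real
  assumes l: "l > 0"
  shows "integrable lborel (\<lambda>t. indicator {0..} t * (t * exp (- l * t)))"
proof (rule Bochner_Integration.integrable_bound)
  show "integrable lborel (\<lambda>t. (2 / l) * (indicator {0..} t * exp (- (l / 2) * t)))"
    using l by (intro integrable_mult_right integrable_exp_half_line) auto
  show "AE t in lborel. norm (indicator {0..} t * (t * exp (- l * t))) \<le> norm ((2 / l) * (indicator {0..} t * exp (- (l / 2) * t)))"
  proof (rule AE_I2)
    fix t :: real
    show "norm (indicator {0..} t * (t * exp (- l * t))) \<le> norm ((2 / l) * (indicator {0..} t * exp (- (l / 2) * t)))"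
    proof (cases "t \<ge> 0")
      case True
      have "l / 2 * t \<le> exp (l / 2 * t)" using exp_ge_add_one_self[of "l / 2 * t"] by linarith
      then have "t \<le> 2 / l * exp (l / 2 * t)" using l by (simp add: field_simps)
      then have "t * exp (- l * t) \<le> 2 / l * exp (l / 2 * t) * exp (- l * t)" by (rule mult_right_mono) simp
      also have "\<dots> = 2 / l * exp (- (l / 2) * t)" by (simp add: exp_add[symmetric] field_simps)
      finally show ?thesis using True l by simp
    qed simp
  qed
qed measurable

lemma laplace_transform_sin:
  fixes l w :: real
  assumes l: "l > 0" and w: "w > 0"
  shows "integrable lborel (\<lambda>t. indicator {0..} t * (exp (- l * t) * (sin (w * t) / w)))"
    and "(\<integral>t. indicator {0..} t * (exp (- l * t) * (sin (w * t) / w)) \<partial>lborel) = 1 / (l\<^sup>2 + w\<^sup>2)"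
proof -
  let ?g = "\<lambda>t. exp (- l * t) * (sin (w * t) / w)"
  show int: "integrable lborel (\<lambda>t. indicator {0..} t * ?g t)"
  proof (rule Bochner_Integration.integrable_bound)
    show "integrable lborel (\<lambda>t. (1 / w) * (indicator {0..} t * exp (- l * t)))"
      using l by (intro integrable_mult_right integrable_exp_half_line)
    have "\<bar>exp (- l * t) * (sin (w * t) / w)\<bar> \<le> 1 / w * exp (- l * t)" for t
      using w mult_left_mono[OF abs_sin_le_one[of "w * t"], of "exp (- l * t) / w"] by (simp add: abs_mult)
    then show "AE t in lborel. norm (indicator {0..} t * ?g t) \<le> norm ((1 / w) * (indicator {0..} t * exp (- l * t)))"
      using w by (intro AE_I2) (auto split: split_indicator)
  qed measurable
  \<comment> \<open>The antiderivative obtained by integrating by parts twice; G vanishes at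
    infinity, and -G 0 is the claimed value.\<close>
  define G where "G t = - exp (- l * t) * (l * (sin (w * t) / w) + cos (w * t)) / (l\<^sup>2 + w\<^sup>2)" for t
  have den: "l\<^sup>2 + w\<^sup>2 > 0" using l by (simp add: add_pos_nonneg)
  have deriv: "(G has_real_derivative ?g t) (at t)" for t
  proof -
    have "((\<lambda>t. - exp (- l * t) * (l * (sin (w * t) / w) + cos (w * t))) has_real_derivative ?g t * (l\<^sup>2 + w\<^sup>2)) (at t)"
      using w by (auto intro!: derivative_eq_intros simp: field_simps power2_eq_square)
    from DERIV_cdivide[OF this, of "l\<^sup>2 + w\<^sup>2"] show ?thesis unfolding G_def using l by simp
  qed
  have "((\<lambda>y. \<integral>t. indicator {..y} t *\<^sub>R (indicator {0..} t * ?g t) \<partial>lborel) \<longlongrightarrow> (\<integral>t. indicator {0..} t * ?g t \<partial>lborel)) at_top"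
    by (rule tendsto_integral_at_top[OF _ int]) simp
  moreover have "eventually (\<lambda>y. (\<integral>t. indicator {..y} t *\<^sub>R (indicator {0..} t * ?g t) \<partial>lborel) = G y - G 0) at_top"
    using eventually_ge_at_top[of 0]
  proof eventually_elim
    case (elim y)
    have "(\<integral>t. indicator {..y} t *\<^sub>R (indicator {0..} t * ?g t) \<partial>lborel) = (\<integral>t. ?g t * indicator {0..y} t \<partial>lborel)"
      by (intro Bochner_Integration.integral_cong) (auto split: split_indicator)
    also have "\<dots> = G y - G 0"
      using elim w by (intro integral_FTC_Icc_real deriv) (auto intro!: continuous_intros)
    finally show ?case .
  qed
  ultimately have "((\<lambda>y. G y - G 0) \<longlongrightarrow> (\<integral>t. indicator {0..} t * ?g t \<partial>lborel)) at_top"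
    by (rule Lim_transform_eventually)
  moreover have "((\<lambda>y. G y - G 0) \<longlongrightarrow> 0 - G 0) at_top"
  proof (rule tendsto_diff[OF _ tendsto_const], rule Lim_null_comparison)
    show "((\<lambda>y. exp (- l * y) * ((l / w + 1) / (l\<^sup>2 + w\<^sup>2))) \<longlongrightarrow> 0) at_top"
    proof (rule tendsto_mult_left_zero)
      show "((\<lambda>y. exp (- l * y)) \<longlongrightarrow> 0) at_top" using l by real_asymp
    qed
    have "norm (G y) \<le> exp (- l * y) * ((l / w + 1) / (l\<^sup>2 + w\<^sup>2))" for y
    proof -
      have "\<bar>l * (sin (w * y) / w)\<bar> \<le> l / w"
        using l w mult_left_mono[OF abs_sin_le_one[of "w * y"], of "l / w"] by (simp add: abs_mult)
      then have "\<bar>l * (sin (w * y) / w) + cos (w * y)\<bar> \<le> l / w + 1"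
        using abs_cos_le_one[of "w * y"] by linarith
      then have "exp (- l * y) * \<bar>l * (sin (w * y) / w) + cos (w * y)\<bar> / (l\<^sup>2 + w\<^sup>2) \<le> exp (- l * y) * (l / w + 1) / (l\<^sup>2 + w\<^sup>2)"
        using den by (intro divide_right_mono mult_left_mono) auto
      moreover have "norm (G y) = exp (- l * y) * \<bar>l * (sin (w * y) / w) + cos (w * y)\<bar> / (l\<^sup>2 + w\<^sup>2)"
        unfolding G_def using den by (simp add: abs_mult)
      ultimately show ?thesis by simp
    qed
    then show "eventually (\<lambda>y. norm (G y) \<le> exp (- l * y) * ((l / w + 1) / (l\<^sup>2 + w\<^sup>2))) at_top" by simp
  qed
  ultimately have "(\<integral>t. indicator {0..} t * ?g t \<partial>lborel) = 0 - G 0"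
    using tendsto_unique[OF trivial_limit_at_top_linorder] by blast
  then show "(\<integral>t. indicator {0..} t * ?g t \<partial>lborel) = 1 / (l\<^sup>2 + w\<^sup>2)" by (simp add: G_def)
qed

context frac_dirichlet
begin

text \<open>The bound |sin (w t) / w| <= |t|, uniform in the frequency, makes the series converge
  for every L2 datum, so the choice in \<open>wave_solution\<close> has a witness.\<close>

lemma wave_solution_L2:
  assumes u: "u0 \<in> L2 \<Omega>"
  shows "wave_solution \<Omega> \<phi> \<mu> u0 t \<in> L2 \<Omega>"
    and "coef (wave_solution \<Omega> \<phi> \<mu> u0 t) k = sin (sqrt (\<mu> k) * t) / sqrt (\<mu> k) * coef u0 k"
proof -
  let ?a = "\<lambda>k. sin (sqrt (\<mu> k) * t) / sqrt (\<mu> k) * coef u0 k"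
  have "summable (\<lambda>k. (?a k)\<^sup>2)"
  proof (rule summable_comparison_test')
    show "summable (\<lambda>k. t\<^sup>2 * (coef u0 k)\<^sup>2)" by (intro summable_mult summable_coef u)
    fix k
    have "\<bar>sin (sqrt (\<mu> k) * t) / sqrt (\<mu> k)\<bar> \<le> \<bar>t\<bar>"
      using abs_sin_x_le_abs_x[of "sqrt (\<mu> k) * t"] \<mu>_pos[of k] by (simp add: abs_mult field_simps)
    then have "(sin (sqrt (\<mu> k) * t) / sqrt (\<mu> k))\<^sup>2 \<le> t\<^sup>2" by (simp only: abs_le_square_iff)
    then have "(sin (sqrt (\<mu> k) * t) / sqrt (\<mu> k))\<^sup>2 * (coef u0 k)\<^sup>2 \<le> t\<^sup>2 * (coef u0 k)\<^sup>2" by (rule mult_right_mono) simp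
    then show "norm ((?a k)\<^sup>2) \<le> t\<^sup>2 * (coef u0 k)\<^sup>2" by (simp add: power_mult_distrib power_divide)
  qed
  then obtain f where "f \<in> L2 \<Omega>" "\<And>x. x \<notin> \<Omega> \<Longrightarrow> f x = 0" "L2_sums \<Omega> (\<lambda>k x. ?a k * \<phi> k x) f"
    by (rule riesz_fischer) blast
  then have "\<exists>f. (\<forall>x. x \<notin> \<Omega> \<longrightarrow> f x = 0) \<and>
     L2_sums \<Omega> (\<lambda>k x. sin (sqrt (\<mu> k) * t) / sqrt (\<mu> k) * L2_inner \<Omega> u0 (\<phi> k) * \<phi> k x) f"
    unfolding coef_def by blast
  from someI_ex[OF this]
  have "L2_sums \<Omega> (\<lambda>k x. ?a k * \<phi> k x) (wave_solution \<Omega> \<phi> \<mu> u0 t)"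
    unfolding wave_solution_def coef_def by blast
  then show "wave_solution \<Omega> \<phi> \<mu> u0 t \<in> L2 \<Omega>" "coef (wave_solution \<Omega> \<phi> \<mu> u0 t) k = ?a k"
    by (simp add: L2_sums_def, rule L2_sums_coef)
qed

lemma coef_cmult: "coef (\<lambda>x. c * f x) k = c * coef f k"
  by (simp add: coef_def L2_inner_cmult)

text \<open>Each coefficient has scalar transform \<open>1 / (l\<^sup>2 + \<mu> k)\<close>. The
  continuous resolvent is thus a witness for the choice in \<open>L2_laplace_transform\<close>, and
  whatever is chosen has the same coefficients.\<close>

lemma laplace_transform_resolvent:
  assumes l: "l > 0" and u: "u0 \<in> L2 \<Omega>" and uM: "\<And>x. x \<in> \<Omega> \<Longrightarrow> \<bar>u0 x\<bar> \<le> M" and M: "0 \<le> M"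
  shows "resolvent l u0 (L2_laplace_transform \<Omega> (wave_solution \<Omega> \<phi> \<mu> u0) l)"
    and "continuous_on \<Omega> (L2_laplace_transform \<Omega> (wave_solution \<Omega> \<phi> \<mu> u0) l)"
proof -
  let ?M = "restrict_space lborel {0::real..}"
  let ?F = "\<lambda>t x. exp (- l * t) * wave_solution \<Omega> \<phi> \<mu> u0 t x"
  have F: "?F t \<in> L2 \<Omega>" for t by (intro L2_cmult wave_solution_L2 u)
  have coefF: "coef (?F t) k = (exp (- l * t) * (sin (sqrt (\<mu> k) * t) / sqrt (\<mu> k))) * coef u0 k" for t k
    unfolding coef_cmult wave_solution_L2(2)[OF u] by simp
  have sq: "sqrt (\<mu> k) > 0" "(sqrt (\<mu> k))\<^sup>2 = \<mu> k" for k using \<mu>_pos[of k] by auto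
  have int: "integrable ?M (\<lambda>t. coef (?F t) k)" for k
    using integrable_mult_left[OF laplace_transform_sin(1)[OF l sq(1)[of k]], of "coef u0 k"]
    unfolding coefF by (simp add: integrable_restrict_space mult_ac)
  have val: "(\<integral>t. coef (?F t) k \<partial>?M) = coef u0 k / (l\<^sup>2 + \<mu> k)" for k
  proof -
    have "(\<integral>t. coef (?F t) k \<partial>?M) = (\<integral>t. (indicator {0..} t * (exp (- l * t) * (sin (sqrt (\<mu> k) * t) / sqrt (\<mu> k)))) * coef u0 k \<partial>lborel)"
      unfolding coefF by (simp add: integral_restrict_space mult.assoc)
    also have "\<dots> = (\<integral>t. indicator {0..} t * (exp (- l * t) * (sin (sqrt (\<mu> k) * t) / sqrt (\<mu> k))) \<partial>lborel) * coef u0 k"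
      by (rule integral_mult_left_zero)
    also have "\<dots> = coef u0 k / (l\<^sup>2 + \<mu> k)"
      unfolding laplace_transform_sin(2)[OF l sq(1)] sq(2) by simp
    finally show ?thesis .
  qed
  obtain V where V: "resolvent l u0 V" "continuous_on \<Omega> V"
    using resolvent_continuous_exists[OF l u uM M] by blast
  have "has_L2_bochner_integral \<Omega> ?M ?F V"
  proof (rule has_L2_bochner_integralI[where w="\<lambda>t. t * exp (- l * t)" and b="coef u0"])
    show "V \<in> L2 \<Omega>" using V(1) by (simp add: resolvent_def)
    show "coef V k = (\<integral>t. coef (?F t) k \<partial>?M)" for k
      unfolding val using V(1) by (simp add: resolvent_def)
    show "integrable ?M (\<lambda>t. t * exp (- l * t))"
      using integrable_mult_exp_half_line[OF l] by (simp add: integrable_restrict_space)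
    fix t k assume "t \<in> space ?M"
    then have t: "t \<ge> 0" by (simp add: space_restrict_space)
    have "\<bar>sin (sqrt (\<mu> k) * t) / sqrt (\<mu> k)\<bar> \<le> t"
      using abs_sin_x_le_abs_x[of "sqrt (\<mu> k) * t"] sq(1)[of k] t by (simp add: abs_mult field_simps)
    then have "exp (- l * t) * \<bar>sin (sqrt (\<mu> k) * t) / sqrt (\<mu> k)\<bar> * \<bar>coef u0 k\<bar> \<le> exp (- l * t) * t * \<bar>coef u0 k\<bar>"
      by (intro mult_right_mono mult_left_mono) auto
    then show "\<bar>coef (?F t) k\<bar> \<le> t * exp (- l * t) * \<bar>coef u0 k\<bar>"
      unfolding coefF by (simp add: abs_mult mult_ac)
  qed (use F int summable_coef[OF u] in \<open>auto simp: space_restrict_space\<close>)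
  then have "\<exists>W. continuous_on \<Omega> W \<and> has_L2_bochner_integral \<Omega> ?M ?F W" using V(2) by blast
  from someI_ex[OF this]
  have L: "continuous_on \<Omega> (L2_laplace_transform \<Omega> (wave_solution \<Omega> \<phi> \<mu> u0) l)"
    "has_L2_bochner_integral \<Omega> ?M ?F (L2_laplace_transform \<Omega> (wave_solution \<Omega> \<phi> \<mu> u0) l)"
    unfolding L2_laplace_transform_def by blast+
  then show "continuous_on \<Omega> (L2_laplace_transform \<Omega> (wave_solution \<Omega> \<phi> \<mu> u0) l)" by simp
  show "resolvent l u0 (L2_laplace_transform \<Omega> (wave_solution \<Omega> \<phi> \<mu> u0) l)"
    unfolding resolvent_def coef_L2_bochner_integral[OF L(2) int] val
    using L(2) unfolding has_L2_bochner_integral_def by blast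
qed

end

section \<open>Unique continuation by duality\<close>

text \<open>In effect a signed measure on K. Arguments are continuous functions on the whole space,
  which avoids a type for C(K); dependence on values on K alone is contained in the bound.\<close>

locale sup_bounded_functional =
  fixes \<Lambda> :: "('a::euclidean_space \<Rightarrow> real) \<Rightarrow> real" and K :: "'a set" and C :: real
  assumes K: "compact K" and C: "0 \<le> C"
    and lincomb: "\<And>f g a b. continuous_on UNIV f \<Longrightarrow> continuous_on UNIV g \<Longrightarrow>
      \<Lambda> (\<lambda>x. a * f x + b * g x) = a * \<Lambda> f + b * \<Lambda> g"
    and bound: "\<And>f M. continuous_on UNIV f \<Longrightarrow> 0 \<le> M \<Longrightarrow> (\<And>x. x \<in> K \<Longrightarrow> \<bar>f x\<bar> \<le> M) \<Longrightarrow> \<bar>\<Lambda> f\<bar> \<le> C * M"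

locale ball_vanishing_functional = sup_bounded_functional \<Lambda> K C
  for \<Lambda> :: "('a::euclidean_space \<Rightarrow> real) \<Rightarrow> real" and K C +
  fixes x0 :: 'a and r :: real
  assumes r: "r > 0"
    and local_zero: "\<And>g \<rho>. continuous_on UNIV g \<Longrightarrow> \<rho> < r \<Longrightarrow> (\<And>x. \<rho> \<le> dist x0 x \<Longrightarrow> g x = 0) \<Longrightarrow> \<Lambda> g = 0"
begin

text \<open>Zero up to radius r/2 and one from 3r/4 on. It lets the functional act on kernels with a
  singularity near the centre of the ball.\<close>

definition cutoff :: "'a \<Rightarrow> real" where
  "cutoff y = min 1 (max 0 ((dist x0 y - r / 2) / (r / 4)))"

lemma cutoff_0: "dist x0 y \<le> r / 2 \<Longrightarrow> cutoff y = 0"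
  using r by (simp add: cutoff_def divide_nonpos_pos)

lemma cutoff_1: "3 / 4 * r \<le> dist x0 y \<Longrightarrow> cutoff y = 1"
  using r by (simp add: cutoff_def field_simps)

lemma cutoff_bounds: "0 \<le> cutoff y" "cutoff y \<le> 1"
  by (auto simp: cutoff_def)

lemma continuous_on_cutoff: "continuous_on A cutoff"
  unfolding cutoff_def[abs_def] using r by (intro continuous_intros) auto

definition far :: "'a set" where "far = - ball x0 (r / 2)"

lemma far_closed: "closed far"
  unfolding far_def by (intro closed_Compl open_ball)

lemma far_dist: "y \<in> far \<Longrightarrow> x \<in> ball x0 (r / 4) \<Longrightarrow> r / 4 \<le> norm (y - x)"
  using dist_triangle[of x0 y x] by (simp add: far_def dist_norm norm_minus_commute)

lemma continuous_on_cutoff_mult: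
  assumes f: "continuous_on far f"
  shows "continuous_on UNIV (\<lambda>y. cutoff y * f y)"
proof -
  have "continuous_on (cball x0 (r / 2) \<union> far) (\<lambda>y. cutoff y * f y)"
  proof (rule continuous_on_closed_Un)
    have "continuous_on (cball x0 (r / 2)) (\<lambda>y. 0 :: real)" by simp
    then show "continuous_on (cball x0 (r / 2)) (\<lambda>y. cutoff y * f y)"
      by (rule continuous_on_eq) (simp add: cutoff_0)
    show "continuous_on far (\<lambda>y. cutoff y * f y)" by (intro continuous_intros continuous_on_cutoff f)
  qed (auto simp: far_closed)
  moreover have "cball x0 (r / 2) \<union> far = UNIV" by (auto simp: far_def)
  ultimately show ?thesis by simp
qed

text \<open>The relation \<open>\<Lambda> f = 0\<close> for functions that need to be continuous
  away from the ball of radius r/2 only; for functions continuous everywhere the cutoff makes no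
  difference, see \<open>kills_iff\<close>.\<close>

definition kills :: "('a \<Rightarrow> real) \<Rightarrow> bool" where
  "kills f \<longleftrightarrow> continuous_on far f \<and> \<Lambda> (\<lambda>y. cutoff y * f y) = 0"

text \<open>The difference of f and its cutoff is supported within radius 3r/4 < r, where the
  functional vanishes by \<open>local_zero\<close>.\<close>

lemma kills_iff:
  assumes f: "continuous_on UNIV f"
  shows "kills f \<longleftrightarrow> \<Lambda> f = 0"
proof -
  have c: "continuous_on UNIV (\<lambda>y. cutoff y * f y)" by (intro continuous_intros continuous_on_cutoff f)
  have "\<Lambda> (\<lambda>y. 1 * f y + (-1) * (cutoff y * f y)) = 0"
  proof (rule local_zero[of _ "3 / 4 * r"])
    show "continuous_on UNIV (\<lambda>y. 1 * f y + (-1) * (cutoff y * f y))"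
      by (intro continuous_intros continuous_on_cutoff f)
  qed (use r in \<open>auto simp: cutoff_1\<close>)
  then have "\<Lambda> f = \<Lambda> (\<lambda>y. cutoff y * f y)" unfolding lincomb[OF f c] by simp
  then show ?thesis using continuous_on_subset[OF f] by (auto simp: kills_def)
qed

lemma kills_cong:
  assumes "kills f" "\<And>y. y \<in> far \<Longrightarrow> f y = g y"
  shows "kills g"
proof -
  have "(\<lambda>y. cutoff y * f y) = (\<lambda>y. cutoff y * g y)"
  proof
    fix y
    show "cutoff y * f y = cutoff y * g y"
      using assms(2)[of y] by (cases "y \<in> far") (auto simp: far_def cutoff_0)
  qed
  moreover have "continuous_on far g" using assms by (auto simp: kills_def intro: continuous_on_eq)
  ultimately show ?thesis using assms(1) by (simp add: kills_def)
qed

lemma kills_lincomb: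
  assumes "kills f" "kills g"
  shows "kills (\<lambda>y. a * f y + b * g y)"
proof -
  have "\<Lambda> (\<lambda>y. a * (cutoff y * f y) + b * (cutoff y * g y)) = 0"
    using assms by (subst lincomb) (auto simp: kills_def intro: continuous_on_cutoff_mult)
  moreover have "(\<lambda>y. a * (cutoff y * f y) + b * (cutoff y * g y)) = (\<lambda>y. cutoff y * (a * f y + b * g y))"
    by (auto simp: algebra_simps)
  ultimately show ?thesis using assms by (auto simp: kills_def intro!: continuous_intros)
qed

lemma kills_cmult: "kills f \<Longrightarrow> kills (\<lambda>y. c * f y)"
  using kills_lincomb[of f f c 0] by simp

lemma kills_add: "kills f \<Longrightarrow> kills g \<Longrightarrow> kills (\<lambda>y. f y + g y)"
  using kills_lincomb[of f g 1 1] by simp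

text \<open>The functional is bounded by the supremum over K, and on the part of K outside
  \<open>far\<close> the cutoff is 0. So the killed functions are closed under uniform convergence
  on \<open>K \<inter> far\<close>.\<close>

lemma kills_limit:
  assumes f: "continuous_on far f"
    and approx: "\<And>e. e > 0 \<Longrightarrow> \<exists>g. kills g \<and> (\<forall>y\<in>K \<inter> far. \<bar>f y - g y\<bar> \<le> e)"
  shows "kills f"
proof -
  let ?v = "\<Lambda> (\<lambda>y. cutoff y * f y)"
  have le: "\<bar>?v\<bar> \<le> C * e" if e: "e > 0" for e
  proof -
    obtain g where g: "kills g" "\<And>y. y \<in> K \<inter> far \<Longrightarrow> \<bar>f y - g y\<bar> \<le> e" using approx[OF e] by blast
    have cg: "continuous_on UNIV (\<lambda>y. cutoff y * g y)" using g(1) by (intro continuous_on_cutoff_mult) (simp add: kills_def)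
    have cf: "continuous_on UNIV (\<lambda>y. cutoff y * f y)" by (rule continuous_on_cutoff_mult[OF f])
    have "?v = \<Lambda> (\<lambda>y. 1 * (cutoff y * f y) + (-1) * (cutoff y * g y))"
      unfolding lincomb[OF cf cg] using g(1) by (simp add: kills_def)
    also have "\<bar>\<dots>\<bar> \<le> C * e"
    proof (rule bound)
      show "continuous_on UNIV (\<lambda>y. 1 * (cutoff y * f y) + (-1) * (cutoff y * g y))"
        by (intro continuous_intros cf cg)
      fix y assume y: "y \<in> K"
      have eq: "1 * (cutoff y * f y) + (-1) * (cutoff y * g y) = cutoff y * (f y - g y)" by (simp add: algebra_simps)
      show "\<bar>1 * (cutoff y * f y) + (-1) * (cutoff y * g y)\<bar> \<le> e"
      proof (cases "y \<in> far")
        case True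
        have "cutoff y * \<bar>f y - g y\<bar> \<le> 1 * e" using g(2)[of y] y True cutoff_bounds[of y] by (intro mult_mono) auto
        then show ?thesis unfolding eq using cutoff_bounds[of y] by (simp add: abs_mult)
      next
        case False
        then show ?thesis unfolding eq using e by (simp add: far_def cutoff_0)
      qed
    qed (use e in simp)
    finally show ?thesis .
  qed
  have "?v = 0"
  proof (rule ccontr)
    assume "?v \<noteq> 0"
    then have "\<bar>?v\<bar> / (C + 1) > 0" using C by simp
    from le[OF this] have "\<bar>?v\<bar> * (C + 1) \<le> C * \<bar>?v\<bar>" using C by (simp add: field_simps)
    then show False using \<open>?v \<noteq> 0\<close> by (simp add: algebra_simps)
  qed
  then show ?thesis using f by (simp add: kills_def)
qed

text \<open>Differentiation under the functional: difference quotients are killed by linearity. By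
  the mean value theorem they are values of the derivative at nearby parameters, and uniform
  continuity on a compact set makes the convergence uniform.\<close>

lemma kills_derivative:
  assumes F: "\<And>x. x \<in> ball x0 (r / 4) \<Longrightarrow> kills (F x)"
    and deriv: "\<And>x y. x \<in> ball x0 (r / 4) \<Longrightarrow> y \<in> far \<Longrightarrow> ((\<lambda>t. F (x + t *\<^sub>R b) y) has_real_derivative F' x y) (at 0)"
    and cont: "continuous_on (ball x0 (r / 4) \<times> far) (\<lambda>(x, y). F' x y)"
    and x: "x \<in> ball x0 (r / 4)"
  shows "kills (F' x)"
proof (rule kills_limit)
  have "continuous_on far (\<lambda>y. case (x, y) of (x, y) \<Rightarrow> F' x y)"
    using x by (intro continuous_on_compose2[OF cont]) (auto intro!: continuous_intros)
  then show "continuous_on far (F' x)" by simp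
  fix e :: real assume e: "e > 0"
  obtain d where d: "d > 0" "cball x d \<subseteq> ball x0 (r / 4)" using x by (meson open_ball open_contains_cball)
  have comp: "compact (cball x d \<times> (K \<inter> far))"
    by (intro compact_Times compact_Int_closed K far_closed) simp
  have "continuous_on (cball x d \<times> (K \<inter> far)) (\<lambda>(x, y). F' x y)"
    by (rule continuous_on_subset[OF cont]) (use d in auto)
  from compact_uniformly_continuous[OF this comp] e
  obtain \<delta> where \<delta>: "\<delta> > 0" "\<And>p q. p \<in> cball x d \<times> (K \<inter> far) \<Longrightarrow> q \<in> cball x d \<times> (K \<inter> far) \<Longrightarrow> dist q p < \<delta> \<Longrightarrow>
      dist ((\<lambda>(x, y). F' x y) q) ((\<lambda>(x, y). F' x y) p) < e"
    unfolding uniformly_continuous_on_def by metis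
  \<comment> \<open>Small enough that the segment from x in direction b stays in
    \<open>cball x d\<close> and the derivative varies by less than e along it; the summand 1 covers
    b = 0.\<close>
  define t where "t = min d \<delta> / 2 / (norm b + 1)"
  have nb: "norm b + 1 > 0" by (simp add: add_nonneg_pos)
  have t: "t > 0" using d \<delta> nb by (simp add: t_def)
  have tb: "\<bar>\<xi>\<bar> * norm b < min d \<delta>" if "\<bar>\<xi>\<bar> \<le> t" for \<xi>
  proof -
    have "\<bar>\<xi>\<bar> * norm b \<le> t * (norm b + 1)" using that t by (intro mult_mono) auto
    also have "\<dots> = min d \<delta> / 2"
      unfolding t_def using nb by (subst times_divide_eq_left, subst nonzero_mult_div_cancel_right) auto
    also have "\<dots> < min d \<delta>"
    proof -
      have "0 < min d \<delta>" using d(1) \<delta>(1) by simp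
      then show ?thesis by linarith
    qed
    finally show ?thesis .
  qed
  have inB: "x + \<xi> *\<^sub>R b \<in> cball x d" if "\<bar>\<xi>\<bar> \<le> t" for \<xi> using tb[OF that] by (simp add: dist_norm)
  have "kills (\<lambda>y. (1 / t) * F (x + t *\<^sub>R b) y + (- (1 / t)) * F x y)"
    using d(2) inB[of t] t x by (intro kills_lincomb F) auto
  moreover have "\<bar>F' x y - ((1 / t) * F (x + t *\<^sub>R b) y + (- (1 / t)) * F x y)\<bar> \<le> e" if y: "y \<in> K \<inter> far" for y
  proof -
    have D: "((\<lambda>t. F (x + t *\<^sub>R b) y) has_real_derivative F' (x + \<xi> *\<^sub>R b) y) (at \<xi>)" if "\<bar>\<xi>\<bar> \<le> t" for \<xi>
    proof -
      have "((\<lambda>t. F ((x + \<xi> *\<^sub>R b) + t *\<^sub>R b) y) has_real_derivative F' (x + \<xi> *\<^sub>R b) y) (at 0)"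
        using inB[OF that] d(2) y by (intro deriv) auto
      then have "((\<lambda>t. F (x + (\<xi> + t) *\<^sub>R b) y) has_real_derivative F' (x + \<xi> *\<^sub>R b) y) (at 0)"
        by (simp add: scaleR_add_left add.assoc)
      then show ?thesis using DERIV_shift[of "\<lambda>t. F (x + t *\<^sub>R b) y" _ 0 \<xi>] by (simp add: add.commute)
    qed
    have "\<exists>\<xi>. 0 < \<xi> \<and> \<xi> < t \<and> F (x + t *\<^sub>R b) y - F (x + 0 *\<^sub>R b) y = (t - 0) * F' (x + \<xi> *\<^sub>R b) y"
      using t D by (intro MVT2) auto
    then obtain \<xi> where \<xi>: "0 < \<xi>" "\<xi> < t" "F (x + t *\<^sub>R b) y - F x y = t * F' (x + \<xi> *\<^sub>R b) y" by auto
    have "dist (F' (x + \<xi> *\<^sub>R b) y) (F' x y) < e"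
      using \<delta>(2)[of "(x, y)" "(x + \<xi> *\<^sub>R b, y)"] inB[of \<xi>] tb[of \<xi>] \<xi> y d by (auto simp: dist_Pair_Pair dist_norm)
    moreover have "(1 / t) * F (x + t *\<^sub>R b) y + (- (1 / t)) * F x y = F' (x + \<xi> *\<^sub>R b) y"
    proof -
      have "(1 / t) * F (x + t *\<^sub>R b) y + (- (1 / t)) * F x y = (F (x + t *\<^sub>R b) y - F x y) / t"
        by (simp add: diff_divide_distrib)
      then show ?thesis unfolding \<xi>(3) using t by simp
    qed
    ultimately show ?thesis by (simp add: dist_real_def abs_minus_commute)
  qed
  ultimately show "\<exists>g. kills g \<and> (\<forall>y\<in>K \<inter> far. \<bar>F' x y - g y\<bar> \<le> e)" by blast
qed

abbreviation sqd :: "'a \<Rightarrow> 'a \<Rightarrow> real" where "sqd x y \<equiv> (norm (y - x))\<^sup>2"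

lemma sqd_derivative: "((\<lambda>t. sqd (x + t *\<^sub>R b) y) has_real_derivative 2 * ((x - y) \<bullet> b)) (at 0)"
proof -
  have "sqd (x + t *\<^sub>R b) y = sqd x y + 2 * t * ((x - y) \<bullet> b) + t\<^sup>2 * (b \<bullet> b)" for t
    unfolding power2_norm_eq_inner by (simp add: inner_simps inner_commute power2_eq_square algebra_simps)
  then show ?thesis by (auto intro!: derivative_eq_intros)
qed

lemma sqd_pos: "x \<in> ball x0 (r / 4) \<Longrightarrow> y \<in> far \<Longrightarrow> 0 < sqd x y"
proof -
  assume "x \<in> ball x0 (r / 4)" "y \<in> far"
  then have "0 < norm (y - x)" using far_dist[of y x] r by linarith
  then show ?thesis by simp
qed

lemma continuous_on_sqd_powr:
  "continuous_on (ball x0 (r / 4) \<times> far) (\<lambda>p. sqd (fst p) (snd p) powr e)"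
proof (intro continuous_intros ballI)
  fix p assume "p \<in> ball x0 (r / 4) \<times> far"
  then show "sqd (fst p) (snd p) \<noteq> 0" using sqd_pos[of "fst p" "snd p"] by auto
qed

text \<open>The Laplacian in \<open>x\<close> maps \<open>norm (y - x) powr (2 * p)\<close> to a multiple of
  \<open>norm (y - x) powr (2 * p - 2)\<close>.\<close>

lemma kills_powr_step:
  assumes F: "\<And>x. x \<in> ball x0 (r / 4) \<Longrightarrow> kills (\<lambda>y. sqd x y powr p)"
    and p: "p \<noteq> 0" "2 * (p - 1) + real DIM('a) \<noteq> 0" and x: "x \<in> ball x0 (r / 4)"
  shows "kills (\<lambda>y. sqd x y powr (p - 1))"
proof -
  let ?N = "real DIM('a)"
  let ?F1 = "\<lambda>b x y. p * sqd x y powr (p - 1) * (2 * ((x - y) \<bullet> b))"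
  let ?F2 = "\<lambda>b x y. 4 * p * (p - 1) * sqd x y powr (p - 2) * ((x - y) \<bullet> b)\<^sup>2 + 2 * p * sqd x y powr (p - 1)"
  have k1: "kills (?F1 b x)" if x: "x \<in> ball x0 (r / 4)" and b: "b \<in> Basis" for b x
  proof (rule kills_derivative[OF F _ _ x, where b=b])
    fix x y assume xy: "x \<in> ball x0 (r / 4)" "y \<in> far"
    show "((\<lambda>t. sqd (x + t *\<^sub>R b) y powr p) has_real_derivative ?F1 b x y) (at 0)"
      using DERIV_chain2[OF has_real_derivative_powr sqd_derivative, of y x b p] sqd_pos[OF xy]
      by simp
  next
    show "continuous_on (ball x0 (r / 4) \<times> far) (\<lambda>(x, y). ?F1 b x y)"
      unfolding case_prod_beta by (intro continuous_intros continuous_on_sqd_powr)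
  qed
  have k2: "kills (?F2 b x)" if b: "b \<in> Basis" for b
  proof (rule kills_derivative[OF k1[OF _ b] _ _ x, where b=b])
    fix x y assume xy: "x \<in> ball x0 (r / 4)" "y \<in> far"
    have A: "((\<lambda>t. sqd (x + t *\<^sub>R b) y powr (p - 1)) has_real_derivative (p - 1) * sqd x y powr (p - 1 - 1) * (2 * ((x - y) \<bullet> b))) (at 0)"
      using DERIV_chain2[OF has_real_derivative_powr sqd_derivative, of y x b "p - 1"] sqd_pos[OF xy]
      by simp
    have B: "((\<lambda>t. 2 * ((x + t *\<^sub>R b - y) \<bullet> b)) has_real_derivative 2) (at 0)"
    proof -
      have "2 * ((x + t *\<^sub>R b - y) \<bullet> b) = 2 * ((x - y) \<bullet> b) + 2 * t" for t
        using b by (simp add: inner_simps algebra_simps)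
      then show ?thesis by (auto intro!: derivative_eq_intros)
    qed
    from DERIV_mult[OF DERIV_cmult[OF A, of p] B]
    show "((\<lambda>t. ?F1 b (x + t *\<^sub>R b) y) has_real_derivative ?F2 b x y) (at 0)"
      by (rule DERIV_cong) (simp add: power2_eq_square algebra_simps)
  next
    show "continuous_on (ball x0 (r / 4) \<times> far) (\<lambda>(x, y). ?F2 b x y)"
      unfolding case_prod_beta by (intro continuous_intros continuous_on_sqd_powr)
  qed
  have sum: "kills (\<lambda>y. \<Sum>b\<in>B. ?F2 b x y)" if "finite B" "B \<subseteq> Basis" for B
    using that
  proof (induction B)
    case empty
    show ?case using kills_cmult[OF F[OF x], of 0] by simp
  next
    case (insert b B)
    then show ?case by (auto intro!: kills_add k2)
  qed
  have "kills (\<lambda>y. \<Sum>b\<in>Basis. ?F2 b x y)" by (rule sum) auto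
  \<comment> \<open>The Laplacian of |y - x|^(2p) is 2p (2(p - 1) + N) |y - x|^(2p - 2), and the
    assumptions on p make this factor nonzero.\<close>
  then have "kills (\<lambda>y. 1 / (2 * p * (2 * (p - 1) + ?N)) * (\<Sum>b\<in>Basis. ?F2 b x y))"
    by (rule kills_cmult)
  then show ?thesis
  proof (rule kills_cong)
    fix y assume y: "y \<in> far"
    have s: "sqd x y > 0" by (rule sqd_pos[OF x y])
    have "(\<Sum>b\<in>Basis. ?F2 b x y) = 4 * p * (p - 1) * sqd x y powr (p - 2) * (\<Sum>b\<in>Basis. ((x - y) \<bullet> b)\<^sup>2) + ?N * (2 * p * sqd x y powr (p - 1))"
      by (simp add: sum.distrib sum_distrib_left)
    also have "(\<Sum>b\<in>Basis. ((x - y) \<bullet> b)\<^sup>2) = sqd x y"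
      unfolding power2_norm_eq_inner euclidean_inner[of "y - x" "y - x"]
      by (intro sum.cong) (auto simp: power2_eq_square inner_simps algebra_simps)
    also have "4 * p * (p - 1) * sqd x y powr (p - 2) * sqd x y = 4 * p * (p - 1) * sqd x y powr (p - 1)"
    proof -
      have "sqd x y powr (p - 2) * sqd x y powr 1 = sqd x y powr (p - 2 + 1)" by (rule powr_add[symmetric])
      moreover have "p - 2 + 1 = p - 1" by simp
      ultimately have "sqd x y powr (p - 2) * sqd x y = sqd x y powr (p - 1)" using s by (simp only: powr_one)
      then show ?thesis by simp
    qed
    also have "4 * p * (p - 1) * sqd x y powr (p - 1) + ?N * (2 * p * sqd x y powr (p - 1))
        = (2 * p * (2 * (p - 1) + ?N)) * sqd x y powr (p - 1)" by (simp add: algebra_simps)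
    finally show "1 / (2 * p * (2 * (p - 1) + ?N)) * (\<Sum>b\<in>Basis. ?F2 b x y) = sqd x y powr (p - 1)"
      using p by simp
  qed
qed

end

section \<open>From bumps to kernels, powers, Gaussians and all continuous functions\<close>

locale unique_continuation = ball_vanishing_functional \<Lambda> K C x0 r + frac_order s
  for \<Lambda> :: "('a::euclidean_space \<Rightarrow> real) \<Rightarrow> real" and K C x0 r s +
  assumes bump_zero: "\<And>x e. e > 0 \<Longrightarrow> cball x e \<subseteq> ball x0 r \<Longrightarrow> \<Lambda> (\<lambda>y. bump_op ((y - x) /\<^sub>R e)) = 0"
begin

lemma frac_kernel_sqd: "frac_kernel s (y - x) = sqd x y powr (- (real DIM('a) + 2 * s) / 2)"
proof (cases "y = x")
  case False
  then have "sqd x y = norm (y - x) powr 2" by simp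
  moreover have "2 * (- (real DIM('a) + 2 * s) / 2) = - (real DIM('a) + 2 * s)" by simp
  ultimately show ?thesis by (simp only: frac_kernel_def powr_powr)
qed (simp add: frac_kernel_def)

text \<open>As e shrinks, \<open>bump_op ((y - x) /\<^sub>R e)\<close> multiplied by e^(-N-2s) tends
  uniformly on \<open>far\<close> to a nonzero multiple of the kernel: the power of e cancels the
  homogeneity of the kernel, and the error in \<open>bump_op_asymptotics\<close> is
  relative.\<close>

lemma kills_kernel:
  assumes x: "x \<in> ball x0 (r / 4)"
  shows "kills (\<lambda>y. frac_kernel s (y - x))"
proof -
  let ?p = "- (real DIM('a) + 2 * s)"
  let ?I = "\<integral>u. bump u \<partial>(lborel :: 'a measure)"
  have kb: "frac_kernel s (y - x) \<le> (r / 4) powr ?p" if "y \<in> far" for y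
    unfolding frac_kernel_def using far_dist[OF that x] r s_pos by (intro powr_mono2') auto
  have cont: "continuous_on far (\<lambda>y. frac_kernel s (y - x))"
  proof (rule continuous_on_compose2[OF continuous_on_frac_kernel])
    show "(\<lambda>y. y - x) ` far \<subseteq> - {0}"
    proof
      fix z assume "z \<in> (\<lambda>y. y - x) ` far"
      then obtain y where y: "y \<in> far" "z = y - x" by auto
      then show "z \<in> - {0}" using far_dist[OF y(1) x] r by auto
    qed
  qed (intro continuous_intros)
  have "kills (\<lambda>y. (- 2 * ?I) * frac_kernel s (y - x))"
  proof (rule kills_limit)
    show "continuous_on far (\<lambda>y. (- 2 * ?I) * frac_kernel s (y - x))" by (intro continuous_intros cont)
    fix e0 :: real assume e0: "e0 > 0"
    \<comment> \<open>The divisor bounds the kernel on \<open>far\<close>, so a relative error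
      \<open>\<eta>\<close> becomes an absolute error e0.\<close>
    define \<eta> where "\<eta> = e0 / (r / 4) powr ?p"
    have rp: "(r / 4) powr ?p > 0" using r by simp
    have \<eta>: "\<eta> > 0" using e0 rp unfolding \<eta>_def by (rule divide_pos_pos)
    obtain R where R: "R \<ge> 2" "\<And>z :: 'a. R \<le> norm z \<Longrightarrow> \<bar>bump_op z + 2 * ?I * frac_kernel s z\<bar> \<le> \<eta> * frac_kernel s z"
      using bump_op_asymptotics[OF \<eta>, where 'a='a] by blast
    \<comment> \<open>Points of \<open>far\<close> are at distance at least r/4 from x, hence at
      rescaled distance at least R.\<close>
    define e where "e = r / 4 / R"
    have e: "e > 0" "e \<le> r / 4" "e * R = r / 4" using r R(1) by (auto simp: e_def divide_le_eq)
    have "cball x e \<subseteq> ball x0 r"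
    proof
      fix y assume "y \<in> cball x e"
      then have "dist x y \<le> r / 4" "dist x0 x < r / 4" using e x by auto
      then show "y \<in> ball x0 r" using dist_triangle[of x0 y x] r by simp
    qed
    from bump_zero[OF e(1) this] have z: "\<Lambda> (\<lambda>y. bump_op ((y - x) /\<^sub>R e)) = 0" .
    have "continuous_on UNIV (\<lambda>y. bump_op ((y - x) /\<^sub>R e))"
      by (rule continuous_on_compose2[OF continuous_on_bump_op[of UNIV]]) (auto intro!: continuous_intros)
    from kills_iff[OF this] z have "kills (\<lambda>y. bump_op ((y - x) /\<^sub>R e))" by simp
    then have k: "kills (\<lambda>y. e powr ?p * bump_op ((y - x) /\<^sub>R e))" by (rule kills_cmult)
    have "\<bar>(- 2 * ?I) * frac_kernel s (y - x) - e powr ?p * bump_op ((y - x) /\<^sub>R e)\<bar> \<le> e0" if y: "y \<in> K \<inter> far" for y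
    proof -
      have yf: "y \<in> far" using y by simp
      have "r / 4 \<le> norm (y - x)" by (rule far_dist[OF yf x])
      then have "e * R \<le> norm (y - x)" using e(3) by simp
      then have "R \<le> norm ((y - x) /\<^sub>R e)" unfolding norm_scaleR using e(1) by (simp add: field_simps)
      from R(2)[OF this]
      have 1: "\<bar>bump_op ((y - x) /\<^sub>R e) + 2 * ?I * frac_kernel s ((y - x) /\<^sub>R e)\<bar> \<le> \<eta> * frac_kernel s ((y - x) /\<^sub>R e)" .
      have sc: "e powr ?p * frac_kernel s ((y - x) /\<^sub>R e) = frac_kernel s (y - x)"
        using frac_kernel_scale[OF e(1), of s "(y - x) /\<^sub>R e"] e(1) by simp
      have "e powr ?p * \<bar>bump_op ((y - x) /\<^sub>R e) + 2 * ?I * frac_kernel s ((y - x) /\<^sub>R e)\<bar> \<le> e powr ?p * (\<eta> * frac_kernel s ((y - x) /\<^sub>R e))"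
        by (rule mult_left_mono[OF 1]) simp
      also have "\<dots> = \<eta> * frac_kernel s (y - x)" by (simp add: sc[symmetric])
      also have "\<dots> \<le> \<eta> * (r / 4) powr ?p" using \<eta> kb[OF yf] by (intro mult_left_mono) auto
      also have "\<dots> = e0" using rp by (simp add: \<eta>_def)
      finally have 2: "e powr ?p * \<bar>bump_op ((y - x) /\<^sub>R e) + 2 * ?I * frac_kernel s ((y - x) /\<^sub>R e)\<bar> \<le> e0" .
      have "(- 2 * ?I) * frac_kernel s (y - x) - e powr ?p * bump_op ((y - x) /\<^sub>R e)
          = - (e powr ?p * (bump_op ((y - x) /\<^sub>R e) + 2 * ?I * frac_kernel s ((y - x) /\<^sub>R e)))"
        unfolding sc[symmetric] by (simp add: algebra_simps)
      then show ?thesis using 2 by (simp add: abs_mult)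
    qed
    then show "\<exists>g. kills g \<and> (\<forall>y\<in>K \<inter> far. \<bar>(- 2 * ?I) * frac_kernel s (y - x) - g y\<bar> \<le> e0)" using k by blast
  qed
  then have "kills (\<lambda>y. (1 / (- 2 * ?I)) * ((- 2 * ?I) * frac_kernel s (y - x)))" by (rule kills_cmult)
  then show ?thesis using integral_bump_pos[where 'a='a] by simp
qed

text \<open>The Laplacian step never degenerates: all exponents are negative, and its second factor
  equals -2s - 2m - 2.\<close>

lemma kills_powers:
  assumes "x \<in> ball x0 (r / 4)"
  shows "kills (\<lambda>y. sqd x y powr (- (real DIM('a) + 2 * s) / 2 - real m))"
  using assms
proof (induction m arbitrary: x)
  case 0
  then show ?case using kills_kernel[OF 0] by (simp add: frac_kernel_sqd)
next
  case (Suc m)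
  let ?p = "- (real DIM('a) + 2 * s) / 2"
  have "kills (\<lambda>y. sqd x y powr ((?p - real m) - 1))"
  proof (rule kills_powr_step[OF Suc.IH _ _ Suc.prems])
    have "real DIM('a) > 0" by simp
    then show "?p - real m \<noteq> 0" using s_pos by (simp add: field_simps)
    show "2 * (?p - real m - 1) + real DIM('a) \<noteq> 0" using s_pos by (simp add: field_simps)
  qed
  then show ?case by (simp add: algebra_simps)
qed

lemma kills_sum:
  assumes "\<And>i. i \<in> I \<Longrightarrow> kills (f i)" "kills g"
  shows "kills (\<lambda>y. \<Sum>i\<in>I. f i y)"
  using assms
proof (induction I rule: infinite_finite_induct)
  case (infinite I)
  then show ?case using kills_cmult[of g 0] by simp
next
  case empty
  then show ?case using kills_cmult[of g 0] by simp
next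
  case (insert i I)
  then show ?case by (auto intro!: kills_add)
qed

text \<open>With \<open>\<tau> = 1 / sqd x y\<close> the killed powers are
  \<open>sqd x y powr p0\<close> times monomials in \<open>\<tau>\<close>, and \<open>\<tau>\<close>
  ranges over a compact interval in the positive reals. Weierstrass approximation therefore reaches
  every function of \<open>\<tau>\<close> continuous there.\<close>

lemma kills_gaussian:
  assumes x: "x \<in> ball x0 (r / 4)"
  shows "kills (\<lambda>y. exp (- sqd x y))"
proof (rule kills_limit)
  show "continuous_on far (\<lambda>y. exp (- sqd x y))" by (intro continuous_intros)
  fix e :: real assume e: "e > 0"
  define p0 where "p0 = - (real DIM('a) + 2 * s) / 2"
  obtain B where B: "\<And>y. y \<in> K \<Longrightarrow> norm y \<le> B" using compact_imp_bounded[OF K] by (auto simp: bounded_iff)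
  define lo where "lo = 1 / ((\<bar>B\<bar> + norm x + 1)\<^sup>2)"
  define hi where "hi = 1 / ((r / 4)\<^sup>2)"
  have Bp: "\<bar>B\<bar> + norm x + 1 > 0" by (simp add: add_nonneg_pos)
  have lo: "lo > 0" using Bp by (simp add: lo_def)
  have range: "1 / sqd x y \<in> {lo..hi}" if "y \<in> K \<inter> far" for y
  proof -
    have s: "sqd x y > 0" using that x by (intro sqd_pos) auto
    have "(r / 4)\<^sup>2 \<le> sqd x y" using far_dist[of y x] that x r by (intro power_mono) auto
    then have "1 / sqd x y \<le> hi" unfolding hi_def using r s by (intro divide_left_mono mult_pos_pos) auto
    moreover have "norm (y - x) \<le> \<bar>B\<bar> + norm x + 1" using B[of y] that norm_triangle_ineq4[of y x] by auto
    then have "sqd x y \<le> (\<bar>B\<bar> + norm x + 1)\<^sup>2" by (intro power_mono) auto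
    then have "lo \<le> 1 / sqd x y" unfolding lo_def using s Bp by (intro divide_left_mono mult_pos_pos) auto
    ultimately show ?thesis by simp
  qed
  define c where "c = ((r / 4)\<^sup>2) powr p0"
  have c: "c > 0" using r by (simp add: c_def)
  \<comment> \<open>Chosen so that \<open>sqd x y powr p0 * f (1 / sqd x y)\<close> is the Gaussian;
    c bounds the prefactor on \<open>far\<close>.\<close>
  define f where "f \<tau> = \<tau> powr p0 * exp (- 1 / \<tau>)" for \<tau> :: real
  have "continuous_on {lo..hi} f" unfolding f_def using lo by (intro continuous_intros) auto
  then obtain g where g: "real_polynomial_function g" "\<And>\<tau>. \<tau> \<in> {lo..hi} \<Longrightarrow> \<bar>f \<tau> - g \<tau>\<bar> < e / c"
    using Stone_Weierstrass_real_polynomial_function[of "{lo..hi}" f "e / c"] e c by auto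
  obtain a n where an: "g = (\<lambda>\<tau>. \<Sum>i\<le>n. a i * \<tau> ^ i)"
    using g(1) unfolding real_polynomial_function_iff_sum by blast
  have "kills (\<lambda>y. \<Sum>i\<le>n. a i * sqd x y powr (p0 - real i))"
    by (rule kills_sum[OF kills_cmult[OF kills_powers[OF x, folded p0_def]] kills_powers[OF x, folded p0_def]])
  moreover have "\<bar>exp (- sqd x y) - (\<Sum>i\<le>n. a i * sqd x y powr (p0 - real i))\<bar> \<le> e" if y: "y \<in> K \<inter> far" for y
  proof -
    have s: "sqd x y > 0" using y x by (intro sqd_pos) auto
    have 1: "(\<Sum>i\<le>n. a i * sqd x y powr (p0 - real i)) = sqd x y powr p0 * g (1 / sqd x y)"
      unfolding an sum_distrib_left
      using s by (intro sum.cong refl) (simp add: powr_diff powr_realpow power_divide)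
    have 2: "exp (- sqd x y) = sqd x y powr p0 * f (1 / sqd x y)"
    proof -
      have "sqd x y powr p0 * (1 / sqd x y) powr p0 = (sqd x y * (1 / sqd x y)) powr p0" by (rule powr_mult[symmetric])
      also have "\<dots> = 1" using s by simp
      finally show ?thesis by (simp add: f_def mult.assoc[symmetric])
    qed
    have "\<bar>exp (- sqd x y) - (\<Sum>i\<le>n. a i * sqd x y powr (p0 - real i))\<bar> = sqd x y powr p0 * \<bar>f (1 / sqd x y) - g (1 / sqd x y)\<bar>"
      unfolding 1 2 right_diff_distrib[symmetric] abs_mult by simp
    also have "\<dots> \<le> c * (e / c)"
    proof (rule mult_mono)
      have "(r / 4)\<^sup>2 \<le> sqd x y" using far_dist[of y x] y x r by (intro power_mono) auto
      then show "sqd x y powr p0 \<le> c" unfolding c_def p0_def using r s_pos by (intro powr_mono2') auto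
    qed (use g(2)[OF range[OF y]] c in auto)
    finally show ?thesis using c by simp
  qed
  ultimately show "\<exists>g. kills g \<and> (\<forall>y\<in>K \<inter> far. \<bar>exp (- sqd x y) - g y\<bar> \<le> e)" by blast
qed

text \<open>Centres x range over an open ball, not just \<open>x0\<close>, because the next step
  differentiates in x.\<close>

definition gauss_multipliers :: "('a \<Rightarrow> real) set" where
  "gauss_multipliers = {p. continuous_on UNIV p \<and> (\<forall>x\<in>ball x0 (r / 4). kills (\<lambda>y. p y * exp (- sqd x y)))}"

lemma gauss_multipliers_lincomb:
  assumes "p \<in> gauss_multipliers" "q \<in> gauss_multipliers"
  shows "(\<lambda>y. a * p y + b * q y) \<in> gauss_multipliers"
  unfolding gauss_multipliers_def
proof safe
  show "continuous_on UNIV (\<lambda>y. a * p y + b * q y)"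
    using assms by (auto simp: gauss_multipliers_def intro!: continuous_intros)
  fix x assume "x \<in> ball x0 (r / 4)"
  then have "kills (\<lambda>y. a * (p y * exp (- sqd x y)) + b * (q y * exp (- sqd x y)))"
    using assms by (intro kills_lincomb) (auto simp: gauss_multipliers_def)
  then show "kills (\<lambda>y. (a * p y + b * q y) * exp (- sqd x y))" by (simp add: algebra_simps)
qed

text \<open>Differentiation of \<open>exp (- sqd x y)\<close> in \<open>x\<close> produces the factor \<open>2 * (y - x) \<bullet> b\<close>.\<close>

lemma gauss_multipliers_inner:
  assumes p: "p \<in> gauss_multipliers"
  shows "(\<lambda>y. p y * (y \<bullet> b)) \<in> gauss_multipliers"
  unfolding gauss_multipliers_def
proof safe
  have pc: "continuous_on UNIV p" using p by (simp add: gauss_multipliers_def)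
  then show "continuous_on UNIV (\<lambda>y. p y * (y \<bullet> b))" by (intro continuous_intros)
  fix x assume x: "x \<in> ball x0 (r / 4)"
  have k0: "kills (\<lambda>y. p y * exp (- sqd x y))" if "x \<in> ball x0 (r / 4)" for x
    using p that by (simp add: gauss_multipliers_def)
  have "kills (\<lambda>y. p y * (exp (- sqd x y) * (- (2 * ((x - y) \<bullet> b)))))"
  proof (rule kills_derivative[OF k0 _ _ x, where b=b])
    fix x y assume "x \<in> ball x0 (r / 4)" "y \<in> far"
    show "((\<lambda>t. p y * exp (- sqd (x + t *\<^sub>R b) y)) has_real_derivative p y * (exp (- sqd x y) * (- (2 * ((x - y) \<bullet> b))))) (at 0)"
      using DERIV_cmult[OF DERIV_fun_exp[OF DERIV_minus[OF sqd_derivative[where x=x and y=y and b=b]]], of "p y"] by simp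
  next
    have "continuous_on (ball x0 (r / 4) \<times> far) (\<lambda>q. p (snd q))"
      by (rule continuous_on_compose2[OF pc]) (auto intro!: continuous_intros)
    then show "continuous_on (ball x0 (r / 4) \<times> far) (\<lambda>(x, y). p y * (exp (- sqd x y) * (- (2 * ((x - y) \<bullet> b)))))"
      unfolding case_prod_beta by (intro continuous_intros)
  qed
  from kills_lincomb[OF this k0[OF x], of "1/2" "x \<bullet> b"]
  show "kills (\<lambda>y. p y * (y \<bullet> b) * exp (- sqd x y))"
    by (rule kills_cong) (simp add: inner_simps algebra_simps)
qed

text \<open>The multiplier p is kept arbitrary in the induction so that the product case can apply
  its two factors one after the other.\<close>

lemma gauss_multipliers_mult_polynomial:
  assumes "real_polynomial_function g" "p \<in> gauss_multipliers"
  shows "(\<lambda>y. p y * g y) \<in> gauss_multipliers"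
  using assms
proof (induction arbitrary: p rule: real_polynomial_function.induct)
  case (linear f)
  have sum: "(\<lambda>y. \<Sum>b\<in>B. f b * (p y * (y \<bullet> b))) \<in> gauss_multipliers" if "finite B" for B
    using that
  proof (induction B)
    case empty
    show ?case using gauss_multipliers_lincomb[OF linear(2) linear(2), of 0 0] by simp
  next
    case (insert b B)
    show ?case
      using gauss_multipliers_lincomb[OF gauss_multipliers_inner[OF linear(2), of b] insert.IH, of "f b" 1] insert.hyps by simp
  qed
  have rep: "f y = (\<Sum>b\<in>Basis. f b * (y \<bullet> b))" for y
  proof -
    interpret bounded_linear f by (rule linear(1))
    have "f y = f (\<Sum>b\<in>Basis. (y \<bullet> b) *\<^sub>R b)" by (simp add: euclidean_representation)
    also have "\<dots> = (\<Sum>b\<in>Basis. (y \<bullet> b) * f b)" by (simp add: sum scaleR)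
    finally show ?thesis by (simp add: mult.commute)
  qed
  have "p y * f y = (\<Sum>b\<in>Basis. f b * (p y * (y \<bullet> b)))" for y
    unfolding rep[of y] sum_distrib_left by (intro sum.cong) auto
  then have "(\<lambda>y. p y * f y) = (\<lambda>y. \<Sum>b\<in>Basis. f b * (p y * (y \<bullet> b)))" by (rule ext)
  then show ?case using sum[of Basis] by simp
next
  case (const c)
  then show ?case using gauss_multipliers_lincomb[of p p c 0] by (simp add: mult.commute)
next
  case (add f g)
  then show ?case using gauss_multipliers_lincomb[OF add.IH(1) add.IH(2), of p p 1 1] by (simp add: algebra_simps)
next
  case (mult f g)
  then show ?case using mult.IH(2)[OF mult.IH(1)] by (simp add: mult.assoc)
qed

text \<open>Stone-Weierstrass is applied to \<open>f y * exp (sqd x0 y)\<close> on K; multiplying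
  back by the Gaussian, which is at most 1, does not increase the error.\<close>

theorem vanishes:
  assumes f: "continuous_on UNIV f"
  shows "\<Lambda> f = 0"
proof -
  have x0: "x0 \<in> ball x0 (r / 4)" using r by simp
  have one: "(\<lambda>y. 1) \<in> gauss_multipliers" using kills_gaussian by (simp add: gauss_multipliers_def)
  have "kills f"
  proof (rule kills_limit)
    show "continuous_on far f" by (rule continuous_on_subset[OF f]) simp
    fix e :: real assume e: "e > 0"
    have "continuous_on K (\<lambda>y. f y * exp (sqd x0 y))"
      by (intro continuous_intros continuous_on_subset[OF f]) auto
    then obtain g where g: "real_polynomial_function g" "\<And>y. y \<in> K \<Longrightarrow> \<bar>f y * exp (sqd x0 y) - g y\<bar> < e"
      using Stone_Weierstrass_real_polynomial_function[OF K _ e] by blast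
    have "kills (\<lambda>y. g y * exp (- sqd x0 y))"
      using gauss_multipliers_mult_polynomial[OF g(1) one] x0 by (simp add: gauss_multipliers_def)
    moreover have "\<bar>f y - g y * exp (- sqd x0 y)\<bar> \<le> e" if "y \<in> K \<inter> far" for y
    proof -
      have "f y - g y * exp (- sqd x0 y) = (f y * exp (sqd x0 y) - g y) * exp (- sqd x0 y)"
        by (simp add: left_diff_distrib mult.assoc exp_add[symmetric])
      also have "\<bar>\<dots>\<bar> \<le> e * 1"
        unfolding abs_mult using g(2)[of y] that by (intro mult_mono) auto
      finally show ?thesis by simp
    qed
    ultimately show "\<exists>g. kills g \<and> (\<forall>y\<in>K \<inter> far. \<bar>f y - g y\<bar> \<le> e)" by blast
  qed
  then show ?thesis using kills_iff[OF f] by simp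
qed

end

section \<open>Density of odd test functions\<close>

text \<open>All orders at once, for a class of functions closed under directional
  derivatives.\<close>

lemma Ck_functionI:
  assumes f: "f \<in> S"
    and S: "\<And>f. f \<in> S \<Longrightarrow> \<exists>f'. (\<forall>x. (f has_derivative f' x) (at x)) \<and> (\<forall>v. (\<lambda>x. f' x v) \<in> S)"
  shows "Ck_function k f"
  using f
proof (induction k arbitrary: f)
  case 0
  obtain f' where "\<And>x. (f has_derivative f' x) (at x)" using S[OF 0] by blast
  then show ?case by (auto intro!: continuous_at_imp_continuous_on has_derivative_continuous)
next
  case (Suc k)
  obtain f' where f': "\<And>x. (f has_derivative f' x) (at x)" "\<And>v. (\<lambda>x. f' x v) \<in> S" using S[OF Suc.prems] by blast
  have "frechet_derivative f (at x) = f' x" for x using frechet_derivative_at[OF f'(1)] by simp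
  then show ?case using f' Suc.IH[OF f'(2)] by (auto simp: differentiable_def)
qed

text \<open>\<open>flat 0\<close> is the classical smooth function that is flat at 0; the powers in
  the denominator make the span of the family closed under differentiation.\<close>

definition flat :: "nat \<Rightarrow> real \<Rightarrow> real" where
  "flat n t = (if t > 0 then exp (- 1 / t) / t ^ n else 0)"

lemma flat_derivative: "(flat n has_real_derivative (flat (n + 2) t - real n * flat (n + 1) t)) (at t)"
proof (cases t "0 :: real" rule: linorder_cases)
  case less
  have "((\<lambda>t. 0) has_real_derivative 0) (at t)" by simp
  then have "(flat n has_real_derivative 0) (at t)"
    by (rule has_field_derivative_transform_within_open[where S="{..<0}"]) (use less in \<open>auto simp: flat_def\<close>)
  then show ?thesis using less by (simp add: flat_def)
next
  case equal
  have R: "((\<lambda>h :: real. exp (- 1 / h) / h ^ n / h) \<longlongrightarrow> 0) (at_right 0)"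
  proof -
    have "((\<lambda>y :: real. y ^ Suc n / exp y) \<longlongrightarrow> 0) at_top" by (rule tendsto_power_div_exp_0)
    then have "((\<lambda>h :: real. inverse h ^ Suc n / exp (inverse h)) \<longlongrightarrow> 0) (at_right 0)"
      by (rule filterlim_compose[OF _ filterlim_inverse_at_top_right])
    moreover have "inverse h ^ Suc n / exp (inverse h) = exp (- 1 / h) / h ^ n / h" for h :: real
      by (simp add: exp_minus field_simps)
    ultimately show ?thesis by simp
  qed
  have "((\<lambda>h. flat n h / h) \<longlongrightarrow> 0) (at 0)"
    unfolding filterlim_at_split
  proof
    have "eventually (\<lambda>h. 0 = flat n h / h) (at_left 0)"
      by (rule eventually_at_leftI[of "-1"]) (auto simp: flat_def)
    then show "((\<lambda>h. flat n h / h) \<longlongrightarrow> 0) (at_left 0)" by (rule tendsto_eventually[OF eventually_mono]) simp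
    have "eventually (\<lambda>h. exp (- 1 / h) / h ^ n / h = flat n h / h) (at_right 0)"
      by (rule eventually_at_rightI[of _ 1]) (auto simp: flat_def)
    then show "((\<lambda>h. flat n h / h) \<longlongrightarrow> 0) (at_right 0)" by (rule Lim_transform_eventually[OF R])
  qed
  then show ?thesis using equal by (simp add: has_field_derivative_def DERIV_def flip: has_field_derivative_def) (simp add: flat_def)
next
  case greater
  have "((\<lambda>t. exp (- 1 / t) / t ^ n) has_real_derivative
      exp (- 1 / t) * (1 / t\<^sup>2) / t ^ n - exp (- 1 / t) * (real n * t ^ (n - 1)) / (t ^ n * t ^ n)) (at t)"
    using greater by (auto intro!: derivative_eq_intros simp: field_simps power2_eq_square)
  also have "exp (- 1 / t) * (1 / t\<^sup>2) / t ^ n - exp (- 1 / t) * (real n * t ^ (n - 1)) / (t ^ n * t ^ n)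
      = flat (n + 2) t - real n * flat (n + 1) t"
    \<comment> \<open>For n = 0 the truncated exponent n - 1 is harmless because of the factor
      \<open>real n\<close>.\<close>
    using greater by (cases n) (simp_all add: flat_def field_simps power2_eq_square)
  finally show ?thesis
    by (rule has_field_derivative_transform_within_open[where S="{0<..}"]) (use greater in \<open>auto simp: flat_def\<close>)
qed

lemma flat_0_bounds: "0 \<le> flat 0 t" "flat 0 t \<le> 1"
  by (auto simp: flat_def)

lemma flat_0_mono: "t \<le> t' \<Longrightarrow> flat 0 t \<le> flat 0 t'"
  by (auto simp: flat_def frac_le)

text \<open>A syntactic class closed under directional derivatives, just rich enough for polynomials
  multiplied by a smooth radial cutoff.\<close>

inductive elementary_smooth :: "('a::euclidean_space \<Rightarrow> real) \<Rightarrow> bool" where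
  const: "elementary_smooth (\<lambda>x. c)"
| inner: "elementary_smooth (\<lambda>x. x \<bullet> b)"
| add: "elementary_smooth f \<Longrightarrow> elementary_smooth g \<Longrightarrow> elementary_smooth (\<lambda>x. f x + g x)"
| mult: "elementary_smooth f \<Longrightarrow> elementary_smooth g \<Longrightarrow> elementary_smooth (\<lambda>x. f x * g x)"
| flat: "elementary_smooth f \<Longrightarrow> elementary_smooth (\<lambda>x. flat n (f x))"

lemma elementary_smooth_derivative:
  assumes "elementary_smooth f"
  shows "\<exists>f'. (\<forall>x. (f has_derivative f' x) (at x)) \<and> (\<forall>v. elementary_smooth (\<lambda>x. f' x v))"
  using assms
proof induction
  case (const c)
  show ?case by (rule exI[of _ "\<lambda>x v. 0"]) (auto intro: elementary_smooth.const)
next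
  case (inner b)
  show ?case by (rule exI[of _ "\<lambda>x v. v \<bullet> b"]) (auto intro!: elementary_smooth.const derivative_eq_intros)
next
  case (add f g)
  then obtain f' g' where "\<And>x. (f has_derivative f' x) (at x)" "\<And>v. elementary_smooth (\<lambda>x. f' x v)"
    "\<And>x. (g has_derivative g' x) (at x)" "\<And>v. elementary_smooth (\<lambda>x. g' x v)" by blast
  then show ?case
    by (intro exI[of _ "\<lambda>x v. f' x v + g' x v"]) (auto intro!: elementary_smooth.add has_derivative_add)
next
  case (mult f g)
  then obtain f' g' where "\<And>x. (f has_derivative f' x) (at x)" "\<And>v. elementary_smooth (\<lambda>x. f' x v)"
    "\<And>x. (g has_derivative g' x) (at x)" "\<And>v. elementary_smooth (\<lambda>x. g' x v)" by blast
  with mult.hyps show ?case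
    by (intro exI[of _ "\<lambda>x v. f x * g' x v + f' x v * g x"])
       (auto intro!: elementary_smooth.add elementary_smooth.mult has_derivative_mult)
next
  case (flat f n)
  then obtain f' where f': "\<And>x. (f has_derivative f' x) (at x)" "\<And>v. elementary_smooth (\<lambda>x. f' x v)" by blast
  let ?d = "\<lambda>x v. (flat (n + 2) (f x) + (- real n) * flat (n + 1) (f x)) * f' x v"
  have "((\<lambda>x. flat n (f x)) has_derivative ?d x) (at x)" for x
    using has_derivative_compose[OF f'(1) has_field_derivative_imp_has_derivative[OF flat_derivative[of n "f x"]]] by simp
  moreover have "elementary_smooth (\<lambda>x. ?d x v)" for v
    by (intro elementary_smooth.intros flat.hyps f'(2))
  ultimately show ?case by (intro exI[of _ ?d] conjI allI)
qed

lemma elementary_smooth_Ck: "elementary_smooth f \<Longrightarrow> Ck_function k f"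
  by (rule Ck_functionI[of _ "Collect elementary_smooth"]) (auto dest: elementary_smooth_derivative)

lemma elementary_smooth_uminus: "elementary_smooth f \<Longrightarrow> elementary_smooth (\<lambda>x. f (- x))"
proof (induction rule: elementary_smooth.induct)
  case (inner b)
  have "elementary_smooth (\<lambda>x. x \<bullet> (- b))" by (rule elementary_smooth.inner)
  then show ?case by simp
qed (auto intro: elementary_smooth.intros)

lemma elementary_smooth_sum: "(\<And>i. i \<in> I \<Longrightarrow> elementary_smooth (f i)) \<Longrightarrow> elementary_smooth (\<lambda>x. \<Sum>i\<in>I. f i x)"
  by (induction I rule: infinite_finite_induct) (auto intro: elementary_smooth.intros)

lemma elementary_smooth_polynomial: "real_polynomial_function g \<Longrightarrow> elementary_smooth g"
proof (induction rule: real_polynomial_function.induct)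
  case (linear f)
  have "f y = (\<Sum>b\<in>Basis. f b * (y \<bullet> b))" for y
  proof -
    interpret bounded_linear f by (rule linear)
    have "f y = f (\<Sum>b\<in>Basis. (y \<bullet> b) *\<^sub>R b)" by (simp add: euclidean_representation)
    also have "\<dots> = (\<Sum>b\<in>Basis. (y \<bullet> b) * f b)" by (simp add: sum scaleR)
    finally show ?thesis by (simp add: mult.commute)
  qed
  then have "f = (\<lambda>y. \<Sum>b\<in>Basis. f b * (y \<bullet> b))" by (rule ext)
  moreover have "elementary_smooth (\<lambda>y. \<Sum>b\<in>Basis. f b * (y \<bullet> b))"
    by (intro elementary_smooth_sum elementary_smooth.intros)
  ultimately show ?case by simp
qed (auto intro: elementary_smooth.intros)

text \<open>Factor g = b h with b a smooth even cutoff supported inside the ball and h continuous,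
  approximate h by a polynomial, and multiply the odd part of that polynomial by b.\<close>

lemma odd_data_dense:
  fixes g :: "'a::euclidean_space \<Rightarrow> real"
  assumes \<delta>: "\<delta> > 0" "ball 0 \<delta> \<subseteq> \<Omega>"
    and g: "continuous_on UNIV g" "\<rho> < \<delta>" "\<And>x. \<rho> \<le> norm x \<Longrightarrow> g x = 0" "\<And>x. g (- x) = - g x"
    and e: "e > 0"
  obtains u where "u \<in> odd_data \<Omega> \<delta>" "\<And>x. \<bar>g x - u x\<bar> \<le> e"
proof -
  define \<rho>0 where "\<rho>0 = max \<rho> 0"
  define \<rho>1 where "\<rho>1 = (\<rho>0 + \<delta>) / 2"
  have \<rho>: "0 \<le> \<rho>0" "\<rho> \<le> \<rho>0" "\<rho>0 < \<rho>1" "\<rho>1 < \<delta>" using \<delta>(1) g(2) by (auto simp: \<rho>0_def \<rho>1_def)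
  define b where "b x = flat 0 (\<rho>1\<^sup>2 + (- 1) * (\<Sum>i\<in>Basis. (x \<bullet> i) * (x \<bullet> i)))" for x :: 'a
  have b: "b x = flat 0 (\<rho>1\<^sup>2 - (norm x)\<^sup>2)" for x
    by (simp add: b_def power2_norm_eq_inner euclidean_inner[of x x])
  have b_smooth: "elementary_smooth b" unfolding b_def by (intro elementary_smooth_sum elementary_smooth.intros)
  have b_zero: "b x = 0" if "\<rho>1 \<le> norm x" for x
  proof -
    have "\<rho>1\<^sup>2 \<le> (norm x)\<^sup>2" using that \<rho> by (intro power_mono) auto
    then show ?thesis unfolding b by (simp add: flat_def)
  qed
  define c where "c = flat 0 (\<rho>1\<^sup>2 - \<rho>0\<^sup>2)"
  have "\<rho>0\<^sup>2 < \<rho>1\<^sup>2" using \<rho> by (intro power_strict_mono) auto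
  then have c: "c > 0" by (simp add: c_def flat_def)
  \<comment> \<open>The maximum keeps the denominator away from 0. Within radius
    \<open>\<rho>0\<close> it equals b x, and elsewhere g vanishes, so g = b h holds
    everywhere.\<close>
  define h where "h x = g x / max c (b x)" for x
  have gh: "g x = b x * h x" for x
  proof (cases "norm x \<le> \<rho>0")
    case True
    then have "(norm x)\<^sup>2 \<le> \<rho>0\<^sup>2" by (intro power_mono) auto
    then have "c \<le> b x" unfolding c_def b by (intro flat_0_mono) simp
    then show ?thesis using c by (simp add: h_def max_def)
  next
    case False
    then show ?thesis using g(3)[of x] \<rho> by (simp add: h_def)
  qed
  have "continuous_on UNIV b" using elementary_smooth_Ck[OF b_smooth, of 0] by simp
  then have "continuous_on UNIV h" unfolding h_def[abs_def] using c by (intro continuous_intros g(1)) auto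
  then have hc: "continuous_on (cball 0 \<delta>) h" by (rule continuous_on_subset) simp
  obtain p where p: "real_polynomial_function p" "\<And>x. x \<in> cball 0 \<delta> \<Longrightarrow> \<bar>h x - p x\<bar> < e"
    using Stone_Weierstrass_real_polynomial_function[OF compact_cball hc e] by blast
  \<comment> \<open>Since h is odd as well, taking the odd part of p does not worsen the
    approximation.\<close>
  define u where "u x = b x * ((1 / 2) * (p x + (- 1) * p (- x)))" for x
  have b_even: "b (- x) = b x" for x by (simp add: b)
  have u_smooth: "elementary_smooth u" unfolding u_def[abs_def]
    by (intro elementary_smooth.intros b_smooth elementary_smooth_uminus elementary_smooth_polynomial[OF p(1)])
  have "{x. u x \<noteq> 0} \<subseteq> cball 0 \<rho>1"
  proof
    fix x assume "x \<in> {x. u x \<noteq> 0}"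
    then have "b x \<noteq> 0" by (auto simp: u_def)
    then show "x \<in> cball 0 \<rho>1" using b_zero[of x] by (cases "\<rho>1 \<le> norm x") auto
  qed
  then have supp: "supp u \<subseteq> cball 0 \<rho>1" unfolding supp_def by (intro closure_minimal) auto
  then have "compact (supp u)"
    unfolding supp_def using compact_eq_bounded_closed bounded_subset[OF bounded_cball] by blast
  moreover have "supp u \<subseteq> ball 0 \<delta>" using supp \<rho> by force
  moreover have "u (- x) = - u x" for x by (simp add: u_def b_even algebra_simps)
  ultimately have "u \<in> odd_data \<Omega> \<delta>"
    using \<delta>(2) elementary_smooth_Ck[OF u_smooth] by (auto simp: odd_data_def test_functions_def)
  moreover have "\<bar>g x - u x\<bar> \<le> e" for x
  proof (cases "norm x \<le> \<delta>")
    case True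
    have "h (- x) = - h x" by (simp add: h_def g(4) b_even)
    then have "\<bar>- h x - p (- x)\<bar> < e" using p(2)[of "- x"] True by simp
    moreover have "\<bar>h x - p x\<bar> < e" using p(2)[of x] True by simp
    ultimately have "\<bar>h x - (1 / 2) * (p x + (- 1) * p (- x))\<bar> \<le> e" unfolding abs_le_iff abs_less_iff by (simp add: field_simps)
    then have "\<bar>b x\<bar> * \<bar>h x - (1 / 2) * (p x + (- 1) * p (- x))\<bar> \<le> 1 * e"
      using flat_0_bounds[of "\<rho>1\<^sup>2 - (norm x)\<^sup>2"] by (intro mult_mono) (auto simp: b)
    moreover have "g x - u x = b x * (h x - (1 / 2) * (p x + (- 1) * p (- x)))"
      unfolding gh[of x] u_def by (simp add: right_diff_distrib)
    ultimately show ?thesis by (simp add: abs_mult)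
  next
    case False
    then have "b x = 0" using \<rho> by (intro b_zero) simp
    then show ?thesis using gh[of x] e by (simp add: u_def)
  qed
  ultimately show ?thesis using that by blast
qed

section \<open>Reflection in the origin\<close>

lemma AE_lborel_reflect:
  assumes "AE x in (lborel :: 'a::euclidean_space measure). P x"
  shows "AE x in (lborel :: 'a measure). P (- x)"
proof -
  have eq: "distr lborel borel uminus = (lborel :: 'a measure)"
    by (rule distr_lborel_involutive_isometry) (auto simp: bounded_linear_minus linear_uminus)
  have "AE x in distr (lborel :: 'a measure) borel uminus. P x" unfolding eq by (rule assms)
  moreover have "uminus \<in> borel_measurable (lborel :: 'a measure)" by simp
  ultimately show ?thesis by (intro AE_distrD[where f=uminus and M=lborel and M'=borel])
qed

lemma energy_integrand_reflect:
  "energy_integrand s (\<lambda>x. u (- x)) (\<lambda>x. v (- x)) p = energy_integrand s u v (- p)"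
  by (cases p) (simp add: energy_integrand_def norm_minus_commute)

lemma energy_reflect: "energy s (\<lambda>x. u (- x)) (\<lambda>x. v (- x)) = energy s u v"
  unfolding energy_def energy_integrand_reflect lborel_prod by (rule integral_reflect)

lemma energy_commute: "energy s u v = energy s v u"
  unfolding energy_sqrt_energy by (simp add: mult.commute)

lemma sq_int_reflect:
  fixes f :: "'a::euclidean_space \<Rightarrow> real"
  assumes "f \<in> sq_int lborel"
  shows "(\<lambda>x. f (- x)) \<in> sq_int lborel"
proof -
  have [measurable]: "f \<in> borel_measurable borel" using assms by (simp add: sq_int_def)
  have "integrable lborel (\<lambda>x. (f (- x))\<^sup>2)"
    using assms integrable_reflect_iff[of "\<lambda>x. (f x)\<^sup>2"] by (simp add: sq_int_def)
  then show ?thesis by (simp add: sq_int_def)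
qed

lemma C11_function_continuous:
  assumes "C11_function \<gamma>"
  shows "continuous_on UNIV \<gamma>"
proof -
  obtain D L where D: "\<forall>x. GDERIV \<gamma> x :> D x" and "lipschitz_on L UNIV D"
    using assms unfolding C11_function_def by (elim exE conjE)
  show ?thesis
  proof (rule continuous_at_imp_continuous_on, rule ballI)
    fix x
    have "GDERIV \<gamma> x :> D x" using D by (rule spec)
    then show "isCont \<gamma> x" unfolding gderiv_def by (rule has_derivative_continuous)
  qed
qed

text \<open>The boundary condition excludes slits and punctures. At a boundary point the set is a
  strict epigraph, and a short step along -e leads strictly below the graph, where a whole
  neighbourhood misses the set.\<close>

lemma C11_boundary_exterior_point:
  assumes C: "C11_boundary \<Omega>" and U: "open U" "p \<in> U" and p: "p \<notin> \<Omega>"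
  obtains y where "y \<in> U" "y \<notin> closure \<Omega>"
proof (cases "p \<in> closure \<Omega>")
  case False
  then show ?thesis using that[of p] U by blast
next
  case True
  then have "p \<in> frontier \<Omega>" using p interior_subset by (auto simp: frontier_def)
  then obtain r e \<gamma> where r: "r > 0" and e: "norm e = 1" and \<gamma>: "C11_function \<gamma>"
    and eq: "\<Omega> \<inter> ball p r = {x \<in> ball p r. \<gamma> (x - (x \<bullet> e) *\<^sub>R e) < x \<bullet> e}"
    using C unfolding C11_boundary_def by blast
  obtain d where d: "d > 0" "ball p d \<subseteq> U" using U open_contains_ball by blast
  have ee: "e \<bullet> e = 1" using e by (simp add: dot_square_norm)
  define h where "h y = \<gamma> (y - (y \<bullet> e) *\<^sub>R e) - y \<bullet> e" for y
  have iff: "x \<in> \<Omega> \<longleftrightarrow> h x < 0" if x: "x \<in> ball p r" for x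
  proof -
    have "x \<in> \<Omega> \<longleftrightarrow> x \<in> \<Omega> \<inter> ball p r" using x by blast
    also have "\<dots> \<longleftrightarrow> h x < 0" unfolding eq h_def using x by simp
    finally show ?thesis .
  qed
  have "continuous_on UNIV (\<lambda>y. \<gamma> (y - (y \<bullet> e) *\<^sub>R e))"
    by (rule continuous_on_compose2[OF C11_function_continuous[OF \<gamma>]]) (auto intro!: continuous_intros)
  then have hc: "continuous_on UNIV h" unfolding h_def[abs_def] by (intro continuous_intros)
  define t where "t = min r d / 2"
  have t: "0 < t" "t < r" "t < d" using r d by (auto simp: t_def)
  define y where "y = p - t *\<^sub>R e"
  have py: "dist p y = t" using e t by (simp add: y_def dist_norm)
  have ye: "y \<bullet> e = p \<bullet> e - t" by (simp add: y_def inner_simps ee)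
  moreover have "p - (p \<bullet> e) *\<^sub>R e = y - (y \<bullet> e) *\<^sub>R e" unfolding ye by (simp add: y_def scaleR_diff_left)
  moreover have "\<not> h p < 0" using iff[of p] p r by simp
  ultimately have hy: "h y > 0" using t by (simp add: h_def)
  have "open (ball p r \<inter> {y. h y > 0})"
    using open_Collect_less[OF continuous_on_const hc, of 0] by (intro open_Int) auto
  moreover have "(ball p r \<inter> {y. h y > 0}) \<inter> \<Omega> = {}"
  proof (rule equals0I)
    fix x assume x: "x \<in> (ball p r \<inter> {y. h y > 0}) \<inter> \<Omega>"
    then show False using iff[of x] by simp
  qed
  ultimately have "(ball p r \<inter> {y. h y > 0}) \<inter> closure \<Omega> = {}" by (simp only: open_Int_closure_eq_empty)
  moreover have "y \<in> ball p r \<inter> {y. h y > 0}" using hy py t by simp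
  ultimately have "y \<notin> closure \<Omega>" by blast
  moreover have "y \<in> U" using d py t by auto
  ultimately show ?thesis using that by blast
qed

lemma odd_data_continuous:
  assumes "u \<in> odd_data \<Omega> \<delta>"
  shows "continuous_on UNIV u"
proof -
  have "Ck_function 0 u" using assms unfolding odd_data_def test_functions_def by blast
  then show ?thesis by simp
qed

section \<open>The value of the resolvent at the origin as a functional of the datum\<close>

locale frac_dirichlet_origin = frac_dirichlet +
  assumes zero_in: "0 \<in> \<Omega>"
begin

lemma bounded_on_closure:
  assumes "continuous_on UNIV (f :: 'a \<Rightarrow> real)"
  obtains M where "0 \<le> M" "\<And>x. x \<in> closure \<Omega> \<Longrightarrow> \<bar>f x\<bar> \<le> M"
proof -
  have "compact (closure \<Omega>)" using \<Omega>_bounded by (simp add: compact_closure)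
  then have "bounded (f ` closure \<Omega>)"
    using assms by (intro compact_imp_bounded compact_continuous_image) (auto intro: continuous_on_subset)
  then obtain B where B: "\<And>x. x \<in> closure \<Omega> \<Longrightarrow> \<bar>f x\<bar> \<le> B" by (auto simp: bounded_iff)
  show ?thesis by (rule that[of "\<bar>B\<bar>"]) (use B in fastforce)+
qed

lemma continuous_L2:
  assumes f: "continuous_on UNIV f"
  shows "f \<in> L2 \<Omega>"
proof -
  have [measurable]: "f \<in> borel_measurable borel" by (rule borel_measurable_continuous_onI[OF f])
  have m: "restr \<Omega> f \<in> borel_measurable borel" unfolding restr_def[abs_def] by measurable
  have "integrable lborel (\<lambda>x. (restr \<Omega> f x)\<^sup>2)"
  proof (rule Bochner_Integration.integrable_bound)
    show "integrable lborel (\<lambda>x. indicator (closure \<Omega>) x *\<^sub>R (f x)\<^sup>2)"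
      using \<Omega>_bounded continuous_on_subset[OF f]
      by (intro borel_integrable_compact continuous_intros) (auto simp: compact_closure)
    show "(\<lambda>x. (restr \<Omega> f x)\<^sup>2) \<in> borel_measurable lborel" using m by measurable
    show "AE x in lborel. norm ((restr \<Omega> f x)\<^sup>2) \<le> norm (indicator (closure \<Omega>) x *\<^sub>R (f x)\<^sup>2)"
      using closure_subset[of \<Omega>] by (intro AE_I2) (auto simp: restr_def split: split_indicator)
  qed
  then show ?thesis using m by (simp add: L2_iff_restr sq_int_def)
qed

text \<open>Junk if no continuous resolvent exists, and only meaningful if \<open>0 \<in> \<Omega>\<close>.\<close>

definition point_value :: "('a \<Rightarrow> real) \<Rightarrow> real" where
  "point_value f = (SOME v. \<exists>V. resolvent 1 f V \<and> continuous_on \<Omega> V \<and> v = V 0)"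

lemma point_value_eq:
  assumes V: "resolvent 1 f V" "continuous_on \<Omega> V"
  shows "point_value f = V 0"
proof -
  have "\<exists>W. resolvent 1 f W \<and> continuous_on \<Omega> W \<and> point_value f = W 0"
    unfolding point_value_def by (rule someI_ex) (use V in blast)
  then show ?thesis using resolvent_continuous_unique[OF _ V(1) _ V(2) zero_in] by force
qed

lemma point_value_resolvent:
  assumes f: "continuous_on UNIV f"
  obtains V where "resolvent 1 f V" "continuous_on \<Omega> V" "point_value f = V 0"
proof -
  obtain M where M: "0 \<le> M" "\<And>x. x \<in> closure \<Omega> \<Longrightarrow> \<bar>f x\<bar> \<le> M" using bounded_on_closure[OF f] by blast
  have "\<bar>f x\<bar> \<le> M" if "x \<in> \<Omega>" for x using M(2) that closure_subset by blast
  from resolvent_continuous_exists[OF zero_less_one continuous_L2[OF f] this M(1)]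
  obtain V where "resolvent 1 f V" "continuous_on \<Omega> V" by blast
  then show ?thesis using that point_value_eq by blast
qed

lemma point_value_lincomb:
  assumes f: "continuous_on UNIV f" and g: "continuous_on UNIV g"
  shows "point_value (\<lambda>x. a * f x + b * g x) = a * point_value f + b * point_value g"
proof -
  obtain V where V: "resolvent 1 f V" "continuous_on \<Omega> V" "point_value f = V 0"
    using point_value_resolvent[OF f] by blast
  obtain W where W: "resolvent 1 g W" "continuous_on \<Omega> W" "point_value g = W 0"
    using point_value_resolvent[OF g] by blast
  have "continuous_on \<Omega> (\<lambda>x. a * V x + b * W x)" using V W by (intro continuous_intros)
  from point_value_eq[OF resolvent_lincomb[OF continuous_L2[OF f] continuous_L2[OF g] V(1) W(1)] this]
  show ?thesis using V W by simp
qed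

lemma point_value_bound:
  assumes f: "continuous_on UNIV f" and M: "0 \<le> M" "\<And>x. x \<in> \<Omega> \<Longrightarrow> \<bar>f x\<bar> \<le> M"
  shows "\<bar>point_value f\<bar> \<le> M"
proof -
  obtain V where V: "resolvent 1 f V" "continuous_on \<Omega> V" "point_value f = V 0"
    using point_value_resolvent[OF f] by blast
  show ?thesis
    using resolvent_continuous_bound[OF zero_less_one continuous_L2[OF f] M(2) M(1) V(1,2) zero_in] V(3) by simp
qed

lemma continuous_on_bump_op_affine: "continuous_on UNIV (\<lambda>y :: 'a. bump_op ((y - x) /\<^sub>R e))"
  by (rule continuous_on_compose2[OF continuous_on_bump_op[of UNIV]]) (auto intro!: continuous_intros)

text \<open>The eigenvalue equation tested with the bump. The integral over the whole space in
  \<open>energy_bump_at\<close> reduces to \<open>\<Omega>\<close> because \<open>\<phi> k\<close>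
  vanishes almost everywhere outside.\<close>

lemma coef_bump_op:
  assumes e: "e > 0" "cball x e \<subseteq> \<Omega>"
  shows "fc / 2 * e powr (- 2 * s) * coef (\<lambda>y. bump_op ((y - x) /\<^sub>R e)) k = \<mu> k * coef (bump_at x e) k"
proof -
  let ?b = "\<lambda>y. bump_op ((y - x) /\<^sub>R e)"
  have ae: "AE y in lborel. restr \<Omega> (\<phi> k) y = \<phi> k y"
  proof -
    have "AE y in lborel. y \<notin> \<Omega> \<longrightarrow> \<phi> k y = 0" using \<phi>_Htilde[of k] by (simp add: Htilde_def)
    then show ?thesis by eventually_elim (auto simp: restr_def split: split_indicator)
  qed
  have [measurable]: "\<phi> k \<in> borel_measurable borel" by (rule Htilde_measurable[OF \<phi>_Htilde])
  have rm: "restr \<Omega> (\<phi> k) \<in> borel_measurable borel" unfolding restr_def[abs_def] by measurable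
  have bm: "?b \<in> borel_measurable borel" by (rule borel_measurable_continuous_onI[OF continuous_on_bump_op_affine])
  have "restr \<Omega> (\<phi> k) \<in> L2 \<Omega>" using \<phi>_L2[of k] by (simp add: L2_iff_restr)
  then have "integrable lborel (restr \<Omega> (\<phi> k))" by (rule integrable_of_L2) simp
  then have int: "integrable lborel (\<phi> k)" by (rule integrable_cong_AE_imp[OF _ _ ae]) simp
  have "coef ?b k = (\<integral>y. restr \<Omega> ?b y * restr \<Omega> (\<phi> k) y \<partial>lborel)" unfolding coef_def L2_inner_restr ..
  also have "\<dots> = (\<integral>y. restr \<Omega> (\<phi> k) y * ?b y \<partial>lborel)"
    by (intro Bochner_Integration.integral_cong) (auto simp: restr_def split: split_indicator)
  also have "\<dots> = (\<integral>y. \<phi> k y * ?b y \<partial>lborel)"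
  proof (rule integral_cong_AE)
    show "AE y in lborel. restr \<Omega> (\<phi> k) y * ?b y = \<phi> k y * ?b y" using ae by eventually_elim simp
  qed (use rm bm in measurable)
  finally have "e powr (- 2 * s) * coef ?b k = energy s (\<phi> k) (bump_at x e)"
    by (simp add: energy_bump_at[OF e \<phi>_Htilde int])
  then show ?thesis using eigen[OF bump_at_Htilde[OF e], of k] by (simp add: mult.assoc)
qed

text \<open>The factor in front makes the first argument the fractional Laplacian of
  \<open>bump_at x e\<close>, by the scaling in \<open>frac_op_bump_at\<close> and the ratio
  \<open>fc / 2\<close> between (-\<Delta>)^s and \<open>frac_op\<close>.\<close>

lemma point_value_bump:
  assumes e: "e > 0" "cball x e \<subseteq> \<Omega>"
  shows "fc / 2 * e powr (- 2 * s) * point_value (\<lambda>y. bump_op ((y - x) /\<^sub>R e)) + point_value (bump_at x e) = bump_at x e 0"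
proof -
  let ?b = "\<lambda>y. bump_op ((y - x) /\<^sub>R e)" and ?c = "fc / 2 * e powr (- 2 * s)"
  have b: "?b \<in> L2 \<Omega>" "bump_at x e \<in> L2 \<Omega>"
    by (intro continuous_L2 continuous_on_bump_op_affine continuous_on_bump_at)+
  have "resolvent 1 (\<lambda>y. ?c * ?b y + 1 * bump_at x e y) (bump_at x e)"
    unfolding resolvent_def
  proof safe
    fix k
    have "coef (\<lambda>y. ?c * ?b y + 1 * bump_at x e y) k = (1\<^sup>2 + \<mu> k) * coef (bump_at x e) k"
      unfolding coef_lincomb[OF b] coef_bump_op[OF e] by (simp add: algebra_simps)
    then show "coef (bump_at x e) k = coef (\<lambda>y. ?c * ?b y + 1 * bump_at x e y) k / (1\<^sup>2 + \<mu> k)"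
      using \<mu>_pos[of k] by simp
  qed (rule b)
  from point_value_eq[OF this continuous_on_bump_at]
  show ?thesis unfolding point_value_lincomb[OF continuous_on_bump_op_affine continuous_on_bump_at] by simp
qed

text \<open>The difference of g and its reflection is odd and supported strictly inside the ball,
  hence a uniform limit of admissible data, and \<open>point_value\<close> is continuous in the
  supremum norm.\<close>

lemma point_value_odd_part:
  assumes \<delta>: "\<delta> > 0" "ball 0 \<delta> \<subseteq> \<Omega>"
    and odd: "\<And>u. u \<in> odd_data \<Omega> \<delta> \<Longrightarrow> point_value u = 0"
    and g: "continuous_on UNIV g" "\<rho> < \<delta>" "\<And>x. \<rho> \<le> norm x \<Longrightarrow> g x = 0"
  shows "point_value g = point_value (\<lambda>x. g (- x))"
proof -
  have g': "continuous_on UNIV (\<lambda>x. g (- x))"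
    by (rule continuous_on_compose2[OF g(1)]) (auto intro!: continuous_intros)
  define h where "h x = 1 * g x + (-1) * g (- x)" for x
  have h: "continuous_on UNIV h" unfolding h_def[abs_def] by (intro continuous_intros g(1) g')
  have "\<bar>point_value h\<bar> \<le> 0 + e" if e: "e > 0" for e
  proof -
    have h0: "h x = 0" if "\<rho> \<le> norm x" for x using g(3)[of x] g(3)[of "- x"] that by (simp add: h_def)
    obtain u where u: "u \<in> odd_data \<Omega> \<delta>" "\<And>x. \<bar>h x - u x\<bar> \<le> e"
      using odd_data_dense[OF \<delta> h g(2) h0 _ e] by (auto simp: h_def)
    have uc: "continuous_on UNIV u" by (rule odd_data_continuous[OF u(1)])
    have "\<bar>point_value (\<lambda>x. 1 * h x + (-1) * u x)\<bar> \<le> e"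
      using u(2) e by (intro point_value_bound continuous_intros h uc) auto
    then show ?thesis unfolding point_value_lincomb[OF h uc] odd[OF u(1)] by simp
  qed
  then have "\<bar>point_value h\<bar> \<le> 0" by (rule field_le_epsilon)
  then show ?thesis unfolding h_def[abs_def] point_value_lincomb[OF g(1) g'] by simp
qed

lemma bump_at_support:
  assumes "e > 0" "cball x e \<subseteq> ball z r" "dist z x + e \<le> dist z y"
  shows "bump_at x e y = 0"
  using assms dist_triangle[of z y x] by (intro bump_at_eq_0) (auto simp: dist_norm norm_minus_commute)

lemma point_value_reflect:
  assumes \<delta>: "\<delta> > 0" "ball 0 \<delta> \<subseteq> \<Omega>"
    and odd: "\<And>u. u \<in> odd_data \<Omega> \<delta> \<Longrightarrow> point_value u = 0"
    and f: "continuous_on UNIV f"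
  shows "point_value f = point_value (\<lambda>x. f (- x))"
proof -
  have refl: "continuous_on UNIV (\<lambda>x :: 'a. g (- x))" if "continuous_on UNIV g" for g :: "'a \<Rightarrow> real"
    by (rule continuous_on_compose2[OF that]) (auto intro!: continuous_intros)
  \<comment> \<open>The compact set contains the reflected closure because the second term evaluates
    f there; the bound 2 adds the two terms.\<close>
  interpret unique_continuation "\<lambda>f. point_value f - point_value (\<lambda>x. f (- x))"
    "closure \<Omega> \<union> uminus ` closure \<Omega>" 2 0 \<delta> s
  proof
    show "compact (closure \<Omega> \<union> uminus ` closure \<Omega>)"
      using \<Omega>_bounded by (intro compact_Un compact_continuous_image) (auto simp: compact_closure intro!: continuous_intros)
    show "point_value (\<lambda>x. a * f x + b * g x) - point_value (\<lambda>x. a * f (- x) + b * g (- x))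
        = a * (point_value f - point_value (\<lambda>x. f (- x))) + b * (point_value g - point_value (\<lambda>x. g (- x)))"
      if "continuous_on UNIV f" "continuous_on UNIV g" for f g :: "'a \<Rightarrow> real" and a b
      unfolding point_value_lincomb[OF that] point_value_lincomb[OF that[THEN refl]] by (simp add: algebra_simps)
    show "\<bar>point_value f - point_value (\<lambda>x. f (- x))\<bar> \<le> 2 * M"
      if f: "continuous_on UNIV f" and M: "0 \<le> M" "\<And>x. x \<in> closure \<Omega> \<union> uminus ` closure \<Omega> \<Longrightarrow> \<bar>f x\<bar> \<le> M" for f M
    proof -
      have "\<bar>point_value f\<bar> \<le> M" using M closure_subset[of \<Omega>] by (intro point_value_bound f) blast+
      moreover have "\<bar>point_value (\<lambda>x. f (- x))\<bar> \<le> M"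
        using M closure_subset[of \<Omega>] by (intro point_value_bound refl f) blast+
      ultimately show ?thesis by linarith
    qed
    show loc: "point_value g - point_value (\<lambda>x. g (- x)) = 0"
      if "continuous_on UNIV g" "\<rho> < \<delta>" "\<And>x. \<rho> \<le> dist 0 x \<Longrightarrow> g x = 0" for g \<rho>
      using point_value_odd_part[OF \<delta> odd that(1,2)] that(3) by simp
    show "point_value (\<lambda>y. bump_op ((y - x) /\<^sub>R e)) - point_value (\<lambda>y. bump_op ((- y - x) /\<^sub>R e)) = 0"
      if e: "e > 0" and sub: "cball x e \<subseteq> ball 0 \<delta>" for x e
    proof -
      have lt: "dist 0 x + e < \<delta>" using sub e by (simp add: cball_subset_ball_iff dist_commute)
      have b: "point_value (bump_at x e) - point_value (\<lambda>y. bump_at x e (- y)) = 0"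
        by (rule loc[OF continuous_on_bump_at lt]) (rule bump_at_support[OF e sub])
      have "(\<lambda>y. bump_op ((- y - x) /\<^sub>R e)) = (\<lambda>y. bump_op ((y - (- x)) /\<^sub>R e))"
      proof
        fix y
        have "- y - x = - (y - (- x))" by simp
        then show "bump_op ((- y - x) /\<^sub>R e) = bump_op ((y - (- x)) /\<^sub>R e)"
          by (intro bump_op_radial) (simp only: norm_scaleR norm_minus_cancel)
      qed
      moreover have sub': "cball (- x) e \<subseteq> ball 0 \<delta>" using lt e by (simp add: cball_subset_ball_iff)
      have "bump_at x e 0 = bump_at (- x) e 0" using bump_at_reflect[of x e 0] by simp
      moreover have "(\<lambda>y. bump_at x e (- y)) = bump_at (- x) e" by (rule ext) (rule bump_at_reflect)
      \<comment> \<open>Reflection moves the bump from x to -x, which lies in the same ball. The two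
        instances of \<open>point_value_bump\<close> have equal right-hand sides by evenness and
        equal bump terms by locality, so the remaining terms agree.\<close>
      ultimately have "fc / 2 * e powr (- 2 * s) * point_value (\<lambda>y. bump_op ((y - x) /\<^sub>R e))
          = fc / 2 * e powr (- 2 * s) * point_value (\<lambda>y. bump_op ((- y - x) /\<^sub>R e))"
        using point_value_bump[OF e order_trans[OF sub \<delta>(2)]] point_value_bump[OF e order_trans[OF sub' \<delta>(2)]] b
        by (simp only:)
      then show ?thesis using fc_pos e by simp
    qed
  qed (use \<delta> in auto)
  show ?thesis using vanishes[OF f] by simp
qed

lemma reflect_not_separated:
  assumes even: "\<And>f. continuous_on UNIV f \<Longrightarrow> point_value f = point_value (\<lambda>x. f (- x))"
    and r: "r > 0" and U: "ball z r \<subseteq> \<Omega>" "ball z r \<inter> uminus ` closure \<Omega> = {}"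
  shows False
proof -
  \<comment> \<open>The reflected function vanishes on all of \<open>\<Omega>\<close>, so its value
    is 0 by the supremum bound, and evenness transfers this to g.\<close>
  have loc: "point_value g = 0" if g: "continuous_on UNIV g" "\<rho> < r" "\<And>x. \<rho> \<le> dist z x \<Longrightarrow> g x = 0" for g \<rho>
  proof -
    have "\<bar>point_value (\<lambda>x. g (- x))\<bar> \<le> 0"
    proof (rule point_value_bound)
      show "continuous_on UNIV (\<lambda>x. g (- x))"
        by (rule continuous_on_compose2[OF g(1)]) (auto intro!: continuous_intros)
      fix x assume "x \<in> \<Omega>"
      then have "- x \<notin> ball z r" using U(2) closure_subset[of \<Omega>] by blast
      then show "\<bar>g (- x)\<bar> \<le> 0" using g(2) g(3)[of "- x"] by simp
    qed simp
    then show ?thesis using even[OF g(1)] by simp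
  qed
  \<comment> \<open>The origin is its own reflection, so the separated ball avoids it, and bumps in
    that ball vanish at 0.\<close>
  have "0 \<in> uminus ` closure \<Omega>" using zero_in closure_subset[of \<Omega>] by force
  then have z0: "0 \<notin> ball z r" using U(2) by blast
  interpret unique_continuation point_value "closure \<Omega>" 1 z r s
  proof
    show "compact (closure \<Omega>)" using \<Omega>_bounded by (simp add: compact_closure)
    show "\<bar>point_value f\<bar> \<le> 1 * M" if "continuous_on UNIV f" "0 \<le> M" "\<And>x. x \<in> closure \<Omega> \<Longrightarrow> \<bar>f x\<bar> \<le> M" for f M
      using point_value_bound[OF that(1,2)] that(3) closure_subset[of \<Omega>] by auto
    show "point_value (\<lambda>y. bump_op ((y - x) /\<^sub>R e)) = 0" if e: "e > 0" and sub: "cball x e \<subseteq> ball z r" for x e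
    proof -
      have lt: "dist z x + e < r" using sub e by (simp add: cball_subset_ball_iff dist_commute)
      have "point_value (bump_at x e) = 0"
        by (rule loc[OF continuous_on_bump_at lt]) (rule bump_at_support[OF e sub])
      moreover have "bump_at x e 0 = 0" using z0 lt by (intro bump_at_support[OF e sub]) simp
      ultimately show ?thesis using point_value_bump[OF e order_trans[OF sub U(1)]] fc_pos e by simp
    qed
  qed (use r in \<open>auto intro: loc point_value_lincomb\<close>)
  obtain e where e: "e > 0" "cball 0 e \<subseteq> \<Omega>" using \<Omega>_open zero_in open_contains_cball by blast
  have "point_value (\<lambda>y. bump_op ((y - 0) /\<^sub>R e)) = 0" by (rule vanishes[OF continuous_on_bump_op_affine])
  moreover have "point_value (bump_at 0 e) = 0" by (rule vanishes[OF continuous_on_bump_at])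
  ultimately show False using point_value_bump[OF e] by simp
qed

lemma centrosymmetric_of_vanishing:
  assumes C: "C11_boundary \<Omega>" and \<delta>: "\<delta> > 0" "ball 0 \<delta> \<subseteq> \<Omega>"
    and odd: "\<And>u. u \<in> odd_data \<Omega> \<delta> \<Longrightarrow> point_value u = 0"
  shows "centrosymmetric \<Omega>"
  unfolding centrosymmetric_def
proof (intro allI impI, rule ccontr)
  fix x assume x: "x \<in> \<Omega>" "- x \<notin> \<Omega>"
  have opn: "open (uminus ` \<Omega>)" by (rule open_negations[OF \<Omega>_open])
  \<comment> \<open>The point -x may lie on the boundary of \<open>\<Omega>\<close>; a nearby point
    of the reflected domain is strictly outside, which leaves room for a ball.\<close>
  obtain y where y: "y \<in> uminus ` \<Omega>" "y \<notin> closure \<Omega>"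
    using C11_boundary_exterior_point[OF C opn imageI[OF x(1)] x(2)] by blast
  have "open (\<Omega> \<inter> - uminus ` closure \<Omega>)"
    using \<Omega>_open closed_negations[OF closed_closure] by (intro open_Int open_Compl) auto
  moreover have "- y \<in> \<Omega> \<inter> - uminus ` closure \<Omega>" using y by auto
  ultimately obtain r where r: "r > 0" "ball (- y) r \<subseteq> \<Omega> \<inter> - uminus ` closure \<Omega>"
    using open_contains_ball by blast
  show False
    by (rule reflect_not_separated[OF point_value_reflect[OF \<delta> odd] r(1)]) (use r(2) in blast)+
qed

text \<open>Reflection preserves the energy form, hence maps each eigenspace to itself, which for
  multiple eigenvalues does not make every \<open>\<phi> k\<close> even or odd. So the argument is
  carried out on coefficients.\<close>

lemma resolvent_reflect:
  assumes cs: "centrosymmetric \<Omega>" and l: "l > 0" and f: "f \<in> L2 \<Omega>" and V: "resolvent l f V"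
  shows "resolvent l (\<lambda>x. f (- x)) (\<lambda>x. V (- x))"
proof -
  have cs': "- x \<in> \<Omega> \<longleftrightarrow> x \<in> \<Omega>" for x using cs minus_minus[of x] unfolding centrosymmetric_def by metis
  have restr_R: "restr \<Omega> (\<lambda>x. g (- x)) = (\<lambda>x. restr \<Omega> g (- x))" for g
    by (auto simp: restr_def fun_eq_iff cs' split: split_indicator)
  have L2R: "(\<lambda>x. g (- x)) \<in> L2 \<Omega>" if "g \<in> L2 \<Omega>" for g
    using that sq_int_reflect by (simp add: L2_iff_restr restr_R)
  have innerR: "L2_inner \<Omega> (\<lambda>x. g (- x)) h = L2_inner \<Omega> g (\<lambda>x. h (- x))" for g h
    unfolding L2_inner_restr restr_R
    using integral_reflect[of "\<lambda>x. restr \<Omega> g x * restr \<Omega> h (- x)"] by simp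
  have HR: "(\<lambda>x. u (- x)) \<in> Htilde s \<Omega>" if u: "u \<in> Htilde s \<Omega>" for u
  proof -
    have "u \<in> sq_int lborel" using u by (simp add: L2_UNIV_iff Htilde_def)
    from sq_int_reflect[OF this] have "(\<lambda>x. u (- x)) \<in> L2 UNIV" by (simp add: L2_UNIV_iff)
    moreover have "integrable (lborel \<Otimes>\<^sub>M lborel) (energy_integrand s (\<lambda>x. u (- x)) (\<lambda>x. u (- x)))"
      using u integrable_reflect_iff[of "energy_integrand s u u"]
      unfolding Htilde_def lborel_prod energy_integrand_reflect[abs_def] by simp
    moreover have "AE x in lborel. x \<notin> \<Omega> \<longrightarrow> u x = 0" using u by (simp add: Htilde_def)
    from AE_lborel_reflect[OF this] have "AE x in lborel. x \<notin> \<Omega> \<longrightarrow> u (- x) = 0" by (simp add: cs')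
    ultimately show ?thesis by (simp add: Htilde_def)
  qed
  have VL: "V \<in> L2 \<Omega>" using V by (simp add: resolvent_def)
  have "coef (\<lambda>x. V (- x)) k = coef (\<lambda>x. f (- x)) k / (l\<^sup>2 + \<mu> k)" for k
  proof -
    let ?\<psi> = "\<lambda>x. \<phi> k (- x)"
    have \<psi>: "?\<psi> \<in> L2 \<Omega>" by (rule L2R[OF \<phi>_L2])
    \<comment> \<open>The reflected \<open>\<phi> k\<close> has components only along eigenfunctions
      with the same eigenvalue, so \<open>\<mu> j\<close> may be replaced by \<open>\<mu> k\<close>
      in every nonzero term.\<close>
    have comm: "\<mu> j * coef ?\<psi> j = \<mu> k * coef ?\<psi> j" for j
    proof -
      have "\<mu> j * coef ?\<psi> j = fc / 2 * energy s (\<phi> j) ?\<psi>" using eigen[OF HR[OF \<phi>_Htilde[of k]], of j] by simp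
      also have "energy s (\<phi> j) ?\<psi> = energy s (\<phi> k) (\<lambda>x. \<phi> j (- x))"
        using energy_reflect[of s "\<lambda>x. \<phi> j (- x)" "\<phi> k"] energy_commute[of s "\<phi> k"] by simp
      also have "fc / 2 * \<dots> = \<mu> k * coef (\<lambda>x. \<phi> j (- x)) k" by (rule eigen[OF HR[OF \<phi>_Htilde[of j]]])
      also have "coef (\<lambda>x. \<phi> j (- x)) k = coef ?\<psi> j"
        unfolding coef_def innerR[of "\<phi> j" "\<phi> k"] by (rule L2_inner_commute)
      finally show ?thesis .
    qed
    have "coef V j * coef ?\<psi> j = coef f j * coef ?\<psi> j / (l\<^sup>2 + \<mu> k)" for j
      using V comm[of j] unfolding resolvent_def by (cases "coef ?\<psi> j = 0") simp_all
    then have "(\<lambda>j. coef f j * coef ?\<psi> j / (l\<^sup>2 + \<mu> k)) sums L2_inner \<Omega> V ?\<psi>"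
      using parseval_inner[OF VL \<psi>] by simp
    moreover have "(\<lambda>j. coef f j * coef ?\<psi> j / (l\<^sup>2 + \<mu> k)) sums (L2_inner \<Omega> f ?\<psi> / (l\<^sup>2 + \<mu> k))"
      by (rule sums_divide[OF parseval_inner[OF f \<psi>]])
    ultimately have "L2_inner \<Omega> V ?\<psi> = L2_inner \<Omega> f ?\<psi> / (l\<^sup>2 + \<mu> k)" by (rule sums_unique2)
    then show ?thesis unfolding coef_def innerR .
  qed
  then show ?thesis using L2R[OF VL] by (simp add: resolvent_def)
qed

lemma odd_resolvent_vanishes:
  assumes cs: "centrosymmetric \<Omega>" and l: "l > 0" and f: "f \<in> L2 \<Omega>" "\<And>x. f (- x) = - f x"
    and V: "resolvent l f V" "continuous_on \<Omega> V"
  shows "V 0 = 0"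
proof -
  have "resolvent l (\<lambda>x. (-1) * f x) (\<lambda>x. V (- x))"
    using resolvent_reflect[OF cs l f(1) V(1)] by (simp add: f(2))
  moreover have "resolvent l (\<lambda>x. (-1) * f x) (\<lambda>x. (-1) * V x)"
    using resolvent_lincomb[OF f(1) f(1) V(1) V(1), of "-1" 0] by simp
  moreover have "continuous_on \<Omega> (\<lambda>x. V (- x))"
    using cs by (intro continuous_on_compose2[OF V(2)] continuous_intros) (auto simp: centrosymmetric_def)
  moreover have "continuous_on \<Omega> (\<lambda>x. (-1) * V x)" by (intro continuous_intros V(2))
  ultimately have "V (- 0) = (-1) * V 0" by (rule resolvent_continuous_unique[OF _ _ _ _ zero_in])
  then show ?thesis by simp
qed

lemma laplace_transform_odd_data:
  assumes u: "u \<in> odd_data \<Omega> \<delta>" and l: "l > 0"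
  shows "resolvent l u (L2_laplace_transform \<Omega> (wave_solution \<Omega> \<phi> \<mu> u) l)"
    and "continuous_on \<Omega> (L2_laplace_transform \<Omega> (wave_solution \<Omega> \<phi> \<mu> u) l)"
proof -
  have uc: "continuous_on UNIV u" by (rule odd_data_continuous[OF u])
  obtain M where M: "0 \<le> M" "\<And>x. x \<in> closure \<Omega> \<Longrightarrow> \<bar>u x\<bar> \<le> M" using bounded_on_closure[OF uc] by blast
  have uM: "\<bar>u x\<bar> \<le> M" if "x \<in> \<Omega>" for x using M(2) that closure_subset by blast
  show "resolvent l u (L2_laplace_transform \<Omega> (wave_solution \<Omega> \<phi> \<mu> u) l)"
    and "continuous_on \<Omega> (L2_laplace_transform \<Omega> (wave_solution \<Omega> \<phi> \<mu> u) l)"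
    using laplace_transform_resolvent[OF l continuous_L2[OF uc] uM M(1)] by blast+
qed

end

theorem theorem3p12:
  fixes \<Omega> :: "'a::euclidean_space set" and s \<delta> :: real
    and \<phi> :: "nat \<Rightarrow> 'a \<Rightarrow> real" and \<mu> :: "nat \<Rightarrow> real"
  assumes s: "0 < s" "s < 1"
    and domain: "open \<Omega>" "connected \<Omega>" "bounded \<Omega>" "C11_boundary \<Omega>"
    and star: "star_shaped_origin \<Omega>"
    and ball: "\<delta> > 0" "ball 0 \<delta> \<subseteq> \<Omega>"
    and basis: "frac_eigenbasis s \<Omega> \<phi> \<mu>"
  shows "(\<forall>l>0. \<forall>u0\<in>odd_data \<Omega> \<delta>.
            L2_laplace_transform \<Omega> (wave_solution \<Omega> \<phi> \<mu> u0) l 0 = 0)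
         \<longleftrightarrow> centrosymmetric \<Omega>"
proof -
  interpret frac_dirichlet_origin s \<Omega> \<phi> \<mu>
    using s domain ball basis by unfold_locales auto
  show ?thesis
  proof
    assume van: "\<forall>l>0. \<forall>u0\<in>odd_data \<Omega> \<delta>. L2_laplace_transform \<Omega> (wave_solution \<Omega> \<phi> \<mu> u0) l 0 = 0"
    show "centrosymmetric \<Omega>"
    proof (rule centrosymmetric_of_vanishing[OF domain(4) ball])
      fix u assume u: "u \<in> odd_data \<Omega> \<delta>"
      show "point_value u = 0"
        using point_value_eq[OF laplace_transform_odd_data[OF u zero_less_one]] van u by simp
    qed
  next
    assume cs: "centrosymmetric \<Omega>"
    show "\<forall>l>0. \<forall>u0\<in>odd_data \<Omega> \<delta>. L2_laplace_transform \<Omega> (wave_solution \<Omega> \<phi> \<mu> u0) l 0 = 0"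
    proof (intro allI impI ballI)
      fix l :: real and u assume l: "l > 0" and u: "u \<in> odd_data \<Omega> \<delta>"
      \<comment> \<open>The data are odd on the ball by definition; outside it both sides are 0
        because the support lies in the symmetric ball.\<close>
      have odd: "u (- x) = - u x" for x
      proof (cases "x \<in> ball 0 \<delta>")
        case True
        then have "u x = - u (- x)" using u unfolding odd_data_def by blast
        then show ?thesis by linarith
      next
        case False
        have zero: "u y = 0" if "y \<notin> ball 0 \<delta>" for y
          using u that closure_subset[of "{x. u x \<noteq> 0}"] unfolding odd_data_def supp_def by blast
        show ?thesis using zero[of x] zero[of "- x"] False by simp
      qed
      show "L2_laplace_transform \<Omega> (wave_solution \<Omega> \<phi> \<mu> u) l 0 = 0"
        by (rule odd_resolvent_vanishes[OF cs l continuous_L2[OF odd_data_continuous[OF u]] odd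
              laplace_transform_odd_data[OF u l]])
    qed
  qed
qed

end
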